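(* Let $H$ be a graph satisfying at least one of the following properties: (i) $H$ has a roof triangle; (ii) $H$ has two hanging triangles whose attachment vertices are adjacent. Then \textsc{$H$-free Subdivision} is NP-complete. Furthermore, assuming the Exponential Time Hypothesis, the problem cannot be solved in time $2^{o(k)}\cdot n^{O(1)}$, where $n$ is the number of vertices of the input graph.
   Context: All graphs are finite, simple and undirected. Subdividing an edge $uv$ means deleting $uv$, adding a new vertex $w$ and the edges $uw,wv$. A graph is $H$-free if it has no induced subgraph isomorphic to $H$. \textsc{$H$-free Subdivision}: given a graph $G$ and an integer $k$, decide whether $G$ can be transformed into an $H$-free graph by applying at most $k$ edge subdivisions successively. A triangle of $H$ is a hanging triangle if it contains exactly one vertex of degree at least $3$ (in $H$), and a roof triangle if it contains exactly two vertices of degree at least $3$; the vertices of degree at least $3$ in such a triangle are its attachment vertices. ETH denotes the Exponential Time Hypothesis. *)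

theory Defs
  imports
    "HOL-Computational_Algebra.Polynomial"
    "HOL-Library.Landau_Symbols"
    "Graph_Theory.Graph_Theory"
begin

section \<open>Multi-tape Turing machines\<close>

text \<open>
  Deterministic multi-tape machines with two-way infinite tapes. States are
  \<open>0, \<dots>, num_states - 1\<close>, with start state 0; the extra state \<open>num_states\<close> is the
  halting state. Tape symbols are \<open>0, \<dots>, num_symbols - 1\<close>, where 0 is the blank and 1 and 2
  stand for the input bits. Tape 0 carries the input, tape 1 the output.
\<close>

datatype direction = Left | Stay | Right

record turing_machine =
  num_tapes :: nat
  num_states :: nat
  num_symbols :: nat
  transition :: "nat \<Rightarrow> nat list \<Rightarrow> nat \<times> (nat \<times> direction) list"

definition turing_machine :: "turing_machine \<Rightarrow> bool" where
  "turing_machine M \<longleftrightarrow>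
     2 \<le> num_tapes M \<and> 3 \<le> num_symbols M \<and>
     (\<forall>q gs. q < num_states M \<and> length gs = num_tapes M \<and> set gs \<subseteq> {..<num_symbols M} \<longrightarrow>
        (case transition M q gs of (q', as) \<Rightarrow>
           q' \<le> num_states M \<and> length as = num_tapes M \<and> fst ` set as \<subseteq> {..<num_symbols M}))"

text \<open>A tape is its contents together with the position of its head.\<close>

type_synonym tape = "(int \<Rightarrow> nat) \<times> int"
type_synonym config = "nat \<times> tape list"

primrec offset :: "direction \<Rightarrow> int" where
  "offset Left = -1"
| "offset Stay = 0"
| "offset Right = 1"

definition act :: "nat \<times> direction \<Rightarrow> tape \<Rightarrow> tape" where
  "act = (\<lambda>(g, d) (c, h). (c(h := g), h + offset d))"

definition step :: "turing_machine \<Rightarrow> config \<Rightarrow> config" where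
  "step M = (\<lambda>(q, ts).
     if q = num_states M then (q, ts)
     else let (q', as) = transition M q (map (\<lambda>(c, h). c h) ts) in (q', map2 act as ts))"

definition bit_symbol :: "bool \<Rightarrow> nat" where
  "bit_symbol b = (if b then 2 else 1)"

definition initial_config :: "turing_machine \<Rightarrow> bool list \<Rightarrow> config" where
  "initial_config M x =
     (0, (\<lambda>i. if 0 \<le> i \<and> i < int (length x) then bit_symbol (x ! nat i) else 0, 0)
         # replicate (num_tapes M - 1) (\<lambda>_. 0, 0))"

definition tape_holds :: "tape \<Rightarrow> bool list \<Rightarrow> bool" where
  "tape_holds t y \<longleftrightarrow>
     (\<forall>i<length y. fst t (int i) = bit_symbol (y ! i)) \<and> fst t (int (length y)) = 0"

text \<open>
  As a halted configuration no longer changes, the following says that \<open>M\<close> halts on \<open>x\<close>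
  after at most \<open>t\<close> steps, with output \<open>y\<close>.
\<close>

definition computes_within :: "turing_machine \<Rightarrow> bool list \<Rightarrow> bool list \<Rightarrow> nat \<Rightarrow> bool" where
  "computes_within M x y t \<longleftrightarrow>
     (case (step M ^^ t) (initial_config M x) of (q, ts) \<Rightarrow>
        q = num_states M \<and> tape_holds (ts ! 1) y)"

section \<open>NP-completeness\<close>

definition polytime_computable :: "(bool list \<Rightarrow> bool list) \<Rightarrow> bool" where
  "polytime_computable f \<longleftrightarrow>
     (\<exists>M (p :: nat poly). turing_machine M \<and>
        (\<forall>x. computes_within M x (f x) (poly p (length x))))"

definition in_P :: "bool list set \<Rightarrow> bool" where
  "in_P L \<longleftrightarrow> polytime_computable (\<lambda>x. [x \<in> L])"

text \<open>Every bit of \<open>x\<close> is preceded by True, so that the first component is self-delimiting.\<close>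

definition encode_pair :: "bool list \<Rightarrow> bool list \<Rightarrow> bool list" where
  "encode_pair x u = concat (map (\<lambda>b. [True, b]) x) @ [False] @ u"

definition in_NP :: "bool list set \<Rightarrow> bool" where
  "in_NP L \<longleftrightarrow>
     (\<exists>R (p :: nat poly). in_P R \<and>
        (\<forall>x. x \<in> L \<longleftrightarrow> (\<exists>u. length u \<le> poly p (length x) \<and> encode_pair x u \<in> R)))"

definition polytime_reducible :: "bool list set \<Rightarrow> bool list set \<Rightarrow> bool" where
  "polytime_reducible A B \<longleftrightarrow> (\<exists>f. polytime_computable f \<and> (\<forall>x. x \<in> A \<longleftrightarrow> f x \<in> B))"

definition NP_hard :: "bool list set \<Rightarrow> bool" where
  "NP_hard L \<longleftrightarrow> (\<forall>A. in_NP A \<longrightarrow> polytime_reducible A L)"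

definition NP_complete :: "bool list set \<Rightarrow> bool" where
  "NP_complete L \<longleftrightarrow> in_NP L \<and> NP_hard L"

section \<open>The Exponential Time Hypothesis\<close>

type_synonym literal = "nat \<times> bool"
type_synonym cnf = "literal list list"

definition satisfiable :: "cnf \<Rightarrow> bool" where
  "satisfiable F \<longleftrightarrow> (\<exists>\<sigma> :: nat \<Rightarrow> bool. \<forall>C\<in>set F. \<exists>(v, b)\<in>set C. \<sigma> v = b)"

definition three_cnf :: "nat \<Rightarrow> cnf \<Rightarrow> bool" where
  "three_cnf n F \<longleftrightarrow> (\<forall>C\<in>set F. length C \<le> 3 \<and> fst ` set C \<subseteq> {..<n})"

definition unary :: "nat \<Rightarrow> bool list" where
  "unary n = replicate n True @ [False]"

definition encode_list :: "('a \<Rightarrow> bool list) \<Rightarrow> 'a list \<Rightarrow> bool list" where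
  "encode_list e xs = concat (map (\<lambda>x. True # e x) xs) @ [False]"

definition encode_literal :: "literal \<Rightarrow> bool list" where
  "encode_literal = (\<lambda>(v, b). b # unary v)"

definition encode_cnf :: "nat \<Rightarrow> cnf \<Rightarrow> bool list" where
  "encode_cnf n F = unary n @ encode_list (encode_list encode_literal) F"

text \<open>
  For some \<open>\<delta> > 0\<close>, satisfiability of 3-CNF formulas with \<open>n\<close> variables cannot be decided in time
  \<open>2\<^sup>\<delta>\<^sup>n\<close> times a polynomial in the input length; that is, the constant \<open>s\<^sub>3\<close> of Impagliazzo and
  Paturi is positive.
\<close>

definition exponential_time_hypothesis :: bool where
  "exponential_time_hypothesis \<longleftrightarrow>
     (\<exists>\<delta>::real. 0 < \<delta> \<and>
        \<not> (\<exists>M (p :: nat poly). turing_machine M \<and>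
             (\<forall>n F. three_cnf n F \<longrightarrow>
                (\<exists>t. real t \<le> 2 powr (\<delta> * real n) * real (poly p (length (encode_cnf n F))) \<and>
                     computes_within M (encode_cnf n F) [satisfiable F] t))))"

section \<open>Graphs\<close>

text \<open>
  Finite simple undirected graphs are the library's \<^const>\<open>pair_graph\<close>s, in which an edge \<open>uv\<close> is
  represented by the two arcs \<open>(u, v)\<close> and \<open>(v, u)\<close>; the degree of a vertex is thus its
  out-degree. The null graph is not excluded.
\<close>

definition triangle :: "'a pair_pre_digraph \<Rightarrow> 'a set \<Rightarrow> bool" where
  "triangle G T \<longleftrightarrow>
     (\<exists>u v w. T = {u, v, w} \<and> (u, v) \<in> parcs G \<and> (v, w) \<in> parcs G \<and> (u, w) \<in> parcs G)"

definition attachment_vertices :: "'a pair_pre_digraph \<Rightarrow> 'a set \<Rightarrow> 'a set" where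
  "attachment_vertices G T = {v \<in> T. 3 \<le> out_degree (with_proj G) v}"

definition hanging_triangle :: "'a pair_pre_digraph \<Rightarrow> 'a set \<Rightarrow> bool" where
  "hanging_triangle G T \<longleftrightarrow> triangle G T \<and> card (attachment_vertices G T) = 1"

definition roof_triangle :: "'a pair_pre_digraph \<Rightarrow> 'a set \<Rightarrow> bool" where
  "roof_triangle G T \<longleftrightarrow> triangle G T \<and> card (attachment_vertices G T) = 2"

definition induced_free :: "'a pair_pre_digraph \<Rightarrow> 'b pair_pre_digraph \<Rightarrow> bool" where
  "induced_free H G \<longleftrightarrow>
     \<not> (\<exists>F. induced_subgraph F (with_proj G) \<and> digraph_iso F (with_proj H))"

definition edge_subdivision :: "'a pair_pre_digraph \<Rightarrow> 'a pair_pre_digraph \<Rightarrow> bool" where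
  "edge_subdivision G G' \<longleftrightarrow>
     (\<exists>u v w. (u, v) \<in> parcs G \<and> w \<notin> pverts G \<and> G' = subdivide G (u, v) w)"

section \<open>The problem H-free Subdivision\<close>

definition subdividable_to_free :: "'a pair_pre_digraph \<Rightarrow> 'b pair_pre_digraph \<Rightarrow> nat \<Rightarrow> bool" where
  "subdividable_to_free H G k \<longleftrightarrow>
     (\<exists>j\<le>k. \<exists>G'. (edge_subdivision ^^ j) G G' \<and> induced_free H G')"

text \<open>Input graphs have an initial segment of the naturals as vertex set.\<close>

definition input_graph :: "nat pair_pre_digraph \<Rightarrow> bool" where
  "input_graph G \<longleftrightarrow> pair_graph G \<and> pverts G = {..<card (pverts G)}"

text \<open>Binary representation, least significant bit first.\<close>

fun nat_bits :: "nat \<Rightarrow> bool list" where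
  "nat_bits n = (if n = 0 then [] else odd n # nat_bits (n div 2))"

declare nat_bits.simps [simp del]

text \<open>The number of vertices in unary, the adjacency matrix row by row, and \<open>k\<close> in binary.\<close>

definition encode_instance :: "nat pair_pre_digraph \<Rightarrow> nat \<Rightarrow> bool list" where
  "encode_instance G k =
     (let n = card (pverts G)
      in unary n @ map (\<lambda>e. e \<in> parcs G) (List.product [0..<n] [0..<n]) @ nat_bits k)"

definition free_subdivision :: "'a pair_pre_digraph \<Rightarrow> bool list set" where
  "free_subdivision H =
     {encode_instance G k |G k. input_graph G \<and> subdividable_to_free H G k}"

text \<open>
  Solvability in time \<open>2\<^sup>o\<^sup>(\<^sup>k\<^sup>) \<cdot> n\<^sup>O\<^sup>(\<^sup>1\<^sup>)\<close>. The factor \<open>n\<^sup>O\<^sup>(\<^sup>1\<^sup>)\<close> is an arbitrary polynomial, so that the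
  bound does not degenerate for \<open>n \<le> 1\<close>; the machine may behave arbitrarily on bit strings that
  do not encode an instance.
\<close>

definition subexponentially_solvable :: "'a pair_pre_digraph \<Rightarrow> bool" where
  "subexponentially_solvable H \<longleftrightarrow>
     (\<exists>M (f :: nat \<Rightarrow> real) (p :: nat poly).
        turing_machine M \<and> f \<in> o(\<lambda>k. real k) \<and>
        (\<forall>G k. input_graph G \<longrightarrow>
           (\<exists>t. real t \<le> 2 powr f k * real (poly p (card (pverts G))) \<and>
                computes_within M (encode_instance G k) [subdividable_to_free H G k] t)))"

section \<open>The encodings are injective\<close>

lemma unary_append_inject: "unary m @ xs = unary n @ ys \<longleftrightarrow> m = n \<and> xs = ys"
proof (induction m arbitrary: n)
  case 0
  then show ?case by (cases n) (auto simp: unary_def)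
next
  case (Suc m)
  then show ?case by (cases n) (auto simp: unary_def)
qed

lemma horner_sum_nat_bits: "horner_sum of_bool 2 (nat_bits n) = n"
proof (induction n rule: nat_bits.induct)
  case (1 n)
  have "of_bool (odd n) + 2 * (n div 2) = n"
    by (cases "even n") auto
  with 1 show ?case
    by (subst nat_bits.simps) auto
qed

lemma encode_instance_inject:
  assumes "input_graph G" "input_graph G'" "encode_instance G k = encode_instance G' k'"
  shows "G = G' \<and> k = k'"
proof -
  define n where "n = card (pverts G)"
  have n': "card (pverts G') = n"
    using assms(3) by (simp add: encode_instance_def Let_def unary_append_inject n_def)
  then have verts: "pverts G = {..<n}" "pverts G' = {..<n}"
    using assms(1,2) by (auto simp: input_graph_def n_def)
  have eq: "map (\<lambda>e. e \<in> parcs G) (List.product [0..<n] [0..<n]) @ nat_bits k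
          = map (\<lambda>e. e \<in> parcs G') (List.product [0..<n] [0..<n]) @ nat_bits k'"
    using assms(3) n' by (simp add: encode_instance_def Let_def unary_append_inject n_def)
  then have "nat_bits k = nat_bits k'"
    by simp
  then have "k = k'"
    by (metis horner_sum_nat_bits)
  have same: "e \<in> parcs G \<longleftrightarrow> e \<in> parcs G'" if "e \<in> {..<n} \<times> {..<n}" for e
    using eq that by (auto simp: atLeast0LessThan)
  interpret G: pair_graph G using assms(1) by (simp add: input_graph_def)
  interpret G': pair_graph G' using assms(2) by (simp add: input_graph_def)
  have "parcs G \<subseteq> {..<n} \<times> {..<n}" "parcs G' \<subseteq> {..<n} \<times> {..<n}"
    using G.in_arcsD1 G.in_arcsD2 G'.in_arcsD1 G'.in_arcsD2 verts by auto
  then have "parcs G = parcs G'"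
    using same by blast
  then show ?thesis
    using verts \<open>k = k'\<close> by simp
qed

lemma encode_pair_inject: "encode_pair x u = encode_pair x' u' \<longleftrightarrow> x = x' \<and> u = u'"
proof (induction x arbitrary: x')
  case Nil
  then show ?case by (cases x') (auto simp: encode_pair_def)
next
  case (Cons b x)
  then show ?case by (cases x') (auto simp: encode_pair_def)
qed

lemma encode_list_append_inject:
  assumes "\<And>x y us vs. e x @ us = e y @ vs \<longleftrightarrow> x = y \<and> us = vs"
  shows "encode_list e xs @ us = encode_list e ys @ vs \<longleftrightarrow> xs = ys \<and> us = vs"
proof (induction xs arbitrary: ys)
  case Nil
  then show ?case by (cases ys) (auto simp: encode_list_def)
next
  case (Cons x xs)
  then show ?case by (cases ys) (auto simp: encode_list_def assms)
qed

lemma encode_cnf_inject: "encode_cnf m F = encode_cnf n F' \<longleftrightarrow> m = n \<and> F = F'"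
proof -
  have "encode_literal l @ us = encode_literal l' @ vs \<longleftrightarrow> l = l' \<and> us = vs" for l l' us vs
    by (auto simp: encode_literal_def unary_append_inject split: prod.splits)
  note inject = encode_list_append_inject [OF encode_list_append_inject [OF this]]
  show ?thesis
    using inject [of F "[]" F' "[]"] by (simp add: encode_cnf_def unary_append_inject)
qed

end

theory Submission
  imports Defs "HOL-Real_Asymp.Real_Asymp"
begin

text \<open>
  Choose in \<open>H\<close> a triangle \<open>uvw\<close> in which \<open>w\<close> has no neighbours but \<open>u\<close> and \<open>v\<close>. Given a triangle-free
  graph \<open>X\<close>, take a copy of the component of the triangle without \<open>w\<close> for each vertex of \<open>X\<close>,
  identify all copies of \<open>u\<close>, and join the copies of \<open>v\<close> like the vertices of \<open>X\<close>; the other components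
  of \<open>H\<close> are added \<open>k + 1\<close> times. Every edge of \<open>X\<close> then forms a triangle with \<open>u\<close> that
  completes a copy of \<open>H\<close>. Subdividing the edges from \<open>u\<close> to the copies of \<open>v\<close> that belong to a
  vertex cover of \<open>X\<close> destroys all copies, and fewer subdivisions than that do not suffice. Vertex cover
  in triangle-free graphs is reached from 3-satisfiability with \<open>k\<close> linear in the numbers of variables and clauses.

  For the lower bound, the number of clauses must be made linear in the number of variables. As long
  as many clauses share a common part, one branches on whether that part is satisfied; a potential
  counting the unit clauses and the new two-literal clauses bounds the number of leaves by \<open>2\<^sup>\<epsilon>\<^sup>n\<close>.
  A subexponential algorithm run on all leaves would refute the hypothesis.
\<close>

section \<open>Structured programs for Turing machines\<close>

text \<open>\<open>H\<close> is arbitrary, so a copy might spread over several bags or avoid the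
  hub, and counting vertices excludes nothing. Triangles can be controlled: once the bags cut off
  from the hub form a cover, every triangle lies in one bag together with the hub, and no bag
  contains \<open>w\<close>. So the 2-connected block of triangle edges around \<open>uv\<close>
  survives only truncated, and a size threshold on blocks discards the remnants. The labels
  \<open>u\<close> and \<open>v\<close> are assigned so that the heaviest branch at \<open>u\<close>
  is no heavier than that at \<open>v\<close>; then the surroundings of the triangle are too heavy
  to touch the image of the hub and fall into a single bag, where an extremal vertex gives the
  contradiction.

  A second obstacle is a component of \<open>H\<close> that itself contains an induced copy of the
  triangle's component: repeated disjointly, it could host that component. Its \<open>k + 1\<close>
  copies are therefore fused into one component of twins, and a pigeonhole argument on components
  and neighbourhoods applies.

  In the lower bound nothing is known about the computability of \<open>f\<close>; so the assumed
  machine is simulated until it halts, and its time bound enters the analysis only.\<close>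

datatype cmd =
 Act "nat list => (nat \<times> direction) list"
| Seq cmd cmd
| Cond "nat list => bool" cmd cmd
| While "nat list => bool" cmd

definition reads :: "tape list => nat list" where
 "reads ts = map (%(c,h). c h) ts"

fun cstep :: "cmd list * tape list => cmd list * tape list" where
 "cstep ([],ts) = ([],ts)"
| "cstep (Act f # K,ts) = (K,map2 act (f (reads ts)) ts)"
| "cstep (Seq a b # K,ts) = (a # b # K,ts)"
| "cstep (Cond p a b # K,ts) = ((if p (reads ts) then a else b) # K,ts)"
| "cstep (While p a # K,ts) = (if p (reads ts) then a # While p a # K else K,ts)"

primrec cmd_ok :: "nat => nat => cmd => bool" where
 "cmd_ok T S (Act f) \<longleftrightarrow> (\<forall>gs. length gs = T & set gs \<subseteq> {..<S} -->
   length (f gs) = T & fst ` set (f gs) \<subseteq> {..<S})"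
| "cmd_ok T S (Seq a b) \<longleftrightarrow> cmd_ok T S a & cmd_ok T S b"
| "cmd_ok T S (Cond p a b) \<longleftrightarrow> cmd_ok T S a & cmd_ok T S b"
| "cmd_ok T S (While p a) \<longleftrightarrow> cmd_ok T S a"

text \<open>The continuations that can occur while \<open>c # K\<close> is executed, before \<open>K\<close> is reached. There are
  finitely many of them, and they serve as the states of a machine.\<close>

primrec conts :: "cmd => cmd list => cmd list set" where
 "conts (Act f) K = {Act f # K}"
| "conts (Seq a b) K = insert (Seq a b # K) (conts a (b # K) \<union> conts b K)"
| "conts (Cond p a b) K = insert (Cond p a b # K) (conts a K \<union> conts b K)"
| "conts (While p a) K = insert (While p a # K) (conts a (While p a # K))"

lemma finite_conts: "finite (conts c K)"
 by (induction c arbitrary: K) auto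

lemma conts_start: "c # K : conts c K"
 by (cases c) auto

lemma conts_step:
 "L : conts c K ==> fst (cstep (L,ts)) : insert K (conts c K)"
proof (induction c arbitrary: K)
 case (Seq a b)
 then consider "L = Seq a b # K" | "L : conts a (b # K)" | "L : conts b K" by auto
 thus ?case
 proof cases
  case 1 thus ?thesis using conts_start[of a "b # K"] by simp
 next
  case 2 thus ?thesis using Seq.IH(1)[OF 2] conts_start[of b K] by (elim insertE) simp_all
 next
  case 3 thus ?thesis using Seq.IH(2)[OF 3] by (elim insertE) simp_all
 qed
next
 case (Cond p a b)
 hence "L = Cond p a b # K \<or> L : conts a K \<or> L : conts b K" by simp
 then consider "L = Cond p a b # K" | "L : conts a K" | "L : conts b K" by blast
 thus ?case
 proof cases
  case 1 thus ?thesis using conts_start[of a K] conts_start[of b K] by simp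
 next
  case 2 thus ?thesis using Cond.IH(1)[OF 2] by (elim insertE) simp_all
 next
  case 3 thus ?thesis using Cond.IH(2)[OF 3] by (elim insertE) simp_all
 qed
next
 case (While p a)
 then consider "L = While p a # K" | "L : conts a (While p a # K)" by auto
 thus ?case
 proof cases
  case 1 thus ?thesis using conts_start[of a "While p a # K"] by simp
 next
  case 2 thus ?thesis using While.IH[OF 2] by (elim insertE) simp_all
 qed
qed simp

text \<open>Keeps \<open>[]\<close> free to be the halting state of the compiled machine.\<close>

lemma conts_nonempty: "[] ~: conts c K"
 by (induction c arbitrary: K) simp_all

lemma conts_ok:
 "cmd_ok T S c ==> list_all (cmd_ok T S) K ==> L : conts c K ==> list_all (cmd_ok T S) L"
proof (induction c arbitrary: K)
 case (Seq a b)
 show ?case using Seq.prems Seq.IH(1)[of "b # K"] Seq.IH(2)[of K] by auto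
next
 case (Cond p a b)
 show ?case using Cond.prems Cond.IH(1)[of K] Cond.IH(2)[of K] by auto
next
 case (While p a)
 show ?case using While.prems While.IH[of "While p a # K"] by auto
qed simp

text \<open>Isolates the finite part of \<open>cstep\<close>: the next continuation and the tape
  actions depend on the scanned symbols only, which is what a transition function may use. Pure
  control steps write every symbol back and stay.\<close>

fun control :: "cmd list => nat list => cmd list * (nat * direction) list" where
 "control [] gs = ([],map (%g. (g,Stay)) gs)"
| "control (Act f # K) gs = (K,f gs)"
| "control (Seq a b # K) gs = (a # b # K,map (%g. (g,Stay)) gs)"
| "control (Cond p a b # K) gs = ((if p gs then a else b) # K,map (%g. (g,Stay)) gs)"
| "control (While p a # K) gs = (if p gs then a # While p a # K else K,map (%g. (g,Stay)) gs)"

lemma map2_act_Stay: "map2 act (map (%g. (g,Stay)) (reads ts)) ts = ts"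
 by (induction ts) (auto simp: reads_def act_def)

lemma cstep_control:
 "cstep (L,ts) = (fst (control L (reads ts)),map2 act (snd (control L (reads ts))) ts)"
 by (cases "(L,reads ts)" rule: control.cases) (auto simp: map2_act_Stay)

lemma control_ok:
 assumes "list_all (cmd_ok T S) L" "length gs = T" "set gs \<subseteq> {..<S}"
 shows "length (snd (control L gs)) = T" "fst ` set (snd (control L gs)) \<subseteq> {..<S}"
 using assms by (cases "(L,gs)" rule: control.cases; auto simp: image_image)+

text \<open>Continuations are numbered so that \<open>[c]\<close> becomes state 0 and
  \<open>[]\<close> the halting state, as the machine model prescribes. The simulation is then step
  for step, without overhead.\<close>

lemma compile:
 assumes ok: "cmd_ok T S c" and T: "2 <= T" and S: "3 <= S"
 obtains M where "turing_machine M" "num_tapes M = T" "num_symbols M = S"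
  "!!ts n ts'. (cstep ^^ n) ([c],ts) = ([],ts') ==> (step M ^^ n) (0,ts) = (num_states M,ts')"
proof -
 define C where "C = conts c []"
 have fC: "finite C" and neC: "[c] : C"
  unfolding C_def by (auto simp: finite_conts conts_start)
 have nC: "[] ~: C" unfolding C_def by (rule conts_nonempty)
 obtain g0 where g0: "bij_betw g0 (C - {[c]}) {1..<card C}"
  by (metis neC fC bij_betw_iff_card card_Diff_singleton card_atLeastLessThan finite_Diff finite_atLeastLessThan)
 define g where "g L = (if L = [c] then 0 else if L = [] then card C else g0 L)" for L
 have pos: "card C > 0" using neC fC by (auto simp: card_gt_0_iff)
 have g1: "bij_betw g (C - {[c]}) {1..<card C}"
  using g0 nC by (subst bij_betw_cong[of _ _ g0]) (auto simp: g_def)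
 have gc: "g [c] = 0" "g [] = card C" by (auto simp: g_def)
 have inj: "inj_on g (insert [] C)"
 proof (rule inj_onI)
  fix x y assume x: "x : insert [] C" and y: "y : insert [] C" and e: "g x = g y"
  have r: "z : C - {[c]} ==> 1 <= g z & g z < card C" for z
   using g1 unfolding bij_betw_def by (metis atLeastLessThan_iff imageI)
  show "x = y" using x y e r[of x] r[of y] gc pos g1 unfolding bij_betw_def inj_on_def
   by (metis Diff_iff insert_iff less_irrefl not_one_le_zero empty_iff)
 qed
 have lt: "L : C ==> g L < card C" for L
  using g1 pos gc unfolding bij_betw_def
  by (metis Diff_iff atLeastLessThan_iff empty_iff imageI insert_iff)
 define h where "h = inv_into (insert [] C) g"
 have hg: "L : insert [] C ==> h (g L) = L" for L
  unfolding h_def using inj by (rule inv_into_f_f)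
 have surj: "q < card C ==> \<exists>L\<in>C. g L = q" for q
 proof (cases "q = 0")
  case False
  assume "q < card C"
  with False have "q : g ` (C - {[c]})" using bij_betw_imp_surj_on[OF g1] by auto
  thus ?thesis by auto
 qed (use gc neC in auto)
 define M where "M = \<lparr> num_tapes = T,num_states = card C,num_symbols = S,
   transition = (%q gs. (g (fst (control (h q) gs)),snd (control (h q) gs))) \<rparr>"
 have cl: "L : C ==> fst (control L (reads ts)) : insert [] C" for L ts
  using conts_step[of L c "[]" ts] unfolding C_def by (simp add: cstep_control)
 have rd: "length gs = T ==> \<exists>ts. reads ts = gs" for gs
  by (rule exI[of _ "map (%g. (%_. g,0)) gs"]) (auto simp: reads_def comp_def)
 have tm: "turing_machine M"
  unfolding turing_machine_def
 proof (intro conjI allI impI)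
  fix q gs assume a: "q < num_states M & length gs = num_tapes M & set gs \<subseteq> {..<num_symbols M}"
  then obtain L where L: "L : C" "g L = q" using surj by (auto simp: M_def)
  have okL: "list_all (cmd_ok T S) L" using conts_ok[OF ok, of "[]" L] L unfolding C_def by simp
  obtain ts where ts: "reads ts = gs" using rd a by (auto simp: M_def)
  have "fst (control L gs) : insert [] C" using cl[OF L(1), of ts] ts by simp
  hence "g (fst (control L gs)) <= card C" using lt gc by (auto intro: less_imp_le)
  thus "case transition M q gs of (q',as) =>
      q' <= num_states M & length as = num_tapes M & fst ` set as \<subseteq> {..<num_symbols M}"
   using control_ok[OF okL, of gs] a hg[of L] L by (simp add: M_def split_beta)
 qed (use T S in \<open>auto simp: M_def\<close>)
 have tr: "transition M q gs = (g (fst (control (h q) gs)),snd (control (h q) gs))"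
  and ns: "num_states M = card C" for q gs
  by (simp_all add: M_def)
 have st: "step M (g L,ts) = (g (fst (cstep (L,ts))),snd (cstep (L,ts)))"
  if L: "L : insert [] C" for L ts
 proof (cases "L = []")
  case True thus ?thesis by (simp add: step_def ns gc)
 next
  case False
  hence "L : C" using L by simp
  hence "g L ~= card C" "h (g L) = L" using lt[of L] hg by auto
  thus ?thesis unfolding step_def cstep_control by (simp add: ns tr reads_def)
 qed
 have cl': "fst (cstep (L,ts)) : insert [] C" if "L : insert [] C" for L ts
  using that cl by (auto simp: cstep_control)
 have *: "(step M ^^ n) (g L,ts) = (g (fst ((cstep ^^ n) (L,ts))),snd ((cstep ^^ n) (L,ts)))"
   "fst ((cstep ^^ n) (L,ts)) : insert [] C" if "L : insert [] C" for n L ts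
 proof (induction n)
  case 0
  { case 1 thus ?case by simp next case 2 thus ?case using that by simp }
 next
  case (Suc n)
  obtain L' ts' where e: "(cstep ^^ n) (L,ts) = (L',ts')" by fastforce
  { case 1 thus ?case using Suc.IH st[of L' ts'] e by simp
  next case 2 thus ?case using Suc.IH cl'[of L' ts'] e by simp }
 qed
 have "(step M ^^ n) (0,ts) = (num_states M,ts')" if "(cstep ^^ n) ([c],ts) = ([],ts')" for n ts ts'
  using *(1)[of "[c]" n ts] neC that gc by (simp add: ns)
 thus thesis using that[OF tm] by (simp add: M_def)
qed

text \<open>The quantification over the pending continuation \<open>K\<close> is what makes runs
  compose.\<close>

definition runs :: "cmd => tape list => tape list => nat => bool" where
 "runs c ts ts' n \<longleftrightarrow> (\<forall>K. (cstep ^^ n) (c # K,ts) = (K,ts'))"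

lemma runs_Act: "runs (Act f) ts (map2 act (f (reads ts)) ts) 1"
 by (simp add: runs_def)

lemma runs_Seq: "runs a ts ts1 n ==> runs b ts1 ts2 m ==> runs (Seq a b) ts ts2 (Suc (m + n))"
 unfolding runs_def by (simp add: funpow_add funpow_Suc_right del: funpow.simps)

lemma runs_Cond: "runs (if p (reads ts) then a else b) ts ts1 n ==> runs (Cond p a b) ts ts1 (Suc n)"
 unfolding runs_def by (simp add: funpow_Suc_right del: funpow.simps)

lemma runs_While_False: "\<not> p (reads ts) ==> runs (While p a) ts ts 1"
 unfolding runs_def by simp

lemma runs_While_True:
 "p (reads ts) ==> runs a ts ts1 n ==> runs (While p a) ts1 ts2 m ==>
  runs (While p a) ts ts2 (Suc (m + n))"
 unfolding runs_def by (simp add: funpow_add funpow_Suc_right del: funpow.simps)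

lemma step_halted: "(step M ^^ n) (num_states M,ts) = (num_states M,ts)"
 by (induction n) (auto simp: step_def)

lemma compile_runs:
 assumes ok: "cmd_ok T S c" and T: "2 <= T" and S: "3 <= S"
 obtains M where "turing_machine M" "num_tapes M = T" "num_symbols M = S"
  "!!x y ts' n t. runs c (snd (initial_config M x)) ts' n ==> n <= t ==> tape_holds (ts' ! 1) y ==>
    computes_within M x y t"
proof -
 obtain M where M: "turing_machine M" "num_tapes M = T" "num_symbols M = S"
  "!!ts n ts'. (cstep ^^ n) ([c],ts) = ([],ts') ==> (step M ^^ n) (0,ts) = (num_states M,ts')"
  using compile[OF assms] by metis
 show thesis
 proof (rule that[OF M(1-3)])
  fix x y ts' n t
  assume r: "runs c (snd (initial_config M x)) ts' n" and t: "n <= t" and h: "tape_holds (ts' ! 1) y"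
  have "(step M ^^ n) (initial_config M x) = (num_states M,ts')"
   using M(4) r unfolding runs_def by (simp add: initial_config_def)
  hence "(step M ^^ t) (initial_config M x) = (num_states M,ts')"
   using t step_halted[of "t - n" M ts'] by (metis funpow_add o_apply le_add_diff_inverse2)
  thus "computes_within M x y t" using h by (simp add: computes_within_def)
 qed
qed

text \<open>The stack lies left of the head, its top adjacent to the head, and a blank marks the
  bottom. The cells from the head onwards are left open, so a pop need not erase anything.\<close>

definition stk :: "nat list => tape => bool" where
 "stk s = (%(c,h). (\<forall>j<length s. c (h - 1 - int j) = s ! j) & c (h - 1 - int (length s)) = 0 & 0 ~: set s)"

definition low :: "nat list => tape => bool" where
 "low s = (%(c,h). stk s (c,h + 1))"

definition rd :: "tape => nat" where "rd = (%(c,h). c h)"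

lemma reads_rd: "reads ts = map rd ts"
 by (simp add: reads_def rd_def)

lemma stk_push: "stk s t ==> g ~= 0 ==> stk (g # s) (act (g,Right) t)"
 by (cases t) (auto simp: stk_def act_def nth_Cons algebra_simps split: nat.splits)

lemma stk_lower: "stk s t ==> low s (act (rd t,Left) t)"
 by (cases t) (auto simp: stk_def low_def act_def rd_def)

text \<open>A head lowered onto the top symbol already is in position for the popped stack; a pop is
  a single move.\<close>

lemma low_Cons: "low (g # s) t ==> rd t = g & g ~= 0 & stk s t"
proof (cases t)
 case (Pair c h)
 assume l: "low (g # s) t"
 hence a: "j < Suc (length s) ==> c (h - int j) = (g # s) ! j" for j
  by (auto simp: Pair low_def stk_def)
 show ?thesis using a[of 0] l a[of "Suc j" for j]
  by (auto simp: Pair low_def stk_def rd_def algebra_simps)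
qed

lemma low_Nil: "low [] t ==> rd t = 0 & stk [] (act (0,Right) t)"
 by (cases t) (auto simp: stk_def low_def act_def rd_def)

definition only :: "nat => (nat => nat * direction) => nat list => (nat * direction) list" where
 "only i f gs = map (%j. if j = i then f (gs ! j) else (gs ! j,Stay)) [0..<length gs]"

lemma act_rd_Stay: "act (rd t,Stay) t = t"
 by (cases t) (auto simp: act_def rd_def)

lemma map2_only: "map2 act (only i f (reads ts)) ts = ts[i := act (f (rd (ts ! i))) (ts ! i)]"
 by (rule nth_equalityI) (auto simp: only_def reads_rd act_rd_Stay nth_list_update)

section \<open>Runs described by stack contents\<close>

type_synonym astate = "tape \<times> tape \<times> (nat => nat list)"

text \<open>Input and output tape are fixed literally; on the stack tapes the garbage above the head
  is abstracted away, so one abstract state stands for many tape lists.\<close>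

definition rel :: "nat => astate => tape list => bool" where
 "rel T = (%(a,b,St) ts. length ts = T & 2 <= T & ts ! 0 = a & ts ! 1 = b &
   (\<forall>i. 2 <= i & i < T --> stk (St i) (ts ! i)))"

definition aruns :: "nat => cmd => astate => astate => nat => bool" where
 "aruns T c s s' n \<longleftrightarrow> (\<forall>ts. rel T s ts --> (\<exists>ts' m. m <= n & rel T s' ts' & runs c ts ts' m))"

lemma aruns_mono: "aruns T c s s' n ==> n <= m ==> aruns T c s s' m"
 unfolding aruns_def by (meson le_trans)

lemma aruns_Seq: "aruns T a s s1 n ==> aruns T b s1 s2 m ==> aruns T (Seq a b) s s2 (n + m + 1)"
 unfolding aruns_def
proof (intro allI impI)
 fix ts assume a: "\<forall>ts. rel T s ts --> (\<exists>ts' m. m <= n & rel T s1 ts' & runs a ts ts' m)"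
  and b: "\<forall>ts. rel T s1 ts --> (\<exists>ts' ma. ma <= m & rel T s2 ts' & runs b ts ts' ma)" and r: "rel T s ts"
 from a r obtain t1 n1 where 1: "n1 <= n" "rel T s1 t1" "runs a ts t1 n1" by blast
 from b 1 obtain t2 n2 where 2: "n2 <= m" "rel T s2 t2" "runs b t1 t2 n2" by blast
 show "\<exists>ts' ma. ma <= n + m + 1 & rel T s2 ts' & runs (Seq a b) ts ts' ma"
  by (rule exI[of _ t2], rule exI[of _ "Suc (n2 + n1)"]) (use 1 2 runs_Seq[OF 1(3) 2(3)] in auto)
qed

definition skip :: cmd where "skip = Act (map (%g. (g,Stay)))"
definition push :: "nat => nat => cmd" where "push i g = Act (only i (%_. (g,Right)))"
definition lower :: "nat => cmd" where "lower i = Act (only i (%g. (g,Left)))"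
definition raise :: "nat => cmd" where "raise i = Act (only i (%g. (g,Right)))"

text \<open>Emptiness shows only after the head has moved onto the blank; in that case
  \<open>raise\<close> restores the position before \<open>c0\<close> starts.\<close>

definition popc :: "nat => cmd => cmd => cmd => cmd" where
 "popc i c0 c1 c2 = Seq (lower i) (Cond (%gs. gs ! i = 0) (Seq (raise i) c0) (Cond (%gs. gs ! i = 1) c1 c2))"

definition wloop :: "nat => (nat => bool) => cmd => cmd => cmd" where
 "wloop i p a b = While (%gs. gs ! i ~= 0) (Seq (Cond (%gs. p (gs ! i)) a b) (lower i))"

text \<open>The body may push onto tape \<open>i\<close> itself, and the loop ends when that tape is
  found empty. This turns the tape into a counter of pending work.\<close>

definition poploop :: "nat => (nat => bool) => cmd => cmd => cmd" where
 "poploop i p a b = Seq (lower i) (Seq (wloop i p a b) (raise i))"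

lemma only_ok:
 assumes "!!g. g < S ==> fst (f g) < S"
 shows "cmd_ok T S (Act (only i f))"
 using assms by (fastforce simp: only_def subset_iff in_set_conv_nth)

lemma cmd_ok_basic[simp]: "cmd_ok T S skip" "g < S ==> cmd_ok T S (push i g)" "cmd_ok T S (lower i)" "cmd_ok T S (raise i)"
 unfolding push_def lower_def raise_def by (auto intro!: only_ok simp del: cmd_ok.simps) (auto simp: skip_def)

lemma cmd_ok_pop[simp]:
 "cmd_ok T S (popc i a b c) \<longleftrightarrow> cmd_ok T S a & cmd_ok T S b & cmd_ok T S c"
 "cmd_ok T S (poploop i p a b) \<longleftrightarrow> cmd_ok T S a & cmd_ok T S b"
 by (auto simp: popc_def poploop_def wloop_def)

lemma aruns_skip: "aruns T skip s s 1"
 unfolding aruns_def skip_def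
 using runs_Act[of "map (%g. (g,Stay))"] by (auto simp: map2_act_Stay intro!: exI[of _ "Suc 0"])

lemma runs_only: "runs (Act (only i f)) ts (ts[i := act (f (rd (ts ! i))) (ts ! i)]) 1"
 using runs_Act[of "only i f" ts] by (simp only: map2_only)

lemma aruns_push:
 assumes "2 <= i" "g ~= 0"
 shows "aruns T (push i g) (a,b,St) (a,b,St(i := g # St i)) 1"
 unfolding aruns_def push_def
proof (intro allI impI)
 fix ts assume r: "rel T (a,b,St) ts"
 have "rel T (a,b,St(i := g # St i)) (ts[i := act (g,Right) (ts ! i)])"
  using r assms by (auto simp: rel_def nth_list_update stk_push)
 thus "\<exists>ts' m. m <= 1 & rel T (a,b,St(i := g # St i)) ts' & runs (Act (only i (%_. (g,Right)))) ts ts' m"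
  using runs_only by blast
qed

definition lowrel :: "nat => nat => astate => tape list => bool" where
 "lowrel T i = (%(a,b,St) ts. length ts = T & 2 <= T & ts ! 0 = a & ts ! 1 = b &
   (\<forall>j. 2 <= j & j < T & j ~= i --> stk (St j) (ts ! j)) & low (St i) (ts ! i))"

lemma runs_lower:
 assumes "rel T (a,b,St) ts" "2 <= i" "i < T"
 obtains ts' where "lowrel T i (a,b,St) ts'" "runs (lower i) ts ts' 1"
proof
 show "runs (lower i) ts (ts[i := act (rd (ts ! i),Left) (ts ! i)]) 1"
  unfolding lower_def by (rule runs_only)
 show "lowrel T i (a,b,St) (ts[i := act (rd (ts ! i),Left) (ts ! i)])"
  using assms by (auto simp: rel_def lowrel_def nth_list_update stk_lower)
qed

lemma runs_raise:
 assumes "lowrel T i (a,b,St) ts" "2 <= i" "i < T" "St i = []"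
 obtains ts' where "rel T (a,b,St) ts'" "runs (raise i) ts ts' 1"
proof
 show "runs (raise i) ts (ts[i := act (rd (ts ! i),Right) (ts ! i)]) 1"
  unfolding raise_def by (rule runs_only)
 show "rel T (a,b,St) (ts[i := act (rd (ts ! i),Right) (ts ! i)])"
  using assms low_Nil[of "ts ! i"] by (auto simp: rel_def lowrel_def nth_list_update)
qed

lemma lowrel_Cons:
 assumes "lowrel T i (a,b,St) ts" "2 <= i" "i < T" "St i = g # s"
 shows "rel T (a,b,St(i := s)) ts" "reads ts ! i = g" "g ~= 0"
 using assms low_Cons[of g s "ts ! i"] by (auto simp: rel_def lowrel_def reads_rd)

lemma lowrel_Nil:
 assumes "lowrel T i (a,b,St) ts" "i < T" "St i = []"
 shows "reads ts ! i = 0"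
 using assms low_Nil[of "ts ! i"] by (auto simp: lowrel_def reads_rd)

lemma aruns_popc_Nil:
 assumes "2 <= i" "i < T" "St i = []" "aruns T c0 (a,b,St) s' n"
 shows "aruns T (popc i c0 c1 c2) (a,b,St) s' (n + 5)"
 unfolding aruns_def popc_def
proof (intro allI impI)
 fix ts assume "rel T (a,b,St) ts"
 then obtain t1 where 1: "lowrel T i (a,b,St) t1" "runs (lower i) ts t1 1" using runs_lower assms by metis
 then obtain t2 where 2: "rel T (a,b,St) t2" "runs (raise i) t1 t2 1" using runs_raise assms by metis
 then obtain t3 m where 3: "m <= n" "rel T s' t3" "runs c0 t2 t3 m" using assms(4) unfolding aruns_def by blast
 have "reads t1 ! i = 0" using lowrel_Nil 1 assms by metis
 hence "runs (Cond (%gs. gs ! i = 0) (Seq (raise i) c0) (Cond (%gs. gs ! i = 1) c1 c2)) t1 t3 (Suc (Suc (m + 1)))"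
  using runs_Seq[OF 2(2) 3(3)] by (intro runs_Cond) simp
 from runs_Seq[OF 1(2) this] 3
 show "\<exists>ts' m. m <= n + 5 & rel T s' ts' & runs (Seq (lower i) (Cond (%gs. gs ! i = 0) (Seq (raise i) c0) (Cond (%gs. gs ! i = 1) c1 c2))) ts ts' m"
  by (intro exI[of _ t3] exI[of _ "Suc (Suc (Suc (m + 1)) + 1)"]) auto
qed

lemma aruns_popc_Cons:
 assumes "2 <= i" "i < T" "St i = g # s" "aruns T (if g = 1 then c1 else c2) (a,b,St(i := s)) s' n"
 shows "aruns T (popc i c0 c1 c2) (a,b,St) s' (n + 5)"
 unfolding aruns_def popc_def
proof (intro allI impI)
 fix ts assume "rel T (a,b,St) ts"
 then obtain t1 where 1: "lowrel T i (a,b,St) t1" "runs (lower i) ts t1 1" using runs_lower assms by metis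
 note l = lowrel_Cons[OF 1(1) assms(1-3)]
 then obtain t3 m where 3: "m <= n" "rel T s' t3" "runs (if g = 1 then c1 else c2) t1 t3 m"
  using assms(4) unfolding aruns_def by blast
 have "runs (Cond (%gs. gs ! i = 1) c1 c2) t1 t3 (Suc m)" using 3 l by (intro runs_Cond) simp
 hence "runs (Cond (%gs. gs ! i = 0) (Seq (raise i) c0) (Cond (%gs. gs ! i = 1) c1 c2)) t1 t3 (Suc (Suc m))"
  using l by (intro runs_Cond) simp
 from runs_Seq[OF 1(2) this] 3
 show "\<exists>ts' m. m <= n + 5 & rel T s' ts' & runs (Seq (lower i) (Cond (%gs. gs ! i = 0) (Seq (raise i) c0) (Cond (%gs. gs ! i = 1) c1 c2))) ts ts' m"
  by (intro exI[of _ t3] exI[of _ "Suc (Suc (Suc m) + 1)"]) auto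
qed

text \<open>Between iterations the head of tape \<open>i\<close> is lowered, because that is where
  the loop test reads it.\<close>

definition lruns :: "nat => nat => (nat => bool) => cmd => cmd => astate => astate => nat => bool" where
 "lruns T i p a b s s' n \<longleftrightarrow>
   (\<forall>ts. lowrel T i s ts --> (\<exists>ts' m. m <= n & lowrel T i s' ts' & runs (wloop i p a b) ts ts' m))"

lemma lruns_mono: "lruns T i p a b s s' n ==> n <= m ==> lruns T i p a b s s' m"
 unfolding lruns_def by (meson le_trans)

lemma lruns_Nil:
 assumes "i < T" "St i = []"
 shows "lruns T i p c d (a,b,St) (a,b,St) 1"
 unfolding lruns_def wloop_def
proof (intro allI impI)
 fix ts assume l: "lowrel T i (a,b,St) ts"
 hence "reads ts ! i = 0" using lowrel_Nil assms by metis
 hence "runs (While (%gs. gs ! i ~= 0) (Seq (Cond (%gs. p (gs ! i)) c d) (lower i))) ts ts 1"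
  by (intro runs_While_False) simp
 thus "\<exists>ts' m. m <= 1 & lowrel T i (a,b,St) ts' &
   runs (While (%gs. gs ! i ~= 0) (Seq (Cond (%gs. p (gs ! i)) c d) (lower i))) ts ts' m" using l by blast
qed

lemma lruns_Cons:
 assumes "2 <= i" "i < T" "St i = g # s" "aruns T (if p g then c else d) (a,b,St(i := s)) s1 n"
  "lruns T i p c d s1 s2 m"
 shows "lruns T i p c d (a,b,St) s2 (n + m + 5)"
 unfolding lruns_def
proof (intro allI impI)
 fix ts assume l: "lowrel T i (a,b,St) ts"
 note l1 = lowrel_Cons[OF l assms(1-3)]
 then obtain t1 n1 where 1: "n1 <= n" "rel T s1 t1" "runs (if p g then c else d) ts t1 n1"
  using assms(4) unfolding aruns_def by blast
 obtain a1 b1 S1 where s1: "s1 = (a1,b1,S1)" by (cases s1)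
 obtain t2 where 2: "lowrel T i s1 t2" "runs (lower i) t1 t2 1"
  using runs_lower[of T a1 b1 S1 t1 i] 1(2) assms(1,2) s1 by metis
 obtain t3 m1 where 3: "m1 <= m" "lowrel T i s2 t3" "runs (wloop i p c d) t2 t3 m1"
  using assms(5) 2 unfolding lruns_def by blast
 have "runs (Cond (%gs. p (gs ! i)) c d) ts t1 (Suc n1)" using 1 l1 by (intro runs_Cond) simp
 from runs_Seq[OF this 2(2)] have "runs (Seq (Cond (%gs. p (gs ! i)) c d) (lower i)) ts t2 (Suc (1 + Suc n1))" .
 hence "runs (wloop i p c d) ts t3 (Suc (m1 + Suc (1 + Suc n1)))"
  unfolding wloop_def using 3(3)[unfolded wloop_def] l1 by (intro runs_While_True) auto
 thus "\<exists>ts' ma. ma <= n + m + 5 & lowrel T i s2 ts' & runs (wloop i p c d) ts ts' ma"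
  using 1 3 by (intro exI[of _ t3] exI[of _ "Suc (m1 + Suc (1 + Suc n1))"]) auto
qed

lemma aruns_poploop:
 assumes "2 <= i" "i < T" "lruns T i p c d (a,b,St) (a',b',St') n" "St' i = []"
 shows "aruns T (poploop i p c d) (a,b,St) (a',b',St') (n + 4)"
 unfolding aruns_def poploop_def
proof (intro allI impI)
 fix ts assume "rel T (a,b,St) ts"
 then obtain t1 where 1: "lowrel T i (a,b,St) t1" "runs (lower i) ts t1 1" using runs_lower assms by metis
 then obtain t2 m where 2: "m <= n" "lowrel T i (a',b',St') t2" "runs (wloop i p c d) t1 t2 m"
  using assms(3) unfolding lruns_def by blast
 then obtain t3 where 3: "rel T (a',b',St') t3" "runs (raise i) t2 t3 1" using runs_raise assms by metis
 from runs_Seq[OF 1(2) runs_Seq[OF 2(3) 3(2)]] 2 3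
 show "\<exists>ts' m. m <= n + 4 & rel T (a',b',St') ts' & runs (Seq (lower i) (Seq (wloop i p c d) (raise i))) ts ts' m"
  by (intro exI[of _ t3] exI[of _ "Suc (Suc (1 + m) + 1)"]) auto
qed

section \<open>A machine working on a stack of binary trees\<close>

datatype tree = Nl | Cn tree tree

text \<open>Preorder encoding is self-delimiting: a tree can be taken off a stack without any length
  mark.\<close>

primrec enc :: "tree => nat list" where
 "enc Nl = [1]"
| "enc (Cn a b) = 2 # enc a @ enc b"

text \<open>Tape 2 is the main stack and tape 3 an auxiliary stack; tapes 4 and 5 are used for
  reversing and counting and are empty between operations, as are all further tapes.\<close>

definition sst :: "nat list => nat list => nat list => nat list => nat => nat list" where
 "sst m a t c = (%i. if i = 2 then m else if i = 3 then a else if i = 4 then t else if i = 5 then c else [])"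

lemma sst_simps[simp]:
 "sst m a t c 2 = m" "sst m a t c 3 = a" "sst m a t c 4 = t" "sst m a t c 5 = c"
 "(sst m a t c)(2 := x) = sst x a t c" "(sst m a t c)(3 := x) = sst m x t c"
 "(sst m a t c)(4 := x) = sst m a x c" "(sst m a t c)(5 := x) = sst m a t x"
 by (auto simp: sst_def fun_eq_iff)

text \<open>Wanted for its induction rule, which follows the preorder traversal of a list of trees,
  symbol by symbol as \<open>gulp\<close> reads it.\<close>

function (sequential) forest :: "tree list => unit" where
 "forest [] = ()"
| "forest (Nl # ts) = forest ts"
| "forest (Cn a b # ts) = forest (a # b # ts)"
 by pat_completeness auto
termination by (relation "measure (%ts. length (concat (map enc ts)))") auto

definition ss :: "nat => nat list => nat list => nat list => nat list => nat => nat list" where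
 "ss i x y t c = (if i = 2 then sst x y t c else sst y x t c)"

lemma ss_simps[simp]:
 "ss 2 x y t c = sst x y t c" "ss 3 x y t c = sst y x t c"
 "i : {2,3} ==> ss i x y t c i = x" "ss i x y t c 4 = t" "ss i x y t c 5 = c"
 "i : {2,3} ==> (ss i x y t c)(i := z) = ss i z y t c"
 "(ss i x y t c)(4 := z) = ss i x y z c" "(ss i x y t c)(5 := z) = ss i x y t z"
 by (auto simp: ss_def)

text \<open>Tape 5 holds one mark per tree that is still to be read: a leaf uses up the mark just
  popped, an inner node replaces it by two.\<close>

definition gulp1 :: "nat => bool => cmd" where
 "gulp1 i keep = popc i skip (if keep then push 4 1 else skip)
   (Seq (Seq (push 5 1) (push 5 1)) (if keep then push 4 2 else skip))"

definition gulp :: "nat => bool => cmd" where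
 "gulp i keep = Seq (push 5 1) (poploop 5 (%_. True) (gulp1 i keep) skip)"

abbreviation kept :: "bool => nat list => nat list => nat list" where
 "kept keep x t \<equiv> (if keep then rev x @ t else t)"

lemma push4_ss: "g ~= 0 ==> aruns T (if keep then push 4 g else skip) (a,b,ss i x y t c)
  (a,b,ss i x y (if keep then g # t else t) c) 1"
 using aruns_push[of 4 g T a b "ss i x y t c"] aruns_skip by auto

lemma push5_ss: "aruns T (push 5 1) (a,b,ss i x y t c) (a,b,ss i x y t (1 # c)) 1"
 using aruns_push[of 5 1 T a b "ss i x y t c"] by auto

lemma gulp_forest:
 assumes i: "i : {2,3}" and T: "6 <= T"
 shows "lruns T 5 (%_. True) (gulp1 i keep) skip
   (a,b,ss i (concat (map enc xs) @ r) y t (replicate (length xs) 1))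
   (a,b,ss i r y (kept keep (concat (map enc xs)) t) [])
   (20 * length (concat (map enc xs)) + 1)"
proof (induction xs arbitrary: t rule: forest.induct)
 case 1
 show ?case using lruns_Nil[of 5 T "ss i r y t []"] T by simp
next
 case (2 ts)
 let ?t = "if keep then 1 # t else t"
 have 1: "aruns T (gulp1 i keep) (a,b,ss i (enc Nl @ concat (map enc ts) @ r) y t (replicate (length ts) 1))
   (a,b,ss i (concat (map enc ts) @ r) y ?t (replicate (length ts) 1)) (1 + 5)"
  unfolding gulp1_def using i T push4_ss[of 1]
  by (intro aruns_popc_Cons[where g = 1 and s = "concat (map enc ts) @ r"]) auto
 have "lruns T 5 (%_. True) (gulp1 i keep) skip
   (a,b,ss i (enc Nl @ concat (map enc ts) @ r) y t (1 # replicate (length ts) 1))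
   (a,b,ss i r y (kept keep (concat (map enc ts)) ?t) []) ((1 + 5) + (20 * length (concat (map enc ts)) + 1) + 5)"
  using 1 T by (intro lruns_Cons[OF _ _ _ _ 2[of ?t], where g = 1 and s = "replicate (length ts) 1"]) auto
 from lruns_mono[OF this, of "20 * length (concat (map enc (Nl # ts))) + 1"] show ?case by (cases keep) simp_all
next
 case (3 x z ts)
 let ?t = "if keep then 2 # t else t" and ?c = "replicate (length ts) (1::nat)"
 let ?r = "concat (map enc (x # z # ts)) @ r"
 have "aruns T (Seq (Seq (push 5 1) (push 5 1)) (if keep then push 4 2 else skip)) (a,b,ss i ?r y t ?c)
   (a,b,ss i ?r y ?t (1 # 1 # ?c)) 5"
  by (rule aruns_mono[OF aruns_Seq[OF aruns_Seq[OF push5_ss push5_ss] push4_ss]]) simp_all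
 hence 1: "aruns T (gulp1 i keep) (a,b,ss i (enc (Cn x z) @ concat (map enc ts) @ r) y t ?c)
   (a,b,ss i ?r y ?t (1 # 1 # ?c)) (5 + 5)"
  unfolding gulp1_def using i T
  by (intro aruns_popc_Cons[where g = 2 and s = ?r]) auto
 have "lruns T 5 (%_. True) (gulp1 i keep) skip
   (a,b,ss i (enc (Cn x z) @ concat (map enc ts) @ r) y t (1 # ?c))
   (a,b,ss i r y (kept keep (concat (map enc (x # z # ts))) ?t) []) ((5 + 5) + (20 * length (concat (map enc (x # z # ts))) + 1) + 5)"
  using 1 T 3[of ?t] by (intro lruns_Cons[where g = 1 and s = ?c and ?s1.0 = "(a,b,ss i ?r y ?t (1 # 1 # ?c))"]) auto
 from lruns_mono[OF this, of "20 * length (concat (map enc (Cn x z # ts))) + 1"] show ?case by (cases keep) simp_all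
qed

lemma aruns_gulp:
 assumes i: "i : {2,3}" and T: "6 <= T"
 shows "aruns T (gulp i keep) (a,b,ss i (enc x @ r) y t []) (a,b,ss i r y (kept keep (enc x) t) [])
   (20 * length (enc x) + 7)"
proof -
 have "aruns T (poploop 5 (%_. True) (gulp1 i keep) skip) (a,b,ss i (enc x @ r) y t [1])
   (a,b,ss i r y (kept keep (enc x) t) []) (20 * length (enc x) + 1 + 4)"
  using T gulp_forest[OF i T, of keep a b "[x]" r y t] by (intro aruns_poploop) auto
 from aruns_mono[OF aruns_Seq[OF push5_ss this]] show ?thesis unfolding gulp_def by simp
qed


lemma enc_symbols: "set (enc x) \<subseteq> {1,2}"
 by (induction x) auto

definition sz :: "tree => nat" where "sz x = length (enc x)"

lemma sz_simps[simp]: "sz Nl = 1" "sz (Cn a b) = Suc (sz a + sz b)"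
 by (auto simp: sz_def)

definition pour1 :: "bool => bool => nat => cmd" where
 "pour1 dm da g = Seq (if dm then push 2 g else skip) (if da then push 3 g else skip)"

text \<open>Tape 4 holds the tree reversed; pouring reverses it once more onto one stack or onto
  both, which is how duplication is obtained.\<close>

definition pour :: "bool => bool => cmd" where
 "pour dm da = poploop 4 (%g. g = 1) (pour1 dm da 1) (pour1 dm da 2)"

lemma aruns_pour1:
 assumes "g ~= 0"
 shows "aruns T (pour1 dm da g) (x,y,sst m a t c)
  (x,y,sst (if dm then g # m else m) (if da then g # a else a) t c) 3"
proof -
 have 1: "aruns T (if dm then push 2 g else skip) (x,y,sst m a t c) (x,y,sst (if dm then g # m else m) a t c) 1"
  using aruns_push[of 2 g T x y "sst m a t c"] aruns_skip assms by auto
 have 2: "aruns T (if da then push 3 g else skip) (x,y,sst (if dm then g # m else m) a t c)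
   (x,y,sst (if dm then g # m else m) (if da then g # a else a) t c) 1"
  using aruns_push[of 3 g T x y "sst (if dm then g # m else m) a t c"] aruns_skip assms by auto
 from aruns_mono[OF aruns_Seq[OF 1 2]] show ?thesis unfolding pour1_def by simp
qed

lemma lruns_pour:
 assumes T: "6 <= T"
 shows "set t \<subseteq> {1,2} ==> lruns T 4 (%g. g = 1) (pour1 dm da 1) (pour1 dm da 2)
  (x,y,sst m a t []) (x,y,sst (if dm then rev t @ m else m) (if da then rev t @ a else a) [] []) (8 * length t + 1)"
proof (induction t arbitrary: m a)
 case Nil
 show ?case using lruns_Nil[of 4 T "sst m a [] []"] T by simp
next
 case (Cons g t)
 have "lruns T 4 (%g. g = 1) (pour1 dm da 1) (pour1 dm da 2) (x,y,sst m a (g # t) [])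
   (x,y,sst (if dm then rev t @ (if dm then g # m else m) else (if dm then g # m else m))
    (if da then rev t @ (if da then g # a else a) else (if da then g # a else a)) [] []) (3 + (8 * length t + 1) + 5)"
  by (rule lruns_Cons[OF _ _ _ _ Cons.IH, where g = g and s = t])
   (use T Cons.prems aruns_pour1[of g T dm da x y m a t "[]"] in auto)
 from lruns_mono[OF this, of "8 * length (g # t) + 1"] show ?case by (cases dm; cases da) simp_all
qed

lemma aruns_pour:
 assumes "6 <= T" "set t \<subseteq> {1,2}"
 shows "aruns T (pour dm da) (x,y,sst m a t [])
  (x,y,sst (if dm then rev t @ m else m) (if da then rev t @ a else a) [] []) (8 * length t + 5)"
 unfolding pour_def by (rule aruns_mono[OF aruns_poploop[OF _ _ lruns_pour[OF assms]]]) (use assms in simp_all)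

definition "toA = Seq (gulp 2 True) (pour False True)"
definition "toM = Seq (gulp 3 True) (pour True False)"
definition "drp = gulp 2 False"
definition "dup = Seq (Seq (gulp 2 True) (pour True True)) toM"

lemma gulp_main:
 assumes "6 <= T"
 shows "aruns T (gulp 2 True) (p,q,sst (enc x @ r) a [] []) (p,q,sst r a (rev (enc x)) []) (20 * sz x + 7)"
  "aruns T (gulp 2 False) (p,q,sst (enc x @ r) a [] []) (p,q,sst r a [] []) (20 * sz x + 7)"
  "aruns T (gulp 3 True) (p,q,sst r (enc x @ a) [] []) (p,q,sst r a (rev (enc x)) []) (20 * sz x + 7)"
 using aruns_gulp[of 2 T True p q x r a "[]"] aruns_gulp[of 2 T False p q x r a "[]"]
  aruns_gulp[of 3 T True p q x a r "[]"] assms by (simp_all add: sz_def)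

lemma pour_enc:
 assumes "6 <= T"
 shows "aruns T (pour dm da) (p,q,sst m a (rev (enc x)) [])
  (p,q,sst (if dm then enc x @ m else m) (if da then enc x @ a else a) [] []) (8 * sz x + 5)"
 using aruns_pour[of T "rev (enc x)" dm da p q m a] assms enc_symbols[of x] by (cases dm; cases da; simp add: sz_def)

lemma pour_cases:
 assumes "6 <= T"
 shows "aruns T (pour False True) (p,q,sst m a (rev (enc x)) []) (p,q,sst m (enc x @ a) [] []) (8 * sz x + 5)"
  "aruns T (pour True False) (p,q,sst m a (rev (enc x)) []) (p,q,sst (enc x @ m) a [] []) (8 * sz x + 5)"
  "aruns T (pour True True) (p,q,sst m a (rev (enc x)) []) (p,q,sst (enc x @ m) (enc x @ a) [] []) (8 * sz x + 5)"
 using pour_enc[OF assms, of False True p q m a x] pour_enc[OF assms, of True False p q m a x]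
  pour_enc[OF assms, of True True p q m a x] by simp_all

primrec hdt :: "tree => tree" where "hdt Nl = Nl" | "hdt (Cn a b) = a"
primrec tlt :: "tree => tree" where "tlt Nl = Nl" | "tlt (Cn a b) = b"

locale machine =
 fixes T S :: nat
 assumes T: "6 <= T" and S: "3 <= S"
begin

lemma toA: "aruns T toA (p,q,sst (enc x @ r) a [] []) (p,q,sst r (enc x @ a) [] []) (28 * sz x + 13)"
 unfolding toA_def
 by (rule aruns_mono[OF aruns_Seq[OF gulp_main(1)[OF T] pour_cases(1)[OF T]]]) simp

lemma toM: "aruns T toM (p,q,sst r (enc x @ a) [] []) (p,q,sst (enc x @ r) a [] []) (28 * sz x + 13)"
 unfolding toM_def
 by (rule aruns_mono[OF aruns_Seq[OF gulp_main(3)[OF T] pour_cases(2)[OF T]]]) simp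

lemma drp: "aruns T drp (p,q,sst (enc x @ r) a [] []) (p,q,sst r a [] []) (20 * sz x + 7)"
 unfolding drp_def by (rule gulp_main(2)[OF T])

lemma dup: "aruns T dup (p,q,sst (enc x @ r) a [] []) (p,q,sst (enc x @ enc x @ r) a [] []) (56 * sz x + 27)"
 unfolding dup_def
 by (rule aruns_mono[OF aruns_Seq[OF aruns_Seq[OF gulp_main(1)[OF T] pour_cases(3)[OF T]] toM]]) simp

lemma ok_ops: "cmd_ok T S toA" "cmd_ok T S toM" "cmd_ok T S drp" "cmd_ok T S dup"
 using S by (auto simp: toA_def toM_def drp_def dup_def gulp_def gulp1_def pour_def pour1_def)

text \<open>The index type of \<open>x\<close> allows specifications on restricted families of
  inputs, with time bounds in any parameter. Quantifying over \<open>r\<close> and \<open>a\<close>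
  makes the program preserve both stacks below its argument, so programs can be nested.\<close>

definition impl :: "('x => tree) => ('x => tree) => ('x => nat) => bool" where
 "impl i f tm \<longleftrightarrow> (\<exists>c. cmd_ok T S c & (\<forall>x r a p q. aruns T c (p,q,sst (enc (i x) @ r) a [] [])
   (p,q,sst (enc (f x) @ r) a [] []) (tm x)))"

lemma impl_mono: "impl i f tm ==> (!!x. tm x <= tm' x) ==> impl i f tm'"
 unfolding impl_def by (meson aruns_mono)

lemma impl_reindex: "impl i f tm ==> impl (%x. i (h x)) (%x. f (h x)) (%x. tm (h x))"
 unfolding impl_def by blast

lemma impl_id: "impl i i (%_. 1)"
 unfolding impl_def using aruns_skip by (intro exI[of _ skip]) auto

lemma impl_comp:
 assumes "impl i f tf" "impl f g tg"
 shows "impl i g (%x. tf x + tg x + 1)"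
proof -
 obtain c d where "cmd_ok T S c" "cmd_ok T S d"
  "!!x r a p q. aruns T c (p,q,sst (enc (i x) @ r) a [] []) (p,q,sst (enc (f x) @ r) a [] []) (tf x)"
  "!!x r a p q. aruns T d (p,q,sst (enc (f x) @ r) a [] []) (p,q,sst (enc (g x) @ r) a [] []) (tg x)"
  using assms unfolding impl_def by metis
 note cd = this
 show ?thesis unfolding impl_def
 proof (intro exI[of _ "Seq c d"] conjI allI)
  show "cmd_ok T S (Seq c d)" using cd by simp
 qed (rule aruns_Seq cd)+
qed

primrec pushl :: "nat list => cmd" where
 "pushl [] = skip"
| "pushl (g # xs) = Seq (pushl xs) (push 2 g)"

lemma aruns_pushl: "0 ~: set xs ==> aruns T (pushl xs) (p,q,sst m a t c) (p,q,sst (xs @ m) a t c) (2 * length xs + 1)"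
proof (induction xs)
 case Nil thus ?case using aruns_skip by simp
next
 case (Cons g xs)
 have "aruns T (push 2 g) (p,q,sst (xs @ m) a t c) (p,q,sst (g # xs @ m) a t c) 1"
  using aruns_push[of 2 g T p q "sst (xs @ m) a t c"] Cons.prems by auto
 from aruns_mono[OF aruns_Seq[OF Cons.IH this]] Cons.prems show ?case by simp
qed

lemma pushl_ok: "set xs \<subseteq> {1,2} ==> cmd_ok T S (pushl xs)"
 using S by (induction xs) auto

lemma impl_const: "impl i (%_. k) (%x. 20 * sz (i x) + 2 * sz k + 9)"
 unfolding impl_def
proof (intro exI[of _ "Seq drp (pushl (enc k))"] conjI allI)
 show "cmd_ok T S (Seq drp (pushl (enc k)))" using ok_ops pushl_ok enc_symbols by simp
 fix x r a p q
 have "0 ~: set (enc k)" using enc_symbols[of k] by auto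
 from aruns_mono[OF aruns_Seq[OF drp aruns_pushl[OF this]]]
 show "aruns T (Seq drp (pushl (enc k))) (p,q,sst (enc (i x) @ r) a [] []) (p,q,sst (enc k @ r) a [] []) (20 * sz (i x) + 2 * sz k + 9)"
  by (simp add: sz_def)
qed

text \<open>The first result is parked on the auxiliary stack while the second is computed from the
  duplicate; the symbol 2 pushed last joins the two encodings into one.\<close>

lemma impl_pair:
 assumes "impl i f tf" "impl i g tg"
 shows "impl i (%x. Cn (f x) (g x)) (%x. tf x + tg x + 60 * sz (i x) + 60 * sz (f x) + 100)"
proof -
 obtain c d where cd: "cmd_ok T S c" "cmd_ok T S d"
  "!!x r a p q. aruns T c (p,q,sst (enc (i x) @ r) a [] []) (p,q,sst (enc (f x) @ r) a [] []) (tf x)"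
  "!!x r a p q. aruns T d (p,q,sst (enc (i x) @ r) a [] []) (p,q,sst (enc (g x) @ r) a [] []) (tg x)"
  using assms unfolding impl_def by metis
 show ?thesis unfolding impl_def
 proof (intro exI[of _ "Seq (Seq (Seq (Seq (Seq dup c) toA) d) toM) (push 2 2)"] conjI allI)
  show "cmd_ok T S (Seq (Seq (Seq (Seq (Seq dup c) toA) d) toM) (push 2 2))" using cd ok_ops S by simp
  fix x r a p q
  have "aruns T (push 2 2) (p,q,sst (enc (f x) @ enc (g x) @ r) a [] [])
    (p,q,sst (enc (Cn (f x) (g x)) @ r) a [] []) 1"
   using aruns_push[of 2 2 T p q "sst (enc (f x) @ enc (g x) @ r) a [] []"] by simp
  from aruns_mono[OF aruns_Seq[OF aruns_Seq[OF aruns_Seq[OF aruns_Seq[OF aruns_Seq[OF dup cd(3)] toA] cd(4)] toM] this]]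
  show "aruns T (Seq (Seq (Seq (Seq (Seq dup c) toA) d) toM) (push 2 2)) (p,q,sst (enc (i x) @ r) a [] [])
   (p,q,sst (enc (Cn (f x) (g x)) @ r) a [] []) (tf x + tg x + 60 * sz (i x) + 60 * sz (f x) + 100)" by simp
 qed
qed

lemma popc2:
 assumes "aruns T (if g = 1 then c1 else c2) (p,q,sst m a t c) s' n"
 shows "aruns T (popc 2 c0 c1 c2) (p,q,sst (g # m) a t c) s' (n + 5)"
 using assms T by (intro aruns_popc_Cons[where g = g and s = m]) auto

lemma impl_cond:
 assumes "impl i f tf" "impl i g tg" "impl i h th"
 shows "impl i (%x. if f x = Nl then g x else h x)
  (%x. tf x + tg x + th x + 60 * sz (i x) + 60 * sz (f x) + 100)"
proof -
 obtain c d e where cd: "cmd_ok T S c" "cmd_ok T S d" "cmd_ok T S e"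
  "!!x r a p q. aruns T c (p,q,sst (enc (i x) @ r) a [] []) (p,q,sst (enc (f x) @ r) a [] []) (tf x)"
  "!!x r a p q. aruns T d (p,q,sst (enc (i x) @ r) a [] []) (p,q,sst (enc (g x) @ r) a [] []) (tg x)"
  "!!x r a p q. aruns T e (p,q,sst (enc (i x) @ r) a [] []) (p,q,sst (enc (h x) @ r) a [] []) (th x)"
  using assms unfolding impl_def by metis
 let ?b = "popc 2 skip d (Seq (Seq drp drp) e)"
 show ?thesis unfolding impl_def
 proof (intro exI[of _ "Seq (Seq dup c) ?b"] conjI allI)
  show "cmd_ok T S (Seq (Seq dup c) ?b)" using cd ok_ops S by simp
  fix x r a p q
  have "aruns T ?b (p,q,sst (enc (f x) @ enc (i x) @ r) a [] [])
    (p,q,sst (enc (if f x = Nl then g x else h x) @ r) a [] []) (tg x + th x + 20 * sz (f x) + 30)"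
  proof (cases "f x")
   case Nl
   have "aruns T ?b (p,q,sst (1 # enc (i x) @ r) a [] []) (p,q,sst (enc (g x) @ r) a [] []) (tg x + 5)"
    by (rule popc2) (simp add: cd(5))
   from aruns_mono[OF this] Nl show ?thesis by simp
  next
   case (Cn y z)
   have "aruns T (Seq (Seq drp drp) e) (p,q,sst (enc y @ enc z @ enc (i x) @ r) a [] []) (p,q,sst (enc (h x) @ r) a [] [])
     (((20 * sz y + 7) + (20 * sz z + 7) + 1) + th x + 1)"
    by (rule aruns_Seq[OF aruns_Seq[OF drp drp] cd(6)])
   hence "aruns T ?b (p,q,sst (2 # enc y @ enc z @ enc (i x) @ r) a [] []) (p,q,sst (enc (h x) @ r) a [] [])
     ((((20 * sz y + 7) + (20 * sz z + 7) + 1) + th x + 1) + 5)"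
    by (intro popc2) simp
   from aruns_mono[OF this] Cn show ?thesis by simp
  qed
  from aruns_mono[OF aruns_Seq[OF aruns_Seq[OF dup cd(4)] this]]
  show "aruns T (Seq (Seq dup c) ?b) (p,q,sst (enc (i x) @ r) a [] [])
   (p,q,sst (enc (if f x = Nl then g x else h x) @ r) a [] []) (tf x + tg x + th x + 60 * sz (i x) + 60 * sz (f x) + 100)" by simp
 qed
qed


lemma impl_hd: "impl i (%x. hdt (i x)) (%x. 80 * sz (i x) + 60)"
 unfolding impl_def
proof (intro exI[of _ "popc 2 skip (push 2 1) (Seq toA (Seq drp toM))"] conjI allI)
 show "cmd_ok T S (popc 2 skip (push 2 1) (Seq toA (Seq drp toM)))" using ok_ops S by simp
 fix x r a p q
 show "aruns T (popc 2 skip (push 2 1) (Seq toA (Seq drp toM))) (p,q,sst (enc (i x) @ r) a [] [])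
   (p,q,sst (enc (hdt (i x)) @ r) a [] []) (80 * sz (i x) + 60)"
 proof (cases "i x")
  case Nl
  have "aruns T (push 2 1) (p,q,sst r a [] []) (p,q,sst (1 # r) a [] []) 1"
   using aruns_push[of 2 1 T p q "sst r a [] []"] by simp
  hence "aruns T (popc 2 skip (push 2 1) (Seq toA (Seq drp toM))) (p,q,sst (1 # r) a [] [])
   (p,q,sst (1 # r) a [] []) (1 + 5)"
   by (intro popc2) simp
  from aruns_mono[OF this] Nl show ?thesis by simp
 next
  case (Cn y z)
  have "aruns T (popc 2 skip (push 2 1) (Seq toA (Seq drp toM))) (p,q,sst (2 # enc y @ enc z @ r) a [] [])
   (p,q,sst (enc y @ r) a [] []) ((28 * sz y + 13 + (20 * sz z + 7 + (28 * sz y + 13) + 1) + 1) + 5)"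
   using aruns_Seq[OF toA aruns_Seq[OF drp toM]] by (intro popc2) simp
  from aruns_mono[OF this] Cn show ?thesis by simp
 qed
qed

lemma impl_tl: "impl i (%x. tlt (i x)) (%x. 80 * sz (i x) + 60)"
 unfolding impl_def
proof (intro exI[of _ "popc 2 skip (push 2 1) drp"] conjI allI)
 show "cmd_ok T S (popc 2 skip (push 2 1) drp)" using ok_ops S by simp
 fix x r a p q
 show "aruns T (popc 2 skip (push 2 1) drp) (p,q,sst (enc (i x) @ r) a [] [])
   (p,q,sst (enc (tlt (i x)) @ r) a [] []) (80 * sz (i x) + 60)"
 proof (cases "i x")
  case Nl
  have "aruns T (push 2 1) (p,q,sst r a [] []) (p,q,sst (1 # r) a [] []) 1"
   using aruns_push[of 2 1 T p q "sst r a [] []"] by simp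
  hence "aruns T (popc 2 skip (push 2 1) drp) (p,q,sst (1 # r) a [] [])
   (p,q,sst (1 # r) a [] []) (1 + 5)"
   by (intro popc2) simp
  from aruns_mono[OF this] Nl show ?thesis by simp
 next
  case (Cn y z)
  have "aruns T (popc 2 skip (push 2 1) drp) (p,q,sst (2 # enc y @ enc z @ r) a [] [])
   (p,q,sst (enc z @ r) a [] []) ((20 * sz y + 7) + 5)"
   using drp by (intro popc2) simp
  from aruns_mono[OF this] Cn show ?thesis by simp
 qed
qed

definition wcost :: "('x => tree) => ('x => tree) => ('x => nat) => ('x => nat) => 'x => nat" where
 "wcost i t tt tg y = tt y + tg y + 60 * sz (i y) + 60 * sz (t y) + 100"

lemma push_flag: "aruns T (push 5 1) (p,q,sst m a t c) (p,q,sst m a t (1 # c)) 1"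
 using aruns_push[of 5 1 T p q "sst m a t c"] by simp

text \<open>Tape 5 carries the loop flag. \<open>poploop\<close> consumes it before the body starts,
  so the body finds tape 5 empty and may use it for \<open>gulp\<close>; a new mark is pushed only
  if the test succeeds. The bound sums the costs of the actual iterations and therefore also serves
  loops of exponential length.\<close>

lemma impl_while:
 assumes "impl i t tt" "impl i (%s. i (g s)) tg"
  and "!!x. \<exists>n. f x = (g ^^ n) (h x) & (\<forall>i<n. t ((g ^^ i) (h x)) ~= Nl) & t (f x) = Nl &
    (\<Sum>j\<le>n. wcost i t tt tg ((g ^^ j) (h x))) + 10 <= tm x"
 shows "impl (%x. i (h x)) (%x. i (f x)) tm"
proof -
 obtain d c where cd: "cmd_ok T S d" "cmd_ok T S c"
  "!!x r a p q. aruns T d (p,q,sst (enc (i x) @ r) a [] []) (p,q,sst (enc (t x) @ r) a [] []) (tt x)"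
  "!!x r a p q. aruns T c (p,q,sst (enc (i x) @ r) a [] []) (p,q,sst (enc (i (g x)) @ r) a [] []) (tg x)"
  using assms(1,2) unfolding impl_def by metis
 define b where "b = Seq (Seq dup d) (popc 2 skip skip (Seq (Seq (Seq drp drp) c) (push 5 1)))"
 \<comment> \<open>The 5 steps held back in this bound are the ones that \<open>lruns_Cons\<close>
   adds for each iteration.\<close>
 have stop: "aruns T b (p,q,sst (enc (i x) @ r) a [] []) (p,q,sst (enc (i x) @ r) a [] []) (wcost i t tt tg x - 5)"
  if "t x = Nl" for x r a p q
 proof -
  have "aruns T (popc 2 skip skip (Seq (Seq (Seq drp drp) c) (push 5 1)))
    (p,q,sst (1 # enc (i x) @ r) a [] []) (p,q,sst (enc (i x) @ r) a [] []) (1 + 5)"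
   using aruns_skip by (intro popc2) simp
  hence "aruns T (popc 2 skip skip (Seq (Seq (Seq drp drp) c) (push 5 1)))
    (p,q,sst (enc (t x) @ enc (i x) @ r) a [] []) (p,q,sst (enc (i x) @ r) a [] []) (1 + 5)" using that by simp
  from aruns_mono[OF aruns_Seq[OF aruns_Seq[OF dup cd(3)] this]] show ?thesis
   unfolding b_def by (simp add: wcost_def)
 qed
 have go: "aruns T b (p,q,sst (enc (i x) @ r) a [] []) (p,q,sst (enc (i (g x)) @ r) a [] [1]) (wcost i t tt tg x - 5)"
  if nn: "t x ~= Nl" for x r a p q
 proof -
  obtain y z where yz: "t x = Cn y z" using nn by (cases "t x") auto
  have "aruns T (popc 2 skip skip (Seq (Seq (Seq drp drp) c) (push 5 1)))
    (p,q,sst (2 # enc y @ enc z @ enc (i x) @ r) a [] []) (p,q,sst (enc (i (g x)) @ r) a [] [1])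
    (((20 * sz y + 7 + (20 * sz z + 7) + 1) + tg x + 1 + 1 + 1) + 5)"
   using aruns_Seq[OF aruns_Seq[OF aruns_Seq[OF drp drp] cd(4)] push_flag] by (intro popc2) simp
  hence "aruns T (popc 2 skip skip (Seq (Seq (Seq drp drp) c) (push 5 1)))
    (p,q,sst (enc (t x) @ enc (i x) @ r) a [] []) (p,q,sst (enc (i (g x)) @ r) a [] [1])
    (((20 * sz y + 7 + (20 * sz z + 7) + 1) + tg x + 1 + 1 + 1) + 5)" using yz by simp
  from aruns_mono[OF aruns_Seq[OF aruns_Seq[OF dup cd(3)] this]] show ?thesis
   unfolding b_def by (simp add: wcost_def yz)
 qed
 have loop: "(\<forall>i<n. t ((g ^^ i) x) ~= Nl) ==> t ((g ^^ n) x) = Nl ==>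
   lruns T 5 (%_. True) b skip (p,q,sst (enc (i x) @ r) a [] [1]) (p,q,sst (enc (i ((g ^^ n) x)) @ r) a [] [])
    ((\<Sum>j\<le>n. wcost i t tt tg ((g ^^ j) x)) + 1)" for n x r a p q
 proof (induction n arbitrary: x)
  case 0
  have "lruns T 5 (%_. True) b skip (p,q,sst (enc (i x) @ r) a [] [1]) (p,q,sst (enc (i x) @ r) a [] [])
    ((wcost i t tt tg x - 5) + 1 + 5)"
   by (rule lruns_Cons[where g = 1 and s = "[]" and ?s1.0 = "(p,q,sst (enc (i x) @ r) a [] [])"])
    (use 0 T stop[of x] lruns_Nil[of 5 T "sst (enc (i x) @ r) a [] []"] in simp_all)
  moreover have "(wcost i t tt tg x - 5) + 1 + 5 <= (\<Sum>j\<le>0. wcost i t tt tg ((g ^^ j) x)) + 1" by (simp add: wcost_def)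
  ultimately have "lruns T 5 (%_. True) b skip (p,q,sst (enc (i x) @ r) a [] [1]) (p,q,sst (enc (i x) @ r) a [] [])
   ((\<Sum>j\<le>0. wcost i t tt tg ((g ^^ j) x)) + 1)" by (rule lruns_mono)
  thus ?case by simp
 next
  case (Suc n)
  have e: "(g ^^ Suc i) x = (g ^^ i) (g x)" for i by (simp add: funpow_swap1)
  have IH: "lruns T 5 (%_. True) b skip (p,q,sst (enc (i (g x)) @ r) a [] [1]) (p,q,sst (enc (i ((g ^^ n) (g x))) @ r) a [] [])
    ((\<Sum>j\<le>n. wcost i t tt tg ((g ^^ j) (g x))) + 1)"
   by (rule Suc.IH) (use Suc.prems e in \<open>auto simp del: funpow.simps\<close>)
  have "t x ~= Nl" using Suc.prems(1)[rule_format, of 0] by simp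
  note go[OF this]
  hence "lruns T 5 (%_. True) b skip (p,q,sst (enc (i x) @ r) a [] [1]) (p,q,sst (enc (i ((g ^^ n) (g x))) @ r) a [] [])
    ((wcost i t tt tg x - 5) + ((\<Sum>j\<le>n. wcost i t tt tg ((g ^^ j) (g x))) + 1) + 5)"
   by (intro lruns_Cons[OF _ _ _ _ IH, where g = 1 and s = "[]"]) (use T in simp_all)
  hence "lruns T 5 (%_. True) b skip (p,q,sst (enc (i x) @ r) a [] [1]) (p,q,sst (enc (i ((g ^^ n) (g x))) @ r) a [] [])
    ((\<Sum>j\<le>Suc n. wcost i t tt tg ((g ^^ j) x)) + 1)"
   by (rule lruns_mono)
    (subst sum.atMost_Suc_shift, unfold e, simp add: wcost_def[of _ _ _ _ x])
  thus ?case unfolding e .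
 qed
 show ?thesis unfolding impl_def
 proof (intro exI[of _ "Seq (push 5 1) (poploop 5 (%_. True) b skip)"] conjI allI)
  show "cmd_ok T S (Seq (push 5 1) (poploop 5 (%_. True) b skip))" using cd ok_ops S by (simp add: b_def)
  fix x r a p q
  obtain n where n: "f x = (g ^^ n) (h x)" "\<forall>i<n. t ((g ^^ i) (h x)) ~= Nl" "t ((g ^^ n) (h x)) = Nl"
    "(\<Sum>j\<le>n. wcost i t tt tg ((g ^^ j) (h x))) + 10 <= tm x" using assms(3)[of x] by auto
  have "aruns T (poploop 5 (%_. True) b skip) (p,q,sst (enc (i (h x)) @ r) a [] [1]) (p,q,sst (enc (i ((g ^^ n) (h x))) @ r) a [] [])
    ((\<Sum>j\<le>n. wcost i t tt tg ((g ^^ j) (h x))) + 1 + 4)"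
   by (rule aruns_poploop[OF _ _ loop[OF n(2,3)]]) (use T in simp_all)
  from aruns_mono[OF aruns_Seq[OF push_flag this]] n(4)
  show "aruns T (Seq (push 5 1) (poploop 5 (%_. True) b skip)) (p,q,sst (enc (i (h x)) @ r) a [] [])
    (p,q,sst (enc (i (f x)) @ r) a [] []) (tm x)" by (simp add: n(1))
 qed
qed

end

section \<open>Input and output\<close>

primrec bits :: "bool list => tree" where
 "bits [] = Nl"
| "bits (b # x) = Cn (if b then Cn Nl Nl else Nl) (bits x)"

context machine
begin


lemma aruns_While0_False: "rd p = 0 ==> aruns T (While (%gs. gs ! 0 ~= 0) c) (p,q,St) (p,q,St) 1"
 unfolding aruns_def
proof (intro allI impI)
 fix ts assume r: "rd p = 0" "rel T (p,q,St) ts"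
 hence "reads ts ! 0 = 0" using T by (auto simp: rel_def reads_rd)
 hence "runs (While (%gs. gs ! 0 ~= 0) c) ts ts 1" by (intro runs_While_False) simp
 thus "\<exists>ts' m. m <= 1 & rel T (p,q,St) ts' & runs (While (%gs. gs ! 0 ~= 0) c) ts ts' m" using r by blast
qed

lemma aruns_While0_True:
 assumes "rd p ~= 0" "aruns T c (p,q,St) s1 n" "aruns T (While (%gs. gs ! 0 ~= 0) c) s1 s2 m"
 shows "aruns T (While (%gs. gs ! 0 ~= 0) c) (p,q,St) s2 (n + m + 1)"
 unfolding aruns_def
proof (intro allI impI)
 fix ts assume r: "rel T (p,q,St) ts"
 hence *: "reads ts ! 0 ~= 0" using T assms(1) by (auto simp: rel_def reads_rd)
 obtain t1 n1 where 1: "n1 <= n" "rel T s1 t1" "runs c ts t1 n1" using assms(2) r unfolding aruns_def by blast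
 obtain t2 n2 where 2: "n2 <= m" "rel T s2 t2" "runs (While (%gs. gs ! 0 ~= 0) c) t1 t2 n2"
  using assms(3) 1 unfolding aruns_def by blast
 have "runs (While (%gs. gs ! 0 ~= 0) c) ts t2 (Suc (n2 + n1))" using * 1 2 by (intro runs_While_True) auto
 thus "\<exists>ts' ma. ma <= n + m + 1 & rel T s2 ts' & runs (While (%gs. gs ! 0 ~= 0) c) ts ts' ma"
  using 1 2 by (intro exI[of _ t2] exI[of _ "Suc (n2 + n1)"]) auto
qed

lemma aruns_Cond0:
 assumes "aruns T (if P (rd p) then c else d) (p,q,St) s' n"
 shows "aruns T (Cond (%gs. P (gs ! 0)) c d) (p,q,St) s' (n + 1)"
 unfolding aruns_def
proof (intro allI impI)
 fix ts assume r: "rel T (p,q,St) ts"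
 hence *: "reads ts ! 0 = rd p" using T by (auto simp: rel_def reads_rd)
 obtain t1 n1 where 1: "n1 <= n" "rel T s' t1" "runs (if P (rd p) then c else d) ts t1 n1"
  using assms r unfolding aruns_def by blast
 have "runs (Cond (%gs. P (gs ! 0)) c d) ts t1 (Suc n1)" using * 1 by (intro runs_Cond) simp
 thus "\<exists>ts' m. m <= n + 1 & rel T s' ts' & runs (Cond (%gs. P (gs ! 0)) c d) ts ts' m"
  using 1 by (intro exI[of _ t1] exI[of _ "Suc n1"]) auto
qed

lemma aruns_act0: "aruns T (Act (only 0 f)) (p,q,St) (act (f (rd p)) p,q,St) 1"
 unfolding aruns_def
proof (intro allI impI)
 fix ts assume "rel T (p,q,St) ts"
 hence "rel T (act (f (rd p)) p,q,St) (ts[0 := act (f (rd (ts ! 0))) (ts ! 0)])"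
  using T by (auto simp: rel_def nth_list_update)
 thus "\<exists>ts' m. m <= 1 & rel T (act (f (rd p)) p,q,St) ts' & runs (Act (only 0 f)) ts ts' m"
  using runs_only by blast
qed

lemma aruns_act1: "aruns T (Act (only 1 f)) (p,q,St) (p,act (f (rd q)) q,St) 1"
 unfolding aruns_def
proof (intro allI impI)
 fix ts assume "rel T (p,q,St) ts"
 hence "rel T (p,act (f (rd q)) q,St) (ts[1 := act (f (rd (ts ! 1))) (ts ! 1)])"
  using T by (auto simp: rel_def nth_list_update)
 thus "\<exists>ts' m. m <= 1 & rel T (p,act (f (rd q)) q,St) ts' & runs (Act (only 1 f)) ts ts' m"
  using runs_only by blast
qed

definition intape :: "bool list => int => nat" where
 "intape x = (%i. if 0 <= i & i < int (length x) then bit_symbol (x ! nat i) else 0)"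

text \<open>Bits are pushed from last to first, because the encoding of a list has its first element
  on top; hence the head first runs to the right end of the input. The words
  \<open>[2,2,1,1]\<close> and \<open>[2,1]\<close> in \<open>readin\<close> begin a list cell with
  head \<open>True\<close> or \<open>False\<close>.\<close>

definition "rewind = While (%gs. gs ! 0 ~= 0) (Act (only 0 (%g. (g,Right))))"
definition "readin = While (%gs. gs ! 0 ~= 0)
  (Seq (Cond (%gs. gs ! 0 = 2) (pushl [2,2,1,1]) (pushl [2,1])) (Act (only 0 (%g. (g,Left)))))"
definition "inp = Seq (Seq (push 2 1) rewind) (Seq (Act (only 0 (%g. (g,Left)))) readin)"

lemma act_moves: "act (g,Right) (c,h) = (c(h := g),h + 1)" "act (g,Left) (c,h) = (c(h := g),h - 1)"
 by (auto simp: act_def)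

lemma rewind: "k <= length x ==> aruns T rewind ((intape x,int (length x - k)),q,St)
  ((intape x,int (length x)),q,St) (2 * k + 1)"
proof (induction k)
 case 0
 show ?case unfolding rewind_def by (simp, rule aruns_While0_False[simplified]) (simp add: rd_def intape_def)
next
 case (Suc k)
 let ?h = "int (length x - Suc k)"
 have h: "?h + 1 = int (length x - k)" using Suc.prems by simp
 have nz: "rd (intape x,?h) ~= 0" using Suc.prems by (simp add: rd_def intape_def bit_symbol_def)
 have "act (rd (intape x,?h),Right) (intape x,?h) = (intape x,int (length x - k))"
  unfolding act_moves h by (simp add: rd_def)
 hence "aruns T (Act (only 0 (%g. (g,Right)))) ((intape x,?h),q,St) ((intape x,int (length x - k)),q,St) 1"
  using aruns_act0[of "%g. (g,Right)" "(intape x,?h)" q St] by simp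
 from aruns_mono[OF aruns_While0_True[OF nz this Suc.IH[unfolded rewind_def]]] Suc.prems
 show ?case unfolding rewind_def by simp
qed

lemma readin: "k <= length x ==> aruns T readin ((intape x,int k - 1),q,sst (enc (bits (drop k x)) @ r) [] [] [])
  ((intape x,- 1),q,sst (enc (bits x) @ r) [] [] []) (20 * k + 1)"
proof (induction k)
 case 0
 show ?case unfolding readin_def by (simp, rule aruns_While0_False[simplified]) (simp add: rd_def intape_def)
next
 case (Suc k)
 let ?p = "(intape x,int (Suc k) - 1)" and ?m = "enc (bits (drop (Suc k) x)) @ r"
 have rd: "rd ?p = bit_symbol (x ! k)" using Suc.prems by (simp add: rd_def intape_def)
 have nz: "rd ?p ~= 0" unfolding rd by (simp add: bit_symbol_def)
 have dk: "drop k x = x ! k # drop (Suc k) x" using Suc.prems by (simp add: Cons_nth_drop_Suc)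
 have push: "aruns T (if rd ?p = 2 then pushl [2,2,1,1] else pushl [2,1]) (?p,q,sst ?m [] [] [])
   (?p,q,sst (enc (bits (drop k x)) @ r) [] [] []) 9"
 proof (cases "x ! k")
  case True
  have "aruns T (pushl [2,2,1,1]) (?p,q,sst ?m [] [] []) (?p,q,sst ([2,2,1,1] @ ?m) [] [] []) (2 * length [2::nat,2,1,1] + 1)"
   by (rule aruns_pushl) simp
  from aruns_mono[OF this, of 9] True show ?thesis unfolding rd dk by (simp add: bit_symbol_def)
 next
  case False
  have "aruns T (pushl [2,1]) (?p,q,sst ?m [] [] []) (?p,q,sst ([2,1] @ ?m) [] [] []) (2 * length [2::nat,1] + 1)"
   by (rule aruns_pushl) simp
  from aruns_mono[OF this, of 9] False show ?thesis unfolding rd dk by (simp add: bit_symbol_def)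
 qed
 have "act (rd ?p,Left) ?p = (intape x,int k - 1)"
  unfolding act_moves by (simp add: rd_def)
 hence mv: "aruns T (Act (only 0 (%g. (g,Left)))) (?p,q,St) ((intape x,int k - 1),q,St) 1" for St
  using aruns_act0[of "%g. (g,Left)" "?p" q St] by simp
 have IH: "aruns T readin ((intape x,int k - 1),q,sst (enc (bits (drop k x)) @ r) [] [] [])
  ((intape x,- 1),q,sst (enc (bits x) @ r) [] [] []) (20 * k + 1)" using Suc by simp
 from aruns_mono[OF aruns_While0_True[OF nz aruns_Seq[OF aruns_Cond0[where P = "%g. g = 2", OF push] mv] IH[unfolded readin_def]]]
 show ?case unfolding readin_def by simp
qed

lemma inp: "aruns T inp ((intape x,0),q,sst [] [] [] []) ((intape x,- 1),q,sst (enc (bits x)) [] [] []) (30 * length x + 30)"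
proof -
 have 1: "aruns T (push 2 1) ((intape x,0),q,sst [] [] [] []) ((intape x,0),q,sst [1] [] [] []) 1"
  using aruns_push[of 2 1 T "(intape x,0)" q "sst [] [] [] []"] by simp
 have 2: "aruns T rewind ((intape x,0),q,sst [1] [] [] []) ((intape x,int (length x)),q,sst [1] [] [] []) (2 * length x + 1)"
  using rewind[of "length x" x q "sst [1] [] [] []"] by simp
 have "act (rd (intape x,int (length x)),Left) (intape x,int (length x)) = (intape x,int (length x) - 1)"
  unfolding act_moves by (simp add: rd_def)
 hence 3: "aruns T (Act (only 0 (%g. (g,Left)))) ((intape x,int (length x)),q,sst [1] [] [] [])
   ((intape x,int (length x) - 1),q,sst [1] [] [] []) 1"
  using aruns_act0[of "%g. (g,Left)" "(intape x,int (length x))" q "sst [1] [] [] []"] by simp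
 have 4: "aruns T readin ((intape x,int (length x) - 1),q,sst [1] [] [] []) ((intape x,- 1),q,sst (enc (bits x)) [] [] []) (20 * length x + 1)"
  using readin[of "length x" x q "[]"] by simp
 from aruns_mono[OF aruns_Seq[OF aruns_Seq[OF 1 2] aruns_Seq[OF 3 4]]] show ?thesis unfolding inp_def by simp
qed

definition outtape :: "bool list => nat => tape" where
 "outtape y k = (%i. if 0 <= i & i < int k then bit_symbol (y ! nat i) else 0,int k)"

text \<open>Unpacks one list cell per call and marks tape 5 for another call unless the list was
  empty.\<close>

definition "out1 = popc 2 skip skip (Seq (popc 2 skip (Act (only 1 (%_. (1,Right)))) (Seq (Seq drp drp) (Act (only 1 (%_. (2,Right)))))) (push 5 1))"
definition "outp = Seq (push 5 1) (poploop 5 (%_. True) out1 skip)"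

lemma outtape_step: "k < length y ==> act (bit_symbol (y ! k),Right) (outtape y k) = outtape y (Suc k)"
 by (auto simp: outtape_def act_def fun_eq_iff)

lemma outp_loop: "k <= length y ==> lruns T 5 (%_. True) out1 skip
  (p,outtape y (length y - k),sst (enc (bits (drop (length y - k) y))) [] [] [1])
  (p,outtape y (length y),sst [] [] [] []) (100 * k + 12)"
proof (induction k)
 case 0
 have "aruns T out1 (p,outtape y (length y),sst [1] [] [] []) (p,outtape y (length y),sst [] [] [] []) (1 + 5)"
  unfolding out1_def using aruns_skip by (intro popc2) simp
 hence "lruns T 5 (%_. True) out1 skip (p,outtape y (length y),sst [1] [] [] [1])
   (p,outtape y (length y),sst [] [] [] []) ((1 + 5) + 1 + 5)"
  by (intro lruns_Cons[where g = 1 and s = "[]" and ?s1.0 = "(p,outtape y (length y),sst [] [] [] [])"])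
    (use T lruns_Nil[of 5 T "sst [] [] [] []"] in simp_all)
 thus ?case by simp
next
 case (Suc k)
 let ?j = "length y - Suc k"
 have j: "?j < length y" "Suc ?j = length y - k" using Suc.prems by auto
 let ?m = "enc (bits (drop (length y - k) y))"
 have dj: "drop ?j y = y ! ?j # drop (length y - k) y" using j by (metis Cons_nth_drop_Suc)
 let ?c = "popc 2 skip (Act (only 1 (%_. (1,Right)))) (Seq (Seq drp drp) (Act (only 1 (%_. (2,Right)))))"
 have w: "aruns T ?c (p,outtape y ?j,sst (enc (if y ! ?j then Cn Nl Nl else Nl) @ ?m) [] [] [])
   (p,outtape y (length y - k),sst ?m [] [] []) 63"
 proof (cases "y ! ?j")
  case True
  have "aruns T (Act (only 1 (%_. (2,Right)))) (p,outtape y ?j,sst ?m [] [] []) (p,outtape y (length y - k),sst ?m [] [] []) 1"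
   using aruns_act1[of "%_. (2,Right)" p "outtape y ?j"] outtape_step[OF j(1)] True j(2) by (simp add: bit_symbol_def)
  from aruns_Seq[OF aruns_Seq[OF drp[of _ _ Nl "enc Nl @ ?m"] drp[of _ _ Nl ?m]] this]
  have "aruns T ?c (p,outtape y ?j,sst (2 # enc Nl @ enc Nl @ ?m) [] [] []) (p,outtape y (length y - k),sst ?m [] [] [])
    (((20 * sz Nl + 7) + (20 * sz Nl + 7) + 1 + 1 + 1) + 5)" by (intro popc2) simp
  from aruns_mono[OF this] True show ?thesis by simp
 next
  case False
  have "aruns T (Act (only 1 (%_. (1,Right)))) (p,outtape y ?j,sst ?m [] [] []) (p,outtape y (length y - k),sst ?m [] [] []) 1"
   using aruns_act1[of "%_. (1,Right)" p "outtape y ?j"] outtape_step[OF j(1)] False j(2) by (simp add: bit_symbol_def)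
  hence "aruns T ?c (p,outtape y ?j,sst (1 # ?m) [] [] []) (p,outtape y (length y - k),sst ?m [] [] []) (1 + 5)"
   by (intro popc2) simp
  from aruns_mono[OF this] False show ?thesis by simp
 qed
 have "aruns T out1 (p,outtape y ?j,sst (2 # enc (if y ! ?j then Cn Nl Nl else Nl) @ ?m) [] [] [])
   (p,outtape y (length y - k),sst ?m [] [] [1]) ((63 + 1 + 1) + 5)"
  unfolding out1_def using aruns_Seq[OF w push_flag] by (intro popc2) simp
 hence o: "aruns T out1 (p,outtape y ?j,sst (enc (bits (drop ?j y))) [] [] [])
   (p,outtape y (length y - k),sst ?m [] [] [1]) 70" unfolding dj by simp
 have "lruns T 5 (%_. True) out1 skip (p,outtape y ?j,sst (enc (bits (drop ?j y))) [] [] [1])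
   (p,outtape y (length y),sst [] [] [] []) (70 + (100 * k + 12) + 5)"
  by (rule lruns_Cons[where g = 1 and s = "[]" and ?s1.0 = "(p,outtape y (length y - k),sst ?m [] [] [1])"])
    (use T o Suc in simp_all)
 thus ?case by (rule lruns_mono) simp
qed

lemma outp: "aruns T outp (p,(%_. 0,0),sst (enc (bits y)) [] [] []) (p,outtape y (length y),sst [] [] [] []) (100 * length y + 20)"
proof -
 have "outtape y 0 = (%_. 0,0)" by (auto simp: outtape_def)
 hence "lruns T 5 (%_. True) out1 skip (p,(%_. 0,0),sst (enc (bits y)) [] [] [1])
  (p,outtape y (length y),sst [] [] [] []) (100 * length y + 12)"
  using outp_loop[of "length y" y p] by simp
 hence "aruns T (poploop 5 (%_. True) out1 skip) (p,(%_. 0,0),sst (enc (bits y)) [] [] [1])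
  (p,outtape y (length y),sst [] [] [] []) (100 * length y + 12 + 4)"
  by (intro aruns_poploop) (use T in simp_all)
 from aruns_mono[OF aruns_Seq[OF push_flag this]] show ?thesis unfolding outp_def by simp
qed

theorem tm_of_impl:
 assumes "impl (%x. bits (i x)) (%x. bits (f x)) tm"
 obtains M where "turing_machine M"
  "!!x t. tm x + 100 * length (i x) + 100 * length (f x) + 100 <= t ==> computes_within M (i x) (f x) t"
proof -
 obtain c where c: "cmd_ok T S c"
  "!!x r a p q. aruns T c (p,q,sst (enc (bits (i x)) @ r) a [] []) (p,q,sst (enc (bits (f x)) @ r) a [] []) (tm x)"
  using assms unfolding impl_def by metis
 let ?c = "Seq (Seq inp c) outp"
 have "cmd_ok T S inp" using S unfolding inp_def readin_def rewind_def
  by (simp add: pushl_ok only_ok del: cmd_ok.simps(1) pushl.simps)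
 moreover have "cmd_ok T S outp" using S ok_ops unfolding outp_def out1_def
  by (simp add: only_ok del: cmd_ok.simps(1))
 ultimately have "cmd_ok T S ?c" using c by simp
 then obtain M where M: "turing_machine M" "num_tapes M = T"
  and run: "!!x ts' n y t. runs ?c (snd (initial_config M x)) ts' n ==> n <= t ==> tape_holds (ts' ! 1) y ==> computes_within M x y t"
  by (rule compile_runs[OF _ _ S]) (use T in auto)
 show thesis
 proof (rule that[OF M(1)])
  fix x t assume t: "tm x + 100 * length (i x) + 100 * length (f x) + 100 <= t"
  have "rel T ((intape (i x),0),(%_. 0,0),sst [] [] [] []) (snd (initial_config M (i x)))"
   using T M(2) by (auto simp: rel_def initial_config_def intape_def nth_Cons stk_def sst_def split: nat.splits)
  moreover have "aruns T ?c ((intape (i x),0),(%_. 0,0),sst [] [] [] [])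
    ((intape (i x),- 1),outtape (f x) (length (f x)),sst [] [] [] [])
    ((30 * length (i x) + 30) + tm x + 1 + (100 * length (f x) + 20) + 1)"
   using c(2)[of "(intape (i x),- 1)" "(%_. 0,0)" x "[]" "[]"]
   by (intro aruns_Seq[OF aruns_Seq[OF inp] outp]) simp
  ultimately obtain ts' m where m: "m <= (30 * length (i x) + 30) + tm x + 1 + (100 * length (f x) + 20) + 1"
   "rel T ((intape (i x),- 1),outtape (f x) (length (f x)),sst [] [] [] []) ts'" "runs ?c (snd (initial_config M (i x))) ts' m"
   unfolding aruns_def by blast
  moreover have "tape_holds (ts' ! 1) (f x)" using m(2) by (auto simp: rel_def tape_holds_def outtape_def)
  ultimately show "computes_within M (i x) (f x) t" using t by (intro run[OF m(3)]) auto
 qed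
qed

end

section \<open>Polynomial-time functions on encodable types\<close>

text \<open>Injectivity lets a comparison of trees decide equality of values, see
  \<open>pt_eq\<close>.\<close>

class coded =
 fixes tr :: "'a => tree"
 assumes tr_inject: "tr x = tr y \<longleftrightarrow> x = y"

instantiation tree :: coded begin
definition tr_tree :: "tree => tree" where "tr_tree t = t"
instance by standard (simp add: tr_tree_def)
end

text \<open>\<open>False\<close> is the leaf because \<open>impl_cond\<close> and
  \<open>impl_while\<close> branch on being a leaf.\<close>

instantiation bool :: coded begin
definition tr_bool :: "bool => tree" where "tr_bool b = (if b then Cn Nl Nl else Nl)"
instance by standard (simp add: tr_bool_def)
end

text \<open>Unary numbers have the trees of lists of leaves, so arithmetic is inherited from list
  programs.\<close>

instantiation nat :: coded begin
primrec tr_nat :: "nat => tree" where "tr_nat 0 = Nl" | "tr_nat (Suc n) = Cn Nl (tr_nat n)"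
instance
proof
 fix x y :: nat show "tr x = tr y \<longleftrightarrow> x = y"
  by (induction x arbitrary: y; case_tac y) auto
qed
end

instantiation prod :: (coded, coded) coded begin
definition tr_prod :: "'a * 'b => tree" where "tr_prod p = Cn (tr (fst p)) (tr (snd p))"
instance by standard (auto simp: tr_prod_def tr_inject prod_eq_iff)
end

instantiation list :: (coded) coded begin
primrec tr_list :: "'a list => tree" where "tr_list [] = Nl" | "tr_list (x # xs) = Cn (tr x) (tr_list xs)"
instance
proof
 fix x y :: "'a list" show "tr x = tr y \<longleftrightarrow> x = y"
  by (induction x arbitrary: y; case_tac y) (auto simp: tr_inject)
qed
end

lemma tr_Nl[simp]: "tr b = Nl \<longleftrightarrow> \<not> b" "tr n = Nl \<longleftrightarrow> n = 0" "tr xs = Nl \<longleftrightarrow> xs = []"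
 for b :: bool and n :: nat and xs :: "'b::coded list"
 by (auto simp: tr_bool_def) (cases n; simp; fail | cases xs; simp)+

lemma tr_bits: "tr x = bits x" for x :: "bool list"
 by (induction x) (auto simp: tr_bool_def)

definition tsz :: "'a::coded => nat" where "tsz x = sz (tr x)"

lemma tsz_simps[simp]:
 "tsz (a,b) = Suc (tsz a + tsz b)" "tsz [] = 1" "tsz (y # ys) = Suc (tsz y + tsz ys)"
 "tsz n = 2 * n + 1" "tsz True = 3" "tsz False = 1"
 for n :: nat and a :: "'a::coded" and b :: "'b::coded" and y :: "'c::coded"
 by (simp_all add: tsz_def tr_prod_def tr_bool_def) (induction n; simp)

lemma sz_pos: "1 <= sz t" by (cases t) auto
lemma tsz_pos[simp]: "0 < tsz x" using sz_pos[of "tr x"] by (simp add: tsz_def)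

lemma tsz_list: "tsz xs = 1 + (\<Sum>y\<leftarrow>xs. 1 + tsz y)"
 by (induction xs) auto

lemma tsz_append[simp]: "tsz (xs @ ys) + 1 = tsz xs + tsz ys"
 by (induction xs) auto

lemma tsz_rev[simp]: "tsz (rev xs) = tsz xs"
 by (simp add: tsz_list rev_map[symmetric] del: sum_list_Suc)

lemma length_le_tsz: "length xs < tsz xs" by (induction xs) auto

lemma mem_tsz: "y : set xs ==> tsz y < tsz xs" by (induction xs) auto

lemma tsz_list_bound: "(!!y. y : set xs ==> tsz y <= b) ==> tsz xs <= 1 + length xs * (1 + b)"
proof (induction xs)
 case (Cons y ys)
 hence "tsz ys <= 1 + length ys * (1 + b)" "tsz y <= b" by simp_all
 thus ?case by simp
qed simp

lemma tsz_take: "tsz (take i xs) <= tsz xs"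
 by (induction xs arbitrary: i) (auto simp: take_Cons split: nat.splits)

lemma tsz_drop: "tsz (drop i xs) <= tsz xs"
 using tsz_append[of "take i xs" "drop i xs"] tsz_pos[of "take i xs"] unfolding append_take_drop_id by linarith

text \<open>The summand 2 keeps the base at least 2, so that constants and sums are absorbed by
  raising the exponent.\<close>

definition pb :: "('a::coded => nat) => bool" where
 "pb t \<longleftrightarrow> (\<exists>k. \<forall>x. t x <= (tsz x + 2) ^ k)"

lemma pb_mono: "pb t ==> (!!x. s x <= t x) ==> pb s"
 unfolding pb_def by (meson le_trans)

lemma pb_const: "pb (%_. c)"
proof -
 have "c <= 2 ^ c" by (simp add: less_imp_le)
 moreover have "2 ^ c <= (tsz x + 2) ^ c" for x :: 'a by (rule power_mono) simp_all
 ultimately show ?thesis unfolding pb_def by (meson le_trans)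
qed

lemma pb_tsz: "pb tsz" unfolding pb_def by (rule exI[of _ 1]) simp

lemma pb_mult: "pb s ==> pb t ==> pb (%x. s x * t x)"
proof -
 assume "pb s" "pb t"
 then obtain k l where "\<forall>x. s x <= (tsz x + 2) ^ k" "\<forall>x. t x <= (tsz x + 2) ^ l" unfolding pb_def by auto
 hence "\<forall>x. s x * t x <= (tsz x + 2) ^ (k + l)" by (simp add: power_add mult_mono)
 thus ?thesis unfolding pb_def by blast
qed

lemma pb_add: "pb s ==> pb t ==> pb (%x. s x + t x)"
proof -
 assume "pb s" "pb t"
 then obtain k l where kl: "!!x. s x <= (tsz x + 2) ^ k" "!!x. t x <= (tsz x + 2) ^ l" unfolding pb_def by auto
 have "s x + t x <= (tsz x + 2) ^ (k + l + 1)" for x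
 proof -
  let ?a = "tsz x + 2"
  have "s x <= ?a ^ (k + l)" by (rule order_trans[OF kl(1) power_increasing]) simp_all
  moreover have "t x <= ?a ^ (k + l)" by (rule order_trans[OF kl(2) power_increasing]) simp_all
  ultimately have "s x + t x <= 2 * ?a ^ (k + l)" by simp
  also have "\<dots> <= ?a * ?a ^ (k + l)" by (rule mult_right_mono) simp_all
  finally show ?thesis by simp
 qed
 thus ?thesis unfolding pb_def by blast
qed

lemma pb_power: "pb s ==> pb (%x. s x ^ k)"
 by (induction k) (auto intro: pb_const pb_mult)

lemma pb_Suc: "pb s ==> pb (%x. Suc (s x))"
 using pb_add[OF _ pb_const[of 1]] by simp

lemma pb_comp: "pb t ==> pb (%x. tsz (f x)) ==> pb (%x. t (f x))"
proof -
 assume "pb t" and f: "pb (%x. tsz (f x))"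
 then obtain k where k: "!!x. t x <= (tsz x + 2) ^ k" unfolding pb_def by auto
 have "pb (%x. (tsz (f x) + 2) ^ k)" by (intro pb_power pb_add pb_const f)
 thus ?thesis by (rule pb_mono) (rule k)
qed

lemmas pb_intros = pb_add pb_mult pb_const pb_power pb_Suc

interpretation m: machine 6 3 by standard simp_all

text \<open>A bound on the output size belongs to the notion, since in a composition the second
  running time is measured in the size of the intermediate value.\<close>

definition ptime :: "('a::coded => 'b::coded) => bool" where
 "ptime f \<longleftrightarrow> (\<exists>tm. m.impl tr (%x. tr (f x)) tm & pb tm) & pb (%x. tsz (f x))"

lemma ptimeI: "m.impl tr (%x. tr (f x)) tm ==> pb tm ==> pb (%x. tsz (f x)) ==> ptime f"
 unfolding ptime_def by blast

lemma ptimeE: assumes "ptime f" obtains tm where "m.impl tr (%x. tr (f x)) tm" "pb tm" "pb (%x. tsz (f x))"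
 using assms unfolding ptime_def by blast

lemma pb_ptime: "ptime f ==> pb (%x. tsz (f x))" unfolding ptime_def by blast

text \<open>Values with equal trees need no computation to pass from one to the other. Connectives,
  \<open>Suc\<close>, list cells and later sums and lengths are reduced in this way to pairs,
  conditionals and list operations.\<close>

lemma pt_recode: assumes "ptime f" "!!x. tr (f x) = tr (g x)" shows "ptime g"
proof -
 have 1: "(%x. tr (f x)) = (%x. tr (g x))" and 2: "(%x. tsz (f x)) = (%x. tsz (g x))"
  using assms(2) by (auto simp: tsz_def)
 show ?thesis using assms(1) unfolding ptime_def 1 2 .
qed

lemma pt_id: "ptime (%x. x)"
 by (rule ptimeI[OF m.impl_id pb_const pb_tsz])

lemma pt_comp: assumes "ptime g" "ptime f" shows "ptime (%x. g (f x))"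
proof -
 obtain tf where f: "m.impl tr (%x. tr (f x)) tf" "pb tf" "pb (%x. tsz (f x))" using assms by (elim ptimeE)
 obtain tg where g: "m.impl tr (%x. tr (g x)) tg" "pb tg" "pb (%x. tsz (g x))" using assms by (elim ptimeE)
 show ?thesis
  by (rule ptimeI[OF m.impl_comp[OF f(1) m.impl_reindex[OF g(1)]]])
   (intro pb_intros f pb_comp[OF g(2)] pb_comp[OF g(3)])+
qed

lemma pt_const: "ptime (%_. c)"
 by (rule ptimeI[OF m.impl_const]) (intro pb_intros pb_tsz[unfolded tsz_def])+

lemma pt_Pair: assumes "ptime f" "ptime g" shows "ptime (%x. (f x,g x))"
proof -
 obtain tf where f: "m.impl tr (%x. tr (f x)) tf" "pb tf" "pb (%x. tsz (f x))" using assms by (elim ptimeE)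
 obtain tg where g: "m.impl tr (%x. tr (g x)) tg" "pb tg" "pb (%x. tsz (g x))" using assms by (elim ptimeE)
 have "m.impl tr (%x. tr (f x,g x)) (%x. tf x + tg x + 60 * sz (tr x) + 60 * sz (tr (f x)) + 100)"
  using m.impl_pair[OF f(1) g(1)] by (simp add: tr_prod_def)
 moreover have "pb (%x. tf x + tg x + 60 * sz (tr x) + 60 * sz (tr (f x)) + 100)"
  by (intro pb_intros f g pb_tsz[unfolded tsz_def] f(3)[unfolded tsz_def])
 moreover have "pb (%x. tsz (f x,g x))" unfolding tsz_simps by (intro pb_intros f g)
 ultimately show ?thesis by (rule ptimeI)
qed

lemma pt_if_tr: assumes "ptime c" "ptime f" "ptime g" shows "ptime (%x. if tr (c x) = Nl then f x else g x)"
proof -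
 obtain tc where c: "m.impl tr (%x. tr (c x)) tc" "pb tc" "pb (%x. tsz (c x))" using assms by (elim ptimeE)
 obtain tf where f: "m.impl tr (%x. tr (f x)) tf" "pb tf" "pb (%x. tsz (f x))" using assms by (elim ptimeE)
 obtain tg where g: "m.impl tr (%x. tr (g x)) tg" "pb tg" "pb (%x. tsz (g x))" using assms by (elim ptimeE)
 have eq: "(%x. if tr (c x) = Nl then tr (f x) else tr (g x)) = (%x. tr (if tr (c x) = Nl then f x else g x))" by auto
 note i = m.impl_cond[OF c(1) f(1) g(1), unfolded eq]
 have "pb (%x. tsz (f x) + tsz (g x))" by (intro pb_intros f g)
 hence s: "pb (%x. tsz (if tr (c x) = Nl then f x else g x))" by (rule pb_mono) simp
 show ?thesis
  by (rule ptimeI[OF i _ s]) (intro pb_intros c f g pb_tsz[unfolded tsz_def] c(3)[unfolded tsz_def])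
qed

lemma pt_if: "ptime c ==> ptime f ==> ptime g ==> ptime (%x. if c x then f x else g x)"
 by (rule pt_recode[OF pt_if_tr[of c g f]]) auto

lemma impl_as: "m.impl i f t ==> (!!x. f x = g x) ==> m.impl i g t"
 by (simp add: ext[of f g])

lemma pt_fst0: "ptime fst"
proof (rule ptimeI)
 show "m.impl tr (%p. tr (fst p)) (%p. 80 * sz (tr p) + 60)"
  by (rule impl_as[OF m.impl_hd[of tr]]) (simp add: tr_prod_def)
 show "pb (%p. 80 * sz (tr p) + 60)" by (intro pb_intros pb_tsz[unfolded tsz_def])
 show "pb (%p. tsz (fst p))" by (rule pb_mono[OF pb_tsz]) (auto simp: tsz_def tr_prod_def)
qed

lemma pt_snd0: "ptime snd"
proof (rule ptimeI)
 show "m.impl tr (%p. tr (snd p)) (%p. 80 * sz (tr p) + 60)"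
  by (rule impl_as[OF m.impl_tl[of tr]]) (simp add: tr_prod_def)
 show "pb (%p. 80 * sz (tr p) + 60)" by (intro pb_intros pb_tsz[unfolded tsz_def])
 show "pb (%p. tsz (snd p))" by (rule pb_mono[OF pb_tsz]) (auto simp: tsz_def tr_prod_def)
qed

lemma tlt_list: "tlt (tr xs) = tr (tl xs)" for xs :: "'a::coded list" by (cases xs) auto

lemma pt_tl0: "ptime (tl :: 'a::coded list => _)"
proof (rule ptimeI)
 show "m.impl tr (%p. tr (tl p)) (%p. 80 * sz (tr p) + 60)" by (rule impl_as[OF m.impl_tl[of tr] tlt_list])
 show "pb (%p. 80 * sz (tr p) + 60)" by (intro pb_intros pb_tsz[unfolded tsz_def])
 have "tsz (tl p) <= tsz p" for p :: "'a list" by (cases p) auto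
 thus "pb (%p::'a list. tsz (tl p))" by (rule pb_mono[OF pb_tsz])
qed

lemma pt_pred0: "ptime (%n::nat. n - 1)"
proof (rule ptimeI)
 have "tlt (tr n) = tr (n - 1)" for n :: nat by (cases n) auto
 thus "m.impl tr (%n::nat. tr (n - 1)) (%p. 80 * sz (tr p) + 60)" by (intro impl_as[OF m.impl_tl[of tr]]) simp
 show "pb (%p::nat. 80 * sz (tr p) + 60)" by (intro pb_intros pb_tsz[unfolded tsz_def])
 show "pb (%p. tsz (p - 1 :: nat))" by (rule pb_mono[OF pb_tsz]) simp
qed

lemma pt_hd0: "ptime (hd :: 'a::coded list => _)"
proof (rule ptimeI)
 have "(if tr xs = Nl then tr (hd [] :: 'a) else hdt (tr xs)) = tr (hd xs)" for xs :: "'a list" by (cases xs) auto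
 thus "m.impl tr (%xs :: 'a list. tr (hd xs)) (%x. 1 + (20 * sz (tr x) + 2 * sz (tr (hd [] :: 'a)) + 9) + (80 * sz (tr x) + 60) + 60 * sz (tr x) + 60 * sz (tr x) + 100)"
  by (intro impl_as[OF m.impl_cond[OF m.impl_id[of tr] m.impl_const[of tr "tr (hd [] :: 'a)"] m.impl_hd[of tr]]]) simp
 show "pb (%x. 1 + (20 * sz (tr x) + 2 * sz (tr (hd [] :: 'a)) + 9) + (80 * sz (tr x) + 60) + 60 * sz (tr x) + 60 * sz (tr x) + 100)"
  by (intro pb_intros pb_tsz[unfolded tsz_def])
 have "tsz (hd p) <= tsz p + tsz (hd [] :: 'a)" for p :: "'a list" by (cases p) auto
 thus "pb (%p::'a list. tsz (hd p))" by (rule pb_mono[rotated]) (intro pb_intros pb_tsz)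
qed

section \<open>Closure properties of polynomial time\<close>

named_theorems pt

lemmas pt_fst = pt_comp[OF pt_fst0] and pt_snd = pt_comp[OF pt_snd0] and pt_tl = pt_comp[OF pt_tl0]
 and pt_hd = pt_comp[OF pt_hd0] and pt_pred = pt_comp[OF pt_pred0]
declare pt_id[pt] pt_const[pt] pt_Pair[pt] pt_if[pt] pt_fst[pt] pt_snd[pt] pt_tl[pt] pt_hd[pt] pt_pred[pt]
 pt_fst0[pt] pt_snd0[pt] pt_tl0[pt] pt_hd0[pt]

lemma pt_Cons[pt]: "ptime f ==> ptime g ==> ptime (%x. f x # g x)"
 by (rule pt_recode[OF pt_Pair]) (auto simp: tr_prod_def)

lemma pt_Suc[pt]: "ptime f ==> ptime (%x. Suc (f x))"
 by (rule pt_recode[OF pt_Pair[OF pt_const[of "0::nat"]]]) (auto simp: tr_prod_def)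

lemma pt_not[pt]: "ptime f ==> ptime (%x. \<not> f x)"
 by (rule pt_recode[OF pt_if[of f "%_. False" "%_. True"]]) (auto simp: pt_const)

lemma pt_conj[pt]: "ptime f ==> ptime g ==> ptime (%x. f x & g x)"
 by (rule pt_recode[OF pt_if[of f g "%_. False"]]) (auto simp: pt_const)

lemma pt_disj[pt]: "ptime f ==> ptime g ==> ptime (%x. f x \<or> g x)"
 by (rule pt_recode[OF pt_if[of f "%_. True" g]]) (auto simp: pt_const)

lemma pt_imp[pt]: "ptime f ==> ptime g ==> ptime (%x. f x --> g x)"
 by (rule pt_recode[OF pt_if[of f g "%_. True"]]) (auto simp: pt_const)

lemma pt_null[pt]: "ptime f ==> ptime (%x. f x = [])"
 by (rule pt_recode[OF pt_if_tr[of f "%_. True" "%_. False"]]) (auto simp: pt_const)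

lemma pt_is0[pt]: "ptime f ==> ptime (%x. f x = (0::nat))"
 by (rule pt_recode[OF pt_if_tr[of f "%_. True" "%_. False"]]) (auto simp: pt_const)

lemma pt_case_list[pt]: "ptime A ==> ptime L ==> ptime (%x. F (hd (L x)) (tl (L x)) x) ==>
  ptime (%x. case L x of [] => A x | y # ys => F y ys x)"
proof -
 assume a: "ptime A" "ptime L" "ptime (%x. F (hd (L x)) (tl (L x)) x)"
 have "(%x. case L x of [] => A x | y # ys => F y ys x) = (%x. if L x = [] then A x else F (hd (L x)) (tl (L x)) x)"
  by (auto split: list.splits)
 thus ?thesis using pt_if[OF pt_null[OF a(2)] a(1,3)] by simp
qed

lemma pt_case_nat[pt]: "ptime A ==> ptime L ==> ptime (%x. F (L x - 1) x) ==>
  ptime (%x. case L x of 0 => A x | Suc n => F n x)"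
proof -
 assume a: "ptime A" "ptime L" "ptime (%x. F (L x - 1) x)"
 have "(%x. case L x of 0 => A x | Suc n => F n x) = (%x. if L x = 0 then A x else F (L x - 1) x)"
  by (auto split: nat.splits)
 thus ?thesis using pt_if[OF pt_is0[OF a(2)] a(1,3)] by simp
qed

lemma pt_case_prod[pt]: "ptime (%x. F (fst (G x)) (snd (G x)) x) ==> ptime (%x. case G x of (a,b) => F a b x)"
 by (simp add: case_prod_beta)

text \<open>Besides the number of rounds, every intermediate state must stay polynomially small,
  because a round is paid for in the size of the state it starts from.\<close>

lemma pt_while:
 fixes g :: "'s::coded => 's" and f :: "'x::coded => 's"
 assumes t: "ptime t" and g: "ptime g" and h: "ptime h" and N: "pb N" and B: "pb B"
  and run: "!!x. \<exists>n\<le>N x. f x = (g ^^ n) (h x) & (\<forall>i<n. t ((g ^^ i) (h x))) & \<not> t (f x) &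
    (\<forall>i\<le>n. tsz ((g ^^ i) (h x)) <= B x)"
 shows "ptime f"
proof -
 obtain tt where tt: "m.impl tr (%x. tr (t x)) tt" "pb tt" "pb (%x. tsz (t x))" using t by (elim ptimeE)
 obtain tg where tg: "m.impl tr (%x. tr (g x)) tg" "pb tg" "pb (%x. tsz (g x))" using g by (elim ptimeE)
 obtain th where th: "m.impl tr (%x. tr (h x)) th" "pb th" "pb (%x. tsz (h x))" using h by (elim ptimeE)
 have "pb (m.wcost tr (%x. tr (t x)) tt tg)"
  unfolding m.wcost_def by (intro pb_intros tt tg pb_tsz[unfolded tsz_def] tt(3)[unfolded tsz_def])
 then obtain K where K: "!!s. m.wcost tr (%x. tr (t x)) tt tg s <= (tsz s + 2) ^ K" unfolding pb_def by auto
 let ?tm = "%x. (N x + 1) * (B x + 2) ^ K + 10"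
 have "m.impl (%x. tr (h x)) (%x. tr (f x)) ?tm"
 proof (rule m.impl_while[OF tt(1) tg(1)])
  fix x
  obtain n where n: "n <= N x" "f x = (g ^^ n) (h x)" "\<forall>i<n. t ((g ^^ i) (h x))" "\<not> t (f x)"
   "\<forall>i\<le>n. tsz ((g ^^ i) (h x)) <= B x" using run[of x] by auto
  have "(\<Sum>j\<le>n. m.wcost tr (%x. tr (t x)) tt tg ((g ^^ j) (h x))) <= (\<Sum>j\<le>n. (B x + 2) ^ K)"
  proof (rule sum_mono)
   fix j assume "j : {..n}"
   hence "(tsz ((g ^^ j) (h x)) + 2) ^ K <= (B x + 2) ^ K" using n(5) by (intro power_mono) auto
   thus "m.wcost tr (%x. tr (t x)) tt tg ((g ^^ j) (h x)) <= (B x + 2) ^ K" using K le_trans by blast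
  qed
  also have "\<dots> = (n + 1) * (B x + 2) ^ K" by simp
  also have "\<dots> <= (N x + 1) * (B x + 2) ^ K" using n(1) by (intro mult_right_mono) auto
  finally show "\<exists>n. f x = (g ^^ n) (h x) & (\<forall>i<n. tr (t ((g ^^ i) (h x))) ~= Nl) & tr (t (f x)) = Nl &
    (\<Sum>j\<le>n. m.wcost tr (%x. tr (t x)) tt tg ((g ^^ j) (h x))) + 10 <= ?tm x"
   using n by (intro exI[of _ n]) simp
 qed
 from m.impl_comp[OF th(1) this] show ?thesis
 proof (rule ptimeI)
  show "pb (%x. th x + ((N x + 1) * (B x + 2) ^ K + 10) + 1)" by (intro pb_intros th N B)
  have "tsz (f x) <= B x" for x using run[of x] by (metis order_refl)
  thus "pb (%x. tsz (f x))" by (rule pb_mono[OF B])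
 qed
qed

lemma pt_funpow:
 fixes F :: "'s::coded => 'x::coded => 's"
 assumes F: "ptime (%p. F (fst p) (snd p))" and n: "ptime n" and I: "ptime I" and B: "pb B"
  and bd: "!!x i. i <= n x ==> tsz (((%s. F s x) ^^ i) (I x)) <= B x"
 shows "ptime (%x. ((%s. F s x) ^^ n x) (I x))"
proof -
 define g where "g = (%p :: nat \<times> _ \<times> _. (fst p - 1,F (fst (snd p)) (snd (snd p)),snd (snd p)))"
 have F': "ptime (%p :: nat \<times> _ \<times> _. F (fst (snd p)) (snd (snd p)))"
  using pt_comp[OF F, of snd] by (simp add: pt)
 have g: "ptime g" unfolding g_def by (intro pt F')
 have it: "(g ^^ i) (n x,I x,x) = (n x - i,((%s. F s x) ^^ i) (I x),x)" for x i
  by (induction i) (auto simp: g_def)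
 have "ptime (%x. (0::nat,((%s. F s x) ^^ n x) (I x),x))"
 proof (rule pt_while[where t = "%p. fst p ~= 0" and g = g and h = "%x. (n x,I x,x)"
    and N = "%x. tsz (n x)" and B = "%x. tsz (n x) + B x + tsz x + 2"])
  show "ptime (%p :: nat \<times> _ \<times> _. fst p ~= 0)" by (intro pt)
  show "ptime (%x. (n x,I x,x))" by (intro pt n I)
  show "pb (%x. tsz (n x) + B x + tsz x + 2)" by (intro pb_intros pb_ptime[OF n] B pb_tsz)
  fix x
  show "\<exists>na\<le>tsz (n x). (0,((%s. F s x) ^^ n x) (I x),x) = (g ^^ na) (n x,I x,x) &
    (\<forall>i<na. fst ((g ^^ i) (n x,I x,x)) ~= 0) & \<not> fst (0::nat,((%s. F s x) ^^ n x) (I x),x) ~= 0 &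
    (\<forall>i\<le>na. tsz ((g ^^ i) (n x,I x,x)) <= tsz (n x) + B x + tsz x + 2)"
   unfolding it using bd[of _ x] by (intro exI[of _ "n x"]) (auto simp: le_diff_conv add_mono)
 qed (use g pb_ptime[OF n] in auto)
 from pt_fst[OF pt_snd[OF this]] show ?thesis by simp
qed

lemma pt_foldl:
 fixes L :: "'x::coded => 'b::coded list"
 assumes F: "ptime (%p. F (fst p) (fst (snd p)) (snd (snd p)))" and L: "ptime L" and I: "ptime I" and B: "pb B"
  and bd: "!!x i. tsz (foldl (%s y. F s y x) (I x) (take i (L x))) <= B x"
 shows "ptime (%x. foldl (%s y. F s y x) (I x) (L x))"
proof -
 \<comment> \<open>The parameter \<open>x\<close> travels along in the loop state, since the folded
   function may depend on it.\<close>
 define g where "g = (%p :: _ list \<times> _ \<times> _. (tl (fst p),F (fst (snd p)) (hd (fst p)) (snd (snd p)),snd (snd p)))"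
 have F': "ptime (%p :: _ list \<times> _ \<times> _. F (fst (snd p)) (hd (fst p)) (snd (snd p)))"
  using pt_comp[OF F, of "%p :: _ list \<times> _ \<times> _. (fst (snd p),hd (fst p),snd (snd p))"] by (simp add: pt)
 have g: "ptime g" unfolding g_def by (intro pt F')
 have it: "i <= length (L x) ==> (g ^^ i) (L x,I x,x) = (drop i (L x),foldl (%s y. F s y x) (I x) (take i (L x)),x)" for x i
  by (induction i) (auto simp: g_def drop_Suc tl_drop take_Suc_conv_app_nth hd_drop_conv_nth)
 have "ptime (%x. ([] :: 'b list,foldl (%s y. F s y x) (I x) (L x),x))"
 proof (rule pt_while[where t = "%p. fst p ~= []" and g = g and h = "%x. (L x,I x,x)"
    and N = "%x. tsz (L x)" and B = "%x. tsz (L x) + B x + tsz x + 2"])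
  show "ptime (%p :: 'b list \<times> _ \<times> _. fst p ~= [])" by (intro pt)
  show "ptime (%x. (L x,I x,x))" by (intro pt L I)
  show "pb (%x. tsz (L x) + B x + tsz x + 2)" by (intro pb_intros pb_ptime[OF L] B pb_tsz)
  fix x
  let ?n = "length (L x)"
  have d: "tsz (drop i (L x)) <= tsz (L x)" for i by (rule tsz_drop)
  have "tsz ((g ^^ i) (L x,I x,x)) <= tsz (L x) + B x + tsz x + 2" if "i <= ?n" for i
   using bd[of x i] d[of i] it[OF that] by simp
  moreover have "fst ((g ^^ i) (L x,I x,x)) ~= []" if "i < ?n" for i using it[of i x] that by simp
  moreover have "(g ^^ ?n) (L x,I x,x) = ([],foldl (%s y. F s y x) (I x) (L x),x)" using it[of ?n x] by simp
  ultimately show "\<exists>na\<le>tsz (L x). ([],foldl (%s y. F s y x) (I x) (L x),x) = (g ^^ na) (L x,I x,x) &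
    (\<forall>i<na. fst ((g ^^ i) (L x,I x,x)) ~= []) & \<not> fst ([] :: 'b list,foldl (%s y. F s y x) (I x) (L x),x) ~= [] &
    (\<forall>i\<le>na. tsz ((g ^^ i) (L x,I x,x)) <= tsz (L x) + B x + tsz x + 2)"
   using length_le_tsz[of "L x"] by (intro exI[of _ ?n]) simp
 qed (use g pb_ptime[OF L] in auto)
 from pt_fst[OF pt_snd[OF this]] show ?thesis by simp
qed

lemma foldl_Cons: "foldl (%s y. y # s) s xs = rev xs @ s"
 by (induction xs arbitrary: s) auto

lemma pt_rev[pt]: assumes "ptime L" shows "ptime (%x. rev (L x))"
proof -
 have "ptime (%x. foldl (%s y. y # s) [] (L x))"
  by (rule pt_foldl[where B = "%x. tsz (L x)"]) (intro pt assms pb_ptime[OF assms] | simp add: foldl_Cons tsz_take)+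
 thus ?thesis by (simp add: foldl_Cons)
qed

lemma pt_append[pt]: assumes "ptime L" "ptime K" shows "ptime (%x. L x @ K x)"
proof -
 have "ptime (%x. foldl (%s y. y # s) (K x) (rev (L x)))"
 proof (rule pt_foldl[where B = "%x. tsz (L x) + tsz (K x)"])
  show "tsz (foldl (%s y. y # s) (K x) (take i (rev (L x)))) <= tsz (L x) + tsz (K x)" for x i
   using tsz_append[of "rev (take i (rev (L x)))" "K x"] tsz_take[of i "rev (L x)"] by (simp add: foldl_Cons)
 qed (intro pt assms pb_intros pb_ptime)+
 thus ?thesis by (simp add: foldl_Cons)
qed

lemma foldl_map_Cons: "foldl (%s y. f y # s) s xs = rev (map f xs) @ s"
 by (induction xs arbitrary: s) auto

lemma pt_map[pt]: assumes F: "ptime (%p. F (fst p) (snd p))" and L: "ptime L" shows "ptime (%x. map (%y. F y x) (L x))"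
proof -
 have F': "ptime (%p. F (fst (snd p)) (snd (snd p)))"
  using pt_comp[OF F, of snd] by (simp add: pt)
 obtain k where k: "!!p. tsz (F (fst p) (snd p)) <= (tsz p + 2) ^ k" using pb_ptime[OF F] unfolding pb_def by blast
 let ?B = "%x. 1 + tsz (L x) * (1 + (tsz (L x) + tsz x + 3) ^ k)"
 have "ptime (%x. foldl (%s y. F y x # s) [] (L x))"
 proof (rule pt_foldl[where B = ?B])
  show "ptime (%p. F (fst (snd p)) (snd (snd p)) # fst p)" by (intro pt F')
  show "pb ?B" by (intro pb_intros pb_ptime[OF L] pb_tsz)
  fix x i
  have "tsz (map (%y. F y x) (take i (L x))) <= 1 + length (map (%y. F y x) (take i (L x))) * (1 + (tsz (L x) + tsz x + 3) ^ k)"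
  proof (rule tsz_list_bound)
   fix z assume "z : set (map (%y. F y x) (take i (L x)))"
   then obtain y where y: "y : set (L x)" "z = F y x" by (auto dest: in_set_takeD)
   have "tsz z <= (tsz (y,x) + 2) ^ k" using k[of "(y,x)"] y by simp
   also have "\<dots> <= (tsz (L x) + tsz x + 3) ^ k" using mem_tsz[OF y(1)] by (intro power_mono) auto
   finally show "tsz z <= (tsz (L x) + tsz x + 3) ^ k" .
  qed
  also have "\<dots> <= ?B x" using length_le_tsz[of "L x"] by (intro add_left_mono mult_right_mono) auto
  finally show "tsz (foldl (%s y. F y x # s) [] (take i (L x))) <= ?B x"
   unfolding foldl_map_Cons by simp
 qed (intro pt L)+
 from pt_rev[OF this] show ?thesis by (simp add: foldl_map_Cons)
qed

lemma tsz_concat: "tsz (concat xss) <= tsz xss"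
proof (induction xss)
 case (Cons a xss)
 thus ?case using tsz_append[of a "concat xss"] by simp
qed simp

lemma foldl_append: "foldl (@) s xs = s @ concat xs"
 by (induction xs arbitrary: s) auto

lemma pt_concat[pt]: assumes L: "ptime L" shows "ptime (%x. concat (L x))"
proof -
 have "ptime (%x. foldl (%s y. s @ y) [] (L x))"
  by (rule pt_foldl[where B = "%x. tsz (L x)"])
   (intro pt assms pb_ptime[OF assms] | simp add: foldl_append, rule le_trans[OF tsz_concat tsz_take])+
 thus ?thesis by (simp add: foldl_append)
qed

lemma pt_filter[pt]: assumes "ptime (%p. F (fst p) (snd p))" "ptime L" shows "ptime (%x. filter (%y. F y x) (L x))"
proof -
 have "concat (map (%y. if P y then [y] else []) xs) = filter P xs" for P and xs :: "'a list" by (induction xs) auto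
 moreover have "ptime (%x. concat (map (%y. if F y x then [y] else []) (L x)))" by (intro pt assms)
 ultimately show ?thesis by simp
qed

lemma pt_Bex[pt]: assumes "ptime (%p. F (fst p) (snd p))" "ptime L" shows "ptime (%x. \<exists>y\<in>set (L x). F y x)"
proof -
 have "ptime (%x. filter (%y. F y x) (L x) ~= [])" by (intro pt assms)
 thus ?thesis by (simp add: filter_empty_conv Bex_def)
qed

lemma pt_Ball[pt]: assumes "ptime (%p. F (fst p) (snd p))" "ptime L" shows "ptime (%x. \<forall>y\<in>set (L x). F y x)"
proof -
 have "ptime (%x. filter (%y. \<not> F y x) (L x) = [])" by (intro pt assms)
 thus ?thesis by (simp add: filter_empty_conv)
qed

text \<open>The bridge between numbers and lists: through it lengths, sums and products are computed
  by mapping, appending and concatenating.\<close>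

lemma tr_rep: "tr (replicate n False) = tr n"
 by (induction n) (auto simp: tr_bool_def)

lemma pt_repF: "ptime n ==> ptime (%x. replicate (n x) False)"
 by (rule pt_recode[of n]) (simp_all add: tr_rep)

lemma pt_length[pt]: assumes "ptime L" shows "ptime (%x. length (L x))"
proof (rule pt_recode)
 show "ptime (%x. map (%_. False) (L x))" by (intro pt assms)
qed (simp add: map_replicate_const tr_rep)

lemma pt_plus[pt]: assumes "ptime f" "ptime g" shows "ptime (%x. f x + g x :: nat)"
 by (rule pt_recode[OF pt_append[OF pt_repF[OF assms(1)] pt_repF[OF assms(2)]]])
  (simp add: replicate_add[symmetric] tr_rep)

lemma pt_times[pt]: assumes "ptime f" "ptime g" shows "ptime (%x. f x * g x :: nat)"
proof -
 have "ptime (%x. length (concat (map (%_. replicate (g x) False) (replicate (f x) False))))"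
  by (intro pt pt_repF pt_comp[OF assms(2)] assms(1))
 thus ?thesis by (simp add: length_concat sum_list_replicate)
qed

lemma funpow_pred: "((%s. s - 1) ^^ n) m = m - (n::nat)"
 by (induction n arbitrary: m) auto

lemma pt_minus[pt]: assumes "ptime f" "ptime g" shows "ptime (%x. f x - g x :: nat)"
proof -
 have "ptime (%x. ((%s. s - 1) ^^ g x) (f x))"
  by (rule pt_funpow[where B = "%x. tsz (f x)"])
   (intro pt assms pb_ptime | simp add: funpow_pred del: One_nat_def)+
 thus ?thesis by (simp add: funpow_pred del: One_nat_def)
qed

lemma pt_le[pt]: "ptime f ==> ptime g ==> ptime (%x. f x <= (g x :: nat))"
 using pt_is0[OF pt_minus, of f g] by simp

lemma pt_less[pt]: "ptime f ==> ptime g ==> ptime (%x. f x < (g x :: nat))"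
 using pt_not[OF pt_le[of g f]] by (simp add: not_le)

lemma funpow_tl: "(tl ^^ n) xs = drop n xs"
 by (induction n arbitrary: xs) (simp_all add: funpow_Suc_right drop_Suc del: funpow.simps(2))

lemma pt_drop[pt]: assumes "ptime n" "ptime L" shows "ptime (%x. drop (n x) (L x))"
proof -
 have "ptime (%x. ((%s. tl s) ^^ n x) (L x))"
  by (rule pt_funpow[where B = "%x. tsz (L x)"]) (intro pt assms pb_ptime | simp add: funpow_tl tsz_drop)+
 thus ?thesis by (simp add: funpow_tl)
qed

lemma pt_take[pt]: fixes L :: "'x::coded => 'b::coded list" assumes "ptime n" "ptime L" shows "ptime (%x. take (n x) (L x))"
proof -
 have "ptime (%x. rev (drop (length (L x) - n x) (rev (L x))))" by (intro pt assms)
 moreover have "rev (drop (length xs - k) (rev xs)) = take k xs" for k and xs :: "'b list"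
  by (cases "k <= length xs") (simp_all add: rev_drop)
 ultimately show ?thesis by simp
qed

lemma pt_upt0: assumes "ptime n" shows "ptime (%x. [0..<n x])"
proof -
 have e: "((%s. length s # s) ^^ n) [] = rev [0..<n]" for n by (induction n) auto
 have "ptime (%x. ((%s. length s # s) ^^ n x) [])"
 proof (rule pt_funpow[where B = "%x. 1 + tsz (n x) * (1 + tsz (n x))"])
  fix x i assume i: "i <= n x"
  have "tsz [0..<i] <= 1 + length [0..<i] * (1 + tsz (n x))" by (rule tsz_list_bound) (use i in auto)
  also have "\<dots> <= 1 + tsz (n x) * (1 + tsz (n x))" using i by (intro add_left_mono mult_right_mono) auto
  finally show "tsz (((%s. length s # s) ^^ i) []) <= 1 + tsz (n x) * (1 + tsz (n x))" by (simp only: e tsz_rev)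
 qed (intro pt assms pb_intros pb_ptime)+
 from pt_rev[OF this] show ?thesis by (simp add: e)
qed

lemma pt_upt[pt]: assumes "ptime m" "ptime n" shows "ptime (%x. [m x..<n x])"
 using pt_drop[OF assms(1) pt_upt0[OF assms(2)]] by simp

lemma pt_replicate[pt]: assumes "ptime n" "ptime f" shows "ptime (%x. replicate (n x) (f x))"
proof -
 have "ptime (%x. map (%_. f x) [0..<n x])" by (intro pt assms(1) pt_comp[OF assms(2)])
 thus ?thesis by (simp add: map_replicate_const)
qed

lemma pt_product[pt]: assumes "ptime f" "ptime g" shows "ptime (%x. List.product (f x) (g x))"
proof -
 have "ptime (%x. concat (map (%a. map (%b. (a,b)) (g x)) (f x)))" by (intro pt assms(1) pt_comp[OF assms(2)])
 thus ?thesis by (simp add: product_concat_map)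
qed

text \<open>Beyond the end of the list \<open>!\<close> is unspecified, and no program could be
  shown to match it; a default value repairs this.\<close>

definition nthd :: "'a => 'a list => nat => 'a" where
 "nthd d xs n = (case drop n xs of [] => d | y # ys => y)"

lemma nthd[simp]: "n < length xs ==> nthd d xs n = xs ! n" "length xs <= n ==> nthd d xs n = d"
 by (auto simp: nthd_def Cons_nth_drop_Suc[symmetric])

lemma pt_nthd[pt]: assumes "ptime d" "ptime L" "ptime n" shows "ptime (%x. nthd (d x) (L x) (n x))"
 unfolding nthd_def by (intro pt assms)

lemma pt_odd_half:
 fixes n :: "'x::coded => nat"
 assumes "ptime n" shows "ptime (%x. (odd (n x),n x div 2))"
proof -
 have e: "((%s. (\<not> fst s,if fst s then Suc (snd s) else snd s)) ^^ n) (False,0) = (odd n,n div 2)" for n :: nat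
  by (induction n) auto
 have "ptime (%x. ((%s. (\<not> fst s,if fst s then Suc (snd s) else snd s)) ^^ n x) (False,0))"
 proof (rule pt_funpow[where B = "%x. 6 + tsz (n x)"])
  fix x i assume i: "i <= n x"
  have "tsz (odd i) <= 3" by (cases "odd i") auto
  moreover have "tsz (i div 2) <= 2 * i + 1" by simp
  ultimately have "tsz (odd i,i div 2) <= 6 + tsz (n x)" using i by (simp only: tsz_simps)
  thus "tsz (((%s. (\<not> fst s,if fst s then Suc (snd s) else snd s)) ^^ i) (False,0)) <= 6 + tsz (n x)"
   by (simp only: e)
 qed (intro pt assms pb_intros pb_ptime)+
 thus ?thesis by (simp add: e)
qed

lemma pt_odd[pt]: "ptime n ==> ptime (%x. odd (n x :: nat))" using pt_fst[OF pt_odd_half] by simp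
lemma pt_half[pt]: "ptime n ==> ptime (%x. n x div 2 :: nat)" using pt_snd[OF pt_odd_half] by simp

lemma pt_hdt0: "ptime hdt"
proof (rule ptimeI)
 show "m.impl tr (%p. tr (hdt p)) (%p. 80 * sz (tr p) + 60)"
  by (rule impl_as[OF m.impl_hd[of tr]]) (simp add: tr_tree_def)
 show "pb (%p. 80 * sz (tr p) + 60)" by (intro pb_intros pb_tsz[unfolded tsz_def])
 have "sz (hdt p) <= sz p" for p by (cases p) auto
 thus "pb (%p. tsz (hdt p))" by (intro pb_mono[OF pb_tsz]) (simp add: tsz_def tr_tree_def)
qed

lemma pt_tlt0: "ptime tlt"
proof (rule ptimeI)
 show "m.impl tr (%p. tr (tlt p)) (%p. 80 * sz (tr p) + 60)"
  by (rule impl_as[OF m.impl_tl[of tr]]) (simp add: tr_tree_def)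
 show "pb (%p. 80 * sz (tr p) + 60)" by (intro pb_intros pb_tsz[unfolded tsz_def])
 have "sz (tlt p) <= sz p" for p by (cases p) auto
 thus "pb (%p. tsz (tlt p))" by (intro pb_mono[OF pb_tsz]) (simp add: tsz_def tr_tree_def)
qed

lemma pt_isNl: "ptime f ==> ptime (%x. f x = Nl)"
 by (rule pt_recode[OF pt_if_tr[of f "%_. True" "%_. False"]]) (auto simp: pt_const tr_tree_def)

text \<open>Equality of trees with a worklist of pairs of subtrees. The first mismatch empties the
  worklist, which ends the loop with the answer \<open>False\<close>.\<close>

definition eqstep :: "bool * (tree * tree) list => bool * (tree * tree) list" where
 "eqstep s = (case snd s of [] => s | p # ws =>
   if fst p = Nl then (if snd p = Nl then (True,ws) else (False,[]))
   else if snd p = Nl then (False,[]) else (True,(hdt (fst p),hdt (snd p)) # (tlt (fst p),tlt (snd p)) # ws))"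

definition weight :: "(tree * tree) list => nat" where
 "weight ws = (\<Sum>p\<leftarrow>ws. sz (fst p) + sz (snd p))"

lemma weight_simps[simp]: "weight [] = 0" "weight (p # ws) = sz (fst p) + sz (snd p) + weight ws"
 by (simp_all add: weight_def)

lemma tsz_weight: "tsz (b :: bool,ws) <= 5 + 2 * weight ws"
proof -
 have "tsz ws <= 1 + 2 * weight ws"
 proof (induction ws)
  case (Cons p ws)
  thus ?case using sz_pos[of "fst p"] sz_pos[of "snd p"] by (cases p) (simp, simp add: tsz_def tr_tree_def)
 qed simp
 thus ?thesis by (cases b) simp_all
qed

lemma eqsteps:
 "\<exists>n\<le>weight ws. (eqstep ^^ n) (True,ws) = ((\<forall>p\<in>set ws. fst p = snd p),[]) &
   (\<forall>i<n. snd ((eqstep ^^ i) (True,ws)) ~= []) & (\<forall>i\<le>n. tsz ((eqstep ^^ i) (True,ws)) <= 5 + 2 * weight ws)"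
proof (induction "weight ws" arbitrary: ws rule: less_induct)
 case less
 show ?case
 proof (cases ws)
  case Nil
  thus ?thesis by (intro exI[of _ 0]) simp
 next
  case (Cons p vs)
  have pos: "sz (fst p) > 0" "sz (snd p) > 0" using sz_pos[of "fst p"] sz_pos[of "snd p"] by auto
  have shift: "(eqstep ^^ Suc i) (True,ws) = (eqstep ^^ i) (eqstep (True,ws))" for i by (simp add: funpow_swap1)
  have *: ?thesis if us: "eqstep (True,ws) = (True,us)" "weight us < weight ws"
    "(\<forall>p\<in>set us. fst p = snd p) \<longleftrightarrow> (\<forall>p\<in>set ws. fst p = snd p)" for us
  proof -
   obtain n where n: "n <= weight us" "(eqstep ^^ n) (True,us) = ((\<forall>p\<in>set us. fst p = snd p),[])"
    "\<forall>i<n. snd ((eqstep ^^ i) (True,us)) ~= []" "\<forall>i\<le>n. tsz ((eqstep ^^ i) (True,us)) <= 5 + 2 * weight us"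
    using less[OF us(2)] by auto
   have a: "snd ((eqstep ^^ i) (True,ws)) ~= []" if "i < Suc n" for i
   proof (cases i)
    case 0 thus ?thesis using Cons by simp
   next
    case (Suc j)
    show ?thesis unfolding Suc shift us(1) using n(3) that Suc by simp
   qed
   have b: "tsz ((eqstep ^^ i) (True,ws)) <= 5 + 2 * weight ws" if "i <= Suc n" for i
   proof (cases i)
    case 0 thus ?thesis using tsz_weight[of True ws] by simp
   next
    case (Suc j)
    have "tsz ((eqstep ^^ j) (True,us)) <= 5 + 2 * weight us" using n(4) that Suc by simp
    thus ?thesis unfolding Suc shift us(1) using us(2) by linarith
   qed
   have c: "(eqstep ^^ Suc n) (True,ws) = ((\<forall>p\<in>set ws. fst p = snd p),[])" unfolding shift us(1) n(2) us(3) ..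
   show ?thesis using a b c n(1) us(2) by (intro exI[of _ "Suc n"]) (auto simp del: funpow.simps)
  qed
  have stop: ?thesis if st: "eqstep (True,ws) = (False,[])" "fst p ~= snd p"
  proof -
   have a: "\<not> (\<forall>p\<in>set ws. fst p = snd p)" using st(2) Cons by auto
   have "tsz (True,ws) <= 5 + 2 * weight ws" by (rule tsz_weight)
   moreover have "i <= Suc 0 \<longleftrightarrow> i = 0 \<or> i = Suc 0" for i by auto
   ultimately show ?thesis using a st Cons pos by (intro exI[of _ 1]) (auto simp: all_conj_distrib)
  qed
  show ?thesis
  proof (cases "fst p")
   case Nl
   show ?thesis
   proof (cases "snd p")
    case Nl2: Nl
    show ?thesis by (rule *[of vs]) (use Nl Nl2 Cons pos in \<open>auto simp: eqstep_def\<close>)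
   next
    case (Cn c d)
    thus ?thesis by (intro stop) (use Nl Cons in \<open>auto simp: eqstep_def\<close>)
   qed
  next
   case (Cn a b)
   show ?thesis
   proof (cases "snd p")
    case Nl
    thus ?thesis by (intro stop) (use Cn Cons in \<open>auto simp: eqstep_def\<close>)
   next
    case Cn2: (Cn c d)
    show ?thesis by (rule *[of "(a,c) # (b,d) # vs"]) (use Cn Cn2 Cons in \<open>auto simp: eqstep_def\<close>)
   qed
  qed
 qed
qed

lemma pt_eq[pt]: assumes f: "ptime f" and g: "ptime g" shows "ptime (%x. f x = g x)"
proof -
 have tr: "ptime h ==> ptime (%x. tr (h x))" for h :: "'a => 'b"
  by (erule pt_recode) (simp add: tr_tree_def)
 have s: "ptime eqstep" unfolding eqstep_def by (intro pt pt_isNl pt_comp[OF pt_hdt0] pt_comp[OF pt_tlt0])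
 have pbf: "pb (%x. sz (tr (f x)))" "pb (%x. sz (tr (g x)))" using pb_ptime[OF f] pb_ptime[OF g] by (simp_all add: tsz_def)
 have "ptime (%x. (f x = g x,[] :: (tree \<times> tree) list))"
 proof (rule pt_while[where t = "%s. snd s ~= []" and g = eqstep and h = "%x. (True,[(tr (f x),tr (g x))])"
   and N = "%x. sz (tr (f x)) + sz (tr (g x))" and B = "%x. 5 + 2 * (sz (tr (f x)) + sz (tr (g x)))"])
  show "ptime (%x. (True,[(tr (f x),tr (g x))]))" by (intro pt tr f g)
  fix x
  show "\<exists>n\<le>sz (tr (f x)) + sz (tr (g x)). (f x = g x,[]) = (eqstep ^^ n) (True,[(tr (f x),tr (g x))]) &
   (\<forall>i<n. snd ((eqstep ^^ i) (True,[(tr (f x),tr (g x))])) ~= []) & \<not> snd (f x = g x,[] :: (tree \<times> tree) list) ~= [] &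
   (\<forall>i\<le>n. tsz ((eqstep ^^ i) (True,[(tr (f x),tr (g x))])) <= 5 + 2 * (sz (tr (f x)) + sz (tr (g x))))"
   using eqsteps[of "[(tr (f x),tr (g x))]"] by (auto simp: tr_inject)
 qed (intro pt s pb_intros pbf)+
 from pt_fst[OF this] show ?thesis by simp
qed

lemma pt_mem[pt]: assumes f: "ptime f" and g: "ptime g" shows "ptime (%x. f x : set (g x))"
proof -
 have "ptime (%x. \<exists>y\<in>set (g x). y = f x)" by (intro pt g pt_comp[OF f])
 thus ?thesis by simp
qed

lemma pt_n_lists[pt]: assumes "ptime L" shows "ptime (%x. List.n_lists h (L x))"
proof (induction h)
 case 0 show ?case by (simp add: pt_const)
next
 case (Suc h)
 have "ptime (%x. concat (map (%ys. map (%y. y # ys) (L x)) (List.n_lists h (L x))))"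
  by (intro pt Suc pt_comp[OF assms])
 thus ?case by simp
qed

text \<open>A hard-wired lookup table. It is what turns the transition function of a fixed machine
  into a program.\<close>

lemma pt_finite:
 assumes "finite A" shows "\<exists>h. ptime h & (\<forall>a\<in>A. h a = f a)"
 using assms
proof induction
 case empty show ?case by (intro exI[of _ "%_. undefined"]) (simp add: pt_const)
next
 case (insert a A)
 then obtain h where h: "ptime h" "\<forall>a\<in>A. h a = f a" by auto
 have "ptime (%x. if x = a then f a else h x)" by (intro pt h)
 thus ?case by (intro exI[of _ "%x. if x = a then f a else h x"]) (use h insert in auto)
qed

definition dedup :: "'a list => 'a list" where
 "dedup xs = foldl (%s y. if y : set s then s else s @ [y]) [] xs"

lemma dedup: "set (dedup xs) = set xs" "distinct (dedup xs)"
proof -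
 have "set (foldl (%s y. if y : set s then s else s @ [y]) s xs) = set s \<union> set xs &
   (distinct s --> distinct (foldl (%s y. if y : set s then s else s @ [y]) s xs))" for s
  by (induction xs arbitrary: s) auto
 from this[of "[]"] show "set (dedup xs) = set xs" "distinct (dedup xs)" by (simp_all add: dedup_def)
qed

lemma pt_dedup[pt]: assumes "ptime L" shows "ptime (%x. dedup (L x))"
proof -
 have e: "tsz (foldl (%s y. if y : set s then s else s @ [y]) s xs) + 1 <= tsz s + tsz xs" for s :: "'b list" and xs
 proof (induction xs arbitrary: s)
  case (Cons y ys)
  show ?case using Cons[of s] Cons[of "s @ [y]"] tsz_append[of s "[y]"] by simp
 qed simp
 have "tsz (foldl (%s y. if y : set s then s else s @ [y]) [] (take i xs)) <= tsz xs" for xs :: "'b list" and i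
  using e[of "[]" "take i xs"] tsz_take[of i xs] by simp
 thus ?thesis unfolding dedup_def
  by (intro pt_foldl[where B = "%x. tsz (L x)"] pb_ptime) (intro pt assms | simp)+
qed

lemma tsz_bits: "tsz x <= 4 * length x + 1" for x :: "bool list"
proof (induction x)
 case (Cons b x) thus ?case by (cases b) auto
qed simp

lemma ptime_polytime_computable:
 assumes "ptime (f :: bool list => bool list)" shows "polytime_computable f"
proof -
 obtain tm where f: "m.impl tr (%x. tr (f x)) tm" "pb tm" "pb (%x. tsz (f x))" using assms by (elim ptimeE)
 obtain M where M: "turing_machine M" "!!x t. tm x + 100 * length x + 100 * length (f x) + 100 <= t ==> computes_within M x (f x) t"
  using m.tm_of_impl[of "%x. x" f tm] f(1) unfolding tr_bits by metis
 obtain k l where kl: "!!x. tm x <= (tsz x + 2) ^ k" "!!x. tsz (f x) <= (tsz x + 2) ^ l" using f unfolding pb_def by auto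
 \<comment> \<open>A bit list of length \<open>l\<close> has tree size at most
   \<open>4 * l + 1\<close>, whence the base \<open>[:3,4:]\<close> for tree size plus 2.\<close>
 define p :: "nat poly" where "p = [:3,4:] ^ k + [:100,100:] + smult 100 ([:3,4:] ^ l)"
 have "tm x + 100 * length x + 100 * length (f x) + 100 <= poly p (length x)" for x
 proof -
  have a: "(tsz x + 2) ^ j <= (3 + 4 * length x) ^ j" for j using tsz_bits[of x] by (intro power_mono) auto
  have "tm x <= (3 + 4 * length x) ^ k" "length (f x) <= (3 + 4 * length x) ^ l"
   using kl(1)[of x] kl(2)[of x] a[of k] a[of l] length_le_tsz[of "f x"] by linarith+
  thus ?thesis by (simp add: p_def poly_power algebra_simps)
 qed
 thus ?thesis unfolding polytime_computable_def using M by (intro exI[of _ M] exI[of _ p]) auto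
qed

lemma pt_poly: assumes "ptime n" shows "ptime (%x. poly (p :: nat poly) (n x))"
proof (induction p)
 case 0 show ?case by (simp add: pt_const)
next
 case (pCons a p)
 have "ptime (%x. a + n x * poly p (n x))" by (intro pt assms pCons)
 thus ?case by simp
qed

section \<open>Connectivity of edge sets\<close>

text \<open>Deleting the vertices \<open>Z\<close> is modelled by forbidding them as links, not by
  removing edges: an edge at a vertex of \<open>Z\<close> remains present and is still attached
  through its other end.\<close>

definition lk :: "'v set set => 'v set => 'v set => 'v set => bool" where
 "lk S Z e f \<longleftrightarrow> e : S & f : S & (\<exists>x. x : e & x : f & x ~: Z)"

abbreviation cn :: "'v set set => 'v set => 'v set => 'v set => bool" where
 "cn S Z \<equiv> (lk S Z)\<^sup>*\<^sup>*"

definition tri :: "('v => 'v => bool) => 'v set set" where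
 "tri R = {{a,b} |a b. R a b & (\<exists>d. R a d & R b d)}"

text \<open>The 2-connected block of \<open>e\<close> in the graph of triangle edges: no single
  vertex separates a member from \<open>e\<close>.\<close>

definition blk :: "('v => 'v => bool) => 'v set => 'v set set" where
 "blk R e = {f \<in> tri R. \<forall>a. cn (tri R) {a} e f}"

definition gam :: "('v => 'v => bool) => nat => 'v set set" where
 "gam R k = {e \<in> tri R. k <= card (blk R e)}"

text \<open>The branch at the vertex \<open>a\<close> that contains the edge \<open>g\<close>: all
  that can be reached from \<open>g\<close> without passing through \<open>a\<close>.\<close>

definition br :: "'v set set => 'v => 'v set => 'v set set" where
 "br S a g = {f \<in> S. cn S {a} g f}"

text \<open>The weight of the heaviest branch hanging at \<open>a\<close>; the inserted 0 covers
  vertices that have no edge in \<open>S\<close>.\<close>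

definition mx :: "'v set set => 'v => nat" where
 "mx S a = Max (insert 0 {card (br S a g) |g. g : S & a : g})"

lemma lk_sym: "lk S Z e f ==> lk S Z f e"
 by (auto simp: lk_def)

lemma cn_sym: "cn S Z e f ==> cn S Z f e"
 by (metis lk_sym sympD sympI symp_rtranclp)

lemma cn_mono: "cn S Z e f ==> S \<subseteq> S' ==> Z' \<subseteq> Z ==> cn S' Z' e f"
 by (erule rtranclp_mono[THEN predicate2D, rotated]) (auto simp: lk_def; blast)

lemma cn_mem: "cn S Z e f ==> e : S ==> f : S"
 by (induction rule: rtranclp_induct) (auto simp: lk_def)

lemma cn_share: "e : S ==> f : S ==> x : e ==> x : f ==> x ~: Z ==> cn S Z e f"
 by (rule r_into_rtranclp) (auto simp: lk_def)

text \<open>Transports connections along a map of edges. It is applied to images under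
  \<open>ph\<close>, under \<open>rl\<close> and under both, and with the identity in order to
  change the edge set or the forbidden vertices.\<close>

lemma cn_map:
 assumes "cn S Z e f" "e : S"
  and S: "!!g. cn S Z e g ==> F g : S'"
  and L: "!!g h. cn S Z e g ==> lk S Z g h ==> \<exists>x. x : F g & x : F h & x ~: Z'"
 shows "cn S' Z' (F e) (F f)"
 using assms(1)
proof (induction rule: rtranclp_induct)
 case (step g h)
 have "cn S Z e h" using step(1,2) by (rule rtranclp.rtrancl_into_rtrancl)
 from S[OF step(1)] S[OF this] L[OF step(1,2)] have "lk S' Z' (F g) (F h)" by (auto simp: lk_def)
 with step show ?case by auto
qed auto

text \<open>Cut the connection at its first edge through \<open>c\<close>: before that no edge
  contains \<open>c\<close>, so no link uses it.\<close>

lemma cn_first: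
 assumes "cn S {} e h" "c : h" "e : S"
 shows "\<exists>h1\<in>S. c : h1 & cn S {c} e h1"
 using assms
proof (induction rule: converse_rtranclp_induct)
 case base thus ?case by auto
next
 case (step e g)
 hence "g : S" by (auto simp: lk_def)
 with step obtain h1 where h1: "h1 : S" "c : h1" "cn S {c} g h1" by auto
 show ?case
 proof (cases "c : e")
  case True thus ?thesis using step by auto
 next
  case False
  hence "lk S {c} e g" using step(1) by (auto simp: lk_def)
  thus ?thesis using h1 by (meson converse_rtranclp_into_rtranclp)
 qed
qed

lemma blk_sym: "f : blk R e ==> e : tri R ==> e : blk R f"
 by (auto simp: blk_def intro: cn_sym)

lemma blk_trans: "f : blk R e ==> g : blk R f ==> g : blk R e"
 by (auto simp: blk_def) (metis rtranclp_trans)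

lemma blk_eq: "f : blk R e ==> e : tri R ==> blk R f = blk R e"
 by (meson blk_sym blk_trans subsetI subset_antisym)

lemma tri_sub: "e : tri R ==> (!!a b. R a b ==> a : V & b : V) ==> e \<subseteq> V"
 by (auto simp: tri_def)

section \<open>Deleting vertex covers destroys all copies of a connected graph\<close>

datatype ('y, 'v) gv = Hub | Bag 'y 'v | Sub 'y

locale tri_graph =
 fixes V :: "'v set" and A :: "'v => 'v => bool" and u v w :: 'v
 assumes finV: "finite V" and AV: "A x y ==> x : V & y : V" and Asym: "A x y ==> A y x"
  and Airr: "\<not> A x x" and conn: "x : V ==> y : V ==> A\<^sup>*\<^sup>* x y"
  and uv: "A u v" and uw: "A u w" and vw: "A v w" and wdeg: "A w x ==> x = u \<or> x = v"
begin

text \<open>\<open>B\<close> joins the copies of \<open>v\<close>, and \<open>X\<close> collects the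
  bags whose edge from the hub to \<open>Bag y v\<close> has been subdivided by
  \<open>Sub y\<close>. Bags have no copies of \<open>u\<close>, which is the hub, or of
  \<open>w\<close>.\<close>

fun adj :: "('y => 'y => bool) => 'y set => ('y,'v) gv => ('y,'v) gv => bool" where
 "adj B X (Bag y m) (Bag y' m') \<longleftrightarrow> m ~= u & m ~= w & m' ~= u & m' ~= w &
   (y = y' & A m m' \<or> m = v & m' = v & B y y')"
| "adj B X Hub (Bag y m) \<longleftrightarrow> A u m & m ~= w & \<not> (m = v & y : X)"
| "adj B X (Bag y m) Hub \<longleftrightarrow> A u m & m ~= w & \<not> (m = v & y : X)"
| "adj B X Hub (Sub y) \<longleftrightarrow> y : X"
| "adj B X (Sub y) Hub \<longleftrightarrow> y : X"
| "adj B X (Sub y) (Bag y' m) \<longleftrightarrow> y : X & y' = y & m = v"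
| "adj B X (Bag y' m) (Sub y) \<longleftrightarrow> y : X & y' = y & m = v"
| "adj B X _ _ \<longleftrightarrow> False"

fun rl :: "('y,'v) gv => 'v" where
 "rl (Bag y m) = m" | "rl _ = u"

lemma neq: "u ~= v" "u ~= w" "v ~= w"
 using uv uw vw Airr by auto

lemma inV: "u : V" "v : V" "w : V" using uv uw AV by blast+

lemma triV: "e : tri A ==> e \<subseteq> V" using tri_sub AV by metis

lemma fin_tri: "finite (tri A)"
 by (rule finite_subset[of _ "Pow V"]) (use triV finV in auto)

lemma tri_uvw: "{u,v} : tri A" "{u,w} : tri A" "{v,w} : tri A"
 using uv uw vw Asym unfolding tri_def by blast+

section \<open>Blocks and branches around the triangle\<close>

definition "Bl = blk A {u,v}"
definition "kk = card Bl"
text \<open>Keeps the blocks at least as heavy as that of \<open>uv\<close>. The threshold is chosen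
  so that the copies of \<open>Bl\<close> in the bags, which lack \<open>w\<close>, fall below
  it.\<close>

definition "Gm = gam A kk"
definition "Gm0 = Gm - Bl"

text \<open>Two edges of a triangle share a vertex; if just that one is forbidden, the third edge
  provides the detour.\<close>

lemma Bl_uvw: "{u,v} : Bl" "{u,w} : Bl" "{v,w} : Bl"
proof -
 have 1: "cn (tri A) {a} {u,v} {u,w}" for a
 proof (cases "a = u")
  case True
  have "cn (tri A) {a} {u,v} {v,w}"
   by (rule cn_share[of _ _ _ v]) (use True neq tri_uvw in auto)
  moreover have "cn (tri A) {a} {v,w} {u,w}"
   by (rule cn_share[of _ _ _ w]) (use True neq tri_uvw in auto)
  ultimately show ?thesis by (rule rtranclp_trans)
 qed (use tri_uvw in \<open>auto intro!: cn_share[of _ _ _ u]\<close>)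
 have 2: "cn (tri A) {a} {u,v} {v,w}" for a
 proof (cases "a = v")
  case True
  have "cn (tri A) {a} {u,v} {u,w}"
   by (rule cn_share[of _ _ _ u]) (use True neq tri_uvw in auto)
  moreover have "cn (tri A) {a} {u,w} {v,w}"
   by (rule cn_share[of _ _ _ w]) (use True neq tri_uvw in auto)
  ultimately show ?thesis by (rule rtranclp_trans)
 qed (use tri_uvw in \<open>auto intro!: cn_share[of _ _ _ v]\<close>)
 show "{u,v} : Bl" "{u,w} : Bl" "{v,w} : Bl"
  using 1 2 tri_uvw unfolding Bl_def blk_def by auto
qed

lemma fin_Bl: "finite Bl"
 using fin_tri by (rule rev_finite_subset) (auto simp: Bl_def blk_def)

lemma Bl_sub: "Bl \<subseteq> Gm"
proof
 fix e assume "e : Bl"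
 hence "e : tri A" "blk A e = Bl" using blk_eq[OF _ tri_uvw(1)] by (auto simp: Bl_def blk_def)
 thus "e : Gm" by (auto simp: Gm_def gam_def kk_def)
qed

lemma Gm_sub: "Gm \<subseteq> tri A" by (auto simp: Gm_def gam_def)
lemma fin_Gm: "finite Gm" "finite Gm0"
 using fin_tri Gm_sub finite_subset unfolding Gm0_def by blast+

text \<open>A connection from \<open>u\<close> to \<open>v\<close> outside the block would close up to a cycle through \<open>uv\<close>.\<close>

lemma separated:
 assumes g: "g : Gm0" "u : g" and f: "v : f" and c: "cn Gm0 {} g f"
 shows False
proof -
 have "cn Gm0 {} f g" "f : Gm0" using c g cn_mem by (auto intro: cn_sym)
 then obtain h where h: "h : Gm0" "u : h" "cn Gm0 {u} f h" using cn_first g by metis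
 have sub: "Gm0 \<subseteq> tri A" using Gm_sub unfolding Gm0_def by auto
 have "cn (tri A) {a} {u,v} h" for a
 proof (cases "a = u")
  case True
  have "cn (tri A) {a} {u,v} f" using f True neq tri_uvw \<open>f \<in> Gm0\<close> sub by (auto intro!: cn_share)
  moreover have "cn (tri A) {a} f h" using h(3) True sub by (auto intro: cn_mono)
  ultimately show ?thesis by (rule rtranclp_trans)
 qed (use h sub tri_uvw in \<open>auto intro!: cn_share[of _ _ _ u]\<close>)
 hence "h : Bl" using h sub unfolding Bl_def blk_def by auto
 thus False using h by (auto simp: Gm0_def)
qed

text \<open>No vertex \<open>a\<close> cuts the part of \<open>Gm\<close> around \<open>e\<close>
  into pieces of weight at most \<open>mx Gm0 u\<close> each. Such a part is too heavy to touch the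
  hub, where no branch of the reduction graph weighs more than that.\<close>

definition "big e \<longleftrightarrow> e : Gm & (\<forall>a. \<exists>f\<in>Gm. cn Gm {} e f & mx Gm0 u < card (br Gm a f))"
definition "Ob = {e. big e}"

lemma fin_mx: "finite {card (br Gm0 a g) |g. g : Gm0 & a : g}"
 using fin_Gm by auto

lemma mx_ge: "g : Gm0 ==> a : g ==> card (br Gm0 a g) <= mx Gm0 a"
 unfolding mx_def using fin_mx by (intro Max_ge) auto

lemma mx_ex: "0 < mx Gm0 a ==> \<exists>g\<in>Gm0. a : g & card (br Gm0 a g) = mx Gm0 a"
 using Max_in[of "insert 0 {card (br Gm0 a g) |g. g : Gm0 & a : g}"] fin_mx[of a]
 unfolding mx_def by fastforce

text \<open>Passing from \<open>Gm0\<close> to \<open>Gm\<close>, a branch gains at least the block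
  edge \<open>g0\<close> through which it is entered; this makes the inequality strict.\<close>

lemma br_sub:
 assumes g: "g : Gm0" and g0: "g0 : Bl" and x: "x : g0" "x : g" "x ~= a"
  and a: "!!f. f : br Gm0 z g ==> a ~: f"
 shows "card (br Gm0 z g) < card (br Gm a g0)"
proof -
 have "insert g0 (br Gm0 z g) \<subseteq> br Gm a g0"
 proof -
  have 0: "g0 : Gm" "g : Gm" using g g0 Bl_sub by (auto simp: Gm0_def)
  have 1: "cn Gm {a} g0 g" using 0 x by (auto intro!: cn_share[of _ _ _ x])
  have "cn Gm {a} g f" if "cn Gm0 {z} g f" for f
  proof (rule cn_map[OF that g, where F = "%x. x"])
   fix g' assume "cn Gm0 {z} g g'"
   thus "g' : Gm" using cn_mem[OF _ g] by (auto simp: Gm0_def)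
  next
   fix g' h assume c: "cn Gm0 {z} g g'" and l: "lk Gm0 {z} g' h"
   hence "a ~: g'" using a[of g'] by (auto simp: br_def lk_def)
   thus "\<exists>x. x : g' & x : h & x ~: {a}" using l by (auto simp: lk_def)
  qed
  thus ?thesis using 0 1 by (auto simp: br_def Gm0_def intro: rtranclp_trans)
 qed
 moreover have "g0 ~: br Gm0 z g" using g0 by (auto simp: br_def Gm0_def)
 moreover have "finite (br Gm a g0)" using fin_Gm by (auto simp: br_def)
 ultimately show ?thesis
  by (metis card_insert_disjoint card_mono finite_subset insert_subset less_eq_Suc_le)
qed

text \<open>By \<open>separated\<close> the heaviest branches at \<open>u\<close> and at
  \<open>v\<close> have no vertex in common, so any \<open>a\<close> misses one of them. The missed
  branch together with \<open>uw\<close> or \<open>vw\<close> outweighs \<open>mx Gm0 u\<close>; if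
  it is the one at \<open>v\<close>, this is due to \<open>le\<close>.\<close>

lemma big_T:
 assumes le: "mx Gm0 u <= mx Gm0 v" and e: "e = {u,w} \<or> e = {v,w}"
 shows "big e"
 unfolding big_def
proof (intro conjI allI)
 show "e : Gm" using e Bl_uvw Bl_sub by auto
 fix a
 have con: "cn Gm {} e f" if "f = {u,w} \<or> f = {v,w}" for f
  using that e Bl_uvw Bl_sub by (auto intro!: cn_share[of _ _ _ w])
 have "\<exists>f. (f = {u,w} \<or> f = {v,w}) & mx Gm0 u < card (br Gm a f)"
 proof (cases "mx Gm0 u = 0")
  case True
  have "{u,w} : br Gm a {u,w}" using Bl_uvw Bl_sub by (auto simp: br_def)
  hence "0 < card (br Gm a {u,w})" using fin_Gm by (auto simp: card_gt_0_iff br_def)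
  thus ?thesis using True by auto
 next
  case False
  then obtain g h where g: "g : Gm0" "u : g" "card (br Gm0 u g) = mx Gm0 u"
   and h: "h : Gm0" "v : h" "card (br Gm0 v h) = mx Gm0 v"
   using mx_ex le by (metis bot_nat_0.not_eq_extremum le_zero_eq)
  have br_cn: "cn Gm0 {} g' f" if "f : br Gm0 z g'" for f z g'
   using that cn_mono[of Gm0 "{z}" g' f Gm0 "{}"] by (simp add: br_def)
  have vg: "v ~: f" if "f : br Gm0 u g" for f
   using separated[OF g(1,2) _ br_cn[OF that]] by blast
  show ?thesis
  proof (cases "a ~= v & (\<forall>f\<in>br Gm0 v h. a ~: f)")
   case True
   hence "card (br Gm0 v h) < card (br Gm a {v,w})"
    by (intro br_sub[OF h(1) Bl_uvw(3) _ h(2)]) blast+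
   hence "mx Gm0 u < card (br Gm a {v,w})" using h(3) le by linarith
   thus ?thesis by blast
  next
   case False
   have "a ~= u & (\<forall>f\<in>br Gm0 u g. a ~: f)"
   proof (cases "a = v")
    case True thus ?thesis using vg neq by blast
   next
    case f: False
    then obtain f1 where f1: "f1 : br Gm0 v h" "a : f1" using False by blast
    hence f1': "f1 : Gm0" "cn Gm0 {} f1 h" using cn_sym[OF br_cn[OF f1(1)]] by (auto simp: br_def)
    have "a ~= u"
     using separated[OF f1'(1) _ h(2) f1'(2)] f1 by blast
    moreover have "a ~: f2" if "f2 : br Gm0 u g" for f2
    proof
     assume a: "a : f2"
     have "cn Gm0 {} f2 f1" by (rule cn_share[of _ _ _ a]) (use that f1' f1 a in \<open>simp_all add: br_def\<close>)
     hence "cn Gm0 {} g h" using br_cn[OF that] f1'(2) by (meson rtranclp_trans)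
     thus False using separated[OF g(1,2) h(2)] by blast
    qed
    ultimately show ?thesis by blast
   qed
   hence "card (br Gm0 u g) < card (br Gm a {u,w})"
    by (intro br_sub[OF g(1) Bl_uvw(2) _ g(2)]) blast+
   hence "mx Gm0 u < card (br Gm a {u,w})" using g(3) by linarith
   thus ?thesis by blast
  qed
 qed
 thus "\<exists>f\<in>Gm. cn Gm {} e f & mx Gm0 u < card (br Gm a f)"
  using con Bl_uvw Bl_sub by blast
qed

end


text \<open>The situation that \<open>no_embedding\<close> refutes.\<close>

locale embedded = tri_graph V A u v w for V :: "'v set" and A and u v w +
 fixes B :: "'y => 'y => bool" and X :: "'y set" and ph :: "'v => ('y,'v) gv"
 assumes Bsym: "B p q ==> B q p" and Btri: "B p q ==> B q r ==> \<not> B p r"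
  and cover: "B p q ==> p : X \<or> q : X"
  and inj: "inj_on ph V" and hom: "A x y ==> adj B X (ph x) (ph y)"
  and le: "mx Gm0 u <= mx Gm0 v"
begin

abbreviation "R \<equiv> adj B X"
definition "Gm1 = gam R kk"

definition bags :: "'y => ('y,'v) gv set" where
 "bags y = insert Hub (Bag y ` (- {u,w}))"

lemma inj_rl: "inj_on rl (bags y)"
 by (auto simp: inj_on_def bags_def)

lemma rl_bags: "s : bags y ==> rl s ~= w"
 using neq unfolding bags_def by (cases s) auto

lemma Birr: "\<not> B x x" using Btri by blast

text \<open>Three copies of \<open>v\<close> cannot form a triangle as \<open>B\<close> has none. A
  triangle through the hub and two bags needs bags adjacent in \<open>B\<close>, one of which the
  cover has cut off from the hub. \<open>Sub y\<close> has only two neighbours, and these are no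
  longer adjacent.\<close>

lemma tri_bag:
 assumes "R p q" "R p r" "R q r"
 shows "\<exists>y. p : bags y & q : bags y & r : bags y & A (rl p) (rl q) & A (rl p) (rl r) & A (rl q) (rl r)"
proof -
 have Bt: "B x y ==> B x z ==> B y z ==> False" for x y z using Btri by blast
 show ?thesis
  using assms neq Airr Birr Bt cover Asym
  by (cases p; cases q; cases r) (auto simp: bags_def dest: Asym cover)
qed

definition bag :: "('y,'v) gv set => 'y" where
 "bag e = (SOME y. e \<subseteq> bags y)"

lemma tri1:
 assumes "e : tri R"
 shows "e \<subseteq> bags (bag e)" "rl ` e : tri A" "w ~: rl ` e" "\<exists>m. Bag (bag e) m : e"
proof -
 obtain p q r where e: "e = {p,q}" "R p q" "R p r" "R q r" using assms unfolding tri_def by auto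
 obtain y where y: "p : bags y" "q : bags y" "A (rl p) (rl q)" "A (rl p) (rl r)" "A (rl q) (rl r)"
  using tri_bag[OF e(2-4)] by auto
 have "e \<subseteq> bags y" using e y by simp
 thus b: "e \<subseteq> bags (bag e)" unfolding bag_def by (rule someI)
 show "rl ` e : tri A" using y e unfolding tri_def by auto
 show "w ~: rl ` e"
 proof
  assume "w : rl ` e"
  then obtain s where "s : bags (bag e)" "rl s = w" using b by auto
  thus False using rl_bags by blast
 qed
 have "p ~= Hub \<or> q ~= Hub" using y(3) Airr by auto
 then obtain s where s: "s : e" "s ~= Hub" using e by auto
 hence "s : bags (bag e)" using b by auto
 thus "\<exists>m. Bag (bag e) m : e" using s by (auto simp: bags_def)
qed

lemma bag_eq: "e : tri R ==> p : e ==> p ~= Hub ==> \<exists>m. p = Bag (bag e) m & m ~= u & m ~= w"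
 using tri1(1)[of e] by (auto simp: bags_def)

lemma same_bag: "e : tri R ==> f : tri R ==> p : e ==> p : f ==> p ~= Hub ==> bag e = bag f"
 using bag_eq by (metis gv.inject(1))

text \<open>Edges between bags lie on no triangle, so triangle edges of different bags can meet in
  the hub only.\<close>

lemma cn_bag:
 assumes "cn S {Hub} e f" "S \<subseteq> tri R"
 shows "bag e = bag f"
 using assms(1)
proof (induction rule: rtranclp_induct)
 case (step g h) thus ?case using same_bag[of g h] assms(2) by (auto simp: lk_def)
qed simp

lemma cn_rl:
 assumes "cn S {Hub} e f" "S \<subseteq> tri R" "e : S" "!!g. g : S ==> rl ` g : S'"
 shows "cn S' {u,w} (rl ` e) (rl ` f)"
proof (rule cn_map[OF assms(1,3)])
 fix g assume "cn S {Hub} e g" thus "rl ` g : S'" using cn_mem assms by blast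
next
 fix g h assume "lk S {Hub} g h"
 then obtain p where p: "p : g" "p : h" "p ~= Hub" "g : S" by (auto simp: lk_def)
 then obtain m where "p = Bag (bag g) m" "m ~= u" "m ~= w" using bag_eq assms(2) by blast
 thus "\<exists>x. x : rl ` g & x : rl ` h & x ~: {u,w}" using p by (intro exI[of _ m]) force
qed

text \<open>Forbidding the hub confines the block to one bag. When another vertex is forbidden, a
  connection may leave the bag, but it leaves and returns through the hub, so the excursion can be
  cut out.\<close>

lemma blk_bag:
 assumes e: "e : tri R" and f: "f : blk R e"
 shows "bag f = bag e" "rl ` f : blk A (rl ` e)"
proof -
 have ft: "f : tri R" and c: "cn (tri R) {a} e f" for a using f by (auto simp: blk_def)
 show be: "bag f = bag e" using cn_bag[OF c] by simp
 have 1: "cn (tri A) {u,w} (rl ` e) (rl ` f)" using cn_rl[OF c _ e tri1(2)] by blast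
 have "cn (tri A) {a} (rl ` e) (rl ` f)" for a
 proof (cases "a : {u,w}")
  case True thus ?thesis using cn_mono[OF 1] by blast
 next
  case a: False
  let ?C = "cn (tri A) {a} (rl ` e)"
  \<comment> \<open>Invariant along the connection: while it is outside the bag, some edge of the
    bag at the hub has already been reached.\<close>
  have "(bag g = bag e & ?C (rl ` g)) \<or>
    (bag g ~= bag e & (\<exists>h\<in>tri R. bag h = bag e & Hub : h & ?C (rl ` h)))"
   if "cn (tri R) {Bag (bag e) a} e g" for g
   using that
  proof (induction rule: rtranclp_induct)
   case base thus ?case by auto
  next
   case (step g g')
   then obtain p where p: "p : g" "p : g'" "p ~= Bag (bag e) a" "g : tri R" "g' : tri R"
    by (auto simp: lk_def)
   show ?case
   proof (cases "bag g = bag e")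
    case g: True
    hence cg: "?C (rl ` g)" using step by auto
    show ?thesis
    proof (cases "bag g' = bag e")
     case g': True
     have "rl p ~= a" using p a g bag_eq[OF p(4,1)] by (cases "p = Hub") auto
     hence "cn (tri A) {a} (rl ` g) (rl ` g')"
      using p tri1(2) by (intro cn_share[of _ _ _ "rl p"]) auto
     thus ?thesis using g' cg by (meson rtranclp_trans)
    next
     case g': False
     hence "p = Hub" using same_bag[OF p(4,5,1,2)] g by auto
     thus ?thesis using g g' p cg by auto
    qed
   next
    case g: False
    then obtain h where h: "h : tri R" "bag h = bag e" "Hub : h" "?C (rl ` h)" using step by auto
    show ?thesis
    proof (cases "bag g' = bag e")
     case g': True
     hence "p = Hub" using same_bag[OF p(4,5,1,2)] g by auto
     hence "cn (tri A) {a} (rl ` h) (rl ` g')"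
      using h p tri1(2) a by (intro cn_share[of _ _ _ u]) force+
     thus ?thesis using g' h by (meson rtranclp_trans)
    qed (use h in auto)
   qed
  qed
  from this[OF c] be show ?thesis by auto
 qed
 thus "rl ` f : blk A (rl ` e)" using tri1(2)[OF ft] by (auto simp: blk_def)
qed

lemma inj_rl_edges: "inj_on ((`) rl) {e \<in> tri R. bag e = y}"
proof (rule inj_onI)
 fix e f assume e: "e : {e \<in> tri R. bag e = y}" and f: "f : {e \<in> tri R. bag e = y}" and eq: "rl ` e = rl ` f"
 have "e \<subseteq> bags y" "f \<subseteq> bags y" using e f tri1(1)[of e] tri1(1)[of f] by simp_all
 thus "e = f" using eq inj_on_image_eq_iff[OF inj_rl] by auto
qed

lemma blk_rl:
 assumes "e : tri R"
 shows "inj_on ((`) rl) (blk R e)" "(`) rl ` blk R e \<subseteq> blk A (rl ` e)" "finite (blk R e)"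
  "card (blk R e) <= card (blk A (rl ` e))"
proof -
 show 1: "inj_on ((`) rl) (blk R e)"
  using blk_bag(1)[OF assms] by (intro inj_on_subset[OF inj_rl_edges[of "bag e"]]) (auto simp: blk_def)
 show 2: "(`) rl ` blk R e \<subseteq> blk A (rl ` e)" using blk_bag(2)[OF assms] by auto
 have 3: "finite (blk A (rl ` e))" using fin_tri by (auto simp: blk_def)
 thus "finite (blk R e)" using 1 2 by (metis finite_imageD finite_subset)
 show "card (blk R e) <= card (blk A (rl ` e))" using card_inj_on_le[OF 1 2 3] .
qed

lemma Gm1_sub: "Gm1 \<subseteq> tri R" by (auto simp: Gm1_def gam_def)

text \<open>The block of \<open>e\<close> maps injectively under \<open>rl\<close> and meets no edge
  at \<open>w\<close>. If it landed in \<open>Bl\<close>, it would miss \<open>uw\<close> and have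
  fewer than \<open>kk\<close> edges.\<close>

lemma Gm1_rl:
 assumes e: "e : Gm1"
 shows "rl ` e : Gm0"
proof -
 have t: "e : tri R" and k: "kk <= card (blk R e)" using e by (auto simp: Gm1_def gam_def)
 note b = blk_rl[OF t]
 have "rl ` e : Gm" using k b(4) tri1(2)[OF t] by (auto simp: Gm_def gam_def)
 moreover have "rl ` e ~: Bl"
 proof
  assume m: "rl ` e : Bl"
  hence eq: "blk A (rl ` e) = Bl" using blk_eq[of "rl ` e" A "{u,v}"] tri_uvw unfolding Bl_def by auto
  have "{u,w} ~: (`) rl ` blk R e"
   using tri1(3) unfolding blk_def by blast
  hence "(`) rl ` blk R e \<subset> Bl" using b(2) eq Bl_uvw by auto
  hence "card ((`) rl ` blk R e) < card Bl" using fin_Bl by (intro psubset_card_mono)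
  thus False using k card_image[OF b(1)] by (simp add: kk_def)
 qed
 ultimately show ?thesis by (simp add: Gm0_def)
qed

lemma ph_tri: "e : tri A ==> ph ` e : tri R"
 unfolding tri_def using hom by blast

lemma inj_edges: "inj_on ((`) ph) (tri A)"
 by (rule inj_onI) (metis inj inj_on_image_eq_iff triV)

lemma cn_ph:
 assumes c: "cn S {a} e f" and e: "e : S" and S: "!!g. g : S ==> ph ` g : S'" "S \<subseteq> tri A"
  and a: "!!x. x : V ==> x ~= a ==> ph x ~: Z"
 shows "cn S' Z (ph ` e) (ph ` f)"
proof (rule cn_map[OF c e])
 fix g assume "cn S {a} e g" thus "ph ` g : S'" using cn_mem e S by blast
next
 fix g h assume "lk S {a} g h"
 then obtain x where "x : g" "x : h" "x ~= a" "x : V" using triV S by (auto simp: lk_def)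
 thus "\<exists>x. x : ph ` g & x : ph ` h & x ~: Z" using a by blast
qed

text \<open>Injectivity leaves at most one vertex over \<open>b\<close>; forbidding it in the source
  is enough to avoid \<open>b\<close> in the target.\<close>

lemma avoid: obtains a where "!!x. x : V ==> x ~= a ==> ph x ~= b"
 using inj by (metis inj_onD)

lemma ph_Gm: "e : Gm ==> ph ` e : Gm1"
proof -
 assume e: "e : Gm"
 hence t: "e : tri A" "kk <= card (blk A e)" by (auto simp: Gm_def gam_def)
 have "(`) ph ` blk A e \<subseteq> blk R (ph ` e)"
 proof safe
  fix f assume f: "f : blk A e"
  have "cn (tri R) {b} (ph ` e) (ph ` f)" for b
  proof -
   obtain a where a: "!!x. x : V ==> x ~= a ==> ph x ~= b" using avoid by metis
   show ?thesis using f t a ph_tri by (intro cn_ph[of "tri A" a]) (auto simp: blk_def)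
  qed
  thus "ph ` f : blk R (ph ` e)" using f ph_tri by (auto simp: blk_def)
 qed
 hence "card (blk A e) <= card (blk R (ph ` e))"
  using blk_rl(3)[OF ph_tri[OF t(1)]]
  by (intro card_inj_on_le[OF inj_on_subset[OF inj_edges]]) (auto simp: blk_def)
 thus ?thesis using t ph_tri by (auto simp: Gm1_def gam_def)
qed

lemma big_mem: "e : Ob ==> e : Gm & e : tri A"
 using Gm_sub by (auto simp: Ob_def big_def)

lemma cn_ph_Gm:
 assumes c: "cn Gm {} e f" and e: "e : Gm"
 shows "cn Gm1 {} (ph ` e) (ph ` f)"
proof (rule cn_map[OF c e])
 fix g assume "cn Gm {} e g" with e show "ph ` g : Gm1" using cn_mem ph_Gm by blast
qed (auto simp: lk_def)

text \<open>\<open>rl\<close> is injective on the edges of one bag, and the image of the branch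
  stays in one bag because it never passes through the hub.\<close>

lemma card_br_le:
 assumes f: "f : Gm" and a: "!!x. x : V ==> x ~= a ==> ph x ~= Hub"
  and m: "!!g. g : br Gm a f ==> rl ` ph ` g : M" and M: "finite M"
 shows "card (br Gm a f) <= card M"
proof (rule card_inj_on_le[OF _ _ M])
 show "(%g. rl ` ph ` g) ` br Gm a f \<subseteq> M" using m by auto
 have c: "cn Gm1 {Hub} (ph ` f) (ph ` g)" if "g : br Gm a f" for g
  using that a f ph_Gm Gm_sub by (intro cn_ph[of Gm a]) (auto simp: br_def)
 have "(`) ph ` br Gm a f \<subseteq> {e \<in> tri R. bag e = bag (ph ` f)}"
 proof (safe, goal_cases)
  case (1 g) thus ?case using ph_tri Gm_sub by (auto simp: br_def)
 next
  case (2 g) thus ?case using cn_bag[OF c[OF 2] Gm1_sub] by simp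
 qed
 hence "inj_on ((`) rl) ((`) ph ` br Gm a f)" using inj_on_subset[OF inj_rl_edges] by blast
 moreover have "inj_on ((`) ph) (br Gm a f)"
  using Gm_sub by (intro inj_on_subset[OF inj_edges]) (auto simp: br_def)
 ultimately show "inj_on (%g. rl ` ph ` g) (br Gm a f)"
  using comp_inj_on[of "(`) ph" "br Gm a f" "(`) rl"] by (simp add: comp_def)
qed

text \<open>Take the heavy branch that \<open>big\<close> grants at the vertex mapped to the hub. If
  the hub were reached, this branch would embed into a branch at \<open>u\<close> in
  \<open>Gm0\<close>, of weight at most \<open>mx Gm0 u\<close>.\<close>

lemma Ob_no_hub:
 assumes e: "e : Ob" and h: "Hub : h" and c: "cn Gm1 {} (ph ` e) h"
 shows False
proof -
 obtain a where a: "!!x. x : V ==> x ~= a ==> ph x ~= Hub" using avoid by metis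
 obtain f where f: "f : Gm" "cn Gm {} e f" "mx Gm0 u < card (br Gm a f)"
  using e unfolding Ob_def big_def by blast
 have f1: "ph ` f : Gm1" using f ph_Gm by auto
 have "cn Gm1 {} (ph ` f) h" using cn_ph_Gm[OF f(2)] big_mem[OF e] c by (meson cn_sym rtranclp_trans)
 then obtain h1 where h1: "h1 : Gm1" "Hub : h1" "cn Gm1 {Hub} (ph ` f) h1" using cn_first[OF _ h f1] by metis
 have "card (br Gm a f) <= card (br Gm0 u (rl ` h1))"
 proof (rule card_br_le[OF f(1) a])
  fix g assume g: "g : br Gm a f"
  have "cn Gm1 {Hub} (ph ` f) (ph ` g)"
   using g a f ph_Gm Gm_sub by (intro cn_ph[of Gm a]) (auto simp: br_def)
  hence "cn Gm1 {Hub} h1 (ph ` g)" using h1(3) by (meson cn_sym rtranclp_trans)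
  from cn_rl[OF this Gm1_sub h1(1) Gm1_rl] have "cn Gm0 {u,w} (rl ` h1) (rl ` ph ` g)" .
  hence "cn Gm0 {u} (rl ` h1) (rl ` ph ` g)" by (rule cn_mono) auto
  moreover have "rl ` ph ` g : Gm0" using g ph_Gm Gm1_rl by (auto simp: br_def)
  ultimately show "rl ` ph ` g : br Gm0 u (rl ` h1)" by (simp add: br_def)
 qed (use fin_Gm in \<open>auto simp: br_def\<close>)
 also have "\<dots> <= mx Gm0 u" using h1 by (intro mx_ge Gm1_rl) force+
 finally show False using f by simp
qed

text \<open>Away from the hub, everything connected to the image of \<open>e\<close> lies in one
  bag, so \<open>rl\<close> carries the heavy branches back into \<open>A\<close> without loss;
  \<open>Bl\<close> is avoided by \<open>Gm1_rl\<close>. Different edges may still go to different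
  bags, so this map alone need not be injective.\<close>

lemma Ob_rl:
 assumes e: "e : Ob"
 shows "rl ` ph ` e : Ob - Bl"
proof -
 let ?y = "bag (ph ` e)"
 have e0: "e : Gm" "ph ` e : Gm1" using big_mem[OF e] ph_Gm by auto
 have r: "rl ` ph ` e : Gm0" using e0 Gm1_rl by auto
 have hub: "cn Gm1 {Hub} (ph ` e) g" if "cn Gm1 {} (ph ` e) g" for g
 proof (rule cn_map[OF that e0(2), where F = "%x. x"])
  fix g' assume "cn Gm1 {} (ph ` e) g'" thus "g' : Gm1" using cn_mem e0 by blast
 next
  fix g' h assume c: "cn Gm1 {} (ph ` e) g'" and "lk Gm1 {} g' h"
  then obtain x where x: "x : g'" "x : h" by (auto simp: lk_def)
  hence "x ~= Hub" using Ob_no_hub[OF e _ c] by blast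
  thus "\<exists>x. x : g' & x : h & x ~: {Hub}" using x by blast
 qed
 have "\<exists>f\<in>Gm. cn Gm {} (rl ` ph ` e) f & mx Gm0 u < card (br Gm a f)" for a
 proof -
  obtain b where b: "!!x. x : V ==> x ~= b ==> ph x ~= Bag ?y a" using avoid by metis
  obtain f where f: "f : Gm" "cn Gm {} e f" "mx Gm0 u < card (br Gm b f)"
   using e unfolding Ob_def big_def by blast
  have c: "cn Gm1 {Hub} (ph ` e) (ph ` g)" if "cn Gm {} e g" for g
   using hub cn_ph_Gm[OF that e0(1)] by auto
  have eg: "cn Gm {} e g" if "cn Gm {b} f g" for g
   using f(2) cn_mono[OF that, of Gm "{}"] by (meson empty_subsetI order_refl rtranclp_trans)
  have "cn Gm0 {u,w} (rl ` ph ` e) (rl ` ph ` f)"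
   using cn_rl[OF c[OF f(2)] Gm1_sub e0(2) Gm1_rl] .
  hence 1: "cn Gm {} (rl ` ph ` e) (rl ` ph ` f)" by (rule cn_mono) (auto simp: Gm0_def)
  have rf: "rl ` ph ` g : Gm" if "g : Gm" for g
   using Gm1_rl[OF ph_Gm[OF that]] by (auto simp: Gm0_def)
  have hubfree: "Hub ~: ph ` g" "bag (ph ` g) = ?y" if "cn Gm {} e g" for g
   using Ob_no_hub[OF e, of "ph ` g"] cn_ph_Gm[OF that e0(1)] cn_bag[OF c[OF that] Gm1_sub] by auto
  have inj1: "inj_on (%g. rl ` ph ` g) (br Gm b f)"
  proof -
   have "(`) ph ` br Gm b f \<subseteq> {e \<in> tri R. bag e = ?y}"
    using hubfree(2)[OF eg] ph_tri Gm_sub by (auto simp: br_def)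
   hence "inj_on ((`) rl) ((`) ph ` br Gm b f)" using inj_on_subset[OF inj_rl_edges] by blast
   moreover have "inj_on ((`) ph) (br Gm b f)"
    using Gm_sub by (intro inj_on_subset[OF inj_edges]) (auto simp: br_def)
   ultimately show ?thesis using comp_inj_on[of "(`) ph" "br Gm b f" "(`) rl"] by (simp add: comp_def)
  qed
  have "(%g. rl ` ph ` g) ` br Gm b f \<subseteq> br Gm a (rl ` ph ` f)"
  proof safe
   fix g assume g: "g : br Gm b f"
   have "cn Gm {a} (rl ` ph ` f) (rl ` ph ` g)"
   proof (rule cn_map[OF _ f(1), where F = "%g. rl ` ph ` g"])
    show "cn Gm {b} f g" using g by (simp add: br_def)
   next
    fix g' assume "cn Gm {b} f g'" thus "rl ` ph ` g' : Gm" using cn_mem[OF _ f(1)] rf by blast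
   next
    fix g' h assume g': "cn Gm {b} f g'" and l: "lk Gm {b} g' h"
    then obtain x where x: "x : g'" "x : h" "x ~= b" "g' : Gm" by (auto simp: lk_def)
    hence "x : V" using triV Gm_sub by blast
    have nh: "ph x ~= Hub" using hubfree(1)[OF eg[OF g']] x(1) by (metis imageI)
    obtain m where m: "ph x = Bag (bag (ph ` g')) m"
     using bag_eq[of "ph ` g'" "ph x"] ph_tri Gm_sub x nh by blast
    hence "m ~= a" using b[OF \<open>x \<in> V\<close> x(3)] hubfree(2)[OF eg[OF g']] by auto
    thus "\<exists>x. x : rl ` ph ` g' & x : rl ` ph ` h & x ~: {a}"
     using x m by (intro exI[of _ m]) force
   qed
   thus "rl ` ph ` g : br Gm a (rl ` ph ` f)" using g rf by (auto simp: br_def)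
  qed
  hence "card (br Gm b f) <= card (br Gm a (rl ` ph ` f))"
   using fin_Gm by (intro card_inj_on_le[OF inj1]) (auto simp: br_def)
  thus ?thesis using f rf[OF f(1)] 1 by (intro bexI[of _ "rl ` ph ` f"]) auto
 qed
 thus ?thesis using r by (auto simp: Ob_def big_def Gm0_def)
qed

text \<open>\<open>profile z i\<close> counts the big edges within distance \<open>i\<close> of \<open>z\<close>. The image of a vertex with
  lexicographically maximal profile sees too few of them, because the triangle is missing and
  the other bags are further away than it was.\<close>

definition near :: "('c => 'c => bool) => nat => 'c => 'c set => bool" where
 "near Q i z e \<longleftrightarrow> (\<exists>x\<in>e. \<exists>n\<le>i. (Q ^^ n) z x)"

definition profile :: "'v => nat => nat" where
 "profile z i = card {e \<in> Ob. near A i z e}"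

definition lexless :: "'v => 'v => bool" where
 "lexless z z' \<longleftrightarrow> (\<exists>i. profile z i < profile z' i & (\<forall>j<i. profile z j = profile z' j))"

lemma fin_Ob: "finite Ob" using fin_tri big_mem by (metis finite_subset subsetI)

lemma lex_max: obtains z where "z : \<Union>Ob" "!!z'. z' : \<Union>Ob ==> \<not> lexless z z'"
proof -
 have "u : \<Union>Ob" using big_T[OF le, of "{u,w}"] by (auto simp: Ob_def)
 moreover have "finite (\<Union>Ob)" using fin_Ob big_mem triV finV by (meson finite_Union finite_subset)
 moreover have "transp_on (\<Union>Ob) lexless"
 proof (rule transp_onI)
  fix x y z assume "lexless x y" "lexless y z"
  then obtain i j where i: "profile x i < profile y i" "\<forall>k<i. profile x k = profile y k"
   and j: "profile y j < profile z j" "\<forall>k<j. profile y k = profile z k" unfolding lexless_def by auto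
  show "lexless x z" unfolding lexless_def
  proof (intro exI[of _ "min i j"] conjI)
   show "profile x (min i j) < profile z (min i j)"
    using i j by (cases i j rule: linorder_cases) (auto simp: min_def)
  qed (use i j in auto)
 qed
 moreover have "asymp_on (\<Union>Ob) lexless"
 proof (rule asymp_onI, rule notI)
  fix x y assume "lexless x y" "lexless y x"
  then obtain i j where i: "profile x i < profile y i" "\<forall>k<i. profile x k = profile y k"
   and j: "profile y j < profile x j" "\<forall>k<j. profile y k = profile x k" unfolding lexless_def by auto
  thus False by (cases i j rule: linorder_cases) auto
 qed
 ultimately obtain m where "m : \<Union>Ob" "\<forall>x\<in>\<Union>Ob. x ~= m --> \<not> lexless m x"
  using Finite_Set.bex_max_element[of "\<Union>Ob" lexless] by blast
 thus thesis using that by (metis lexless_def less_irrefl)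
qed

lemma relpow_ph: "(A ^^ n) x y ==> (R ^^ n) (ph x) (ph y)"
 by (induction n arbitrary: y) (auto intro: hom)

text \<open>The roles \<open>u\<close> and \<open>v\<close> are the only exits of a bag, and before
  time \<open>\<rho>\<close> the walk meets neither of them.\<close>

lemma walk_in_bag:
 assumes \<rho>: "!!n. n < \<rho> ==> \<not> (A ^^ n) z u & \<not> (A ^^ n) z v" and z: "z ~= u" "z ~= w"
 shows "n <= \<rho> ==> (R ^^ n) (Bag y z) q ==>
  (\<exists>m. q = Bag y m & m ~= w & (A ^^ n) z m) \<or> (q = Hub & (A ^^ n) z u)"
proof (induction n arbitrary: q)
 case 0 thus ?case using z by auto
next
 case (Suc n)
 then obtain q' where q': "(R ^^ n) (Bag y z) q'" "R q' q" by auto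
 then obtain m where m: "q' = Bag y m" "m ~= w" "(A ^^ n) z m" using Suc.IH[OF _ q'(1)] Suc.prems \<rho>[of n] by auto
 hence "m ~= v" "m ~= u" using \<rho>[of n] Suc.prems by auto
 thus ?case using m q' Asym by (cases q) auto
qed

end

context embedded
begin

theorem no_embedding: False
proof -
 obtain z0 where z0: "z0 : \<Union>Ob" "!!z'. z' : \<Union>Ob ==> \<not> lexless z0 z'" using lex_max by metis
 then obtain e0 where e0: "e0 : Ob" "z0 : e0" by auto
 define y where "y = bag (ph ` e0)"
 have nohub: "Hub ~: ph ` e" "ph ` e : tri R" if "e : Ob" for e
  using Ob_no_hub[OF that, of "ph ` e"] ph_tri big_mem[OF that] by auto
 obtain z where z: "ph z0 = Bag y z" "z ~= u" "z ~= w"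
 proof -
  have i: "ph z0 : ph ` e0" using e0(2) by (rule imageI)
  hence "ph z0 ~= Hub" using nohub(1)[OF e0(1)] by metis
  from bag_eq[OF nohub(2)[OF e0(1)] i this] show thesis using that unfolding y_def by blast
 qed
 have "z = rl (ph z0)" using z by simp
 hence "z : rl ` ph ` e0" using e0(2) by blast
 hence zO: "z : \<Union>Ob" using Ob_rl[OF e0(1)] by blast
 hence zV: "z : V" using big_mem triV by (meson UnionE subsetD)
 then obtain n0 where "(A ^^ n0) z u" using conn[OF zV inV(1)] by (metis rtranclp_imp_relpowp)
 hence ex: "\<exists>n. (A ^^ n) z u \<or> (A ^^ n) z v" by auto
 define \<rho> where "\<rho> = (LEAST n. (A ^^ n) z u \<or> (A ^^ n) z v)"
 have \<rho>1: "(A ^^ \<rho>) z u \<or> (A ^^ \<rho>) z v" unfolding \<rho>_def using ex by (rule LeastI_ex)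
 have \<rho>2: "n < \<rho> ==> \<not> (A ^^ n) z u & \<not> (A ^^ n) z v" for n unfolding \<rho>_def using not_less_Least by blast
 \<comment> \<open>Up to radius \<open>\<rho>\<close> all edges counted around \<open>z0\<close>
   have their images in the bag \<open>y\<close>, where \<open>rl\<close> is injective, and these
   images avoid \<open>Bl\<close>.\<close>
 have key: "profile z0 i <= card ({e \<in> Ob. near A i z e} - Bl)" if i: "i <= \<rho>" for i
 proof -
  let ?S = "{e \<in> Ob. near R i (ph z0) (ph ` e)}"
  have "profile z0 i <= card ?S"
   unfolding profile_def using fin_Ob relpow_ph by (intro card_mono) (auto simp: near_def, blast)
  also have "\<dots> <= card ({e \<in> Ob. near A i z e} - Bl)"
  proof (rule card_inj_on_le[where f = "%e. rl ` ph ` e"])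
   have in_bag: "\<exists>m. Bag y m : ph ` e & bag (ph ` e) = y & (\<exists>n\<le>i. (A ^^ n) z m)" if e: "e : ?S" for e
   proof -
    obtain q n where q: "q : ph ` e" "n <= i" "(R ^^ n) (Bag y z) q" using e z by (auto simp: near_def)
    have eO: "e : Ob" using e by simp
    have "q ~= Hub" using nohub(1)[OF eO] q(1) by metis
    then obtain m where m: "q = Bag y m" "(A ^^ n) z m" using walk_in_bag[of \<rho> z n y q, OF \<rho>2 z(2,3) _ q(3)] q(2) i by auto
    have "bag (ph ` e) = y" using bag_eq[OF nohub(2)[OF eO] q(1)] m by auto
    thus ?thesis using m q(1,2) by blast
   qed
   have "(`) ph ` ?S \<subseteq> {e \<in> tri R. bag e = y}" using in_bag nohub by blast
   hence "inj_on ((`) rl) ((`) ph ` ?S)" using inj_on_subset[OF inj_rl_edges] by blast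
   moreover have "inj_on ((`) ph) ?S" using big_mem by (intro inj_on_subset[OF inj_edges]) blast
   ultimately show "inj_on (%e. rl ` ph ` e) ?S"
    using comp_inj_on[of "(`) ph" ?S "(`) rl"] by (simp add: comp_def)
   show "(%e. rl ` ph ` e) ` ?S \<subseteq> {e \<in> Ob. near A i z e} - Bl"
   proof (rule image_subsetI)
    fix e assume e: "e : ?S"
    obtain m n where m: "Bag y m : ph ` e" "n <= i" "(A ^^ n) z m" using in_bag[OF e] by blast
    hence "rl (Bag y m) : rl ` ph ` e" by (intro imageI)
    hence "m : rl ` ph ` e" by simp
    hence "near A i z (rl ` ph ` e)" using m by (auto simp: near_def)
    thus "rl ` ph ` e : {e \<in> Ob. near A i z e} - Bl" using Ob_rl[of e] e by simp
   qed
  next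
   show "finite ({e \<in> Ob. near A i z e} - Bl)" using fin_Ob by (intro finite_Diff) simp
  qed
  finally show ?thesis .
 qed
 have 1: "profile z0 i <= profile z i" if "i <= \<rho>" for i
  proof -
  have "card ({e \<in> Ob. near A i z e} - Bl) <= profile z i"
   unfolding profile_def using fin_Ob by (intro card_mono Diff_subset) simp
  thus ?thesis using key[OF that] by (rule le_trans[rotated])
 qed
 \<comment> \<open>At radius \<open>\<rho>\<close> the edge \<open>uw\<close> or \<open>vw\<close>
   comes into the view of \<open>z\<close>. It is big but belongs to \<open>Bl\<close>, so it is not
   among the images.\<close>
 have 2: "profile z0 \<rho> < profile z \<rho>"
 proof -
  obtain e where e: "e : Ob" "e : Bl" "near A \<rho> z e"
  proof (cases "(A ^^ \<rho>) z u")
   case True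
   thus ?thesis using that[of "{u,w}"] big_T[OF le, of "{u,w}"] Bl_uvw by (auto simp: Ob_def near_def)
  next
   case False
   thus ?thesis using that[of "{v,w}"] big_T[OF le, of "{v,w}"] Bl_uvw \<rho>1 by (auto simp: Ob_def near_def)
  qed
  hence "{e \<in> Ob. near A \<rho> z e} - Bl \<subset> {e \<in> Ob. near A \<rho> z e}" by auto
  hence "card ({e \<in> Ob. near A \<rho> z e} - Bl) < profile z \<rho>"
   unfolding profile_def using fin_Ob by (intro psubset_card_mono) auto
  thus ?thesis using key[of \<rho>] by simp
 qed
 define i where "i = (LEAST i. profile z0 i < profile z i)"
 have i: "profile z0 i < profile z i" unfolding i_def using 2 by (rule LeastI)
 have "i <= \<rho>" unfolding i_def using 2 by (rule Least_le)
 moreover have "\<not> profile z0 j < profile z j" if "j < i" for j using that not_less_Least unfolding i_def by blast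
 ultimately have "lexless z0 z" unfolding lexless_def using i 1 by (intro exI[of _ i]) (metis le_neq_implies_less less_imp_le less_le_trans nat_less_le)
 thus False using z0 zO by auto
qed

end

section \<open>Copies and subdivisions\<close>

definition copy :: "('a => 'b) => 'a pair_pre_digraph => 'b pair_pre_digraph => bool" where
 "copy ph H G \<longleftrightarrow> inj_on ph (pverts H) & ph ` pverts H \<subseteq> pverts G &
   (\<forall>x\<in>pverts H. \<forall>y\<in>pverts H. (ph x,ph y) : parcs G \<longleftrightarrow> (x,y) : parcs H)"

lemma pair_graph_facts:
 assumes "pair_graph G"
 shows "finite (pverts G)" "(x,y) : parcs G ==> x : pverts G & y : pverts G"
  "(x,y) : parcs G ==> (y,x) : parcs G" "(x,x) ~: parcs G"
proof -
 interpret pair_graph G by (rule assms)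
 show "finite (pverts G)" by (rule pair_finite_verts)
 show "(x,y) : parcs G ==> x : pverts G & y : pverts G" using arc_fst_in_verts arc_snd_in_verts by fastforce
 show "(x,y) : parcs G ==> (y,x) : parcs G" by (rule arcs_symmetric)
 show "(x,x) ~: parcs G" using pair_no_loops[of "(x,x)"] by auto
qed

lemma induced_free_copy:
 assumes H: "pair_graph H" and G: "pair_graph G"
 shows "induced_free H G \<longleftrightarrow> \<not> (\<exists>ph. copy ph H G)"
proof
 assume free: "induced_free H G"
 show "\<not> (\<exists>ph. copy ph H G)"
 proof
  assume "\<exists>ph. copy ph H G"
  then obtain ph where c: "inj_on ph (pverts H)" "ph ` pverts H \<subseteq> pverts G"
   "!!x y. x : pverts H ==> y : pverts H ==> (ph x,ph y) : parcs G \<longleftrightarrow> (x,y) : parcs H"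
   unfolding copy_def by blast
  let ?W = "ph ` pverts H"
  define F where "F = \<lparr>verts = ?W,arcs = {e \<in> parcs G. fst e : ?W & snd e : ?W},tail = fst,head = snd\<rparr>"
  have wfG: "wf_digraph (with_proj G)" using G pair_graph_facts(2)[OF G] by unfold_locales auto
  have wfF: "wf_digraph F" by unfold_locales (auto simp: F_def)
  have sub: "induced_subgraph F (with_proj G)"
   using wfG wfF c(2) by (auto simp: induced_subgraph_def subgraph_def compatible_def F_def)
  define g where "g = inv_into (pverts H) ph"
  have g: "g (ph x) = x" if "x : pverts H" for x using that c(1) by (simp add: g_def)
  define f where "f = \<lparr>iso_verts = g,iso_arcs = map_prod g g,iso_head = snd,iso_tail = fst\<rparr>"
  have injg: "inj_on g ?W" by (auto simp: inj_on_def g)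
  have "pre_digraph.digraph_isomorphism F f"
   unfolding pre_digraph.digraph_isomorphism_def
  proof (intro conjI)
   show "wf_digraph F" by (rule wfF)
   show "inj_on (iso_verts f) (verts F)" using injg by (simp add: f_def F_def)
   show "inj_on (iso_arcs f) (arcs F)"
    unfolding inj_on_def
   proof (intro ballI impI)
    fix a b assume "a : arcs F" "b : arcs F" "iso_arcs f a = iso_arcs f b"
    thus "a = b" using injg by (simp add: f_def F_def prod_eq_iff inj_on_eq_iff)
   qed
   show "\<forall>a\<in>arcs F. iso_verts f (tail F a) = iso_tail f (iso_arcs f a) & iso_verts f (head F a) = iso_head f (iso_arcs f a)"
    by (auto simp: f_def F_def)
  qed
  moreover have "with_proj H = app_iso f F"
  proof -
   have "g ` ?W = pverts H" using g by force
   moreover have "map_prod g g ` {e \<in> parcs G. fst e : ?W & snd e : ?W} = parcs H"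
   proof (intro equalityI subsetI)
    fix e assume "e : map_prod g g ` {e \<in> parcs G. fst e : ?W & snd e : ?W}"
    then obtain x y where "x : pverts H" "y : pverts H" "(ph x,ph y) : parcs G" "e = (g (ph x),g (ph y))" by auto
    thus "e : parcs H" using g c(3) by simp
   next
    fix e assume "e : parcs H"
    then obtain x y where e: "e = (x,y)" "x : pverts H" "y : pverts H" "(x,y) : parcs H"
     using pair_graph_facts(2)[OF H] by (cases e) auto
    thus "e : map_prod g g ` {e \<in> parcs G. fst e : ?W & snd e : ?W}"
     using c(3) g by (intro image_eqI[of _ _ "(ph x,ph y)"]) auto
   qed
   ultimately show ?thesis by (simp add: app_iso_def f_def F_def with_proj_def)
  qed
  ultimately show False using free sub unfolding induced_free_def digraph_iso_def by blast
 qed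
next
 assume nc: "\<not> (\<exists>ph. copy ph H G)"
 show "induced_free H G" unfolding induced_free_def
 proof
  assume "\<exists>F. induced_subgraph F (with_proj G) & digraph_iso F (with_proj H)"
  then obtain F f where F: "induced_subgraph F (with_proj G)" and f: "pre_digraph.digraph_isomorphism F f"
   and Hf: "with_proj H = app_iso f F" unfolding digraph_iso_def by blast
  define g where "g = iso_verts f"
  have sub: "verts F \<subseteq> pverts G" "arcs F = {e \<in> parcs G. fst e : verts F & snd e : verts F}" "tail F = fst" "head F = snd"
   using F by (auto simp: induced_subgraph_def subgraph_def compatible_def)
  have HV: "pverts H = g ` verts F" "parcs H = iso_arcs f ` arcs F" "iso_tail f = fst" "iso_head f = snd"
   using Hf by (auto simp: app_iso_def with_proj_def g_def)
  have ia: "iso_arcs f a = (g (fst a),g (snd a))" if "a : arcs F" for a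
   using f that HV(3,4) sub(3,4) unfolding pre_digraph.digraph_isomorphism_def g_def
   by (metis prod.collapse)
  have injg: "inj_on g (verts F)" using f unfolding pre_digraph.digraph_isomorphism_def g_def by blast
  define ph where "ph = inv_into (verts F) g"
  have ph: "ph (g x) = x" if "x : verts F" for x using that injg by (simp add: ph_def)
  have "copy ph H G" unfolding copy_def
  proof (intro conjI ballI)
   show "inj_on ph (pverts H)" unfolding HV by (auto simp: inj_on_def ph)
   show "ph ` pverts H \<subseteq> pverts G" unfolding HV using sub ph by auto
   fix x y assume "x : pverts H" "y : pverts H"
   then obtain a b where ab: "x = g a" "y = g b" "a : verts F" "b : verts F" unfolding HV by auto
   show "(ph x,ph y) : parcs G \<longleftrightarrow> (x,y) : parcs H"
   proof
    assume "(ph x,ph y) : parcs G"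
    hence "(a,b) : arcs F" using ab ph sub by simp
    thus "(x,y) : parcs H" unfolding HV using ia ab by (metis fst_conv image_eqI snd_conv)
   next
    assume "(x,y) : parcs H"
    then obtain e where e: "e : arcs F" "(x,y) = (g (fst e),g (snd e))" unfolding HV using ia by auto
    have m: "fst e : verts F" "snd e : verts F" using e(1) unfolding sub(2) by auto
    have "g (fst e) = g a" "g (snd e) = g b" using e(2) unfolding ab(1,2) by simp_all
    hence "fst e = a" "snd e = b" using inj_onD[OF injg _ m(1) ab(3)] inj_onD[OF injg _ m(2) ab(4)] by blast+
    hence "e = (a,b)" by (simp add: prod_eq_iff)
    hence "(a,b) : parcs G" using e(1) unfolding sub(2) by simp
    thus "(ph x,ph y) : parcs G" by (simp only: ab(1,2) ph[OF ab(3)] ph[OF ab(4)])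
   qed
  qed
  thus False using nc by blast
 qed
qed

lemma edge_subdivision_graph: "pair_graph G ==> edge_subdivision G G' ==> pair_graph G'"
 unfolding edge_subdivision_def by (elim exE conjE) (simp add: pair_graph.pair_graph_subdivide)

lemma subdivisions_graph: "pair_graph G ==> (edge_subdivision ^^ j) G G' ==> pair_graph G'"
proof (induction j arbitrary: G')
 case (Suc j)
 then obtain G1 where "(edge_subdivision ^^ j) G G1" "edge_subdivision G1 G'" by (auto elim: relpowp_Suc_E)
 thus ?case using Suc edge_subdivision_graph by blast
qed simp

text \<open>A subdivision destroys one edge and never joins two old vertices. Hence at most
  \<open>j\<close> pairs of original vertices lose their edge, whatever happens to new
  edges.\<close>

lemma subdivisions_survive:
 assumes "pair_graph G" "(edge_subdivision ^^ j) G G'"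
 shows "pverts G \<subseteq> pverts G' & (\<exists>F. finite F & card F <= j &
   (\<forall>x\<in>pverts G. \<forall>y\<in>pverts G. (x,y) : parcs G' \<longleftrightarrow> (x,y) : parcs G & {x,y} ~: F))"
 using assms(2)
proof (induction j arbitrary: G')
 case 0 thus ?case by (intro conjI exI[of _ "{}"]) auto
next
 case (Suc j)
 then obtain G1 where G1: "(edge_subdivision ^^ j) G G1" "edge_subdivision G1 G'" by auto
 then obtain F where F: "finite F" "card F <= j" "pverts G \<subseteq> pverts G1"
  "!!x y. x : pverts G ==> y : pverts G ==> (x,y) : parcs G1 \<longleftrightarrow> (x,y) : parcs G & {x,y} ~: F"
  using Suc.IH[OF G1(1)] by blast
 obtain a b w where s: "(a,b) : parcs G1" "w ~: pverts G1" "G' = subdivide G1 (a,b) w"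
  using G1(2) unfolding edge_subdivision_def by blast
 have "(x,y) : parcs G' \<longleftrightarrow> (x,y) : parcs G & {x,y} ~: insert {a,b} F"
  if "x : pverts G" "y : pverts G" for x y
 proof -
  have "x ~= w" "y ~= w" using that F(3) s(2) by auto
  thus ?thesis using F(4)[OF that] s(3) by (auto simp: doubleton_eq_iff)
 qed
 moreover have "card (insert {a,b} F) <= Suc j" using F(1,2) by (simp add: card_insert_if)
 moreover have "pverts G \<subseteq> pverts G'" using F(3) s(3) by auto
 ultimately show ?case using F(1) by (intro conjI exI[of _ "insert {a,b} F"]) auto
qed

text \<open>The orbit of \<open>c\<close> repeats but never returns to \<open>c\<close>, which has
  no preimage; so it is a tail running into a cycle. The entry point of the cycle has two
  predecessors in the orbit, and for the one on the cycle equality holds because \<open>r\<close> is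
  constant there.\<close>

lemma fixpoint_collision:
 assumes "finite S" "c : S" "!!x. x : S ==> sg x : S" "!!x. x : S ==> sg x ~= c"
  and r: "!!x. x : S ==> r x <= (r (sg x) :: nat)"
 shows "\<exists>x\<in>S. \<exists>y\<in>S. x ~= y & sg x = sg y & r x = r (sg x)"
proof -
 define q where "q n = (sg ^^ n) c" for n
 have qS: "q n : S" for n unfolding q_def by (induction n) (auto simp: assms)
 have qm: "m <= n ==> r (q m) <= r (q n)" for m n
 proof (induction n)
  case (Suc n)
  thus ?case using r[OF qS[of n]] by (cases "m = Suc n") (auto simp: q_def)
 qed simp
 have "\<not> inj q" using finite_subset[of "range q" S] qS assms(1) finite_imageD[of q UNIV] by auto
 then obtain m n where "m < n" "q m = q n" unfolding inj_def by (metis nat_neq_iff)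
 hence ex: "\<exists>n. \<exists>m<n. q m = q n" by blast
 define n where "n = (LEAST n. \<exists>m<n. q m = q n)"
 obtain m where m: "m < n" "q m = q n" using LeastI_ex[OF ex] unfolding n_def by blast
 have min: "m' < n' ==> n' < n ==> q m' ~= q n'" for m' n' using not_less_Least unfolding n_def by blast
 obtain n0 where n0: "n = Suc n0" using m by (cases n) auto
 have "m ~= 0"
 proof
  assume "m = 0"
  hence "sg (q n0) = c" using m by (simp add: q_def n0)
  thus False using assms(4)[OF qS] by blast
 qed
 then obtain m0 where m0: "m = Suc m0" by (cases m) auto
 have s: "sg (q n0) = q n" "sg (q m0) = q m" by (simp_all add: q_def n0 m0)
 have "r (q n0) = r (sg (q n0))"
  using r[OF qS[of n0]] qm[of m n0] m n0 s by simp
 moreover have "q m0 ~= q n0" using min m0 n0 m by auto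
 ultimately show ?thesis using qS s m by (intro bexI[of _ "q n0"] bexI[of _ "q m0"]) auto
qed

section \<open>The reduction graph\<close>

locale target = tri_graph C "%x y. x : C & A x y" u v w
 for V C :: "'v set" and A :: "'v => 'v => bool" and u v w :: 'v +
 assumes le: "mx Gm0 u <= mx Gm0 v"
  and VA: "A x y ==> x : V & y : V" and Vfin: "finite V" and VAsym: "A x y ==> A y x" and CV: "C \<subseteq> V"
begin

abbreviation comp :: "'v => 'v set" where "comp x \<equiv> {y. A\<^sup>*\<^sup>* x y}"

text \<open>Marks the components that contain an induced copy of \<open>C\<close> and could
  therefore host the triangle's component away from the hub.\<close>

definition rich :: "'v => bool" where
 "rich x \<longleftrightarrow> x : V & (\<exists>tht. inj_on tht C & (\<forall>c\<in>C. A\<^sup>*\<^sup>* x (tht c)) & (\<forall>c\<in>C. \<forall>d\<in>C. A (tht c) (tht d) \<longleftrightarrow> A c d))"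

definition W :: "'v set" where "W = {x. x ~: C & rich x}"

text \<open>The layers of a component in \<open>W\<close> are joined like twins: every layer is
  still an induced copy, but all of them together form a single component. The remaining components
  are repeated disjointly.\<close>

fun gadj :: "('y => 'y => bool) => 'y set => ('y,'v) gv + 'v * nat => ('y,'v) gv + 'v * nat => bool" where
 "gadj B X (Inl p) (Inl q) \<longleftrightarrow> adj B X p q"
| "gadj B X (Inr (s,i)) (Inr (t,j)) \<longleftrightarrow> A s t & (s : W \<or> i = j)"
| "gadj B X _ _ \<longleftrightarrow> False"

definition gverts :: "'y set => 'y set => nat => (('y,'v) gv + 'v * nat) set" where
 "gverts Y X k = Inl ` (insert Hub ((%(y,m). Bag y m) ` (Y \<times> (C - {u,w})) \<union> Sub ` X)) \<union> Inr ` ((V - C) \<times> {..k})"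

definition labelled :: "('y => 'y => bool) => 'y set => 'y set => nat => nat pair_pre_digraph => (nat => ('y,'v) gv + 'v * nat) => bool" where
 "labelled B X Y k G lab \<longleftrightarrow> bij_betw lab (pverts G) (gverts Y X k) &
   (\<forall>i\<in>pverts G. \<forall>j\<in>pverts G. (i,j) : parcs G \<longleftrightarrow> gadj B X (lab i) (lab j))"

lemma Ccl: "A x y ==> x : C ==> y : C" using AV by blast

lemma adj_insert:
 "y ~: X ==> p ~= Sub y ==> q ~= Sub y ==>
   adj B (insert y X) p q \<longleftrightarrow> adj B X p q & \<not> (p = Hub & q = Bag y v \<or> p = Bag y v & q = Hub)"
 "adj B (insert y X) (Sub y) q \<longleftrightarrow> q = Hub \<or> q = Bag y v"
 "adj B (insert y X) q (Sub y) \<longleftrightarrow> q = Hub \<or> q = Bag y v"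
 using neq by (cases p; cases q; auto) (cases q; auto)+

lemma gadj_insert:
 assumes "y ~: X"
 shows "p ~= Inl (Sub y) ==> q ~= Inl (Sub y) ==> gadj B (insert y X) p q \<longleftrightarrow> gadj B X p q &
    \<not> (p = Inl Hub & q = Inl (Bag y v) \<or> p = Inl (Bag y v) & q = Inl Hub)"
  "gadj B (insert y X) (Inl (Sub y)) q \<longleftrightarrow> q = Inl Hub \<or> q = Inl (Bag y v)"
  "gadj B (insert y X) q (Inl (Sub y)) \<longleftrightarrow> q = Inl Hub \<or> q = Inl (Bag y v)"
 subgoal by (cases p; cases q) (auto simp: adj_insert(1)[OF assms])
 subgoal by (cases q) (auto simp: adj_insert)
 subgoal by (cases q) (auto simp: adj_insert)
 done

text \<open>Moving \<open>y\<close> into \<open>X\<close> is realised by subdividing the edge from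
  the hub to \<open>Bag y v\<close>; the new vertex gets the label \<open>Sub y\<close>.\<close>

lemma subdivide_labelled:
 assumes G: "pair_graph G" and l: "labelled B X Y k G lab" and y: "y : Y" "y ~: X"
 shows "\<exists>G' lab'. edge_subdivision G G' & labelled B (insert y X) Y k G' lab'"
proof -
 note b = l[unfolded labelled_def, THEN conjunct1] and e = l[unfolded labelled_def, THEN conjunct2, rule_format]
 have vC: "v : C - {u,w}" using inV neq by auto
 have "Inl Hub : gverts Y X k" "Inl (Bag y v) : gverts Y X k" using y vC by (auto simp: gverts_def)
 then obtain h a where h: "h : pverts G" "lab h = Inl Hub" and a: "a : pverts G" "lab a = Inl (Bag y v)"
  unfolding bij_betw_imp_surj_on[OF b, symmetric] by (elim imageE) metis
 have inj: "i : pverts G ==> j : pverts G ==> lab i = lab j \<longleftrightarrow> i = j" for i j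
  using b unfolding bij_betw_def inj_on_def by blast
 have ha: "(h,a) : parcs G" using e[OF h(1) a(1)] h a y uv neq inV by simp
 obtain z where z: "z ~: pverts G" using pair_graph_facts(1)[OF G] ex_new_if_finite[OF infinite_UNIV_nat] by blast
 define G' where "G' = subdivide G (h,a) z"
 define lab' where "lab' = lab(z := Inl (Sub y))"
 have nS: "Inl (Sub y) ~: gverts Y X k" using y by (auto simp: gverts_def)
 have nS': "lab i ~= Inl (Sub y)" if "i : pverts G" for i using that nS b by (metis bij_betwE)
 have old: "lab' i = lab i" if "i : pverts G" for i using that z by (auto simp: lab'_def)
 have gv: "gverts Y (insert y X) k = insert (Inl (Sub y)) (gverts Y X k)" by (auto simp: gverts_def)
 have "labelled B (insert y X) Y k G' lab'"
  unfolding labelled_def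
 proof (intro conjI ballI)
  have "bij_betw lab' (pverts G) (gverts Y X k)" using b old by (simp cong: bij_betw_cong)
  thus "bij_betw lab' (pverts G') (gverts Y (insert y X) k)"
   using notIn_Un_bij_betw[of z "pverts G" lab' "gverts Y X k"] z nS by (simp add: gv G'_def lab'_def)
  fix i j assume ij: "i : pverts G'" "j : pverts G'"
  have two: "gadj B (insert y X) (Inl (Sub y)) (lab i) \<longleftrightarrow> i = h \<or> i = a"
   "gadj B (insert y X) (lab i) (Inl (Sub y)) \<longleftrightarrow> i = h \<or> i = a" if "i : pverts G" for i
   using gadj_insert(2,3)[OF y(2)] inj[OF that h(1)] inj[OF that a(1)] h a by auto
  have nz: "h ~= z" "a ~= z" using z h a by auto
  show "(i,j) : parcs G' \<longleftrightarrow> gadj B (insert y X) (lab' i) (lab' j)"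
  proof (cases "i = z")
   case iz: True
   show ?thesis
   proof (cases "j = z")
    case True
    thus ?thesis using iz nz z pair_graph_facts(2)[OF G] by (auto simp: G'_def lab'_def adj_insert)
   next
    case False
    hence "j : pverts G" using ij by (auto simp: G'_def)
    thus ?thesis using iz nz z False pair_graph_facts(2)[OF G] two[of j] by (auto simp: G'_def lab'_def)
   qed
  next
   case iz: False
   hence i: "i : pverts G" using ij by (auto simp: G'_def)
   show ?thesis
   proof (cases "j = z")
    case True
    thus ?thesis using iz i nz z pair_graph_facts(2)[OF G] two[of i] by (auto simp: G'_def lab'_def)
   next
    case False
    hence j: "j : pverts G" using ij by (auto simp: G'_def)
    have "(i,j) : parcs G' \<longleftrightarrow> (i,j) : parcs G & \<not> (i = h & j = a \<or> i = a & j = h)"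
     using iz False by (auto simp: G'_def)
    thus ?thesis unfolding old[OF i] old[OF j] gadj_insert(1)[OF y(2) nS'[OF i] nS'[OF j]]
     using e[OF i j] inj[OF i h(1)] inj[OF i a(1)] inj[OF j h(1)] inj[OF j a(1)] h a by auto
   qed
  qed
 qed
 moreover have "edge_subdivision G G'" unfolding edge_subdivision_def G'_def using ha z by blast
 ultimately show ?thesis by blast
qed

lemma subdivide_cover:
 assumes "finite X" "X \<subseteq> Y" and G: "pair_graph G" and l: "labelled B {} Y k G lab"
 shows "\<exists>G' lab'. (edge_subdivision ^^ card X) G G' & labelled B X Y k G' lab'"
 using assms(1,2)
proof induction
 case empty thus ?case using l by auto
next
 case (insert y X)
 then obtain G1 lab1 where 1: "(edge_subdivision ^^ card X) G G1" "labelled B X Y k G1 lab1" by auto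
 obtain G2 lab2 where 2: "edge_subdivision G1 G2" "labelled B (insert y X) Y k G2 lab2"
  using subdivide_labelled[OF subdivisions_graph[OF G 1(1)] 1(2), of y] insert by auto
 have "(edge_subdivision ^^ card (insert y X)) G G2" using insert 1 2 by auto
 thus ?case using 2 by blast
qed

lemma inl_no_copy:
 assumes "!!p q. B p q ==> B q p" "!!p q r. B p q ==> B q r ==> \<not> B p r" "!!p q. B p q ==> p : X \<or> q : X"
  and "inj_on tht C" "!!c d. c : C ==> A c d ==> adj B X (tht c) (tht d)"
 shows False
proof -
 interpret embedded C "%x y. x : C & A x y" u v w B X tht
  by unfold_locales (erule assms(1) | erule (1) assms(2) | erule assms(3) | rule assms(4)
   | (elim conjE, erule (1) assms(5)) | rule le)+
 show False by (rule no_embedding)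
qed

lemma reach_sym: "A\<^sup>*\<^sup>* x y ==> A\<^sup>*\<^sup>* y x"
 by (induction rule: rtranclp_induct) (auto intro: converse_rtranclp_into_rtranclp VAsym)

lemma comp_eq: "A\<^sup>*\<^sup>* x y ==> comp x = comp y"
 using rtranclp_trans[of A] reach_sym by blast

lemma reach_C: "A\<^sup>*\<^sup>* x y ==> x : C ==> y : C"
 by (induction rule: rtranclp_induct) (auto intro: Ccl)

lemma reach_V: "A\<^sup>*\<^sup>* x y ==> x : V ==> y : V"
 by (induction rule: rtranclp_induct) (auto dest: VA)

lemma rich_reach: "rich x ==> A\<^sup>*\<^sup>* x y ==> rich y"
proof -
 assume r: "rich x" and xy: "A\<^sup>*\<^sup>* x y"
 then obtain tht where "x : V" "inj_on tht C" "\<forall>c\<in>C. A\<^sup>*\<^sup>* x (tht c)" "\<forall>c\<in>C. \<forall>d\<in>C. A (tht c) (tht d) \<longleftrightarrow> A c d"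
  unfolding rich_def by blast
 thus "rich y" unfolding rich_def using reach_V[OF xy] rtranclp_trans[OF reach_sym[OF xy]]
  by (intro conjI exI[of _ tht]) simp_all
qed

lemma rich_C: "x : C ==> rich x"
proof -
 assume x: "x : C"
 have "A\<^sup>*\<^sup>* x c" if "c : C" for c
  using conn[OF x that] by (rule rtranclp_mono[THEN predicate2D, rotated]) auto
 thus ?thesis using x CV unfolding rich_def by (intro conjI exI[of _ "%c. c"]) auto
qed

lemma W_step: "A s t ==> s : W \<longleftrightarrow> t : W"
 using rich_reach[of s t] rich_reach[of t s] VAsym[of s t] Ccl[of s t] Ccl[of t s] by (auto simp: W_def)

end

context target
begin

text \<open>The rich components of \<open>H\<close> can go only into blow-ups of components in
  \<open>W\<close>, and these are fewer since \<open>C\<close> is rich but not in \<open>W\<close>.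
  Hence two of them share a blow-up; one can be chosen to meet every neighbourhood class there, and
  then it would be adjacent to the other.\<close>

lemma no_copy:
 fixes f :: "'v => ('y,'v) gv + 'v * nat"
 assumes B: "!!p q. B p q ==> B q p" "!!p q r. B p q ==> B q r ==> \<not> B p r" "!!p q. B p q ==> p : X \<or> q : X"
  and inj: "inj_on f V" and gv: "!!x. x : V ==> f x : gverts Y X k"
  and ad: "!!x y. x : V ==> y : V ==> gadj B X (f x) (f y) \<longleftrightarrow> A x y"
 shows False
proof -
 have st: "\<exists>s i. f y = Inr (s,i) & A\<^sup>*\<^sup>* s0 s & (s0 ~: W --> i = i0)"
  if x: "x : V" "f x = Inr (s0,i0)" and xy: "A\<^sup>*\<^sup>* x y" for x y s0 i0
  using xy
 proof (induction rule: rtranclp_induct)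
  case base thus ?case using x by auto
 next
  case (step y z)
  then obtain s i where s: "f y = Inr (s,i)" "A\<^sup>*\<^sup>* s0 s" "s0 ~: W --> i = i0" by auto
  have yz: "y : V" "z : V" using VA[OF step(2)] by auto
  have g: "gadj B X (f y) (f z)" using ad[OF yz] step(2) by simp
  then obtain t j where t: "f z = Inr (t,j)" "A s t" "s : W \<or> i = j" using s(1) by (cases "f z") auto
  have "s0 ~: W --> s ~: W" using s(2) by (induction rule: rtranclp_induct) (auto dest: W_step)
  thus ?case using s t by (auto intro: rtranclp.rtrancl_into_rtrancl)
 qed
 have stl: "\<exists>p. f y = Inl p" if x: "x : V" "f x = Inl p0" and xy: "A\<^sup>*\<^sup>* x y" for x y p0
 proof (rule ccontr)
  assume "\<nexists>p. f y = Inl p"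
  then obtain s i where "f y = Inr (s,i)" by (cases "f y") auto
  from st[OF reach_V[OF xy x(1)] this reach_sym[OF xy]] show False using x by auto
 qed
 \<comment> \<open>In the part around the hub, a rich component would give an embedding excluded by
   \<open>inl_no_copy\<close>. Among the copies of a component outside \<open>W\<close> it would
   stay in one layer and make that component rich.\<close>
 have rich_W: "\<exists>s i. f x = Inr (s,i) & s : W" if r: "rich x" for x
 proof -
  have x: "x : V" using r by (simp add: rich_def)
  obtain tht where tht: "inj_on tht C" "!!c. c : C ==> A\<^sup>*\<^sup>* x (tht c)"
   "!!c d. c : C ==> d : C ==> A (tht c) (tht d) \<longleftrightarrow> A c d" using r unfolding rich_def by blast
  have thtV: "tht c : V" if "c : C" for c using reach_V[OF tht(2)[OF that] x] .
  have injtht: "f (tht c) = f (tht d) ==> c : C ==> d : C ==> c = d" for c d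
   using inj tht(1) thtV by (auto simp: inj_on_def)
  have "\<not> (\<exists>p. f x = Inl p)"
  proof
   assume "\<exists>p. f x = Inl p"
   hence l: "\<exists>p. f (tht c) = Inl p" if "c : C" for c using stl[OF x _ tht(2)[OF that]] by blast
   show False
   proof (rule inl_no_copy[where tht = "%c. projl (f (tht c))", OF B])
    show "inj_on (%c. projl (f (tht c))) C"
    proof (rule inj_onI)
     fix c d assume cd: "c : C" "d : C" and e: "projl (f (tht c)) = projl (f (tht d))"
     obtain p q where "f (tht c) = Inl p" "f (tht d) = Inl q" using l[OF cd(1)] l[OF cd(2)] by blast
     hence "f (tht c) = f (tht d)" using e by simp
     thus "c = d" by (rule injtht[OF _ cd])
    qed
    fix c d assume cd: "c : C" "A c d"
    hence d: "d : C" using Ccl by blast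
    obtain p q where pq: "f (tht c) = Inl p" "f (tht d) = Inl q" using l[OF cd(1)] l[OF d] by blast
    have "gadj B X (f (tht c)) (f (tht d))" using ad[OF thtV[OF cd(1)] thtV[OF d]] tht(3)[OF cd(1) d] cd(2) by simp
    thus "adj B X (projl (f (tht c))) (projl (f (tht d)))" by (simp add: pq)
   qed
  qed
  then obtain s i where s: "f x = Inr (s,i)" by (cases "f x") auto
  have sV: "s : V" "s ~: C" using gv[OF x] s by (auto simp: gverts_def)
  have "s : W"
  proof (rule ccontr)
   assume nW: "s ~: W"
   have h: "\<exists>t. f (tht c) = Inr (t,i) & A\<^sup>*\<^sup>* s t" if "c : C" for c
    using st[OF x s tht(2)[OF that]] nW by blast
   have "rich s" unfolding rich_def
   proof (intro conjI exI[of _ "%c. fst (projr (f (tht c)))"] ballI)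
    show "s : V" by fact
    show "inj_on (%c. fst (projr (f (tht c)))) C"
    proof (rule inj_onI)
     fix c d assume cd: "c : C" "d : C" and e: "fst (projr (f (tht c))) = fst (projr (f (tht d)))"
     obtain p q where "f (tht c) = Inr (p,i)" "f (tht d) = Inr (q,i)" using h[OF cd(1)] h[OF cd(2)] by blast
     hence "f (tht c) = f (tht d)" using e by simp
     thus "c = d" by (rule injtht[OF _ cd])
    qed
    fix c assume c: "c : C"
    obtain p where p: "f (tht c) = Inr (p,i)" "A\<^sup>*\<^sup>* s p" using h[OF c] by blast
    thus "A\<^sup>*\<^sup>* s (fst (projr (f (tht c))))" by simp
    fix d assume d: "d : C"
    obtain q where q: "f (tht d) = Inr (q,i)" using h[OF d] by blast
    show "A (fst (projr (f (tht c)))) (fst (projr (f (tht d)))) \<longleftrightarrow> A c d"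
     using ad[OF thtV[OF c] thtV[OF d]] tht(3)[OF c d] by (simp add: p q)
   qed
   thus False using nW sV by (simp add: W_def)
  qed
  thus ?thesis using s by blast
 qed
 define h where "h x = fst (projr (f x))" for x
 have hW: "h x : W" "rich (h x)" "\<exists>i. f x = Inr (h x,i)" if "rich x" for x
  using rich_W[OF that] by (auto simp: h_def W_def)
 \<comment> \<open>Inside \<open>W\<close> adjacency ignores the layer, so dropping the layer
   preserves and reflects adjacency, although distinct vertices may be identified.\<close>
 have hA: "A (h x) (h y) \<longleftrightarrow> A x y" if r: "rich x" "rich y" for x y
 proof -
  obtain i j where "f x = Inr (h x,i)" "f y = Inr (h y,j)" using hW(3)[OF r(1)] hW(3)[OF r(2)] by auto
  hence "gadj B X (f x) (f y) \<longleftrightarrow> A (h x) (h y)" using hW(1)[OF r(1)] by simp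
  thus ?thesis using ad[of x y] r by (simp add: rich_def)
 qed
 have hR: "A\<^sup>*\<^sup>* (h x) (h y)" if "rich x" "A\<^sup>*\<^sup>* x y" for x y
  using that(2)
 proof (induction rule: rtranclp_induct)
  case (step y z)
  hence "rich y" "rich z" using rich_reach[OF that(1)] by (auto intro: rtranclp.rtrancl_into_rtrancl)
  thus ?case using step hA by (auto intro: rtranclp.rtrancl_into_rtrancl)
 qed simp
 define N where "N s = {t. A s t}" for s
 define S where "S = comp ` {x. rich x}"
 define sg where "sg K = (\<Union>x\<in>K. comp (h x))" for K
 define r where "r K = card (N ` K)" for K
 have sg: "sg (comp x) = comp (h x)" if "rich x" for x
 proof -
  have "comp (h y) = comp (h x)" if "y : comp x" for y using hR[OF \<open>rich x\<close>, of y] that comp_eq by blast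
  thus ?thesis unfolding sg_def by blast
 qed
 have fV: "finite {x. rich x}" using Vfin by (rule finite_subset[rotated]) (auto simp: rich_def)
 have finc: "finite (comp x)" if "rich x" for x
  using fV by (rule finite_subset[rotated]) (use rich_reach[OF that] in auto)
 have Ninj: "N a = N b" if ab: "rich a" "rich b" "N (h a) = N (h b)" for a b
 proof -
  have "A a t \<longleftrightarrow> A b t" for t
  proof (cases "rich t")
   case True
   have "A (h a) (h t) \<longleftrightarrow> A (h b) (h t)" using ab(3) unfolding N_def by blast
   thus ?thesis using hA ab True by simp
  next
   case False
   thus ?thesis using rich_reach[OF ab(1)] rich_reach[OF ab(2)] by blast
  qed
  thus ?thesis by (simp add: N_def)
 qed
 have rN: "r (comp x) <= card (N ` h ` comp x)" "h ` comp x \<subseteq> comp (h x)" if x: "rich x" for x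
 proof -
  let ?K = "comp x"
  have rK: "rich y" if "y : ?K" for y using rich_reach[OF x] that by simp
  have i: "inv_into ?K N Z : ?K" "N (inv_into ?K N Z) = Z" if "Z : N ` ?K" for Z
   using inv_into_into[OF that] f_inv_into_f[OF that] by auto
  have inj: "inj_on (%Z. N (h (inv_into ?K N Z))) (N ` ?K)"
  proof (rule inj_onI)
   fix Z Z' assume z: "Z : N ` ?K" "Z' : N ` ?K" and e: "N (h (inv_into ?K N Z)) = N (h (inv_into ?K N Z'))"
   from Ninj[OF rK[OF i(1)[OF z(1)]] rK[OF i(1)[OF z(2)]] e] show "Z = Z'" using i(2) z by simp
  qed
  have img: "(%Z. N (h (inv_into ?K N Z))) ` (N ` ?K) \<subseteq> N ` h ` ?K" using i(1) by blast
  show "r ?K <= card (N ` h ` ?K)" unfolding r_def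
   by (rule card_inj_on_le[OF inj img]) (use finc[OF x] in simp)
  show "h ` ?K \<subseteq> comp (h x)" using hR[OF x] by blast
 qed
 obtain K1 K2 where K: "K1 : S" "K2 : S" "K1 ~= K2" "sg K1 = sg K2" "r K1 = r (sg K1)"
 proof -
  have "finite S" using fV by (simp add: S_def)
  moreover have "comp u : S" using rich_C[OF inV(1)] by (auto simp: S_def)
  moreover have "sg K : S" if "K : S" for K using that sg hW(2) by (auto simp: S_def)
  moreover have "sg K ~= comp u" if KS: "K : S" for K
  proof
   assume e: "sg K = comp u"
   obtain x where x: "K = comp x" "rich x" using KS unfolding S_def by blast
   hence "h x : comp u" using sg[OF x(2)] e by auto
   hence "h x : C" using reach_C inV by blast
   thus False using hW(1)[OF x(2)] by (simp add: W_def)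
  qed
  moreover have "r K <= r (sg K)" if KS: "K : S" for K
  proof -
   obtain x where x: "K = comp x" "rich x" using KS unfolding S_def by blast
   have "card (N ` h ` comp x) <= card (N ` comp (h x))"
    using rN(2)[OF x(2)] finc[OF hW(2)[OF x(2)]] by (intro card_mono image_mono) auto
   thus ?thesis using rN(1)[OF x(2)] sg[OF x(2)] x(1) by (simp add: r_def)
  qed
  ultimately show thesis using fixpoint_collision[of S "comp u" sg r] that by blast
 qed
 obtain x1 x2 where x: "K1 = comp x1" "rich x1" "K2 = comp x2" "rich x2" using K(1,2) by (auto simp: S_def)
 let ?L = "comp (h x1)"
 have L: "sg K1 = ?L" "sg K2 = comp (h x2)" using sg x by auto
 have "N ` h ` K1 = N ` ?L"
 proof (rule card_subset_eq)
  show "finite (N ` ?L)" using finc[OF hW(2)[OF x(2)]] by simp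
  show sub: "N ` h ` K1 \<subseteq> N ` ?L" using rN(2)[OF x(2)] x(1) by (auto intro!: imageI)
  have "card (N ` ?L) <= card (N ` h ` K1)" using rN(1)[OF x(2)] K(5) L(1) x(1) by (simp add: r_def)
  thus "card (N ` h ` K1) = card (N ` ?L)"
   using card_mono[OF _ sub] finc[OF hW(2)[OF x(2)]] by simp
 qed
 \<comment> \<open>The component of \<open>h x2\<close> contains copies of both \<open>u\<close> and
   \<open>v\<close>, so \<open>h x2\<close> is not isolated.\<close>
 moreover obtain t where t: "A (h x2) t"
 proof -
  obtain tht where tht: "inj_on tht C" "!!c. c : C ==> A\<^sup>*\<^sup>* (h x2) (tht c)"
   using hW(2)[OF x(4)] unfolding rich_def by blast
  have "tht u ~= tht v" using tht(1) inV neq by (auto simp: inj_on_def)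
  hence "h x2 ~= tht u \<or> h x2 ~= tht v" by auto
  thus thesis using that tht(2)[OF inV(1)] tht(2)[OF inV(2)] by (metis converse_rtranclpE)
 qed
 moreover have "t : ?L"
 proof -
  have "h x2 : ?L" using L K(4) by auto
  thus ?thesis using t by (auto intro: rtranclp.rtrancl_into_rtrancl)
 qed
 ultimately obtain a where a: "a : K1" "N (h a) = N t" by (metis (no_types, lifting) imageE imageI)
 \<comment> \<open>As \<open>h a\<close> has the neighbourhood of \<open>t\<close>, it is adjacent
   to \<open>h x2\<close>; so \<open>a\<close> is adjacent to \<open>x2\<close>, and the two
   components coincide.\<close>
 have ra: "rich a" using a(1) x rich_reach by auto
 have "A t (h x2)" using t VAsym by blast
 hence "A (h a) (h x2)" using a(2) unfolding N_def by blast
 hence "A a x2" using hA[OF ra x(4)] by simp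
 hence "A\<^sup>*\<^sup>* x1 x2" using a(1) x(1) by (auto intro: rtranclp.rtrancl_into_rtrancl)
 thus False using comp_eq x K(3) by metis
qed

text \<open>At most \<open>k\<close> edges are destroyed but there are \<open>k + 1\<close> layers,
  so one layer is intact. Each edge of \<open>B\<close> completes an induced copy of
  \<open>H\<close> with that layer; a destroyed edge must hit the copy in one of two bags, and each
  destroyed edge is charged to one bag.\<close>

lemma cover_from_subdivision:
 assumes B: "!!p q. B p q ==> p : Y & q : Y" "!!p. \<not> B p p" "!!p q. B p q ==> B q p" and G: "pair_graph G" and l: "labelled B {} Y k G lab"
  and s: "(edge_subdivision ^^ j) G G'" and jk: "j <= k"
  and nc: "\<not> (\<exists>ph. inj_on ph V & ph ` V \<subseteq> pverts G' & (\<forall>x\<in>V. \<forall>y\<in>V. (ph x,ph y) : parcs G' \<longleftrightarrow> A x y))"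
 shows "\<exists>X\<subseteq>Y. finite X & card X <= k & (\<forall>p q. B p q --> p : X \<or> q : X)"
proof -
 note b = l[unfolded labelled_def, THEN conjunct1] and e = l[unfolded labelled_def, THEN conjunct2, rule_format]
 obtain F where F: "finite F" "card F <= j" "pverts G \<subseteq> pverts G'"
  "!!x y. x : pverts G ==> y : pverts G ==> (x,y) : parcs G' \<longleftrightarrow> (x,y) : parcs G & {x,y} ~: F"
  using subdivisions_survive[OF G s] by blast
 define ps where "ps = inv_into (pverts G) lab"
 have ps: "ps q : pverts G" "lab (ps q) = q" if "q : gverts Y {} k" for q
  using that b unfolding ps_def by (auto simp: bij_betw_def inv_into_into f_inv_into_f)
 have psi: "ps q = ps q' \<longleftrightarrow> q = q'" if "q : gverts Y {} k" "q' : gverts Y {} k" for q q'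
  using ps(2)[OF that(1)] ps(2)[OF that(2)] by metis
 have inrv: "Inr (s,i) : gverts Y {} k \<longleftrightarrow> s : V - C & i <= k" for s i by (auto simp: gverts_def)
 have "\<exists>i\<le>k. \<forall>s\<in>V - C. \<forall>t\<in>V - C. {ps (Inr (s,i)),ps (Inr (t,i))} ~: F"
 proof (rule ccontr)
  assume "\<not> ?thesis"
  hence "\<forall>i. \<exists>p. i <= k --> fst p : V - C & snd p : V - C & {ps (Inr (fst p,i)),ps (Inr (snd p,i))} : F"
   by (metis fst_conv snd_conv)
  then obtain P where P: "!!i. i <= k ==> fst (P i) : V - C & snd (P i) : V - C & {ps (Inr (fst (P i),i)),ps (Inr (snd (P i),i))} : F"
   by metis
  define E where "E i = {ps (Inr (fst (P i),i)),ps (Inr (snd (P i),i))}" for i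
  have E: "E i : F" if "i <= k" for i using P[OF that] by (simp add: E_def)
  have "inj_on E {..k}"
  proof (rule inj_onI)
   fix i i' assume i: "i : {..k}" "i' : {..k}" "E i = E i'"
   have le: "i <= k" "i' <= k" using i by auto
   have "ps (Inr (fst (P i),i)) = ps (Inr (fst (P i'),i')) \<or> ps (Inr (fst (P i),i)) = ps (Inr (snd (P i'),i'))"
    using i(3) unfolding E_def by (metis doubleton_eq_iff)
   thus "i = i'" using psi inrv P[OF le(1)] P[OF le(2)] le by auto
  qed
  hence "card {..k} <= card F" using E F(1) by (intro card_inj_on_le[of E]) auto
  thus False using F(2) jk by simp
 qed
 then obtain i where i: "i <= k" "!!s t. s : V - C ==> t : V - C ==> {ps (Inr (s,i)),ps (Inr (t,i))} ~: F" by blast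
 \<comment> \<open>Picks a single bag that \<open>f\<close> touches, even if \<open>f\<close> joins
   two bags; this keeps the cover as small as the set of destroyed edges.\<close>
 define g where "g f = (SOME y. \<exists>m. Inl (Bag y m) : lab ` f)" for f
 define X where "X = g ` F \<inter> Y"
 have "x : X \<or> y : X" if xy: "B x y" for x y
 proof -
  have yY: "x : Y" "y : Y" "x ~= y" using B xy by auto
  \<comment> \<open>The bag \<open>y\<close> supplies the component, and \<open>Bag x v\<close>
    plays the part of \<open>w\<close>: within the copy its neighbours are exactly the hub and
    \<open>Bag y v\<close>.\<close>
  define \<tau> where "\<tau> s = (if s : C then Inl (if s = u then Hub else if s = w then Bag x v else Bag y s) else Inr (s,i))" for s
  have \<tau>v: "\<tau> s : gverts Y {} k" if "s : V" for s
   using that yY i(1) inV neq by (auto simp: \<tau>_def gverts_def)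
  have \<tau>i: "inj_on \<tau> V" using yY by (auto simp: inj_on_def \<tau>_def split: if_splits)
  have \<tau>a: "gadj B {} (\<tau> s) (\<tau> t) \<longleftrightarrow> A s t" if st: "s : V" "t : V" for s t
  proof (cases "s : C & t : C")
   case True
   have wn: "A w z \<longleftrightarrow> z = u \<or> z = v" "A z w \<longleftrightarrow> z = u \<or> z = v" for z
    using wdeg[of z] uw vw inV VAsym by blast+
   have irr: "\<not> A z z" if "z : C" for z using Airr[of z] that by blast
   have sym: "A s u \<longleftrightarrow> A u s" "A t u \<longleftrightarrow> A u t" using VAsym by blast+
   show ?thesis using True neq inV wn irr sym yY xy uv B(2)[of x] B(2)[of y] B(3)[OF xy] by (auto simp: \<tau>_def)
  next
   case False
   show ?thesis
   proof (cases "s : C \<or> t : C")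
    case True
    hence "\<not> A s t" using False Ccl[of s t] Ccl[of t s] VAsym[of s t] by blast
    thus ?thesis using True False by (auto simp: \<tau>_def)
   next
    case False thus ?thesis by (auto simp: \<tau>_def)
   qed
  qed
  have "\<exists>s\<in>V. \<exists>t\<in>V. A s t & {ps (\<tau> s),ps (\<tau> t)} : F"
  proof (rule ccontr)
   assume n: "\<not> ?thesis"
   have "inj_on (%s. ps (\<tau> s)) V" using \<tau>i \<tau>v psi by (auto simp: inj_on_def)
   moreover have "(%s. ps (\<tau> s)) ` V \<subseteq> pverts G'" using ps(1)[OF \<tau>v] F(3) by auto
   moreover have "(ps (\<tau> s),ps (\<tau> t)) : parcs G' \<longleftrightarrow> A s t" if "s : V" "t : V" for s t
    using F(4)[OF ps(1)[OF \<tau>v] ps(1)[OF \<tau>v], OF that] e[OF ps(1)[OF \<tau>v] ps(1)[OF \<tau>v], OF that] n that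
     ps(2)[OF \<tau>v] \<tau>a[OF that] by auto
   ultimately show False using nc by blast
  qed
  then obtain s t where st: "s : V" "t : V" "A s t" "{ps (\<tau> s),ps (\<tau> t)} : F" by blast
  have sC: "s : C"
  proof (rule ccontr)
   assume s: "s ~: C"
   hence t: "t ~: C" using Ccl[of t s] VAsym[OF st(3)] by blast
   thus False using i(2)[of s t] st s by (auto simp: \<tau>_def)
  qed
  have tC: "t : C" using Ccl st(3) sC by blast
  have stn: "s ~= t" using Airr[of s] sC st(3) by blast
  let ?f = "{ps (\<tau> s),ps (\<tau> t)}"
  have lf: "lab ` ?f = {\<tau> s,\<tau> t}" using ps(2)[OF \<tau>v] st by auto
  have "\<exists>z m. Inl (Bag z m) : lab ` ?f" unfolding lf using stn sC tC by (auto simp: \<tau>_def)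
  hence "\<exists>m. Inl (Bag (g ?f) m) : lab ` ?f" unfolding g_def by (rule someI_ex)
  hence "g ?f = x \<or> g ?f = y" unfolding lf using sC tC by (auto simp: \<tau>_def split: if_splits)
  thus ?thesis using st(4) yY unfolding X_def by blast
 qed
 moreover have "card X <= k"
 proof -
  have "card X <= card (g ` F)" unfolding X_def using F(1) by (intro card_mono) auto
  thus ?thesis using card_image_le[OF F(1), of g] F(2) jk by linarith
 qed
 ultimately show ?thesis using F(1) by (intro exI[of _ X]) (auto simp: X_def)
qed

theorem reduction:
 assumes H: "pair_graph H" "pverts H = V" "!!x y. (x,y) : parcs H \<longleftrightarrow> A x y"
  and B: "!!p q. B p q ==> B q p" "!!p q r. B p q ==> B q r ==> \<not> B p r" "!!p q. B p q ==> p : Y & q : Y"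
  and G: "pair_graph G" and l: "labelled B {} Y k G lab" and Y: "finite Y"
 shows "subdividable_to_free H G k \<longleftrightarrow> (\<exists>X\<subseteq>Y. card X <= k & (\<forall>p q. B p q --> p : X \<or> q : X))"
proof
 assume "subdividable_to_free H G k"
 then obtain j G' where j: "j <= k" "(edge_subdivision ^^ j) G G'" "induced_free H G'"
  unfolding subdividable_to_free_def by blast
 have "\<not> (\<exists>ph. copy ph H G')" using induced_free_copy[OF H(1) subdivisions_graph[OF G j(2)]] j(3) by simp
 hence nc: "\<not> (\<exists>ph. inj_on ph V & ph ` V \<subseteq> pverts G' & (\<forall>x\<in>V. \<forall>y\<in>V. (ph x,ph y) : parcs G' \<longleftrightarrow> A x y))"
  unfolding copy_def H(2,3) .
 have irr: "\<not> B p p" for p using B(2)[of p p p] by blast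
 from cover_from_subdivision[OF B(3) irr B(1) G l j(2,1) nc]
 show "\<exists>X\<subseteq>Y. card X <= k & (\<forall>p q. B p q --> p : X \<or> q : X)" by blast
next
 assume "\<exists>X\<subseteq>Y. card X <= k & (\<forall>p q. B p q --> p : X \<or> q : X)"
 then obtain X where X: "X \<subseteq> Y" "card X <= k" "!!p q. B p q ==> p : X \<or> q : X" by blast
 obtain G' lab' where G': "(edge_subdivision ^^ card X) G G'" "labelled B X Y k G' lab'"
  using subdivide_cover[OF finite_subset[OF X(1) Y] X(1) G l] by blast
 have "\<not> (\<exists>\<psi>. copy \<psi> H G')"
 proof
  assume "\<exists>\<psi>. copy \<psi> H G'"
  then obtain \<psi> where c: "inj_on \<psi> V" "\<psi> ` V \<subseteq> pverts G'" "!!x y. x : V ==> y : V ==> (\<psi> x,\<psi> y) : parcs G' \<longleftrightarrow> A x y"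
   unfolding copy_def H(2,3) by blast
  have bl: "bij_betw lab' (pverts G') (gverts Y X k)" and
   el: "!!i j. i : pverts G' ==> j : pverts G' ==> (i,j) : parcs G' \<longleftrightarrow> gadj B X (lab' i) (lab' j)"
   using G'(2) unfolding labelled_def by blast+
  have p: "\<psi> x : pverts G'" if "x : V" for x using c(2) that by blast
  show False
  proof (rule no_copy[where f = "%x. lab' (\<psi> x)" and Y = Y and k = k, OF B(1,2) X(3)])
   show "inj_on (%x. lab' (\<psi> x)) V"
    using comp_inj_on[OF c(1) inj_on_subset[OF bij_betw_imp_inj_on[OF bl] c(2)]] by (simp add: comp_def)
   fix x assume x: "x : V"
   show "lab' (\<psi> x) : gverts Y X k" using bij_betwE[OF bl] p[OF x] by blast
   fix y assume y: "y : V"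
   show "gadj B X (lab' (\<psi> x)) (lab' (\<psi> y)) \<longleftrightarrow> A x y" using el[OF p[OF x] p[OF y]] c(3)[OF x y] by simp
  qed
 qed
 hence "induced_free H G'" using induced_free_copy[OF H(1) subdivisions_graph[OF G G'(1)]] by simp
 thus "subdividable_to_free H G k" unfolding subdividable_to_free_def using G'(1) X(2) by blast
qed

end

text \<open>Both properties give a triangle with fewer than three attachment vertices; a remaining
  vertex has degree at most 2, and the triangle accounts for all its neighbours.\<close>

lemma low_triangle:
 assumes H: "pair_graph H"
  and "(\<exists>T. roof_triangle H T) \<or>
     (\<exists>S T. S ~= T & hanging_triangle H S & hanging_triangle H T &
      (\<exists>a\<in>attachment_vertices H S. \<exists>b\<in>attachment_vertices H T. (a,b) : parcs H))"
 obtains u v w where "(u,v) : parcs H" "(u,w) : parcs H" "(v,w) : parcs H" "!!x. (w,x) : parcs H ==> x = u \<or> x = v"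
proof -
 note f = pair_graph_facts[OF H] and found = that
 obtain T where T: "triangle H T" "card (attachment_vertices H T) < 3"
 proof -
  have "\<exists>T. triangle H T & (card (attachment_vertices H T) = 2 \<or> card (attachment_vertices H T) = 1)"
   using assms(2) unfolding roof_triangle_def hanging_triangle_def by blast
  thus thesis using that by (elim exE conjE disjE) auto
 qed
 then obtain a b c where t: "T = {a,b,c}" "(a,b) : parcs H" "(b,c) : parcs H" "(a,c) : parcs H"
  unfolding triangle_def by blast
 have d: "a ~= b" "b ~= c" "a ~= c" using t f(4) by auto
 have "card T = 3" using d t(1) by simp
 hence "attachment_vertices H T ~= T" using T(2) by auto
 then obtain w where w: "w : T" "\<not> 3 <= out_degree (with_proj H) w" unfolding attachment_vertices_def by blast
 have fin: "finite (parcs H)" using f(1,2) by (intro finite_subset[of "parcs H" "pverts H \<times> pverts H"]) auto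
 have deg: "card {e \<in> parcs H. fst e = w} <= 2" using w(2) by (simp add: out_degree_def out_arcs_def)
 have *: thesis if uv: "(u,v) : parcs H" "(u,w) : parcs H" "(v,w) : parcs H" "u ~= v" for u v
 proof (rule found[OF uv(1-3)])
  fix x assume x: "(w,x) : parcs H"
  have sub: "{(w,u),(w,v),(w,x)} \<subseteq> {e \<in> parcs H. fst e = w}" using uv(2,3) x f(3) by simp
  have "card {(w,u),(w,v),(w,x)} <= card {e \<in> parcs H. fst e = w}"
   by (rule card_mono[OF _ sub]) (rule finite_subset[OF _ fin], blast)
  hence "card {(w,u),(w,v),(w,x)} <= 2" using deg by linarith
  thus "x = u \<or> x = v" using uv(4) by (auto simp: card_insert_if split: if_splits)
 qed
 consider "w = a" | "w = b" | "w = c" using w(1) t(1) by auto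
 thus thesis
 proof cases
  case 1 show ?thesis by (rule *[of b c]) (use 1 t d f(3) in auto)
 next
  case 2 show ?thesis by (rule *[of a c]) (use 2 t d f(3) in auto)
 next
  case 3 show ?thesis by (rule *[of a b]) (use 3 t d f(3) in auto)
 qed
qed

text \<open>\<open>Gm0\<close> is unchanged when \<open>u\<close> and \<open>v\<close> are
  exchanged, so the labels may be assigned with the heavier branch at \<open>v\<close>.\<close>

lemma obtain_target:
 assumes H: "pair_graph H" and t: "(u,v) : parcs H" "(u,w) : parcs H" "(v,w) : parcs H"
  "!!x. (w,x) : parcs H ==> x = u \<or> x = v"
 shows "\<exists>C u v. target (pverts H) C (%x y. (x,y) : parcs H) u v w"
proof -
 note f = pair_graph_facts[OF H]
 define A where "A = (%x y. (x,y) : parcs H)"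
 define C where "C = {x. A\<^sup>*\<^sup>* u x}"
 have As: "A x y ==> A y x" for x y using f(3) by (simp add: A_def)
 have Asr: "A\<^sup>*\<^sup>* x y ==> A\<^sup>*\<^sup>* y x" for x y
  by (induction rule: rtranclp_induct) (auto intro: converse_rtranclp_into_rtranclp As)
 have uC: "u : C" "v : C" "w : C" using t by (auto simp: C_def A_def)
 have cl: "x : C ==> A x y ==> y : C" for x y unfolding C_def by (auto intro: rtranclp.rtrancl_into_rtrancl)
 have "C \<subseteq> insert u (pverts H)"
 proof
  fix x assume "x : C"
  hence "A\<^sup>*\<^sup>* u x" by (simp add: C_def)
  thus "x : insert u (pverts H)" by cases (auto simp: A_def dest: f(2))
 qed
 hence CV: "C \<subseteq> pverts H" using f(2)[OF t(1)] by auto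
 have conn: "(%x y. x : C & A x y)\<^sup>*\<^sup>* x y" if "x : C" "y : C" for x y
 proof -
  have "A\<^sup>*\<^sup>* x y" using that Asr[of u x] rtranclp_trans[of A x u y] by (simp add: C_def)
  hence "(%x y. x : C & A x y)\<^sup>*\<^sup>* x y & y : C"
  proof (induction rule: rtranclp_induct)
   case base thus ?case using that by simp
  next
   case (step y z) thus ?case using cl by (auto intro: rtranclp.rtrancl_into_rtrancl)
  qed
  thus ?thesis by simp
 qed
 have T: "tri_graph C (%x y. x : C & A x y) a b w" if "a = u & b = v \<or> a = v & b = u" for a b
 proof unfold_locales
  show "finite C" using CV f(1) finite_subset by blast
  show "x : C & A x y ==> x : C & y : C" for x y using cl by blast
  show "x : C & A x y ==> y : C & A y x" for x y using cl As by blast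
  show "\<not> (x : C & A x x)" for x using f(4) by (simp add: A_def)
  show "x : C ==> y : C ==> (%x y. x : C & A x y)\<^sup>*\<^sup>* x y" for x y by (rule conn)
  show "a : C & A a b" "a : C & A a w" "b : C & A b w" using that uC t f(3) by (auto simp: A_def)
  show "w : C & A w x ==> x = a \<or> x = b" for x using that t(4) by (auto simp: A_def)
 qed
 interpret a: tri_graph C "%x y. x : C & A x y" u v w by (rule T) simp
 interpret b: tri_graph C "%x y. x : C & A x y" v u w by (rule T) simp
 have eq: "a.Gm0 = b.Gm0"
  unfolding a.Gm0_def b.Gm0_def a.Gm_def b.Gm_def a.kk_def b.kk_def a.Bl_def b.Bl_def by (simp add: insert_commute)
 show ?thesis
 proof (cases "mx a.Gm0 u <= mx a.Gm0 v")
  case True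
  hence "target (pverts H) C A u v w"
   by unfold_locales (use f CV in \<open>auto simp: A_def\<close>)
  thus ?thesis unfolding A_def by blast
 next
  case False
  hence "mx b.Gm0 v <= mx b.Gm0 u" using eq by simp
  hence "target (pverts H) C A v u w"
   by unfold_locales (use f CV in \<open>auto simp: A_def\<close>)
  thus ?thesis unfolding A_def by blast
 qed
qed

section \<open>From 3-CNF formulas to vertex cover in triangle-free graphs\<close>

text \<open>For a variable: \<open>[v]\<close>, a side 0 or 1, and a copy number below 3. For a
  clause: \<open>[]\<close>, the clause index, and a position on a 5-cycle.\<close>

type_synonym 'x node = "'x list \<times> nat \<times> nat"

definition sat :: "('x * bool) list list => bool" where
 "sat F \<longleftrightarrow> (\<exists>sg. \<forall>c\<in>set F. \<exists>l\<in>set c. sg (fst l) = snd l)"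

text \<open>Short clauses are padded by repeating their last literal.\<close>

definition lit :: "('x * bool) list list => nat => nat => 'x * bool" where
 "lit F j p = nthd undefined (nthd [] F j) (if p < length (nthd [] F j) then p else length (nthd [] F j) - 1)"

definition cyc :: "(nat * nat) list" where
 "cyc = [(0,1),(1,2),(2,3),(3,4),(4,0)]"

text \<open>A variable becomes a complete bipartite graph on 3 + 3 nodes whose sides are the truth
  values; a clause becomes a 5-cycle whose positions 0, 1, 2 stand for its literals. Position
  \<open>p\<close> is joined to copy \<open>p\<close> only: otherwise equal literals at neighbouring
  positions would create a triangle.\<close>

definition half_adj :: "('x * bool) list list => 'x node => 'x node => bool" where
 "half_adj F a b \<longleftrightarrow>
   (if fst a = [] then
    (if fst b = [] then fst (snd a) = fst (snd b) & (snd (snd a),snd (snd b)) : set cyc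
     else snd (snd a) < 3 & snd (snd b) = snd (snd a) &
      fst b = [fst (lit F (fst (snd a)) (snd (snd a)))] &
      fst (snd b) = (if snd (lit F (fst (snd a)) (snd (snd a))) then 1 else 0))
   else fst a = fst b & fst (snd a) = 0 & fst (snd b) = 1)"

definition vadj :: "('x * bool) list list => 'x node => 'x node => bool" where
 "vadj F a b \<longleftrightarrow> half_adj F a b \<or> half_adj F b a"

definition nodes :: "'x list => ('x * bool) list list => 'x node list" where
 "nodes vl F = concat (map (%v. map (%bq. ([v],fst bq,snd bq)) (List.product [0,1] [0,1,2])) vl) @
   concat (map (%j. map (%p. ([],j,p)) [0,1,2,3,4]) [0..<length F])"

definition wf3 :: "'x list => ('x * bool) list list => bool" where
 "wf3 vl F \<longleftrightarrow> distinct vl & (\<forall>c\<in>set F. c ~= [] & length c <= 3 & fst ` set c \<subseteq> set vl)"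

lemma nodes_mem: "(xs,i,q) : set (nodes vl F) \<longleftrightarrow>
  (\<exists>v\<in>set vl. xs = [v] & i < 2 & q < 3) \<or> xs = [] & i < length F & q < 5"
 by (auto simp: nodes_def numeral_eq_Suc less_Suc_eq)

lemma distinct_nodes: "distinct vl ==> distinct (nodes vl F)"
proof -
 assume d: "distinct vl"
 have 1: "distinct (concat (map (%v. map (%bq. ([v],fst bq,snd bq :: nat)) (List.product [0,1 :: nat] [0,1,2])) vl))"
  using d by (induction vl) (auto simp: distinct_map inj_on_def)
 have 2: "distinct (concat (map (%j. map (%p. ([] :: 'a list,j :: nat,p :: nat)) [0,1,2,3,4]) js))" if "distinct js" for js
  using that by (induction js) auto
 show ?thesis unfolding nodes_def using 1 2[of "[0..<length F]"] by auto
qed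

lemma vadj_sym: "vadj F a b ==> vadj F b a" by (auto simp: vadj_def)

definition cadj :: "nat => nat => bool" where
 "cadj p q \<longleftrightarrow> (p,q) : set cyc \<or> (q,p) : set cyc"

lemma cadj_triangle: "cadj p q ==> cadj q r ==> \<not> cadj p r"
proof -
 have "\<forall>p\<in>{0,1,2,3,4}. \<forall>q\<in>{0,1,2,3,4}. \<forall>r\<in>{0,1,2,3,4}. \<not> (cadj p q & cadj q r & cadj p r)"
  by (simp add: cadj_def cyc_def)
 moreover have "cadj p q ==> p : {0,1,2,3,4} & q : {0,1,2,3,4}" for p q
  by (auto simp: cadj_def cyc_def)
 ultimately show "cadj p q ==> cadj q r ==> \<not> cadj p r" by blast
qed

lemma vadj_triangle: "vadj F a b ==> vadj F b c ==> \<not> vadj F a c"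
proof -
 have vv: "vadj F x y \<longleftrightarrow> fst x = fst y & (fst (snd x) = 0 & fst (snd y) = 1 \<or> fst (snd x) = 1 & fst (snd y) = 0)"
  if "fst x ~= []" "fst y ~= []" for x y using that by (auto simp: vadj_def half_adj_def)
 have cc: "vadj F x y ==> snd (snd x) ~= snd (snd y) & fst (snd x) = fst (snd y)" if "fst x = []" "fst y = []" for x y
  using that by (auto simp: vadj_def half_adj_def cyc_def)
 have cv: "vadj F x y \<longleftrightarrow> snd (snd x) < 3 & y = ([fst (lit F (fst (snd x)) (snd (snd x)))],
   if snd (lit F (fst (snd x)) (snd (snd x))) then 1 else 0,snd (snd x))"
  if "fst x = []" "fst y ~= []" for x y using that by (auto simp: vadj_def half_adj_def prod_eq_iff)
 have three: "\<not> (vadj F x y & vadj F y z & vadj F x z)" if "fst x = []" "fst y = []" "fst z = []" for x y z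
 proof -
  have "vadj F x y ==> cadj (snd (snd x)) (snd (snd y))" if "fst x = []" "fst y = []" for x y
   using that by (auto simp: vadj_def half_adj_def cadj_def)
  thus ?thesis using that cadj_triangle by blast
 qed
 have two: "\<not> (vadj F x y & vadj F y z & vadj F x z)" if "fst x = []" "fst y = []" "fst z ~= []" for x y z
 proof
  assume a: "vadj F x y & vadj F y z & vadj F x z"
  have "snd (snd z) = snd (snd x)" using cv[of x z] that a by simp
  moreover have "snd (snd z) = snd (snd y)" using cv[of y z] that a by simp
  ultimately show False using cc[of x y] that a by simp
 qed
 have one: "\<not> (vadj F x y & vadj F y z & vadj F x z)" if "fst x = []" "fst y ~= []" "fst z ~= []" for x y z
  using that cv[of x y] cv[of x z] vv[of y z] by auto
 have none: "\<not> (vadj F x y & vadj F y z & vadj F x z)" if "fst x ~= []" "fst y ~= []" "fst z ~= []" for x y z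
  using that vv[of x y] vv[of x z] vv[of y z] by auto
 assume a: "vadj F a b" "vadj F b c"
 show "\<not> vadj F a c"
 proof
  assume "vadj F a c"
  note a' = a this and a'' = a[THEN vadj_sym] this[THEN vadj_sym]
  show False
   using a' a'' three[of a b c] two[of a b c] two[of a c b] two[of b c a] one[of a b c] one[of b a c] one[of c a b] none[of a b c]
   by blast
 qed
qed

definition blk_of :: "'x node => 'x list * nat" where
 "blk_of x = (if fst x = [] then ([],fst (snd x)) else (fst x,0))"

lemma cycle_cover:
 assumes "(0::nat) : P \<or> 1 : P" "1 : P \<or> 2 : P" "2 : P \<or> 3 : P" "3 : P \<or> 4 : P" "4 : P \<or> 0 : P" "finite P"
 shows "3 <= card P" "{0,1,2} \<subseteq> P ==> 4 <= card P"
proof -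
 have m: "card Q <= card P" if "Q \<subseteq> P" for Q using card_mono[OF assms(6) that] .
 have "{0,1,3} \<subseteq> P \<or> {0,2,3} \<subseteq> P \<or> {0,2,4} \<subseteq> P \<or> {1,2,4} \<subseteq> P \<or> {1,3,4} \<subseteq> P"
  using assms by auto
 thus "3 <= card P" using m[of "{0,1,3}"] m[of "{0,2,3}"] m[of "{0,2,4}"] m[of "{1,2,4}"] m[of "{1,3,4}"] by auto
 assume "{0,1,2} \<subseteq> P"
 hence "{0,1,2,3} \<subseteq> P \<or> {0,1,2,4} \<subseteq> P" using assms(4) by auto
 thus "4 <= card P" using m[of "{0,1,2,3}"] m[of "{0,1,2,4}"] by auto
qed

text \<open>The lower bounds of the blocks add up to the whole budget, so there is no slack and each
  is attained.\<close>

lemma card_blocks: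
 assumes "finite X" "finite I" "!!i. i : I ==> k <= card {x \<in> X. f x = i}" "card X <= k * card I" "i : I"
 shows "card {x \<in> X. f x = i} = k"
proof (rule ccontr)
 assume n: "\<not> ?thesis"
 have "(\<Sum>j\<in>I. k) < (\<Sum>j\<in>I. card {x \<in> X. f x = j})"
  by (rule sum_strict_mono_ex1) (use assms n in \<open>auto intro!: bexI[of _ i]\<close>, metis le_neq_implies_less)
 also have "\<dots> = card (\<Union>j\<in>I. {x \<in> X. f x = j})"
  by (rule card_UN_disjoint[symmetric]) (use assms in auto)
 also have "\<dots> <= card X" using assms by (intro card_mono) auto
 finally show False using assms(4) by (simp add: mult.commute)
qed

text \<open>Every gadget costs at least 3, so the budget is tight. A variable gadget is then covered
  by exactly one side, from which a value is read off. A 5-cycle covered by 3 vertices leaves out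
  one of the positions 0, 1, 2, and the literal node attached there must be in the cover.\<close>

theorem vc_sat:
 assumes wf: "wf3 vl F"
 shows "(\<exists>X\<subseteq>set (nodes vl F). card X <= 3 * length vl + 3 * length F &
   (\<forall>a b. a : set (nodes vl F) & b : set (nodes vl F) & vadj F a b --> a : X \<or> b : X)) \<longleftrightarrow> sat F"
proof
 let ?Y = "set (nodes vl F)"
 have lit: "lit F j p : set (F ! j)" "fst (lit F j p) : set vl" if "j < length F" for j p
 proof -
  have c: "F ! j : set F" using that by simp
  hence ne: "F ! j ~= []" "fst ` set (F ! j) \<subseteq> set vl" using wf by (auto simp: wf3_def)
  hence "0 < length (F ! j)" by simp
  thus "lit F j p : set (F ! j)" using that by (auto simp: lit_def)
  thus "fst (lit F j p) : set vl" using ne by auto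
 qed
 {
  assume "sat F"
  then obtain sg where sg: "!!c. c : set F ==> \<exists>l\<in>set c. sg (fst l) = snd l" unfolding sat_def by blast
  have "\<exists>q<3. sg (fst (lit F j q)) = snd (lit F j q)" if j: "j < length F" for j
  proof -
   obtain l where l: "l : set (F ! j)" "sg (fst l) = snd l" using sg[of "F ! j"] j by auto
   then obtain q where q: "q < length (F ! j)" "l = F ! j ! q" by (auto simp: in_set_conv_nth)
   moreover have "length (F ! j) <= 3" using wf j by (auto simp: wf3_def)
   ultimately show ?thesis using l j by (intro exI[of _ q]) (auto simp: lit_def)
  qed
  then obtain qf where qf: "!!j. j < length F ==> qf j < 3 & sg (fst (lit F j (qf j))) = snd (lit F j (qf j))" by metis
  \<comment> \<open>The covers of the 5-cycle by 3 vertices that leave out position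
    \<open>q\<close>; with \<open>q = qf j\<close> this is the position of a true literal.\<close>
  define cv :: "nat => nat list" where "cv q = (if q = 0 then [1,2,4] else if q = 1 then [0,2,3] else [0,1,3])" for q
  define X1 where "X1 = (%(v,q). ([v],if sg v then 1 else 0 :: nat,q :: nat)) ` (set vl \<times> {..<3})"
  define X2 where "X2 = (%(j,i). ([] :: 'a list,j,cv (qf j) ! i)) ` ({..<length F} \<times> {..<3})"
  have c3: "cv q ! i < 5" if "i < 3" for q i using that by (auto simp: cv_def numeral_eq_Suc less_Suc_eq)
  have cvm: "p : set (cv q) ==> \<exists>i<3. cv q ! i = p" for p q
   by (metis cv_def in_set_conv_nth length_Cons list.size(3) numeral_3_eq_3)
  have X1m: "([v],if sg v then 1 else 0,q) : X1" if "v : set vl" "q < 3" for v q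
   using that unfolding X1_def by (intro image_eqI[of _ _ "(v,q)"]) auto
  have X2m: "([],j,p) : X2" if jp: "j < length F" "p : set (cv (qf j))" for j p
  proof -
   obtain i where "i < 3" "cv (qf j) ! i = p" using cvm[OF jp(2)] by blast
   thus ?thesis unfolding X2_def using jp(1) by (intro image_eqI[of _ _ "(j,i)"]) auto
  qed
  have "X1 \<union> X2 \<subseteq> ?Y" unfolding X1_def X2_def using c3 by (auto simp: nodes_mem)
  moreover have "card (X1 \<union> X2) <= 3 * length vl + 3 * length F"
  proof -
   have "card X1 <= card (set vl) * 3" unfolding X1_def by (rule order_trans[OF card_image_le]) (simp_all add: card_cartesian_product)
   moreover have "card X2 <= length F * 3" unfolding X2_def by (rule order_trans[OF card_image_le]) (simp_all add: card_cartesian_product)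
   ultimately show ?thesis using card_Un_le[of X1 X2] card_length[of vl] by linarith
  qed
  moreover have half: "a : X1 \<union> X2 \<or> b : X1 \<union> X2" if ab: "a : ?Y" "b : ?Y" "half_adj F a b" for a b
  proof -
   obtain xs i q where a: "a = (xs,i,q)" by (cases a) auto
   obtain ys j r where b: "b = (ys,j,r)" by (cases b) auto
   show ?thesis
   proof (cases "xs = []")
    case xs: True
    have i: "i < length F" using ab(1) a xs by (simp add: nodes_mem)
    show ?thesis
    proof (cases "ys = []")
     case True
     hence "j = i" "(q,r) : set cyc" using ab(3) a b xs by (auto simp: half_adj_def)
     hence "q : set (cv (qf i)) \<or> r : set (cv (qf i))" by (auto simp: cyc_def cv_def)
     thus ?thesis using X2m[OF i] a b xs True \<open>j = i\<close> by auto
    next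
     case False
     let ?l = "lit F i q"
     have h: "q < 3" "r = q" "ys = [fst ?l]" "j = (if snd ?l then 1 else 0)" using ab(3) a b xs False by (auto simp: half_adj_def)
     show ?thesis
     proof (cases "q = qf i")
      case True
      hence "sg (fst ?l) = snd ?l" using qf[OF i] by simp
      thus ?thesis using X1m[OF lit(2)[OF i, of q] h(1)] h b by auto
     next
      case False
      hence "q : set (cv (qf i))" using h(1) qf[OF i] by (auto simp: cv_def numeral_eq_Suc less_Suc_eq)
      thus ?thesis using X2m[OF i] a xs by auto
     qed
    qed
   next
    case False
    then obtain v where v: "xs = [v]" "v : set vl" "q < 3" using ab(1) a by (auto simp: nodes_mem)
    have h: "ys = [v]" "i = 0" "j = 1" using ab(3) a b v by (auto simp: half_adj_def)
    hence "r < 3" using ab(2) b by (auto simp: nodes_mem)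
    thus ?thesis using X1m[OF v(2,3)] X1m[OF v(2), of r] h a b v(1) by (cases "sg v") auto
   qed
  qed
  ultimately show "\<exists>X\<subseteq>?Y. card X <= 3 * length vl + 3 * length F &
    (\<forall>a b. a : ?Y & b : ?Y & vadj F a b --> a : X \<or> b : X)"
   unfolding vadj_def by (intro exI[of _ "X1 \<union> X2"]) blast
 }
 assume "\<exists>X\<subseteq>?Y. card X <= 3 * length vl + 3 * length F &
   (\<forall>a b. a : ?Y & b : ?Y & vadj F a b --> a : X \<or> b : X)"
 then obtain X where X: "X \<subseteq> ?Y" "card X <= 3 * length vl + 3 * length F"
  "!!a b. a : ?Y ==> b : ?Y ==> half_adj F a b ==> a : X \<or> b : X" unfolding vadj_def by blast
 have fX: "finite X" using X(1) finite_subset by blast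
 define I where "I = (%v. ([v],0 :: nat)) ` set vl \<union> (%j. ([] :: 'a list,j)) ` {..<length F}"
 have cI: "card I = length vl + length F"
 proof -
  have "card I = card ((%v. ([v],0 :: nat)) ` set vl) + card ((%j. ([] :: 'a list,j)) ` {..<length F})"
   unfolding I_def by (rule card_Un_disjoint) auto
  thus ?thesis using wf by (simp add: card_image inj_on_def wf3_def distinct_card)
 qed
 define S where "S v b = (%q. ([v],b :: nat,q :: nat)) ` {..<3}" for v :: 'a and b
 have Sc: "card (S v b) = 3" "finite (S v b)" for v b unfolding S_def by (simp_all add: card_image inj_on_def)
 have Sb: "x : S v b ==> blk_of x = ([v],0)" for x v b by (auto simp: S_def blk_of_def)
 have side: "S v 0 \<subseteq> X \<or> S v 1 \<subseteq> X" if v: "v : set vl" for v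
 proof (rule ccontr)
  assume "\<not> ?thesis"
  then obtain q r where "q < 3" "r < 3" "([v],0,q) ~: X" "([v],1,r) ~: X" by (auto simp: S_def)
  thus False using X(3)[of "([v],0,q)" "([v],1,r)"] v by (auto simp: nodes_mem half_adj_def)
 qed
 define P where "P j = {p. ([],j,p) : X}" for j
 have Pblk: "{x \<in> X. blk_of x = ([],j)} = (%p. ([],j,p)) ` P j" for j
  by (auto simp: P_def blk_of_def split: if_splits)
 have Pc: "card {x \<in> X. blk_of x = ([],j)} = card (P j)" for j unfolding Pblk by (rule card_image) (simp add: inj_on_def)
 have Pf: "finite (P j)" for j using finite_imageD[of "%p. ([] :: 'a list,j,p)" "P j"] fX unfolding Pblk[symmetric] by (simp add: inj_on_def)
 have Pe: "p : P j \<or> r : P j" if "j < length F" "(p,r) : set cyc" for j p r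
 proof -
  have "p < 5" "r < 5" using that(2) by (auto simp: cyc_def)
  thus ?thesis using X(3)[of "([],j,p)" "([],j,r)"] that by (auto simp: nodes_mem half_adj_def P_def)
 qed
 have Pcov: "3 <= card (P j)" "{0,1,2} \<subseteq> P j ==> 4 <= card (P j)" if j: "j < length F" for j
  using cycle_cover[of "P j"] Pe[OF j] Pf[of j] by (simp_all add: cyc_def)
 have ge3: "3 <= card {x \<in> X. blk_of x = i}" if "i : I" for i
 proof -
  from that consider v where "i = ([v],0)" "v : set vl" | j where "i = ([],j)" "j < length F" unfolding I_def by auto
  thus ?thesis
  proof cases
   case 1
   obtain b where "S v b \<subseteq> X" using side[OF 1(2)] by blast
   hence "S v b \<subseteq> {x \<in> X. blk_of x = i}" using Sb 1 by blast
   from card_mono[OF _ this] show ?thesis using fX Sc by simp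
  next
   case 2
   thus ?thesis using Pcov(1) Pc by simp
  qed
 qed
 have eq3: "card {x \<in> X. blk_of x = i} = 3" if "i : I" for i
  proof (rule card_blocks[OF fX _ ge3 _ that])
  show "finite I" by (simp add: I_def)
  show "card X <= 3 * card I" using X(2) cI by simp
 qed
 define sg where "sg v \<longleftrightarrow> S v 1 \<subseteq> X" for v
 have val: "sg v = b" if v: "v : set vl" "q < 3" "([v],if b then 1 else 0,q) : X" for v b q
 proof -
  have I: "([v],0) : I" using v by (auto simp: I_def)
  have only: "x : S v c" if "S v c \<subseteq> X" "x : X" "blk_of x = ([v],0)" for c x
  proof -
   have "S v c = {x \<in> X. blk_of x = ([v],0)}"
    by (rule card_subset_eq) (use fX that(1) Sb Sc eq3[OF I] in auto)
   thus ?thesis using that by blast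
  qed
  have bk: "blk_of ([v],if b then 1 else 0,q) = ([v],0)" by (simp add: blk_of_def)
  show ?thesis
  proof (cases b)
   case True
   have "\<not> S v 0 \<subseteq> X" using only[OF _ v(3) bk, of 0] True by (auto simp: S_def)
   thus ?thesis using side[OF v(1)] True by (simp add: sg_def)
  next
   case False
   have "\<not> S v 1 \<subseteq> X" using only[OF _ v(3) bk, of 1] False by (auto simp: S_def)
   thus ?thesis using False by (simp add: sg_def)
  qed
 qed
 show "sat F" unfolding sat_def
 proof (intro exI[of _ sg] ballI)
  fix c assume "c : set F"
  then obtain j where j: "j < length F" "c = F ! j" by (auto simp: in_set_conv_nth)
  have "([],j) : I" using j by (auto simp: I_def)
  hence "card (P j) = 3" using eq3 Pc by metis
  hence "\<not> {0,1,2} \<subseteq> P j" using Pcov(2)[OF j(1)] by auto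
  hence "0 ~: P j \<or> 1 ~: P j \<or> 2 ~: P j" by auto
  moreover have "(0::nat) < 3" "(1::nat) < 3" "(2::nat) < 3" by auto
  ultimately obtain q where q: "q < 3" "q ~: P j" by blast
  let ?l = "lit F j q" and ?n = "([fst (lit F j q)],if snd (lit F j q) then 1 else 0 :: nat,q)"
  have "?n : ?Y" using lit(2)[OF j(1)] q by (auto simp: nodes_mem)
  moreover have "([],j,q) : ?Y" using j q by (simp add: nodes_mem)
  moreover have "half_adj F ([],j,q) ?n" using q by (simp add: half_adj_def)
  ultimately have "?n : X" using X(3) q(2) unfolding P_def by blast
  hence "sg (fst ?l) = snd ?l" using val[OF lit(2)[OF j(1)] q(1)] by blast
  thus "\<exists>l\<in>set c. sg (fst l) = snd l" using lit(1)[OF j(1)] j(2) by blast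
 qed
qed

section \<open>The reduction in polynomial time\<close>

definition mkgraph :: "'l list => ('l => 'l => bool) => nat pair_pre_digraph" where
 "mkgraph L R = \<lparr>pverts = {..<length L},parcs = {(i,j). i < length L & j < length L & R (L ! i) (L ! j)}\<rparr>"

lemma pair_graphI:
 assumes "finite V" "!!x y. (x,y) : E ==> x : V & y : V" "!!x y. (x,y) : E ==> (y,x) : E" "!!x. (x,x) ~: E"
 shows "pair_graph \<lparr>pverts = V,parcs = E\<rparr>" (is "pair_graph ?G")
proof unfold_locales
 show "finite (pverts ?G)" using assms(1) by simp
 show "finite (parcs ?G)" proof -
  have "E \<subseteq> V \<times> V" by (rule subrelI) (use assms(2) in blast)
  thus ?thesis using finite_subset[of E "V \<times> V"] assms(1) by simp
 qed
 show "symmetric (with_proj ?G)" using assms(3) by (auto simp: symmetric_def intro!: symI)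
 fix e assume e: "e : parcs ?G"
 obtain x y where xy: "e = (x,y)" by (cases e)
 show "fst e : pverts ?G" "snd e : pverts ?G" using e assms(2) by (auto simp: xy)
 show "fst e ~= snd e" using e assms(4) by (auto simp: xy)
qed

lemma mkgraph_input:
 assumes "!!x y. x : set L ==> y : set L ==> R x y ==> R y x" "!!x. x : set L ==> \<not> R x x"
 shows "input_graph (mkgraph L R)"
proof -
 have "pair_graph (mkgraph L R)" unfolding mkgraph_def
  by (rule pair_graphI) (use assms in auto)
 thus ?thesis by (simp add: input_graph_def mkgraph_def)
qed

lemma encode_mkgraph:
 "encode_instance (mkgraph L R) k = unary (length L) @ map (%e. R (fst e) (snd e)) (List.product L L) @ nat_bits k"
proof -
 have "map (%e. e : parcs (mkgraph L R)) (List.product [0..<length L] [0..<length L]) =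
   map (%e. R (L ! fst e) (L ! snd e)) (List.product [0..<length L] [0..<length L])"
  by (rule map_cong) (auto simp: mkgraph_def)
 also have "\<dots> = map (%e. R (fst e) (snd e)) (map (%e. (L ! fst e,L ! snd e)) (List.product [0..<length L] [0..<length L]))"
  by simp
 also have "map (%e. (L ! fst e,L ! snd e)) (List.product [0..<length L] [0..<length L]) =
   List.product (map ((!) L) [0..<length L]) (map ((!) L) [0..<length L])"
  unfolding product_concat_map by (simp add: map_concat comp_def)
 finally show ?thesis by (simp add: encode_instance_def mkgraph_def map_nth)
qed

lemma subdividable_iso:
 assumes H: "pair_graph H" and H': "pair_graph H'" and G: "pair_graph G" and b: "bij_betw bt (pverts H) (pverts H')"
  and e: "!!x y. x : pverts H ==> y : pverts H ==> (bt x,bt y) : parcs H' \<longleftrightarrow> (x,y) : parcs H"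
 shows "subdividable_to_free H G k \<longleftrightarrow> subdividable_to_free H' G k"
proof -
 have img: "pverts H' = bt ` pverts H" and inj: "inj_on bt (pverts H)" using b by (auto simp: bij_betw_def)
 have "(\<exists>ph. copy ph H G') \<longleftrightarrow> (\<exists>ph. copy ph H' G')" for G' :: "'c pair_pre_digraph"
 proof
  assume "\<exists>ph. copy ph H G'"
  then obtain ph where c: "copy ph H G'" by blast
  define \<gamma> where "\<gamma> = inv_into (pverts H) bt"
  have g: "\<gamma> (bt x) = x" if "x : pverts H" for x using inj that by (simp add: \<gamma>_def)
  have "copy (%z. ph (\<gamma> z)) H' G'"
   using c g e inj unfolding copy_def img by (auto simp: inj_on_def)
  thus "\<exists>ph. copy ph H' G'" by blast
 next
  assume "\<exists>ph. copy ph H' G'"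
  then obtain ph where "copy ph H' G'" by blast
  hence "copy (%z. ph (bt z)) H G'"
   using e inj unfolding copy_def img by (auto simp: inj_on_def)
  thus "\<exists>ph. copy ph H G'" by blast
 qed
 hence "induced_free H G' \<longleftrightarrow> induced_free H' G'" if "(edge_subdivision ^^ j) G G'" for j G'
  using induced_free_copy[OF H subdivisions_graph[OF G that]] induced_free_copy[OF H' subdivisions_graph[OF G that]] by simp
 thus ?thesis unfolding subdividable_to_free_def by blast
qed

definition bitstep :: "nat * bool list => nat * bool list" where
 "bitstep s = (if fst s = 0 then s else (fst s div 2,snd s @ [odd (fst s)]))"

lemma pt_nat_bits: assumes "ptime n" shows "ptime (%x. nat_bits (n x))"
proof -
 have st: "(bitstep ^^ i) (k,acc) = (k div 2 ^ i,acc @ take i (nat_bits k))" for i k acc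
 proof (induction i arbitrary: k acc)
  case (Suc i)
  show ?case
  proof (cases "k = 0")
   case True
   thus ?thesis using Suc[of 0 acc] by (simp add: bitstep_def funpow_swap1 nat_bits.simps[of 0])
  next
   case False
   have "(bitstep ^^ Suc i) (k,acc) = (bitstep ^^ i) (k div 2,acc @ [odd k])"
    using False by (simp add: funpow_swap1 bitstep_def)
   thus ?thesis using Suc[of "k div 2" "acc @ [odd k]"] False
    by (simp add: nat_bits.simps[of k] div_mult2_eq)
  qed
 qed simp
 have len: "length (nat_bits k) <= k" for k
 proof (induction k rule: less_induct)
  case (less k)
  show ?case
  proof (cases "k = 0")
   case False
   hence "length (nat_bits (k div 2)) <= k div 2" using less by simp
   thus ?thesis using False by (subst nat_bits.simps) auto
  qed (simp add: nat_bits.simps)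
 qed
 have "ptime (%x. ((%s. bitstep s) ^^ n x) (n x,[]))"
 proof (rule pt_funpow[where B = "%x. tsz (n x) + 4 * tsz (n x) + 10"])
  show "ptime (%p. bitstep (fst p))" unfolding bitstep_def by (intro pt)
  show "pb (%x. tsz (n x) + 4 * tsz (n x) + 10)" by (intro pb_intros pb_ptime[OF assms])
  fix x i
  have a: "tsz (take i (nat_bits (n x))) <= 4 * n x + 1"
   using tsz_bits[of "take i (nat_bits (n x))"] len[of "n x"] by simp
  define d where "d = n x div 2 ^ i"
  have d: "d <= n x" by (simp add: d_def)
  show "tsz (((%s. bitstep s) ^^ i) (n x,[])) <= tsz (n x) + 4 * tsz (n x) + 10"
   unfolding st d_def[symmetric] using a d by simp
 qed (intro pt assms)+
 from pt_snd[OF this] show ?thesis using len by (simp add: st)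
qed

lemma pt_lit: assumes "ptime F" "ptime j" "ptime p" shows "ptime (%x. lit (F x) (j x) (p x))"
 unfolding lit_def by (intro pt assms)

lemma pt_vadj: assumes "ptime F" "ptime a" "ptime b" shows "ptime (%x. vadj (F x) (a x) (b x))"
 unfolding vadj_def half_adj_def by (intro pt pt_lit assms)

lemma pt_nodes: assumes "ptime vl" "ptime F" shows "ptime (%x. nodes (vl x) (F x))"
 unfolding nodes_def by (intro pt assms)

text \<open>Flat records with a leading tag, 0 for the hub, 1 for bags and 2 for the other
  components. They live in a type of class \<open>coded\<close>, unlike the labels they
  denote.\<close>

type_synonym 'x code = "nat \<times> nat \<times> 'x node list \<times> nat"

definition dec :: "'x code => ('x node,nat) gv + nat * nat" where
 "dec p = (if fst p = 0 then Inl Hub else if fst p = 1 then Inl (Bag (hd (fst (snd (snd p)))) (fst (snd p)))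
   else Inr (fst (snd p),snd (snd (snd p))))"

definition codes :: "nat list => nat list => 'x list => ('x * bool) list list => nat => 'x code list" where
 "codes Ms Ss vl F k = (0,0,[],0) # concat (map (%y. map (%m. (1,m,[y],0)) Ms) (nodes vl F)) @
   concat (map (%s. map (%i. (2,s,[],i)) [0..<Suc k]) Ss)"

definition cdadj :: "nat list => (nat * nat) list => nat list => nat => ('x * bool) list list => 'x code => 'x code => bool" where
 "cdadj Us Es Wl v F p q =
   (if fst p = 0 then fst q = 1 & fst (snd q) : set Us
   else if fst p = 1 then
    (if fst q = 0 then fst (snd p) : set Us
     else if fst q = 1 then
      fst (snd (snd p)) = fst (snd (snd q)) & (fst (snd p),fst (snd q)) : set Es \<or>
      fst (snd p) = v & fst (snd q) = v & vadj F (hd (fst (snd (snd p)))) (hd (fst (snd (snd q))))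
     else False)
   else fst q = 2 & (fst (snd p),fst (snd q)) : set Es &
    (fst (snd p) : set Wl \<or> snd (snd (snd p)) = snd (snd (snd q))))"

text \<open>The lists from \<open>Ms\<close> to \<open>Wl\<close> and the number \<open>v\<close>
  describe \<open>H\<close> and are constants of the program; only variables and clauses are its
  input.\<close>

definition redn :: "nat list => nat list => nat list => (nat * nat) list => nat list => nat => 'x list * ('x * bool) list list => bool list" where
 "redn Ms Ss Us Es Wl v x =
   (replicate (length (codes Ms Ss (fst x) (snd x) (3 * length (fst x) + 3 * length (snd x)))) True @ [False]) @
   map (%e. cdadj Us Es Wl v (snd x) (fst e) (snd e))
    (List.product (codes Ms Ss (fst x) (snd x) (3 * length (fst x) + 3 * length (snd x)))
     (codes Ms Ss (fst x) (snd x) (3 * length (fst x) + 3 * length (snd x)))) @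
   nat_bits (3 * length (fst x) + 3 * length (snd x))"

lemma pt_codes: assumes "ptime vl" "ptime F" "ptime k" shows "ptime (%x. codes Ms Ss (vl x) (F x) (k x))"
 unfolding codes_def by (intro pt pt_nodes assms pt_comp[OF assms(3)])

lemma pt_redn: "ptime (redn Ms Ss Us Es Wl v :: 'x::coded list \<times> ('x \<times> bool) list list => bool list)"
proof -
 have "ptime (%x :: 'x::coded list \<times> ('x \<times> bool) list list. redn Ms Ss Us Es Wl v x)"
  unfolding redn_def cdadj_def by (intro pt pt_codes pt_nat_bits pt_vadj)
 thus ?thesis by simp
qed

lemma distinct_concat_map:
 "distinct xs ==> distinct ys ==> (!!x y x' y'. g x y = g x' y' \<longleftrightarrow> x = x' & y = y') ==> distinct (concat (map (%x. map (g x) ys) xs))"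
 by (induction xs) (auto simp: distinct_map inj_on_def)

lemma set_concat_map: "set (concat (map (%x. map (g x) ys) xs)) = (%p. g (fst p) (snd p)) ` (set xs \<times> set ys)"
proof (induction xs)
 case (Cons x xs)
 have "set (x # xs) \<times> set ys = Pair x ` set ys \<union> set xs \<times> set ys" by auto
 thus ?case using Cons by (simp add: image_Un image_image del: set_simps(2))
qed simp

theorem redn_correct:
 fixes vl :: "'x list"
 assumes T: "target V C A u v w" and H: "pair_graph H" "pverts H = V" "!!x y. (x,y) : parcs H \<longleftrightarrow> A x y"
  and Ms: "set Ms = C - {u,w}" "distinct Ms" and Ss: "set Ss = V - C" "distinct Ss" and Us: "set Us = {m. A u m}"
  and Es: "set Es = {(x,y). A x y}" and Wl: "set Wl = target.W V C A" and wf: "wf3 vl F"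
 defines "k \<equiv> 3 * length vl + 3 * length F"
 shows "\<exists>G. input_graph G & redn Ms Ss Us Es Wl v (vl,F) = encode_instance G k & (subdividable_to_free H G k \<longleftrightarrow> sat F)"
proof -
 interpret target V C A u v w by (rule T)
 let ?Y = "set (nodes vl F)"
 define B where "B a b \<longleftrightarrow> a : ?Y & b : ?Y & vadj F a b" for a b
 define L where "L = codes Ms Ss vl F k"
 define R where "R = cdadj Us Es Wl v F"
 define G where "G = mkgraph L R"
 have dl: "distinct vl" using wf by (simp add: wf3_def)
 have Lm: "p : set L \<longleftrightarrow> p = (0,0,[],0) \<or> (\<exists>y m. p = (1,m,[y],0) & y : ?Y & m : C - {u,w}) \<or>
   (\<exists>s i. p = (2,s,[],i) & s : V - C & i <= k)" for p
  unfolding L_def codes_def using Ms(1) Ss(1)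
  by (cases p) (auto simp del: upt_Suc simp: image_iff less_Suc_eq_le)
 have mdec: "map dec L = Inl Hub # concat (map (%y. map (%m. Inl (Bag y m)) Ms) (nodes vl F)) @
   concat (map (%s. map (%i. Inr (s,i)) [0..<Suc k]) Ss)"
  by (simp add: L_def codes_def dec_def map_concat comp_def del: upt_Suc)
 have d1: "distinct (concat (map (%y. map (%m. Inl (Bag y m) :: ('x node,nat) gv + nat \<times> nat) Ms) (nodes vl F)))"
  by (rule distinct_concat_map[OF distinct_nodes[OF dl] Ms(2)]) simp
 have d2: "distinct (concat (map (%s. map (%i. Inr (s,i) :: ('x node,nat) gv + nat \<times> nat) [0..<Suc k]) Ss))"
  by (rule distinct_concat_map[OF Ss(2) distinct_upt]) simp
 have "distinct (map dec L)"
  unfolding mdec distinct.simps distinct_append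
 proof (intro conjI)
  show "Inl Hub ~: set (concat (map (%y. map (%m. Inl (Bag y m)) Ms) (nodes vl F)) @ concat (map (%s. map (%i. Inr (s,i)) [0..<Suc k]) Ss))"
   by (auto simp del: upt_Suc)
  show "set (concat (map (%y. map (%m. Inl (Bag y m)) Ms) (nodes vl F))) \<inter> set (concat (map (%s. map (%i. Inr (s,i)) [0..<Suc k]) Ss)) = {}"
   by (auto simp del: upt_Suc)
 qed (use d1 d2 in blast)+
 moreover have "set (map dec L) = gverts ?Y {} k"
 proof -
  have "set (map dec L) = insert (Inl Hub) ((%p. Inl (Bag (fst p) (snd p))) ` (?Y \<times> set Ms) \<union> Inr ` (set Ss \<times> {..k}))"
   unfolding mdec set_simps(2) set_append set_concat_map
   by (simp add: atLeastLessThanSuc_atLeastAtMost atLeast0AtMost del: upt_Suc)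
  thus ?thesis unfolding Ms(1) Ss(1) gverts_def by (simp add: image_Un image_image case_prod_beta')
 qed
 ultimately have "bij_betw ((!) (map dec L)) {..<length L} (gverts ?Y {} k)"
  using bij_betw_nth[of "map dec L" "{..<length L}" "gverts ?Y {} k"] by simp
 hence bij: "bij_betw (%i. dec (L ! i)) {..<length L} (gverts ?Y {} k)"
  by (subst bij_betw_cong[where g = "(!) (map dec L)"]) simp_all
 have Rg: "R p q \<longleftrightarrow> gadj B {} (dec p) (dec q)" if "p : set L" "q : set L" for p q
  using that unfolding Lm by (elim disjE exE conjE)
   (use Us Es Wl inV neq in \<open>auto simp: R_def cdadj_def dec_def B_def dest: AV\<close>)
 have Bs: "B a b ==> B b a" "B a b ==> B b c ==> \<not> B a c" "B a b ==> a : ?Y & b : ?Y" for a b c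
  using vadj_sym vadj_triangle unfolding B_def by blast+
 have Birr: "\<not> B a a" for a using Bs(2)[of a a a] by blast
 have adjs: "adj B {} p q ==> adj B {} q p" for p q
  by (cases p; cases q; simp; (use Asym Bs(1) in blast)?)
 have gs: "gadj B {} p q ==> gadj B {} q p" for p q
 proof -
  assume g: "gadj B {} p q"
  show "gadj B {} q p"
  proof (cases p)
   case (Inl a)
   then obtain b where "q = Inl b" using g by (cases q) auto
   thus ?thesis using g Inl adjs[of a b] by simp
  next
   case (Inr a)
   obtain s i where a: "a = (s,i)" by (cases a)
   obtain t j where q: "q = Inr (t,j)" using g Inr a by (cases q) auto
   have "A s t" "s : W \<or> i = j" using g Inr a q by simp_all
   thus ?thesis using Inr a q VAsym[of s t] W_step[of s t] by auto
  qed
 qed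
 have gi: "\<not> gadj B {} p p" for p
 proof (cases p)
  case (Inl a) thus ?thesis using Birr Airr by (cases a) auto
 next
  case (Inr b) thus ?thesis using pair_graph_facts(4)[OF H(1)] H(3) by (cases b) auto
 qed
 have inp: "input_graph G" unfolding G_def
  by (rule mkgraph_input) (use Rg gs gi in blast)+
 hence pg: "pair_graph G" by (simp add: input_graph_def)
 have lab: "labelled B {} ?Y k G (%i. dec (L ! i))"
  unfolding labelled_def G_def using bij Rg by (auto simp: mkgraph_def)
 have "subdividable_to_free H G k \<longleftrightarrow> (\<exists>X\<subseteq>?Y. card X <= k & (\<forall>p q. B p q --> p : X \<or> q : X))"
  by (rule reduction[OF H Bs pg lab]) auto
 also have "\<dots> \<longleftrightarrow> sat F" using vc_sat[OF wf] unfolding B_def k_def by blast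
 finally have "subdividable_to_free H G k \<longleftrightarrow> sat F" .
 moreover have "redn Ms Ss Us Es Wl v (vl,F) = encode_instance G k"
  unfolding G_def encode_mkgraph by (simp add: redn_def L_def R_def k_def unary_def)
 ultimately show ?thesis using inp by blast
qed

theorem main_reduction:
 fixes H :: "'a pair_pre_digraph"
 assumes H: "pair_graph H"
  and tri: "(\<exists>T. roof_triangle H T) \<or>
     (\<exists>S T. S ~= T & hanging_triangle H S & hanging_triangle H T &
      (\<exists>a\<in>attachment_vertices H S. \<exists>b\<in>attachment_vertices H T. (a,b) : parcs H))"
 shows "\<exists>r :: 'x::coded list \<times> ('x \<times> bool) list list => bool list. ptime r & (\<forall>vl F. wf3 vl F -->
  (\<exists>G. input_graph G & r (vl,F) = encode_instance G (3 * length vl + 3 * length F) &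
   (subdividable_to_free H G (3 * length vl + 3 * length F) \<longleftrightarrow> sat F)))"
proof -
 note f = pair_graph_facts[OF H]
 obtain u v w where t: "(u,v) : parcs H" "(u,w) : parcs H" "(v,w) : parcs H" "!!x. (w,x) : parcs H ==> x = u \<or> x = v"
  using low_triangle[OF H tri] by blast
 \<comment> \<open>The vertices of \<open>H\<close> are renumbered by naturals so that they can
   occur in encodable codes.\<close>
 obtain bt :: "'a => nat" where b: "bij_betw bt (pverts H) {..<card (pverts H)}"
  using ex_bij_betw_finite_nat[OF f(1)] by (auto simp: atLeast0LessThan)
 have inj: "inj_on bt (pverts H)" and img: "bt ` pverts H = {..<card (pverts H)}" using b by (auto simp: bij_betw_def)
 define H0 where "H0 = \<lparr>pverts = bt ` pverts H,parcs = (%e. (bt (fst e),bt (snd e))) ` parcs H\<rparr>"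
 have e0: "(bt x,bt y) : parcs H0 \<longleftrightarrow> (x,y) : parcs H" if "x : pverts H" "y : pverts H" for x y
 proof
  assume "(bt x,bt y) : parcs H0"
  then obtain a b where ab: "(a,b) : parcs H" "bt x = bt a" "bt y = bt b" by (auto simp: H0_def)
  hence "x = a" "y = b" using inj_onD[OF inj] that f(2)[OF ab(1)] by auto
  thus "(x,y) : parcs H" using ab by simp
 qed (force simp: H0_def)
 have fin: "finite (parcs H)" using f(1,2) by (intro finite_subset[of "parcs H" "pverts H \<times> pverts H"]) auto
 have H0: "pair_graph H0" unfolding H0_def
 proof (rule pair_graphI)
  show "finite (bt ` pverts H)" using f(1) by simp
  fix p q assume pq: "(p,q) : (%e. (bt (fst e),bt (snd e))) ` parcs H"
  then obtain x y where "(x,y) : parcs H" "p = bt x" "q = bt y" by auto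
  thus "p : bt ` pverts H & q : bt ` pverts H" "(q,p) : (%e. (bt (fst e),bt (snd e))) ` parcs H"
   using f(2)[of x y] image_eqI[of _ "%e. (bt (fst e),bt (snd e))" "(y,x)"] f(3)[of x y] by auto
 next
  fix p show "(p,p) ~: (%e. (bt (fst e),bt (snd e))) ` parcs H"
  proof
   assume "(p,p) : (%e. (bt (fst e),bt (snd e))) ` parcs H"
   then obtain x y where xy: "(x,y) : parcs H" "bt x = bt y" by auto
   hence "x = y" using inj_onD[OF inj] f(2)[OF xy(1)] by blast
   thus False using xy f(4) by simp
  qed
 qed
 have b0: "bij_betw bt (pverts H) (pverts H0)" using inj by (simp add: bij_betw_def H0_def)
 have "(bt w,x) : parcs H0 ==> x = bt u \<or> x = bt v" for x
 proof -
  assume "(bt w,x) : parcs H0"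
  then obtain a b where ab: "(a,b) : parcs H" "bt w = bt a" "x = bt b" by (auto simp: H0_def)
  hence "w = a" using inj_onD[OF inj] f(2)[OF ab(1)] f(2)[OF t(2)] by auto
  thus ?thesis using t(4) ab by auto
 qed
 moreover have "(bt u,bt v) : parcs H0" "(bt u,bt w) : parcs H0" "(bt v,bt w) : parcs H0"
  using t(1-3) f(2) e0 by blast+
 ultimately obtain C u' v' where T: "target (pverts H0) C (%x y. (x,y) : parcs H0) u' v' (bt w)"
  using obtain_target[OF H0, of "bt u" "bt v" "bt w"] by blast
 let ?A = "%x y. (x,y) : parcs H0"
 note f0 = pair_graph_facts[OF H0]
 have fp: "finite (parcs H0)" using fin by (simp add: H0_def)
 obtain Ms where Ms: "set Ms = C - {u',bt w}" "distinct Ms"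
  using finite_distinct_list[of "C - {u',bt w}"] target.CV[OF T] f0(1) by (meson finite_Diff finite_subset)
 obtain Ss where Ss: "set Ss = pverts H0 - C" "distinct Ss"
  using finite_distinct_list[of "pverts H0 - C"] f0(1) by (meson finite_Diff)
 obtain Us where Us: "set Us = {m. ?A u' m}"
 proof -
  have "{m. ?A u' m} \<subseteq> pverts H0" using f0(2) by auto
  thus thesis using that finite_list[OF finite_subset[OF _ f0(1)]] by blast
 qed
 obtain Es where Es: "set Es = {(x,y). ?A x y}" using finite_list[OF fp] by auto
 obtain Wl where Wl: "set Wl = target.W (pverts H0) C ?A"
 proof -
  have "target.W (pverts H0) C ?A \<subseteq> pverts H0" using target.W_def[OF T] target.rich_def[OF T] by auto
  thus thesis using that finite_list[OF finite_subset[OF _ f0(1)]] by blast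
 qed
 show ?thesis
 proof (intro exI[of _ "redn Ms Ss Us Es Wl v'"] conjI allI impI)
  show "ptime (redn Ms Ss Us Es Wl v' :: 'x list \<times> ('x \<times> bool) list list => bool list)" by (rule pt_redn)
  fix vl :: "'x list" and F assume wf: "wf3 vl F"
  obtain G where G: "input_graph G" "redn Ms Ss Us Es Wl v' (vl,F) = encode_instance G (3 * length vl + 3 * length F)"
   "subdividable_to_free H0 G (3 * length vl + 3 * length F) \<longleftrightarrow> sat F"
   using redn_correct[OF T H0 refl _ Ms Ss Us Es Wl wf] by blast
  have "subdividable_to_free H G (3 * length vl + 3 * length F) \<longleftrightarrow> subdividable_to_free H0 G (3 * length vl + 3 * length F)"
   by (rule subdividable_iso[OF H H0 _ b0 e0]) (use G(1) in \<open>simp_all add: input_graph_def\<close>)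
  thus "\<exists>G. input_graph G & redn Ms Ss Us Es Wl v' (vl,F) = encode_instance G (3 * length vl + 3 * length F) &
   (subdividable_to_free H G (3 * length vl + 3 * length F) \<longleftrightarrow> sat F)" using G by blast
 qed
qed

section \<open>Machine runs as formulas\<close>

text \<open>A halted machine rewrites what it reads, so every run has exactly \<open>T\<close> steps
  and the formula treats halting like any other state.\<close>

definition tstep :: "turing_machine => nat => nat list => nat * (nat * direction) list" where
 "tstep M q gs = (if q = num_states M then (q,map (%g. (g,Stay)) gs) else transition M q gs)"

definition reading :: "tape list => nat list" where
 "reading ts = map (%t. fst t (snd t)) ts"

definition okcfg :: "turing_machine => nat => config => bool" where
 "okcfg M b c \<longleftrightarrow> fst c <= num_states M & length (snd c) = num_tapes M &
   (\<forall>i<num_tapes M. (\<forall>h. fst (snd c ! i) h < num_symbols M) & \<bar>snd (snd c ! i)\<bar> <= int b)"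

lemma tstep_ok:
 assumes M: "turing_machine M" and c: "okcfg M b c"
 shows "fst (tstep M (fst c) (reading (snd c))) <= num_states M"
  "length (snd (tstep M (fst c) (reading (snd c)))) = num_tapes M"
  "i < num_tapes M ==> fst (snd (tstep M (fst c) (reading (snd c))) ! i) < num_symbols M"
proof -
 let ?gs = "reading (snd c)"
 have l: "length ?gs = num_tapes M" using c by (simp add: reading_def okcfg_def)
 have n: "?gs ! i < num_symbols M" if "i < num_tapes M" for i
  using c that by (simp add: reading_def okcfg_def)
 have s: "set ?gs \<subseteq> {..<num_symbols M}" using n l by (auto simp: in_set_conv_nth)
 have "fst (tstep M (fst c) ?gs) <= num_states M & length (snd (tstep M (fst c) ?gs)) = num_tapes M &
   (i < num_tapes M --> fst (snd (tstep M (fst c) ?gs) ! i) < num_symbols M)"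
 proof (cases "fst c = num_states M")
  case True thus ?thesis using l n by (simp add: tstep_def)
 next
  case False
  hence qlt: "fst c < num_states M" using c by (simp add: okcfg_def)
  have tm: "\<forall>q gs. q < num_states M & length gs = num_tapes M & set gs \<subseteq> {..<num_symbols M} -->
    (case transition M q gs of (q',as) =>
      q' <= num_states M & length as = num_tapes M & fst ` set as \<subseteq> {..<num_symbols M})"
   using M[unfolded turing_machine_def, THEN conjunct2, THEN conjunct2] .
  obtain q' as where tr: "transition M (fst c) ?gs = (q',as)" by (cases "transition M (fst c) ?gs")
  have "q' <= num_states M & length as = num_tapes M & fst ` set as \<subseteq> {..<num_symbols M}"
   using tm[THEN spec, THEN spec, THEN mp, OF conjI[OF qlt conjI[OF l s]]] unfolding tr prod.case .
  hence *: "q' <= num_states M" "length as = num_tapes M" "fst ` set as \<subseteq> {..<num_symbols M}" by blast+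
  have "fst (as ! i) < num_symbols M" if i: "i < num_tapes M"
  proof -
   have "as ! i : set as" using i *(2) by simp
   hence "fst (as ! i) : {..<num_symbols M}" using *(3) by blast
   thus ?thesis by simp
  qed
  thus ?thesis using False *(1,2) by (simp add: tstep_def tr)
 qed
 thus "fst (tstep M (fst c) ?gs) <= num_states M" "length (snd (tstep M (fst c) ?gs)) = num_tapes M"
  "i < num_tapes M ==> fst (snd (tstep M (fst c) ?gs) ! i) < num_symbols M" by auto
qed

lemma act_alt: "act p t = ((fst t)(snd t := fst p),snd t + offset (snd p))"
 by (cases p; cases t) (simp add: act_def)

lemma step_tstep:
 assumes c: "okcfg M b c"
 shows "step M c = (fst (tstep M (fst c) (reading (snd c))),map2 act (snd (tstep M (fst c) (reading (snd c)))) (snd c))"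
proof -
 obtain q ts where c': "c = (q,ts)" by (cases c)
 have rd: "map (%(c,h). c h) ts = reading ts" by (simp add: reading_def case_prod_beta)
 have st: "map2 act (map (%g. (g,Stay)) (reading ts)) ts = ts"
  by (rule nth_equalityI) (auto simp: reading_def act_alt)
 show ?thesis unfolding c' by (simp add: step_def tstep_def rd st split: prod.splits)
qed

lemma step_facts:
 assumes M: "turing_machine M" and c: "okcfg M b c"
 defines "a \<equiv> tstep M (fst c) (reading (snd c))"
 shows "fst (step M c) = fst a" "okcfg M (Suc b) (step M c)"
  "i < num_tapes M ==> snd (step M c) ! i = ((fst (snd c ! i))(snd (snd c ! i) := fst (snd a ! i)),snd (snd c ! i) + offset (snd (snd a ! i)))"
proof -
 note t = tstep_ok[OF M c, folded a_def] and s = step_tstep[OF c, folded a_def]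
 have l: "length (snd c) = num_tapes M" using c by (simp add: okcfg_def)
 show "fst (step M c) = fst a" by (simp add: s)
 have e: "snd (step M c) ! i = ((fst (snd c ! i))(snd (snd c ! i) := fst (snd a ! i)),snd (snd c ! i) + offset (snd (snd a ! i)))"
  if "i < num_tapes M" for i using that t(2) l by (simp add: s act_alt)
 thus "i < num_tapes M ==> snd (step M c) ! i = ((fst (snd c ! i))(snd (snd c ! i) := fst (snd a ! i)),snd (snd c ! i) + offset (snd (snd a ! i)))" .
 have o: "\<bar>offset d\<bar> <= 1" for d by (cases d) auto
 show "okcfg M (Suc b) (step M c)" unfolding okcfg_def
 proof (intro conjI allI impI)
  show "fst (step M c) <= num_states M" using t(1) by (simp add: s)
  show "length (snd (step M c)) = num_tapes M" using t(2) l by (simp add: s)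
  fix i assume i: "i < num_tapes M"
  show "fst (snd (step M c) ! i) h < num_symbols M" for h
   using c t(3)[OF i] i by (simp add: e okcfg_def)
  have "\<bar>snd (snd c ! i)\<bar> <= int b" using c i by (simp add: okcfg_def)
  thus "\<bar>snd (snd (step M c) ! i)\<bar> <= int (Suc b)" using o[of "snd (snd a ! i)"] by (simp add: e[OF i])
 qed
qed

text \<open>Propositional variables are number lists with a leading tag, followed by the time:
  state, head position, cell content, scanned symbol, scanned word, action.\<close>

definition vQ :: "nat => nat => nat list" where "vQ t q = [0,t,q]"
definition vP :: "nat => nat => nat => nat list" where "vP t i h = [1,t,i,h]"
definition vC :: "nat => nat => nat => nat => nat list" where "vC t i h g = [2,t,i,h,g]"
definition vS :: "nat => nat => nat => nat list" where "vS t i g = [3,t,i,g]"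
text \<open>Collects the symbols scanned on the first tapes one at a time. This breaks a transition
  depending on all tapes into clauses of at most 3 literals.\<close>

definition vW :: "nat => nat => nat list => nat list" where "vW t q gs = 4 # t # q # gs"
definition vA :: "nat => nat => nat => nat => nat list" where "vA t i g d = [5,t,i,g,d]"

definition imp1 :: "'x => 'x => ('x * bool) list" where "imp1 a c = [(a,False),(c,True)]"
definition imp2 :: "'x => 'x => 'x => ('x * bool) list" where "imp2 a b c = [(a,False),(b,False),(c,True)]"

definition sats :: "('x => bool) => ('x * bool) list list => bool" where
 "sats sg F \<longleftrightarrow> (\<forall>c\<in>set F. \<exists>l\<in>set c. sg (fst l) = snd l)"

lemma sats_simps[simp]: "sats sg (F @ G) \<longleftrightarrow> sats sg F & sats sg G" "sats sg []" "sats sg (c # F) \<longleftrightarrow> (\<exists>l\<in>set c. sg (fst l) = snd l) & sats sg F"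
 by (auto simp: sats_def)

lemma sats_map: "sats sg (map f L) \<longleftrightarrow> (\<forall>y\<in>set L. \<exists>l\<in>set (f y). sg (fst l) = snd l)"
 by (auto simp: sats_def)

lemma imp_sat[simp]: "(\<exists>l\<in>set (imp1 a c). sg (fst l) = snd l) \<longleftrightarrow> (sg a --> sg c)"
 "(\<exists>l\<in>set (imp2 a b c). sg (fst l) = snd l) \<longleftrightarrow> (sg a & sg b --> sg c)"
 by (auto simp: imp1_def imp2_def)

fun dcode :: "direction => nat" where "dcode Left = 0" | "dcode Stay = 1" | "dcode Right = 2"

lemma dcode_offset: "int (dcode d) = offset d + 1" "dcode d < 3" by (cases d; simp)+

definition words :: "turing_machine => nat => nat list list" where
 "words M l = List.n_lists l [0..<num_symbols M]"

definition rules :: "turing_machine => (nat * nat list) list" where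
 "rules M = List.product [0..<Suc (num_states M)] (words M (num_tapes M))"

definition state_table :: "turing_machine => (nat * nat list * nat) list" where
 "state_table M = map (%(q,gs). (q,gs,fst (tstep M q gs))) (rules M)"

definition action_table :: "turing_machine => (nat * nat list * nat * nat * nat) list" where
 "action_table M = map (%((q,gs),i). (q,gs,i,fst (snd (tstep M q gs) ! i),dcode (snd (snd (tstep M q gs) ! i))))
   (List.product (rules M) [0..<num_tapes M])"

definition prefixes :: "turing_machine => (nat * nat list) list" where
 "prefixes M = List.product [0..<Suc (num_states M)] (concat (map (words M) [0..<num_tapes M]))"

text \<open>The clauses on the run are implications forward in time and demand no uniqueness: a
  satisfying assignment must make true whatever happens in the real run, and the last clause forbids
  the answer \<open>False\<close>. Positions are shifted by \<open>Z\<close> to become naturals. The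
  \<open>P\<close> cells behind \<open>y\<close> are left open for the certificate, with the blanks
  forced to form a suffix. The tautology for \<open>h = h'\<close> spares a filter.\<close>

definition formula :: "turing_machine => nat => nat => bool list => nat => (nat list * bool) list list" where
 "formula M T Z y P =
  map (%(t,i,h,g). imp2 (vP t i h) (vC t i h g) (vS t i g))
   (List.product [0..<T] (List.product [0..<num_tapes M] (List.product [0..<2 * Z + 1] [0..<num_symbols M]))) @
  map (%(t,q). imp1 (vQ t q) (vW t q [])) (List.product [0..<T] [0..<Suc (num_states M)]) @
  map (%(t,p,g). imp2 (vW t (fst p) (snd p)) (vS t (length (snd p)) g) (vW t (fst p) (snd p @ [g])))
   (List.product [0..<T] (List.product (prefixes M) [0..<num_symbols M])) @
  map (%(t,q,gs,q'). imp1 (vW t q gs) (vQ (Suc t) q')) (List.product [0..<T] (state_table M)) @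
  map (%(t,q,gs,i,g,d). imp1 (vW t q gs) (vA t i g d)) (List.product [0..<T] (action_table M)) @
  map (%(t,i,h,g,d). imp2 (vA t i g d) (vP t i h) (vP (Suc t) i (h + d - 1)))
   (List.product [0..<T] (List.product [0..<num_tapes M] (List.product [0..<2 * Z + 1] (List.product [0..<num_symbols M] [0,1,2])))) @
  map (%(t,i,h,g,d). imp2 (vA t i g d) (vP t i h) (vC (Suc t) i h g))
   (List.product [0..<T] (List.product [0..<num_tapes M] (List.product [0..<2 * Z + 1] (List.product [0..<num_symbols M] [0,1,2])))) @
  map (%(t,i,h,h',g). if h = h' then imp1 (vP t i h) (vP t i h) else imp2 (vP t i h) (vC t i h' g) (vC (Suc t) i h' g))
   (List.product [0..<T] (List.product [0..<num_tapes M] (List.product [0..<2 * Z + 1] (List.product [0..<2 * Z + 1] [0..<num_symbols M])))) @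
  [[(vQ 0 0,True)]] @
  map (%i. [(vP 0 i Z,True)]) [0..<num_tapes M] @
  map (%(i,h). [(vC 0 i h 0,True)]) (List.product [1..<num_tapes M] [0..<2 * Z + 1]) @
  map (%h. [(vC 0 0 h 0,True)]) ([0..<Z] @ [Z + length y + P..<2 * Z + 1]) @
  map (%j. [(vC 0 0 (Z + j) (if nthd False y j then 2 else 1),True)]) [0..<length y] @
  map (%j. [(vC 0 0 (Z + length y + j) 0,True),(vC 0 0 (Z + length y + j) 1,True),(vC 0 0 (Z + length y + j) 2,True)]) [0..<P] @
  map (%j. imp1 (vC 0 0 (Z + length y + j) 0) (vC 0 0 (Z + length y + Suc j) 0)) [0..<P] @
  [[(vC T 1 Z 1,False)]]"

lemma set_words: "gs : set (words M l) \<longleftrightarrow> length gs = l & set gs \<subseteq> {..<num_symbols M}"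
 by (auto simp: words_def set_n_lists)

lemma sats_formula:
 "sats sg (formula M T Z y P) \<longleftrightarrow>
  (\<forall>t<T. \<forall>i<num_tapes M. \<forall>h\<le>2 * Z. \<forall>g<num_symbols M. sg (vP t i h) & sg (vC t i h g) --> sg (vS t i g)) &
  (\<forall>t<T. \<forall>q\<le>num_states M. sg (vQ t q) --> sg (vW t q [])) &
  (\<forall>t<T. \<forall>q\<le>num_states M. \<forall>gs. length gs < num_tapes M & set gs \<subseteq> {..<num_symbols M} -->
    (\<forall>g<num_symbols M. sg (vW t q gs) & sg (vS t (length gs) g) --> sg (vW t q (gs @ [g])))) &
  (\<forall>t<T. \<forall>q\<le>num_states M. \<forall>gs. length gs = num_tapes M & set gs \<subseteq> {..<num_symbols M} -->
    sg (vW t q gs) --> sg (vQ (Suc t) (fst (tstep M q gs)))) &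
  (\<forall>t<T. \<forall>q\<le>num_states M. \<forall>gs. length gs = num_tapes M & set gs \<subseteq> {..<num_symbols M} -->
    (\<forall>i<num_tapes M. sg (vW t q gs) --> sg (vA t i (fst (snd (tstep M q gs) ! i)) (dcode (snd (snd (tstep M q gs) ! i)))))) &
  (\<forall>t<T. \<forall>i<num_tapes M. \<forall>h\<le>2 * Z. \<forall>g<num_symbols M. \<forall>d<3. sg (vA t i g d) & sg (vP t i h) --> sg (vP (Suc t) i (h + d - 1))) &
  (\<forall>t<T. \<forall>i<num_tapes M. \<forall>h\<le>2 * Z. \<forall>g<num_symbols M. \<forall>d<3. sg (vA t i g d) & sg (vP t i h) --> sg (vC (Suc t) i h g)) &
  (\<forall>t<T. \<forall>i<num_tapes M. \<forall>h\<le>2 * Z. \<forall>h'\<le>2 * Z. \<forall>g<num_symbols M. h ~= h' --> sg (vP t i h) & sg (vC t i h' g) --> sg (vC (Suc t) i h' g)) &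
  sg (vQ 0 0) & (\<forall>i<num_tapes M. sg (vP 0 i Z)) & (\<forall>i. 1 <= i & i < num_tapes M --> (\<forall>h\<le>2 * Z. sg (vC 0 i h 0))) &
  (\<forall>h. h < Z \<or> Z + length y + P <= h & h <= 2 * Z --> sg (vC 0 0 h 0)) &
  (\<forall>j<length y. sg (vC 0 0 (Z + j) (bit_symbol (y ! j)))) &
  (\<forall>j<P. sg (vC 0 0 (Z + length y + j) 0) \<or> sg (vC 0 0 (Z + length y + j) 1) \<or> sg (vC 0 0 (Z + length y + j) 2)) &
  (\<forall>j<P. sg (vC 0 0 (Z + length y + j) 0) --> sg (vC 0 0 (Z + length y + Suc j) 0)) &
  \<not> sg (vC T 1 Z 1)" (is "?L \<longleftrightarrow> ?R")
proof -
 have three: "(\<forall>d\<in>set [0,1,2::nat]. Q d) \<longleftrightarrow> (\<forall>d<3. Q d)" for Q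
  by (auto simp: numeral_eq_Suc less_Suc_eq)
 have ball: "(\<forall>x\<in>set [0..<n]. Q x) \<longleftrightarrow> (\<forall>x<n. Q x)" for n Q by auto
 have ball1: "(\<forall>x\<in>set [0..<Suc n]. Q x) \<longleftrightarrow> (\<forall>x\<le>n. Q x)" "(\<forall>x\<in>set [0..<n + 1]. Q x) \<longleftrightarrow> (\<forall>x\<le>n. Q x)" for n Q
  by (auto simp: less_Suc_eq_le simp del: upt_Suc)
 have prod: "(\<forall>p\<in>set (List.product A B). Q p) \<longleftrightarrow> (\<forall>a\<in>set A. \<forall>b\<in>set B. Q (a,b))" for A :: "'c list" and B :: "'d list" and Q
  by auto
 have pf: "(\<forall>p\<in>set (prefixes M). Q p) \<longleftrightarrow> (\<forall>q\<le>num_states M. \<forall>gs. length gs < num_tapes M & set gs \<subseteq> {..<num_symbols M} --> Q (q,gs))" for Q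
  unfolding prefixes_def prod ball1 by (auto simp: set_words)
 have ru: "(\<forall>p\<in>set (rules M). Q p) \<longleftrightarrow> (\<forall>q\<le>num_states M. \<forall>gs. length gs = num_tapes M & set gs \<subseteq> {..<num_symbols M} --> Q (q,gs))" for Q
  unfolding rules_def prod ball1 by (auto simp: set_words)
 have stt: "(\<forall>p\<in>set (state_table M). Q p) \<longleftrightarrow> (\<forall>q\<le>num_states M. \<forall>gs. length gs = num_tapes M & set gs \<subseteq> {..<num_symbols M} --> Q (q,gs,fst (tstep M q gs)))" for Q
  unfolding state_table_def set_map ball_simps ru by simp
 have att: "(\<forall>p\<in>set (action_table M). Q p) \<longleftrightarrow> (\<forall>q\<le>num_states M. \<forall>gs. length gs = num_tapes M & set gs \<subseteq> {..<num_symbols M} -->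
   (\<forall>i<num_tapes M. Q (q,gs,i,fst (snd (tstep M q gs) ! i),dcode (snd (snd (tstep M q gs) ! i)))))" for Q
  unfolding action_table_def set_map ball_simps prod ball ru by simp
 have un: "(\<exists>l\<in>set [(a,True)]. sg (fst l) = snd l) \<longleftrightarrow> sg a" "(\<exists>l\<in>set [(a,False)]. sg (fst l) = snd l) \<longleftrightarrow> \<not> sg a"
  "(\<exists>l\<in>set [(a,True),(b,True),(c,True)]. sg (fst l) = snd l) \<longleftrightarrow> sg a \<or> sg b \<or> sg c" for a b c by auto
 have ifs: "(\<exists>l\<in>set (if h = h' then imp1 a a else imp2 a b c). sg (fst l) = snd l) \<longleftrightarrow> (h ~= h' --> sg a & sg b --> sg c)" for h h' :: nat and a b c
  by simp
 have rng: "(\<forall>h\<in>set ([0..<Z] @ [Z + length y + P..<2 * Z + 1]). Q h) \<longleftrightarrow> (\<forall>h. h < Z \<or> Z + length y + P <= h & h <= 2 * Z --> Q h)" for Q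
  by (auto simp del: upt_Suc)
 have one: "(\<forall>i\<in>set [1..<n]. Q i) \<longleftrightarrow> (\<forall>i. 1 <= i & i < n --> Q i)" for n and Q :: "nat => bool" by auto
 have bs: "(\<forall>j<length y. sg (vC 0 0 (Z + j) (if nthd False y j then 2 else 1))) \<longleftrightarrow> (\<forall>j<length y. sg (vC 0 0 (Z + j) (bit_symbol (y ! j))))"
  by (simp add: bit_symbol_def)
 show ?thesis
  unfolding formula_def sats_simps sats_map prod case_prod_conv imp_sat ball ball1 three pf stt att fst_conv snd_conv un ifs rng one bs
  by (simp add: less_Suc_eq_le)
qed

lemma halted_funpow: "fst c = num_states M ==> (step M ^^ n) c = c"
 by (induction n) (auto simp: step_def split: prod.splits)

lemma computes_mono: "computes_within M x y t ==> t <= t' ==> computes_within M x y t'"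
proof -
 assume c: "computes_within M x y t" and "t <= t'"
 then obtain d where d: "t' = d + t" by (metis add.commute le_Suc_ex)
 have "fst ((step M ^^ t) (initial_config M x)) = num_states M" using c by (auto simp: computes_within_def split: prod.splits)
 hence "(step M ^^ t') (initial_config M x) = (step M ^^ t) (initial_config M x)"
  unfolding d funpow_add comp_def by (rule halted_funpow)
 thus ?thesis using c by (simp add: computes_within_def)
qed

locale cook =
 fixes M :: turing_machine and y :: "bool list" and P T Z :: nat and R :: "bool list => bool"
 assumes M: "turing_machine M" and Z: "Z = T + length y + P + 1"
  and run: "!!u. length u <= P ==> computes_within M (y @ u) [R u] T"
begin

definition cf :: "bool list => nat => config" where
 "cf u t = (step M ^^ t) (initial_config M (y @ u))"

abbreviation "K \<equiv> num_tapes M"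
abbreviation "cont u t i \<equiv> fst (snd (cf u t) ! i)"
abbreviation "pos u t i \<equiv> snd (snd (cf u t) ! i)"
abbreviation "rds u t \<equiv> reading (snd (cf u t))"
abbreviation "acts u t \<equiv> tstep M (fst (cf u t)) (rds u t)"

lemma K: "2 <= K" "3 <= num_symbols M" using M by (auto simp: turing_machine_def)

lemma start: "fst (cf u 0) = 0" "i < K ==> pos u 0 i = 0"
 "cont u 0 0 h = (if 0 <= h & h < int (length (y @ u)) then bit_symbol ((y @ u) ! nat h) else 0)"
 "1 <= i ==> i < K ==> cont u 0 i h = 0"
 by (auto simp: cf_def initial_config_def nth_Cons split: nat.splits)

lemma start_tape: "cont u 0 0 (int m) = (if m < length (y @ u) then bit_symbol ((y @ u) ! m) else 0)"
 unfolding start(3) by simp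

lemma ok: "okcfg M t (cf u t)"
proof (induction t)
 case 0
 have "length (snd (cf u 0)) = K" using K by (simp add: cf_def initial_config_def)
 moreover have "cont u 0 i h < num_symbols M" if "i < K" for i h
  using that K start(3)[of u h] start(4)[of i u h] by (cases i) (auto simp: bit_symbol_def)
 ultimately show ?case using start(1,2) by (simp add: okcfg_def)
next
 case (Suc t)
 thus ?case using step_facts(2)[OF M, of t "cf u t"] by (simp add: cf_def)
qed

lemma len: "length (rds u t) = K" "i < K ==> rds u t ! i = cont u t i (pos u t i)"
 using ok[of t u] by (auto simp: okcfg_def reading_def)

lemma rd_lt: "i < K ==> cont u t i h < num_symbols M" "fst (cf u t) <= num_states M"
 using ok[of t u] by (auto simp: okcfg_def)

lemma rd_set: "set (rds u t) \<subseteq> {..<num_symbols M}"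
 using len(1)[of u t] len(2)[of _ u t] rd_lt(1)[of _ u t] by (auto simp: in_set_conv_nth)

lemma pos_le: "i < K ==> t <= T ==> \<bar>pos u t i\<bar> <= int t" "i < K ==> t <= T ==> 0 < pos u t i + int Z"
 "i < K ==> t <= T ==> nat (pos u t i + int Z) <= 2 * Z"
proof -
 assume i: "i < K" and t: "t <= T"
 show a: "\<bar>pos u t i\<bar> <= int t" using ok[of t u] i by (simp add: okcfg_def)
 have "t < Z" using t Z by simp
 thus "0 < pos u t i + int Z" "nat (pos u t i + int Z) <= 2 * Z" using a by linarith+
qed

lemma next_facts:
 "fst (cf u (Suc t)) = fst (acts u t)"
 "i < K ==> cont u (Suc t) i = (cont u t i)(pos u t i := fst (snd (acts u t) ! i))"
 "i < K ==> pos u (Suc t) i = pos u t i + offset (snd (snd (acts u t) ! i))"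
 "i < K ==> fst (snd (acts u t) ! i) < num_symbols M"
proof -
 have e: "cf u (Suc t) = step M (cf u t)" by (simp add: cf_def)
 show "fst (cf u (Suc t)) = fst (acts u t)" unfolding e by (rule step_facts(1)[OF M ok])
 show "i < K ==> cont u (Suc t) i = (cont u t i)(pos u t i := fst (snd (acts u t) ! i))"
  unfolding e by (simp add: step_facts(3)[OF M ok[of t u]])
 show "i < K ==> pos u (Suc t) i = pos u t i + offset (snd (snd (acts u t) ! i))"
  unfolding e by (simp add: step_facts(3)[OF M ok[of t u]])
 show "i < K ==> fst (snd (acts u t) ! i) < num_symbols M" by (rule tstep_ok(3)[OF M ok])
qed

lemma final_cell: "length u <= P ==> cont u T 1 0 = bit_symbol (R u)"
 using run[of u] by (auto simp: computes_within_def cf_def tape_holds_def split: prod.splits)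

definition truth :: "bool list => nat list => bool" where
 "truth u v = (let k = v ! 0; t = v ! 1 in
   if k = 0 then v ! 2 = fst (cf u t)
   else if k = 1 then v ! 2 < K & v ! 3 = nat (pos u t (v ! 2) + int Z)
   else if k = 2 then v ! 2 < K & v ! 4 = cont u t (v ! 2) (int (v ! 3) - int Z)
   else if k = 3 then v ! 2 < K & v ! 3 = rds u t ! (v ! 2)
   else if k = 4 then v ! 2 = fst (cf u t) & drop 3 v = take (length (drop 3 v)) (rds u t)
   else v ! 2 < K & v ! 3 = fst (snd (acts u t) ! (v ! 2)) & v ! 4 = dcode (snd (snd (acts u t) ! (v ! 2))))"

lemma truth_simps:
 "truth u (vQ t q) \<longleftrightarrow> q = fst (cf u t)"
 "truth u (vP t i h) \<longleftrightarrow> i < K & h = nat (pos u t i + int Z)"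
 "truth u (vC t i h g) \<longleftrightarrow> i < K & g = cont u t i (int h - int Z)"
 "truth u (vS t i g) \<longleftrightarrow> i < K & g = rds u t ! i"
 "truth u (vW t q gs) \<longleftrightarrow> q = fst (cf u t) & gs = take (length gs) (rds u t)"
 "truth u (vA t i g d) \<longleftrightarrow> i < K & g = fst (snd (acts u t) ! i) & d = dcode (snd (snd (acts u t) ! i))"
 by (simp_all add: truth_def vQ_def vP_def vC_def vS_def vW_def vA_def Let_def numeral_2_eq_2 numeral_3_eq_3 eval_nat_numeral)

lemma sound: assumes u: "length u <= P" "R u" shows "sats (truth u) (formula M T Z y P)"
 unfolding sats_formula
proof (intro conjI allI impI, goal_cases)
 case (1 t i h g)
 hence "h = nat (pos u t i + int Z)" "g = cont u t i (int h - int Z)" "i < K" "t <= T" by (auto simp: truth_simps)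
 moreover have "int h - int Z = pos u t i" using calculation pos_le(2)[of i t u] by simp
 ultimately show ?case using len(2)[of i u t] by (simp add: truth_simps)
next
 case (2 t q) thus ?case by (simp add: truth_simps)
next
 case (3 t q gs g)
 hence a: "q = fst (cf u t)" "gs = take (length gs) (rds u t)" "g = rds u t ! length gs" "length gs < K"
  by (auto simp: truth_simps)
 have "take (Suc (length gs)) (rds u t) = take (length gs) (rds u t) @ [rds u t ! length gs]"
  by (rule take_Suc_conv_app_nth) (simp add: len a(4))
 hence "gs @ [g] = take (length (gs @ [g])) (rds u t)" using a(2,3) by simp
 thus ?case using a(1) by (simp only: truth_simps)
next
 case (4 t q gs)
 hence "q = fst (cf u t)" "gs = rds u t" using len(1)[of u t] by (auto simp: truth_simps)
 thus ?case by (simp add: truth_simps next_facts(1))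
next
 case (5 t q gs i)
 hence "q = fst (cf u t)" "gs = rds u t" "i < K" using len(1)[of u t] by (auto simp: truth_simps)
 thus ?case by (simp add: truth_simps)
next
 case (6 t i h g d)
 hence a: "h = nat (pos u t i + int Z)" "d = dcode (snd (snd (acts u t) ! i))" "i < K" "t <= T" by (auto simp: truth_simps)
 have "int d = offset (snd (snd (acts u t) ! i)) + 1" unfolding a(2) by (rule dcode_offset)
 hence "h + d - 1 = nat (pos u (Suc t) i + int Z)"
  using a(1) pos_le(2)[OF a(3,4), of u] next_facts(3)[OF a(3), of u t] by linarith
 thus ?case using a(3) by (simp add: truth_simps)
next
 case (7 t i h g d)
 hence a: "h = nat (pos u t i + int Z)" "g = fst (snd (acts u t) ! i)" "i < K" "t <= T" by (auto simp: truth_simps)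
 have "int h - int Z = pos u t i" using a(1) pos_le(2)[OF a(3,4), of u] by simp
 thus ?case using a(2,3) by (simp add: truth_simps next_facts(2))
next
 case (8 t i h h' g)
 hence a: "h = nat (pos u t i + int Z)" "g = cont u t i (int h' - int Z)" "i < K" "t <= T" "h ~= h'" by (auto simp: truth_simps)
 have "int h' - int Z ~= pos u t i" using a(1,5) by auto
 thus ?case using a(2,3) by (simp add: truth_simps next_facts(2))
next
 case 9 show ?case by (simp add: truth_simps start)
next
 case (10 i) thus ?case by (simp add: truth_simps start)
next
 case (11 i h) thus ?case by (simp add: truth_simps start)
next
 case (12 h)
 hence "int h - int Z < 0 \<or> int (length (y @ u)) <= int h - int Z" using u(1) by auto
 thus ?case using K by (auto simp: truth_simps start)
next
 case (13 j) thus ?case using K by (simp add: truth_simps start nth_append)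
next
 case (14 j)
 have "int (Z + length y + j) - int Z = int (length y + j)" by simp
 thus ?case using K by (auto simp: truth_simps start bit_symbol_def)
next
 case (15 j)
 have e: "int (Z + length y + i) - int Z = int (length y + i)" for i by simp
 have "length u <= j" using 15 by (auto simp: truth_simps e start bit_symbol_def split: if_splits)
 thus ?case using K unfolding truth_simps e start by simp
next
 case 16
 show ?case using final_cell[OF u(1)] u(2) K by (simp add: truth_simps bit_symbol_def)
qed

text \<open>A certificate is read off the assignment. By induction on time the assignment makes all
  facts of the run on it true; a negative answer would then contradict the last clause.\<close>

lemma complete: assumes s: "sats sg (formula M T Z y P)" shows "\<exists>u. length u <= P & R u"
proof -
 note F = s[unfolded sats_formula]
 note G1 = F[THEN conjunct2] and F1 = F[THEN conjunct1]
 note G2 = G1[THEN conjunct2] and F2 = G1[THEN conjunct1]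
 note G3 = G2[THEN conjunct2] and F3 = G2[THEN conjunct1]
 note G4 = G3[THEN conjunct2] and F4 = G3[THEN conjunct1]
 note G5 = G4[THEN conjunct2] and F5 = G4[THEN conjunct1]
 note G6 = G5[THEN conjunct2] and F6 = G5[THEN conjunct1]
 note G7 = G6[THEN conjunct2] and F7 = G6[THEN conjunct1]
 note G8 = G7[THEN conjunct2] and F8 = G7[THEN conjunct1]
 note G9 = G8[THEN conjunct2] and F9 = G8[THEN conjunct1]
 note G10 = G9[THEN conjunct2] and F10 = G9[THEN conjunct1]
 note G11 = G10[THEN conjunct2] and F11 = G10[THEN conjunct1]
 note G12 = G11[THEN conjunct2] and F12 = G11[THEN conjunct1]
 note G13 = G12[THEN conjunct2] and F13 = G12[THEN conjunct1]
 note G14 = G13[THEN conjunct2] and F14 = G13[THEN conjunct1]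
 note G15 = G14[THEN conjunct2] and F15 = G14[THEN conjunct1]
 note F16 = G15
 define blank where "blank j \<longleftrightarrow> sg (vC 0 0 (Z + length y + j) 0)" for j
 \<comment> \<open>The certificate ends at the first open cell marked blank, and after
   \<open>P\<close> cells if there is none.\<close>
 define m where "m = (LEAST m. P <= m \<or> blank m)"
 have m1: "P <= m \<or> blank m" unfolding m_def by (rule LeastI[of _ P]) simp
 have m2: "m <= P" unfolding m_def by (rule Least_le) simp
 have m3: "\<not> blank j" "j < P" if "j < m" for j using not_less_Least[of j "%m. P <= m \<or> blank m"] that unfolding m_def by auto
 have clos: "blank (Suc j)" if "j < P" "blank j" for j
  using F15 that unfolding blank_def by blast
 have m4: "blank j" if "m <= j" "j < P" for j
  using that
 proof (induction j rule: dec_induct)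
  case base thus ?case using m1 by auto
 next
  case (step j) thus ?case using clos by auto
 qed
 \<comment> \<open>Before \<open>m\<close> no cell is marked blank, so a cell that is not marked 1
   is marked 2.\<close>
 define u where "u = map (%j. \<not> sg (vC 0 0 (Z + length y + j) 1)) [0..<m]"
 have ul: "length u = m" by (simp add: u_def)
 have cell: "sg (vC 0 0 (Z + length y + j) (bit_symbol (u ! j)))" if "j < m" for j
 proof -
  have "blank j \<or> sg (vC 0 0 (Z + length y + j) 1) \<or> sg (vC 0 0 (Z + length y + j) 2)"
   using F14 m3(2)[OF that] unfolding blank_def by blast
  thus ?thesis using m3(1)[OF that] that by (auto simp: u_def bit_symbol_def)
 qed
 have c0: "sg (vC 0 i h (cont u 0 i (int h - int Z)))" if i: "i < K" and h: "h <= 2 * Z" for i h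
 proof (cases "i = 0")
  case False
  hence "1 <= i" by simp
  hence "sg (vC 0 i h 0)" using F11 i h by blast
  thus ?thesis using start(4)[of i] False i by simp
 next
  case i0: True
  consider "h < Z" | "Z <= h" "h < Z + length y" | "Z + length y <= h" "h < Z + length y + m"
   | "Z + length y + m <= h" "h < Z + length y + P" | "Z + length y + P <= h" by linarith
  thus ?thesis
  proof cases
   case 1
   hence "sg (vC 0 0 h 0)" using F12 by blast
   thus ?thesis using 1 i0 by (simp add: start)
  next
   case 2
   then obtain j where j: "h = Z + j" "j < length y" by (metis add_less_cancel_left le_Suc_ex)
   hence "sg (vC 0 0 h (bit_symbol (y ! j)))" using F13 by blast
   thus ?thesis using j i0 by (simp add: start nth_append)
  next
   case 3
   then obtain j where j: "h = Z + length y + j" "j < m" by (metis add_less_cancel_left le_Suc_ex)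
   have e: "int h - int Z = int (length y + j)" using j by simp
   have c: "cont u 0 0 (int (length y + j)) = bit_symbol (u ! j)"
    unfolding start_tape using j ul by (simp add: nth_append)
   show ?thesis unfolding i0 e c unfolding j(1) by (rule cell[OF j(2)])
  next
   case 4
   then obtain j where j: "h = Z + length y + j" "m <= j" "j < P" by (metis add_le_cancel_left add_less_cancel_left le_Suc_ex le_trans le_add1)
   have e: "int h - int Z = int (length y + j)" using j by simp
   have c: "cont u 0 0 (int (length y + j)) = 0" unfolding start_tape using j ul by simp
   show ?thesis unfolding i0 e c unfolding j(1) using m4[OF j(2,3)] by (simp only: blank_def)
  next
   case 5
   hence "sg (vC 0 0 h 0)" using F12 h by blast
   thus ?thesis using 5 i0 ul m2 by (simp add: start)
  qed
 qed
 have main: "t <= T ==> sg (vQ t (fst (cf u t))) & (\<forall>i<K. sg (vP t i (nat (pos u t i + int Z)))) &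
   (\<forall>i<K. \<forall>h\<le>2 * Z. sg (vC t i h (cont u t i (int h - int Z))))" for t
 proof (induction t)
  case 0
  have "sg (vQ 0 0)" "\<forall>i<K. sg (vP 0 i Z)" by (fact F9, fact F10)
  thus ?case using c0 by (simp add: start)
 next
  case (Suc t)
  hence t: "t < T" "t <= T" by simp_all
  have IH: "sg (vQ t (fst (cf u t)))" "!!i. i < K ==> sg (vP t i (nat (pos u t i + int Z)))"
   "!!i h. i < K ==> h <= 2 * Z ==> sg (vC t i h (cont u t i (int h - int Z)))" using Suc t by auto
  have S: "sg (vS t i (rds u t ! i))" if i: "i < K" for i
  proof -
   let ?h = "nat (pos u t i + int Z)"
   have "int ?h - int Z = pos u t i" using pos_le(2)[OF i t(2), of u] by simp
   hence "sg (vC t i ?h (rds u t ! i))" using IH(3)[OF i pos_le(3)[OF i t(2)], of u] len(2)[OF i] by simp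
   moreover have "rds u t ! i < num_symbols M" using rd_lt(1)[OF i] len(2)[OF i] by simp
   ultimately show ?thesis using F1 t(1) i IH(2)[OF i] pos_le(3)[OF i t(2), of u] by blast
  qed
  have W: "l <= K ==> sg (vW t (fst (cf u t)) (take l (rds u t)))" for l
  proof (induction l)
   case 0
   have "sg (vW t (fst (cf u t)) [])" using F2 t(1) IH(1) rd_lt(2)[of u t] by blast
   thus ?case by simp
  next
   case (Suc l)
   let ?gs = "take l (rds u t)"
   have l: "length ?gs = l" "l < K" using Suc.prems len(1)[of u t] by auto
   have g: "length ?gs < K & set ?gs \<subseteq> {..<num_symbols M}" using l rd_set[of u t] set_take_subset[of l "rds u t"] by auto
   have r: "rds u t ! l < num_symbols M" using rd_lt(1)[OF l(2)] len(2)[OF l(2)] by simp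
   have "sg (vS t (length ?gs) (rds u t ! l))" unfolding l(1) by (rule S[OF l(2)])
   hence "sg (vW t (fst (cf u t)) (?gs @ [rds u t ! l]))"
    using F3 t(1) rd_lt(2)[of u t] g r Suc.IH[OF less_imp_le[OF l(2)]] by blast
   thus ?case using l(2) len(1)[of u t] by (simp add: take_Suc_conv_app_nth)
  qed
  have w: "sg (vW t (fst (cf u t)) (rds u t))" using W[of K] len(1)[of u t] by simp
  have g: "length (rds u t) = K & set (rds u t) \<subseteq> {..<num_symbols M}" using len(1) rd_set by blast
  have Q: "sg (vQ (Suc t) (fst (acts u t)))" using F4 t(1) rd_lt(2)[of u t] g w by blast
  have A: "sg (vA t i (fst (snd (acts u t) ! i)) (dcode (snd (snd (acts u t) ! i))))" if "i < K" for i
   using F5 t(1) rd_lt(2)[of u t] g w that by blast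
  have Pn: "sg (vP (Suc t) i (nat (pos u (Suc t) i + int Z)))" if i: "i < K" for i
  proof -
   let ?h = "nat (pos u t i + int Z)" and ?d = "dcode (snd (snd (acts u t) ! i))"
   have "sg (vP (Suc t) i (?h + ?d - 1))"
    using F6 t(1) i pos_le(3)[OF i t(2), of u] next_facts(4)[OF i, of u t] dcode_offset(2) A[OF i] IH(2)[OF i] by blast
   moreover have "?h + ?d - 1 = nat (pos u (Suc t) i + int Z)"
    using dcode_offset(1)[of "snd (snd (acts u t) ! i)"] pos_le(2)[OF i t(2), of u] next_facts(3)[OF i, of u t] by linarith
   ultimately show ?thesis by simp
  qed
  have Cn: "sg (vC (Suc t) i h (cont u (Suc t) i (int h - int Z)))" if i: "i < K" and h: "h <= 2 * Z" for i h
  proof (cases "h = nat (pos u t i + int Z)")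
   case True
   have "sg (vC (Suc t) i h (fst (snd (acts u t) ! i)))"
    using F7 t(1) i h next_facts(4)[OF i, of u t] dcode_offset(2) A[OF i] IH(2)[OF i] True by blast
   moreover have "int h - int Z = pos u t i" using True pos_le(2)[OF i t(2), of u] by simp
   ultimately show ?thesis by (simp add: next_facts(2)[OF i])
  next
   case False
   have "sg (vC (Suc t) i h (cont u t i (int h - int Z)))"
    using F8 t(1) i h rd_lt(1)[OF i] pos_le(3)[OF i t(2), of u] IH(2)[OF i] IH(3)[OF i h] False by blast
   moreover have "int h - int Z ~= pos u t i" using False by auto
   ultimately show ?thesis by (simp add: next_facts(2)[OF i])
  qed
  show ?case using Q Pn Cn by (simp add: next_facts(1))
 qed
 have "R u"
 proof (rule ccontr)
  assume "\<not> R u"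
  hence z1: "cont u T 1 0 = 1" using final_cell[of u] ul m2 by (simp add: bit_symbol_def)
  have "\<forall>i<K. \<forall>h\<le>2 * Z. sg (vC T i h (cont u T i (int h - int Z)))" using main[of T] by simp
  hence h: "sg (vC T i h (cont u T i (int h - int Z)))" if "i < K" "h <= 2 * Z" for i h using that by blast
  have "sg (vC T 1 Z (cont u T 1 (int Z - int Z)))" by (rule h) (use K(1) in simp_all)
  hence "sg (vC T 1 Z 1)" by (simp only: diff_self z1)
  thus False using F16 by blast
 qed
 thus ?thesis using ul m2 by blast
qed

theorem cook: "sat (formula M T Z y P) \<longleftrightarrow> (\<exists>u. length u <= P & R u)"
 using sound complete unfolding sat_def sats_def by blast

end

lemma formula_clauses: "\<forall>c\<in>set (formula M T Z y P). c ~= [] & length c <= 3"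
 unfolding formula_def set_append ball_Un set_map ball_simps
 by (simp add: imp1_def imp2_def split: prod.split)

lemma pt_formula:
 assumes "ptime T" "ptime Z" "ptime y" "ptime P" shows "ptime (%x. formula M (T x) (Z x) (y x) (P x))"
 unfolding formula_def imp1_def imp2_def vQ_def vP_def vC_def vS_def vW_def vA_def
 by (intro pt assms pt_comp[OF assms(1)] pt_comp[OF assms(2)] pt_comp[OF assms(3)] pt_comp[OF assms(4)])

lemma poly_nat_mono: "m <= n ==> poly (p :: nat poly) m <= poly p n"
 by (induction p) (auto intro!: add_mono mult_mono)

theorem NP_hard_free_subdivision:
 fixes H :: "'a pair_pre_digraph"
 assumes H: "pair_graph H"
  and tri: "(\<exists>T. roof_triangle H T) \<or>
     (\<exists>S T. S ~= T & hanging_triangle H S & hanging_triangle H T &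
      (\<exists>a\<in>attachment_vertices H S. \<exists>b\<in>attachment_vertices H T. (a,b) : parcs H))"
 shows "NP_hard (free_subdivision H)"
 unfolding NP_hard_def
proof (intro allI impI)
 fix A assume "in_NP A"
 then obtain R and p :: "nat poly" where R: "in_P R" "!!x. x : A \<longleftrightarrow> (\<exists>u. length u <= poly p (length x) & encode_pair x u : R)"
  unfolding in_NP_def by blast
 obtain M and q :: "nat poly" where M: "turing_machine M" "!!z. computes_within M z [z : R] (poly q (length z))"
  using R(1) unfolding in_P_def polytime_computable_def by blast
 obtain r :: "nat list list * (nat list * bool) list list => bool list" where r: "ptime r"
  "!!vl F. wf3 vl F ==> \<exists>G. input_graph G & r (vl,F) = encode_instance G (3 * length vl + 3 * length F) &
   (subdividable_to_free H G (3 * length vl + 3 * length F) \<longleftrightarrow> sat F)"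
  using main_reduction[OF H tri] by blast
 define P where "P x = poly p (length x)" for x :: "bool list"
 define T where "T x = poly q (2 * length x + 1 + P x)" for x
 \<comment> \<open>The part of the pair encoding that precedes the certificate; its length
   \<open>2 * length x + 1\<close> appears in \<open>T\<close>.\<close>
 define y where "y x = concat (map (%b. [True,b]) x) @ [False]" for x
 define Z where "Z x = T x + length (y x) + P x + 1" for x
 define F where "F x = formula M (T x) (Z x) (y x) (P x)" for x
 define f where "f x = r (dedup (concat (map (map fst) (F x))),F x)" for x
 have yl: "length (y x) = 2 * length x + 1" for x by (simp add: y_def length_concat comp_def sum_list_triv)
 have pP: "ptime P" unfolding P_def by (intro pt pt_poly)
 have pT: "ptime T" unfolding T_def by (intro pt pt_poly pP)
 have py: "ptime y" unfolding y_def by (intro pt)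
 have pZ: "ptime Z" unfolding Z_def by (intro pt pP pT py)
 have pF: "ptime F" unfolding F_def by (rule pt_formula[OF pT pZ py pP])
 have "ptime f" unfolding f_def by (intro pt_comp[OF r(1)] pt pF)
 hence pc: "polytime_computable f" by (rule ptime_polytime_computable)
 have "x : A \<longleftrightarrow> f x : free_subdivision H" for x
 proof -
  have pair: "encode_pair x u = y x @ u" for u by (simp add: encode_pair_def y_def)
  interpret cook M "y x" "P x" "T x" "Z x" "%u. encode_pair x u : R"
  proof
   show "turing_machine M" by (rule M(1))
   show "Z x = T x + length (y x) + P x + 1" by (simp add: Z_def)
   fix u :: "bool list" assume "length u <= P x"
   hence "poly q (length (y x @ u)) <= T x" unfolding T_def by (intro poly_nat_mono) (simp add: yl)
   thus "computes_within M (y x @ u) [encode_pair x u : R] (T x)"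
    using computes_mono[OF M(2)[of "y x @ u"]] by (simp add: pair)
  qed
  have "sat (F x) \<longleftrightarrow> x : A" unfolding F_def using cook R(2)[of x] by (simp add: P_def)
  moreover have "wf3 (dedup (concat (map (map fst) (F x)))) (F x)"
   using formula_clauses[of M "T x" "Z x" "y x" "P x"] by (auto simp: wf3_def dedup F_def)
  then obtain G where G: "input_graph G" "f x = encode_instance G (3 * length (dedup (concat (map (map fst) (F x)))) + 3 * length (F x))"
   "subdividable_to_free H G (3 * length (dedup (concat (map (map fst) (F x)))) + 3 * length (F x)) \<longleftrightarrow> sat (F x)"
   using r(2) unfolding f_def by blast
  have "f x : free_subdivision H \<longleftrightarrow> sat (F x)"
  proof
   assume "f x : free_subdivision H"
   then obtain G' k' where "f x = encode_instance G' k'" "input_graph G'" "subdividable_to_free H G' k'"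
    unfolding free_subdivision_def by blast
   thus "sat (F x)" using encode_instance_inject[OF G(1), of G'] G by metis
  next
   assume "sat (F x)" thus "f x : free_subdivision H" using G unfolding free_subdivision_def by blast
  qed
  ultimately show ?thesis by simp
 qed
 thus "polytime_reducible A (free_subdivision H)" unfolding polytime_reducible_def using pc by blast
qed

section \<open>Membership in NP\<close>

text \<open>The flag drops at the first \<open>False\<close>, so \<open>lead\<close> decodes a unary
  prefix.\<close>

definition lead_step :: "bool * nat => bool => bool * nat" where
 "lead_step s b = (if fst s & b then (True,Suc (snd s)) else (False,snd s))"

definition lead :: "bool list => nat" where "lead x = snd (foldl lead_step (True,0) x)"

lemma lead_stop: "snd (foldl lead_step (False,c) x) = c"
 by (induction x) (auto simp: lead_step_def)

lemma lead: "lead (replicate n True @ False # r) = n"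
proof -
 have "snd (foldl lead_step (True,c) (replicate n True @ False # r)) = n + c" for c
  by (induction n arbitrary: c) (auto simp: lead_step_def lead_stop)
 thus ?thesis by (simp add: lead_def)
qed

lemma pt_lead: assumes "ptime x" shows "ptime (%i. lead (x i))"
proof -
 have le: "snd (foldl lead_step s x) <= snd s + length x" for s x
 proof (induction x rule: rev_induct)
  case (snoc b x)
  have "snd (lead_step t b) <= Suc (snd t)" for t by (simp add: lead_step_def)
  from order_trans[OF this, of "foldl lead_step s x"] snoc show ?case by simp
 qed simp
 have tb: "tsz (b :: bool) <= 3" for b by (cases b) auto
 have "ptime (%i. foldl (%s b. lead_step s b) (True,0) (x i))"
 proof (rule pt_foldl[where B = "%i. 2 * tsz (x i) + 10"])
  show "ptime (%p. lead_step (fst p) (fst (snd p)))" unfolding lead_step_def by (intro pt)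
  show "pb (%i. 2 * tsz (x i) + 10)" by (intro pb_intros pb_ptime assms)
  fix i j
  obtain b c where bc: "foldl lead_step (True,0) (take j (x i)) = (b,c)" by (cases "foldl lead_step (True,0) (take j (x i))")
  have "c <= length (x i)" using le[of "(True,0)" "take j (x i)"] by (simp add: bc)
  thus "tsz (foldl (%s b. lead_step s b) (True,0) (take j (x i))) <= 2 * tsz (x i) + 10"
   using tb[of b] length_le_tsz[of "x i"] by (simp add: bc)
 qed (intro pt assms)+
 from pt_snd[OF this] show ?thesis by (simp add: lead_def)
qed

text \<open>Modes 0 and 1 alternate between marker and bit of the first component; mode 2 collects
  the second one.\<close>

definition pair_step :: "nat * bool list * bool list => bool => nat * bool list * bool list" where
 "pair_step s b = (if fst s = 0 then (if b then 1 else 2,snd s)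
   else if fst s = 1 then (0,fst (snd s) @ [b],snd (snd s)) else (2,fst (snd s),snd (snd s) @ [b]))"

definition unpair :: "bool list => bool list * bool list" where
 "unpair z = snd (foldl pair_step (0,[],[]) z)"

lemma unpair: "unpair (encode_pair x u) = (x,u)"
proof -
 have 1: "foldl pair_step (2,a,c) u = (2,a,c @ u)" for a c
  by (induction u arbitrary: c) (auto simp: pair_step_def)
 have "foldl pair_step (0,a,[]) (encode_pair x u) = (2,a @ x,u)" for a
  by (induction x arbitrary: a) (auto simp: encode_pair_def pair_step_def 1)
 thus ?thesis by (simp add: unpair_def)
qed

lemma pt_unpair: assumes "ptime z" shows "ptime (%i. unpair (z i))"
proof -
 have ap: "tsz (a @ [b]) <= tsz a + 4" for a and b :: bool using tsz_append[of a "[b]"] by (cases b) simp_all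
 have st: "tsz (pair_step s b) <= max 9 (tsz s + 8)" for s b
  using ap[of "fst (snd s)" b] ap[of "snd (snd s)" b] by (cases s) (auto simp: pair_step_def)
 have bd: "tsz (foldl pair_step s x) <= tsz s + 8 * length x + 9" for s x
 proof (induction x rule: rev_induct)
  case (snoc b x)
  thus ?case using st[of "foldl pair_step s x" b] by simp
 qed simp
 have "ptime (%i. foldl (%s b. pair_step s b) (0,[],[]) (z i))"
 proof (rule pt_foldl[where B = "%i. 8 * tsz (z i) + 20"])
  show "ptime (%p. pair_step (fst p) (fst (snd p)))" unfolding pair_step_def by (intro pt)
  show "pb (%i. 8 * tsz (z i) + 20)" by (intro pb_intros pb_ptime assms)
  fix i j
  show "tsz (foldl (%s b. pair_step s b) (0,[],[]) (take j (z i))) <= 8 * tsz (z i) + 20"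
   using bd[of "(0,[],[])" "take j (z i)"] length_le_tsz[of "z i"] by simp
 qed (intro pt assms)+
 from pt_snd[OF this] show ?thesis by (simp add: unpair_def)
qed

definition num_step :: "nat * nat list => bool => nat * nat list" where
 "num_step s b = (if b then (Suc (fst s),snd s) else (0,snd s @ [fst s]))"

definition nums :: "bool list => nat list" where "nums x = snd (foldl num_step (0,[]) x)"

definition edges_of :: "bool list => (nat * nat) list" where
 "edges_of x = map (%i. (nthd 0 (nums x) (2 * i),nthd 0 (nums x) (2 * i + 1))) [0..<length (nums x) div 2]"

definition bits_of :: "(nat * nat) list => bool list" where
 "bits_of es = concat (map (%e. unary (fst e) @ unary (snd e)) es)"

lemma edges_of_bits_of: "edges_of (bits_of es) = es"
proof -
 have u: "foldl num_step (c,ns) (unary n) = (0,ns @ [n + c])" for c ns n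
  by (induction n arbitrary: c) (auto simp: unary_def num_step_def)
 have "foldl num_step (0,ns) (bits_of es) = (0,ns @ concat (map (%e. [fst e,snd e]) es))" for ns
  by (induction es arbitrary: ns) (auto simp: bits_of_def u)
 hence n: "nums (bits_of es) = concat (map (%e. [fst e,snd e]) es)" by (simp add: nums_def)
 have l: "length (concat (map (%e. [fst e,snd e]) es)) = 2 * length es" for es :: "(nat * nat) list"
  by (induction es) auto
 have i: "i < length es ==> concat (map (%e. [fst e,snd e]) es) ! (2 * i) = fst (es ! i) &
   concat (map (%e. [fst e,snd e]) es) ! (2 * i + 1) = snd (es ! i)" for i and es :: "(nat * nat) list"
 proof (induction es arbitrary: i)
  case (Cons e es) thus ?case by (cases i) auto
 qed simp
 define cs where "cs = concat (map (%e. [fst e,snd e]) es)"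
 have lc: "length cs = 2 * length es" unfolding cs_def by (rule l)
 have e: "(nthd 0 cs (2 * j),nthd 0 cs (2 * j + 1)) = es ! j" if j: "j < length es" for j
 proof -
  have "2 * j < length cs" "2 * j + 1 < length cs" using j lc by simp_all
  hence "nthd 0 cs (2 * j) = cs ! (2 * j)" "nthd 0 cs (2 * j + 1) = cs ! (2 * j + 1)" by simp_all
  thus ?thesis using i[OF j] by (simp only: cs_def prod.collapse)
 qed
 have "edges_of (bits_of es) = map (%i. (nthd 0 cs (2 * i),nthd 0 cs (2 * i + 1))) [0..<length es]"
  unfolding edges_of_def n cs_def[symmetric] lc by simp
 also have "\<dots> = map ((!) es) [0..<length es]" using e by (intro map_cong) auto
 finally show ?thesis by (simp add: map_nth)
qed

lemma pt_nums: assumes "ptime x" shows "ptime (%i. nums (x i))"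
proof -
 have st: "tsz (num_step s b) <= tsz s + 2" for s b
  using tsz_append[of "snd s" "[fst s]"] by (cases s) (auto simp: num_step_def)
 have bd: "tsz (foldl num_step s x) <= tsz s + 2 * length x" for s x
 proof (induction x rule: rev_induct)
  case (snoc b x)
  thus ?case using st[of "foldl num_step s x" b] by simp
 qed simp
 have "ptime (%i. foldl (%s b. num_step s b) (0,[]) (x i))"
 proof (rule pt_foldl[where B = "%i. 2 * tsz (x i) + 20"])
  show "ptime (%p. num_step (fst p) (fst (snd p)))" unfolding num_step_def by (intro pt)
  show "pb (%i. 2 * tsz (x i) + 20)" by (intro pb_intros pb_ptime assms)
  fix i j
  show "tsz (foldl (%s b. num_step s b) (0,[]) (take j (x i))) <= 2 * tsz (x i) + 20"
   using bd[of "(0,[])" "take j (x i)"] length_le_tsz[of "x i"] by simp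
 qed (intro pt assms)+
 from pt_snd[OF this] show ?thesis by (simp add: nums_def)
qed

lemma pt_edges_of: assumes "ptime x" shows "ptime (%i. edges_of (x i))"
 unfolding edges_of_def by (intro pt pt_nums pt_comp[OF assms] assms)

text \<open>Comparison with a binary number bit by bit: \<open>j <= b + 2 * v\<close> holds iff
  \<open>j - b\<close>, halved and rounded up, is at most \<open>v\<close>. The number itself may be
  exponential in the length of its code and is never formed.\<close>

definition halve :: "nat => bool => nat" where
 "halve t b = (t - (if b then 1 else 0) + 1) div 2"

definition le_bits :: "nat => bool list => bool" where
 "le_bits j ks \<longleftrightarrow> foldl halve j ks = 0"

lemma le_bits: "le_bits j ks \<longleftrightarrow> j <= horner_sum of_bool 2 ks"
proof (induction ks arbitrary: j)
 case Nil thus ?case by (simp add: le_bits_def)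
next
 case (Cons b ks)
 have "le_bits j (b # ks) \<longleftrightarrow> halve j b <= horner_sum of_bool 2 ks"
  using Cons[of "halve j b"] by (simp add: le_bits_def)
 also have "\<dots> \<longleftrightarrow> j <= of_bool b + 2 * horner_sum of_bool 2 ks" by (cases b) (auto simp: halve_def)
 finally show ?case by simp
qed

lemma pt_le_bits: assumes "ptime j" "ptime ks" shows "ptime (%x. le_bits (j x) (ks x))"
proof -
 have st: "halve t b <= t" for t b by (cases b) (auto simp: halve_def)
 have bd: "foldl halve j ks <= j" for j ks
 proof (induction ks rule: rev_induct)
  case (snoc b ks)
  show ?case using order_trans[OF st[of "foldl halve j ks" b] snoc] by simp
 qed simp
 have "ptime (%x. foldl (%t b. halve t b) (j x) (ks x))"
 proof (rule pt_foldl[where B = "%x. tsz (j x)"])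
  show "ptime (%p. halve (fst p) (fst (snd p)))" unfolding halve_def by (intro pt)
  fix x i show "tsz (foldl (%t b. halve t b) (j x) (take i (ks x))) <= tsz (j x)" using bd[of "j x"] by simp
 qed (intro assms pb_ptime)+
 thus ?thesis unfolding le_bits_def by (rule pt_is0)
qed

lemma nat_bits_value: "ks = [] \<or> last ks ==> nat_bits (horner_sum of_bool 2 ks) = ks"
proof (induction ks)
 case Nil thus ?case by (simp add: nat_bits.simps)
next
 case (Cons b ks)
 let ?v = "horner_sum of_bool 2 ks :: nat"
 have IH: "nat_bits ?v = ks" using Cons by (auto split: if_splits)
 have nz: "of_bool b + 2 * ?v ~= 0"
 proof (cases "ks = []")
  case True thus ?thesis using Cons.prems by simp
 next
  case False
  hence "?v ~= 0" using IH nat_bits.simps[of 0] by metis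
  thus ?thesis by simp
 qed
 have "nat_bits (of_bool b + 2 * ?v) = b # nat_bits ?v"
  using nz by (subst nat_bits.simps) (cases b; simp)
 thus ?case by (simp add: IH)
qed

lemma last_nat_bits: "k ~= 0 ==> nat_bits k ~= [] & last (nat_bits k)"
proof (induction k rule: less_induct)
 case (less k)
 have e: "nat_bits k = odd k # nat_bits (k div 2)" using less.prems by (subst nat_bits.simps) simp
 show ?case
 proof (cases "k div 2 = 0")
  case True
  hence "k = 1" using less.prems by (simp add: div_eq_0_iff)
  thus ?thesis by (simp add: nat_bits.simps[of 1] nat_bits.simps[of "Suc 0"] nat_bits.simps[of 0])
 next
  case False
  thus ?thesis using less.IH[of "k div 2"] less.prems by (simp add: e)
 qed
qed

section \<open>Decoding of instances\<close>

definition mat_of :: "bool list => bool list" where "mat_of x = take (lead x * lead x) (drop (Suc (lead x)) x)"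
definition rest_of :: "bool list => bool list" where "rest_of x = drop (Suc (lead x) + lead x * lead x) x"
definition arcs_of :: "bool list => (nat * nat) list" where
 "arcs_of x = filter (%p. nthd False (mat_of x) (fst p * lead x + snd p)) (List.product [0..<lead x] [0..<lead x])"

definition valid :: "bool list => bool" where
 "valid x \<longleftrightarrow> x = replicate (lead x) True @ [False] @ mat_of x @ rest_of x & length (mat_of x) = lead x * lead x &
   (\<forall>p\<in>set (arcs_of x). (snd p,fst p) : set (arcs_of x) & fst p ~= snd p) &
   (rest_of x = [] \<or> nthd False (rest_of x) (length (rest_of x) - 1))"

lemma matrix_map: "length mat = n * n ==> map (%p. nthd False mat (fst p * n + snd p)) (List.product [0..<n] [0..<n]) = mat"
proof (rule nth_equalityI)
 assume l: "length mat = n * n"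
 show "length (map (%p. nthd False mat (fst p * n + snd p)) (List.product [0..<n] [0..<n])) = length mat" using l by simp
 fix i assume "i < length (map (%p. nthd False mat (fst p * n + snd p)) (List.product [0..<n] [0..<n]))"
 hence i: "i < n * n" by simp
 hence "0 < n" by (cases n) auto
 hence d: "i div n < n" "i mod n < n" using i by (auto simp: less_mult_imp_div_less)
 have "List.product [0..<n] [0..<n] ! i = ([0..<n] ! (i div n),[0..<n] ! (i mod n))"
  using product_nth[of i "[0..<n]" "[0..<n]"] i by simp
 hence "List.product [0..<n] [0..<n] ! i = (i div n,i mod n)" using d by simp
 thus "map (%p. nthd False mat (fst p * n + snd p)) (List.product [0..<n] [0..<n]) ! i = mat ! i" using i l by simp
qed

lemma pair_idx: "length mat = n * n ==> map f (List.product [0..<n] [0..<n]) = mat ==> a < n ==> b < n ==>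
  nthd False mat (a * n + b) = f (a,b)"
proof -
 assume l: "length mat = n * n" and m: "map f (List.product [0..<n] [0..<n]) = mat" and ab: "a < n" "b < n"
 have "map f (List.product [0..<n] [0..<n]) = map (%p. nthd False mat (fst p * n + snd p)) (List.product [0..<n] [0..<n])"
  using matrix_map[OF l] m by simp
 hence "\<forall>p\<in>set (List.product [0..<n] [0..<n]). f p = nthd False mat (fst p * n + snd p)" by simp
 thus ?thesis using ab by auto
qed

lemma decode_instance:
 assumes G: "input_graph G" and x: "x = encode_instance G k"
 shows "lead x = card (pverts G)" "rest_of x = nat_bits k" "set (arcs_of x) = parcs G" "valid x"
proof -
 define n where "n = card (pverts G)"
 define mat where "mat = map (%e. e : parcs G) (List.product [0..<n] [0..<n])"
 have pg: "pair_graph G" and V: "pverts G = {..<n}" using G by (auto simp: input_graph_def n_def)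
 note f = pair_graph_facts[OF pg]
 have lm: "length mat = n * n" by (simp add: mat_def)
 have xe: "x = replicate n True @ False # mat @ nat_bits k" by (simp add: x encode_instance_def unary_def Let_def mat_def n_def)
 show ld: "lead x = card (pverts G)" unfolding xe by (simp add: lead n_def)
 hence ldn: "lead x = n" by (simp add: n_def)
 have mo: "mat_of x = mat" unfolding mat_of_def ldn by (simp add: xe lm)
 show ro: "rest_of x = nat_bits k" unfolding rest_of_def ldn by (simp add: xe lm)
 have idx: "nthd False mat (a * n + b) = ((a,b) : parcs G)" if "a < n" "b < n" for a b
  using pair_idx[OF lm _ that, of "%e. e : parcs G"] by (simp add: mat_def)
 show ar: "set (arcs_of x) = parcs G"
  unfolding arcs_of_def mo ldn using idx f(2) V by auto
 have "rest_of x = [] \<or> nthd False (rest_of x) (length (rest_of x) - 1)"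
 proof (cases "k = 0")
  case True thus ?thesis by (simp add: ro nat_bits.simps)
 next
  case False
  note l = last_nat_bits[OF this]
  hence "nat_bits k ! (length (nat_bits k) - 1)" using last_conv_nth[of "nat_bits k"] by metis
  thus ?thesis unfolding ro using l by simp
 qed
 thus "valid x" unfolding valid_def ar using f(3,4) mo ro ldn lm xe by auto
qed

lemma valid_instance:
 assumes v: "valid x"
 defines "G \<equiv> \<lparr>pverts = {..<lead x},parcs = set (arcs_of x)\<rparr>"
 shows "input_graph G" "x = encode_instance G (horner_sum of_bool 2 (rest_of x))"
proof -
 let ?n = "lead x"
 have a: "a < ?n & b < ?n" if "(a,b) : set (arcs_of x)" for a b using that by (auto simp: arcs_of_def)
 have "pair_graph G" unfolding G_def
  by (rule pair_graphI) (use v a in \<open>force simp: valid_def\<close>)+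
 thus "input_graph G" by (simp add: input_graph_def G_def)
 have lm: "length (mat_of x) = ?n * ?n" using v by (simp add: valid_def)
 have "map (%e. e : parcs G) (List.product [0..<?n] [0..<?n]) = map (%p. nthd False (mat_of x) (fst p * ?n + snd p)) (List.product [0..<?n] [0..<?n])"
  by (rule map_cong) (auto simp: G_def arcs_of_def)
 hence m: "map (%e. e : parcs G) (List.product [0..<?n] [0..<?n]) = mat_of x" using matrix_map[OF lm] by simp
 have r: "nat_bits (horner_sum of_bool 2 (rest_of x)) = rest_of x"
 proof (rule nat_bits_value)
  show "rest_of x = [] \<or> last (rest_of x)"
  proof (cases "rest_of x = []")
   case False
   hence "nthd False (rest_of x) (length (rest_of x) - 1)" using v by (simp add: valid_def)
   thus ?thesis using False by (simp add: last_conv_nth)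
  qed simp
 qed
 have "encode_instance G (horner_sum of_bool 2 (rest_of x)) = replicate ?n True @ [False] @ mat_of x @ rest_of x"
  using m r by (simp add: encode_instance_def Let_def unary_def G_def)
 thus "x = encode_instance G (horner_sum of_bool 2 (rest_of x))" using v by (simp add: valid_def)
qed

lemma pt_mat_of: assumes "ptime x" shows "ptime (%i. mat_of (x i))"
 unfolding mat_of_def by (intro pt pt_lead assms)

lemma pt_rest_of: assumes "ptime x" shows "ptime (%i. rest_of (x i))"
 unfolding rest_of_def by (intro pt pt_lead assms)

lemma pt_arcs_of: assumes "ptime x" shows "ptime (%i. arcs_of (x i))"
 unfolding arcs_of_def by (intro pt pt_lead pt_mat_of pt_comp[OF assms] assms)

lemma pt_valid: assumes "ptime x" shows "ptime (%i. valid (x i))"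
 unfolding valid_def by (intro pt pt_lead pt_mat_of pt_rest_of pt_arcs_of pt_comp[OF assms] assms)

definition gstep :: "nat * (nat * nat) list => nat * nat => nat * (nat * nat) list" where
 "gstep s e = (if e : set (snd s) then (Suc (fst s),(fst e,fst s) # (fst s,fst e) # (fst s,snd e) # (snd e,fst s) #
   filter (%p. p ~= e & p ~= (snd e,fst e)) (snd s)) else s)"

definition gr :: "nat * (nat * nat) list => nat pair_pre_digraph" where
 "gr s = \<lparr>pverts = {..<fst s},parcs = set (snd s)\<rparr>"

lemma gstep_graph: "(a,b) : set (snd s) ==> gr (gstep s (a,b)) = subdivide (gr s) (a,b) (fst s)"
 by (auto simp: gr_def gstep_def subdivide.simps)

lemma gstep_sub: "(a,b) : set (snd s) ==> edge_subdivision (gr s) (gr (gstep s (a,b)))"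
 unfolding edge_subdivision_def
 by (rule exI[of _ a], rule exI[of _ b], rule exI[of _ "fst s"]) (simp add: gstep_graph, simp add: gr_def)

lemma grun_sound: "\<exists>j\<le>length es. (edge_subdivision ^^ j) (gr s) (gr (foldl gstep s es))"
proof (induction es arbitrary: s)
 case Nil show ?case by (intro exI[of _ 0]) simp
next
 case (Cons e es)
 obtain j where j: "j <= length es" "(edge_subdivision ^^ j) (gr (gstep s e)) (gr (foldl gstep (gstep s e) es))" using Cons by blast
 obtain a b where e: "e = (a,b)" by (cases e)
 show ?case
 proof (cases "e : set (snd s)")
  case True
  hence "edge_subdivision (gr s) (gr (gstep s e))" using gstep_sub e by simp
  from relpowp_Suc_I2[of edge_subdivision, OF this j(2)] show ?thesis using j(1) by (intro exI[of _ "Suc j"]) simp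
 next
  case False
  hence "gstep s e = s" by (simp add: gstep_def)
  thus ?thesis using j by (intro exI[of _ j]) simp
 qed
qed

text \<open>\<open>edge_subdivision\<close> may pick any fresh vertex; numbering new vertices in the
  order of their creation gives an isomorphic graph.\<close>

lemma grun_complete:
 assumes s: "pair_graph (gr s)" and r: "(edge_subdivision ^^ j) (gr s) G'"
 shows "\<exists>es bt. length es = j & fst (foldl gstep s es) = fst s + j & (\<forall>e\<in>set es. fst e < fst s + j & snd e < fst s + j) &
   bij_betw bt (pverts G') {..<fst s + j} &
   (\<forall>x\<in>pverts G'. \<forall>y\<in>pverts G'. (bt x,bt y) : set (snd (foldl gstep s es)) \<longleftrightarrow> (x,y) : parcs G')"
 using r
proof (induction j arbitrary: G')
 case 0
 hence "G' = gr s" by simp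
 thus ?case by (intro exI[of _ "[]"] exI[of _ "%x. x"]) (auto simp: gr_def bij_betw_def)
next
 case (Suc j)
 then obtain G1 where G1: "(edge_subdivision ^^ j) (gr s) G1" "edge_subdivision G1 G'" by (auto elim: relpowp_Suc_E)
 obtain es bt where IH: "length es = j" "fst (foldl gstep s es) = fst s + j"
  "\<forall>e\<in>set es. fst e < fst s + j & snd e < fst s + j" "bij_betw bt (pverts G1) {..<fst s + j}"
  "!!x y. x : pverts G1 ==> y : pverts G1 ==> (bt x,bt y) : set (snd (foldl gstep s es)) \<longleftrightarrow> (x,y) : parcs G1"
  using Suc.IH[OF G1(1)] by blast
 have pg: "pair_graph G1" by (rule subdivisions_graph[OF s G1(1)])
 note f = pair_graph_facts[OF pg]
 obtain a b w where w: "(a,b) : parcs G1" "w ~: pverts G1" "G' = subdivide G1 (a,b) w"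
  using G1(2) unfolding edge_subdivision_def by blast
 let ?s = "foldl gstep s es" and ?N = "fst s + j"
 have ab: "a : pverts G1" "b : pverts G1" "a ~= b" using f(2,4) w(1) by auto
 have inj: "bt x = bt y \<longleftrightarrow> x = y" if "x : pverts G1" "y : pverts G1" for x y
  using IH(4) that unfolding bij_betw_def inj_on_def by blast
 have lt: "bt x < ?N" if "x : pverts G1" for x using bij_betwE[OF IH(4)] that by auto
 define \<gamma> where "\<gamma> = bt(w := ?N)"
 have old: "\<gamma> x = bt x" if "x : pverts G1" for x using that w(2) by (auto simp: \<gamma>_def)
 have e: "(bt a,bt b) : set (snd ?s)" using IH(5) ab w(1) by simp
 have gs: "foldl gstep s (es @ [(bt a,bt b)]) = (Suc ?N,(bt a,?N) # (?N,bt a) # (?N,bt b) # (bt b,?N) #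
   filter (%p. p ~= (bt a,bt b) & p ~= (bt b,bt a)) (snd ?s))"
  using e IH(2) by (simp add: gstep_def)
 have "bij_betw \<gamma> (pverts G1) {..<?N}" using IH(4) old by (simp cong: bij_betw_cong)
 hence bij: "bij_betw \<gamma> (pverts G') {..<fst s + Suc j}"
  using notIn_Un_bij_betw[of w "pverts G1" \<gamma> "{..<?N}"] w(2,3) by (simp add: \<gamma>_def lessThan_Suc)
 have arcs: "(\<gamma> x,\<gamma> y) : set (snd (foldl gstep s (es @ [(bt a,bt b)]))) \<longleftrightarrow> (x,y) : parcs G'"
  if xy: "x : pverts G'" "y : pverts G'" for x y
 proof -
  have outE: "p : set (snd ?s) ==> fst p < ?N & snd p < ?N" for p
  proof -
   assume p: "p : set (snd ?s)"
   obtain j' where "(edge_subdivision ^^ j') (gr s) (gr ?s)" using grun_sound[of es s] by blast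
   hence "pair_graph (gr ?s)" by (rule subdivisions_graph[OF s])
   from pair_graph_facts(2)[OF this, of "fst p" "snd p"] p show ?thesis by (simp add: gr_def IH(2))
  qed
  have nE: "(?N,z) ~: set (snd ?s)" "(z,?N) ~: set (snd ?s)" for z using outE by fastforce+
  consider "x = w" "y = w" | "x = w" "y : pverts G1" "y ~= w" | "y = w" "x : pverts G1" "x ~= w" | "x : pverts G1" "y : pverts G1" "x ~= w" "y ~= w"
   using xy w(2,3) by auto
  thus ?thesis
  proof cases
   case 1
   have "\<gamma> w = ?N" by (simp add: \<gamma>_def)
   thus ?thesis unfolding 1 gs using lt[OF ab(1)] lt[OF ab(2)] nE[of ?N] w ab f(2)[of w w] by auto
  next
   case 2
   have "\<gamma> x = ?N" "\<gamma> y = bt y" using 2 old by (simp_all add: \<gamma>_def)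
   thus ?thesis unfolding gs using lt[OF ab(1)] lt[OF ab(2)] lt[OF 2(2)] nE w ab f(2)[of w y] 2 inj[OF 2(2) ab(1)] inj[OF 2(2) ab(2)] by auto
  next
   case 3
   have "\<gamma> y = ?N" "\<gamma> x = bt x" using 3 old by (simp_all add: \<gamma>_def)
   thus ?thesis unfolding gs using lt[OF ab(1)] lt[OF ab(2)] lt[OF 3(2)] nE w ab f(2)[of x w] 3 inj[OF 3(2) ab(1)] inj[OF 3(2) ab(2)] by auto
  next
   case 4
   have "(\<gamma> x,\<gamma> y) : set (snd (foldl gstep s (es @ [(bt a,bt b)]))) \<longleftrightarrow>
     (bt x,bt y) : set (snd ?s) & (bt x,bt y) ~= (bt a,bt b) & (bt x,bt y) ~= (bt b,bt a)"
    unfolding gs old[OF 4(1)] old[OF 4(2)] using lt[OF 4(1)] lt[OF 4(2)] by auto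
   also have "\<dots> \<longleftrightarrow> (x,y) : parcs G1 & (x,y) ~= (a,b) & (x,y) ~= (b,a)"
    using IH(5)[OF 4(1,2)] inj[OF 4(1) ab(1)] inj[OF 4(1) ab(2)] inj[OF 4(2) ab(1)] inj[OF 4(2) ab(2)] by auto
   also have "\<dots> \<longleftrightarrow> (x,y) : parcs G'" using 4 w(3) by auto
   finally show ?thesis .
  qed
 qed
 have "\<forall>e\<in>set (es @ [(bt a,bt b)]). fst e < fst s + Suc j & snd e < fst s + Suc j"
  using IH(3) lt[OF ab(1)] lt[OF ab(2)] by (auto simp: less_Suc_eq)
 thus ?case using IH(1) gs bij arcs by (intro exI[of _ "es @ [(bt a,bt b)]"] exI[of _ \<gamma>]) simp
qed

text \<open>Brute force over all \<open>h\<close>-tuples of vertices, polynomial because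
  \<open>h\<close> is the constant size of \<open>H\<close>.\<close>

definition has_copy :: "nat => (nat * nat * bool) list => nat * (nat * nat) list => bool" where
 "has_copy h tab s \<longleftrightarrow> (\<exists>vs\<in>set (List.n_lists h [0..<fst s]). \<forall>t\<in>set tab.
   (nthd 0 vs (fst t) = nthd 0 vs (fst (snd t)) \<longleftrightarrow> fst t = fst (snd t)) &
   ((nthd 0 vs (fst t),nthd 0 vs (fst (snd t))) : set (snd s) \<longleftrightarrow> snd (snd t)))"

lemma has_copy:
 assumes hv: "distinct hv" "set hv = pverts H"
 shows "has_copy (length hv) (map (%p. (fst p,snd p,(hv ! fst p,hv ! snd p) : parcs H)) (List.product [0..<length hv] [0..<length hv])) s
   \<longleftrightarrow> (\<exists>ph. copy ph H (gr s))" (is "?L \<longleftrightarrow> ?R")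
proof -
 let ?h = "length hv"
 have L: "?L \<longleftrightarrow> (\<exists>vs. length vs = ?h & set vs \<subseteq> {..<fst s} & (\<forall>i<?h. \<forall>j<?h. (vs ! i = vs ! j \<longleftrightarrow> i = j) &
   ((vs ! i,vs ! j) : set (snd s) \<longleftrightarrow> (hv ! i,hv ! j) : parcs H)))"
  unfolding has_copy_def by (auto simp: set_n_lists Bex_def atLeast0LessThan)
 have V: "pverts H = (!) hv ` {..<?h}" unfolding hv(2)[symmetric] by (force simp: in_set_conv_nth)
 show ?thesis
 proof
  assume ?L
  then obtain vs where vs: "length vs = ?h" "set vs \<subseteq> {..<fst s}"
   "!!i j. i < ?h ==> j < ?h ==> (vs ! i = vs ! j \<longleftrightarrow> i = j)"
   "!!i j. i < ?h ==> j < ?h ==> ((vs ! i,vs ! j) : set (snd s) \<longleftrightarrow> (hv ! i,hv ! j) : parcs H)" unfolding L by blast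
  define ph where "ph x = vs ! (inv_into {..<?h} ((!) hv) x)" for x
  have inj: "inj_on ((!) hv) {..<?h}" using hv(1) by (auto simp: inj_on_def nth_eq_iff_index_eq)
  have p: "ph (hv ! i) = vs ! i" if "i < ?h" for i using inj that by (simp add: ph_def)
  have "copy ph H (gr s)" unfolding copy_def
  proof (intro conjI ballI)
   show "inj_on ph (pverts H)" unfolding V by (auto simp: inj_on_def p vs(3))
   show "ph ` pverts H \<subseteq> pverts (gr s)" unfolding V using vs(1,2) by (auto simp: p gr_def subset_iff)
   fix x y assume "x : pverts H" "y : pverts H"
   then obtain i j where "i < ?h" "j < ?h" "x = hv ! i" "y = hv ! j" unfolding V by auto
   thus "(ph x,ph y) : parcs (gr s) \<longleftrightarrow> (x,y) : parcs H" by (simp add: p vs(4) gr_def)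
  qed
  thus ?R by blast
 next
  assume ?R
  then obtain ph where c: "inj_on ph (pverts H)" "ph ` pverts H \<subseteq> {..<fst s}"
   "!!x y. x : pverts H ==> y : pverts H ==> (ph x,ph y) : set (snd s) \<longleftrightarrow> (x,y) : parcs H"
   unfolding copy_def gr_def by auto
  have m: "hv ! i : pverts H" if "i < ?h" for i using that V by blast
  have "length (map ph hv) = ?h & set (map ph hv) \<subseteq> {..<fst s} & (\<forall>i<?h. \<forall>j<?h. (map ph hv ! i = map ph hv ! j \<longleftrightarrow> i = j) &
   ((map ph hv ! i,map ph hv ! j) : set (snd s) \<longleftrightarrow> (hv ! i,hv ! j) : parcs H))"
  proof (intro conjI allI impI)
   show "set (map ph hv) \<subseteq> {..<fst s}" using c(2) hv(2) by simp
   fix i j assume ij: "i < ?h" "j < ?h"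
   show "map ph hv ! i = map ph hv ! j \<longleftrightarrow> i = j"
    using inj_on_eq_iff[OF c(1) m[OF ij(1)] m[OF ij(2)]] ij hv(1) by (simp add: nth_eq_iff_index_eq)
   show "(map ph hv ! i,map ph hv ! j) : set (snd s) \<longleftrightarrow> (hv ! i,hv ! j) : parcs H"
    using c(3)[OF m[OF ij(1)] m[OF ij(2)]] ij by simp
  qed simp
  thus ?L unfolding L by blast
 qed
qed

lemma pt_has_copy: assumes "ptime s" shows "ptime (%x. has_copy h tab (s x))"
 unfolding has_copy_def by (intro pt assms pt_comp[OF assms])

text \<open>Subdividing every edge once makes the graph bipartite, so \<open>n\<^sup>2\<close> subdivisions always suffice.\<close>

lemma subdivide_all:
 assumes "!!e. e : set es ==> fst e < n & snd e < n" "n <= fst s"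
  and "pair_graph (gr s)"
  and "!!p. p : set (snd s) ==> (fst p < n \<longleftrightarrow> \<not> snd p < n) \<or> Q p"
  and "p : set (snd (foldl gstep s es))"
 shows "(fst p < n \<longleftrightarrow> \<not> snd p < n) \<or> Q p & p ~: set es & (snd p,fst p) ~: set es"
 using assms
proof (induction es arbitrary: s Q)
 case Nil thus ?case by auto
next
 case (Cons e es)
 obtain a b where e: "e = (a,b)" by (cases e)
 have ab: "a < n" "b < n" using Cons.prems(1)[of e] e by auto
 note f = pair_graph_facts[OF Cons.prems(3)]
 let ?Q = "%p. Q p & p ~= e & (snd p,fst p) ~= e"
 have pg: "pair_graph (gr (gstep s e))"
 proof (cases "e : set (snd s)")
  case True
  thus ?thesis using edge_subdivision_graph[OF Cons.prems(3) gstep_sub[of a b s]] e by simp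
 next
  case False
  thus ?thesis using Cons.prems(3) by (simp add: gstep_def)
 qed
 have step: "(fst p < n \<longleftrightarrow> \<not> snd p < n) \<or> ?Q p" if p: "p : set (snd (gstep s e))" for p
 proof (cases "e : set (snd s)")
  case True
  hence "p : {(a,fst s),(fst s,a),(fst s,b),(b,fst s)} \<or> p : set (snd s) & p ~= (a,b) & p ~= (b,a)"
   using p by (auto simp: gstep_def e)
  thus ?thesis
  proof
   assume "p : {(a,fst s),(fst s,a),(fst s,b),(b,fst s)}"
   thus ?thesis using ab Cons.prems(2) by auto
  next
   assume a: "p : set (snd s) & p ~= (a,b) & p ~= (b,a)"
   thus ?thesis using Cons.prems(4)[of p] by (cases p) (auto simp: e)
  qed
 next
  case False
  hence ps: "p : set (snd s)" using p by (simp add: gstep_def)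
  have "p ~= e" using ps False by blast
  moreover have "(snd p,fst p) ~= e" using ps False f(3)[of "fst p" "snd p"] by (auto simp: gr_def)
  ultimately show ?thesis using Cons.prems(4)[OF ps] by blast
 qed
 have "(fst p < n \<longleftrightarrow> \<not> snd p < n) \<or> ?Q p & p ~: set es & (snd p,fst p) ~: set es"
 proof (rule Cons.IH[OF _ _ pg step])
  show "e' : set es ==> fst e' < n & snd e' < n" for e' using Cons.prems(1) by simp
  show "n <= fst (gstep s e)" using Cons.prems(2) by (simp add: gstep_def)
  show "p : set (snd (foldl gstep (gstep s e) es))" using Cons.prems(5) by simp
 qed
 thus ?case by auto
qed

definition accept :: "nat => (nat * nat * bool) list => bool list => bool" where
 "accept h tab z \<longleftrightarrow> valid (fst (unpair z)) & le_bits (length (edges_of (snd (unpair z)))) (rest_of (fst (unpair z))) &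
   \<not> has_copy h tab (foldl gstep (lead (fst (unpair z)),arcs_of (fst (unpair z))) (edges_of (snd (unpair z))))"

text \<open>Each step lengthens the arc list by at most 4 and raises the largest number by at most
  1, so the state grows linearly.\<close>

lemma pt_grun: assumes n: "ptime n" and E: "ptime E" and es: "ptime es"
 shows "ptime (%x. foldl (%s e. gstep s e) (n x,E x) (es x))"
proof -
 have one: "fst (gstep t e) <= Suc B & (\<forall>p\<in>set (snd (gstep t e)). fst p <= Suc B & snd p <= Suc B) &
   length (snd (gstep t e)) <= m + 4"
  if t: "fst t <= B & (\<forall>p\<in>set (snd t). fst p <= B & snd p <= B) & length (snd t) <= m" for t e B m
 proof (cases "e : set (snd t)")
  case True
  have "length (filter (%p. p ~= e & p ~= (snd e,fst e)) (snd t)) <= length (snd t)" by (rule length_filter_le)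
  hence "length (filter (%p. p ~= e & p ~= (snd e,fst e)) (snd t)) <= m" using t by linarith
  thus ?thesis using t True by (auto simp: gstep_def le_SucI)
 next
  case False
  hence "gstep t e = t" by (simp add: gstep_def)
  thus ?thesis using t by (auto simp: le_SucI)
 qed
 have inv: "fst (foldl gstep s es) <= A + length es & (\<forall>p\<in>set (snd (foldl gstep s es)). fst p <= A + length es & snd p <= A + length es) &
   length (snd (foldl gstep s es)) <= length (snd s) + 4 * length es"
  if "fst s <= A" "\<forall>p\<in>set (snd s). fst p <= A & snd p <= A" for s es A
 proof (induction es rule: rev_induct)
  case Nil thus ?case using that by simp
 next
  case (snoc e es)
  show ?case using one[OF snoc.IH, of e] by (auto simp: algebra_simps)
 qed
 let ?A = "%x. tsz (n x) + tsz (E x) + tsz (es x)"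
 let ?B = "%x. 2 + (2 * ?A x + 1) + (1 + (tsz (E x) + 4 * tsz (es x)) * (1 + (4 * ?A x + 3)))"
 show ?thesis
 proof (rule pt_foldl[where B = ?B])
  show "ptime (%p :: (nat \<times> (nat \<times> nat) list) \<times> (nat \<times> nat) \<times> 'a. gstep (fst p) (fst (snd p)))" unfolding gstep_def by (intro pt)
  show "pb ?B" by (intro pb_intros pb_ptime n E es)
  fix x i
  let ?es = "take i (es x)" and ?s = "(n x,E x)"
  have ent: "fst p <= tsz (n x) + tsz (E x) & snd p <= tsz (n x) + tsz (E x)" if "p : set (E x)" for p
   using mem_tsz[OF that] by (cases p) simp
  have l: "length ?es <= tsz (es x)" using length_le_tsz[of "es x"] by simp
  obtain m F where mF: "foldl gstep ?s ?es = (m,F)" by (cases "foldl gstep ?s ?es")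
  have "m <= ?A x & (\<forall>p\<in>set F. fst p <= ?A x & snd p <= ?A x) & length F <= tsz (E x) + 4 * tsz (es x)"
   using inv[of ?s "tsz (n x) + tsz (E x)" ?es] ent l length_le_tsz[of "E x"] unfolding mF by fastforce
  hence b: "m <= ?A x" "!!p. p : set F ==> fst p <= ?A x & snd p <= ?A x" "length F <= tsz (E x) + 4 * tsz (es x)" by blast+
  have "tsz F <= 1 + length F * (1 + (4 * ?A x + 3))"
  proof (rule tsz_list_bound)
   fix p assume "p : set F"
   from b(2)[OF this] show "tsz p <= 4 * ?A x + 3" by (cases p) simp
  qed
  also have "\<dots> <= 1 + (tsz (E x) + 4 * tsz (es x)) * (1 + (4 * ?A x + 3))" using b(3) by (intro add_left_mono mult_right_mono) auto
  finally have "tsz F <= 1 + (tsz (E x) + 4 * tsz (es x)) * (1 + (4 * ?A x + 3))" .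
  moreover define X where "X = (tsz (E x) + 4 * tsz (es x)) * (1 + (4 * ?A x + 3))"
  ultimately have "tsz F <= 1 + X" by simp
  moreover have lin: "Suc ((2 * m + 1) + f) <= 2 + (2 * a + 1) + (1 + X)" if "f <= 1 + X" "m <= a" for f a X m :: nat
   using that by simp
  ultimately have "Suc (tsz m + tsz F) <= 2 + (2 * ?A x + 1) + (1 + X)" unfolding tsz_simps(4)[of m] by (intro lin b(1))
  hence "Suc (tsz m + tsz F) <= ?B x" unfolding X_def .
  thus "tsz (foldl (%s e. gstep s e) (n x,E x) (take i (es x))) <= ?B x" unfolding mF tsz_simps .
 qed (intro pt n E es)+
qed

lemma pt_accept: "ptime (%z. accept h tab z)"
 unfolding accept_def
 by (intro pt pt_valid pt_unpair pt_le_bits pt_edges_of pt_rest_of pt_has_copy pt_grun pt_lead pt_arcs_of)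

text \<open>The certificate lists the edges to be subdivided. Since \<open>k\<close> is binary and
  may be exponential, sequences of more than \<open>n * n\<close> steps are replaced by subdividing
  each edge once, after which no copy of the triangle of \<open>H\<close> remains.\<close>

theorem in_NP_free_subdivision:
 fixes H :: "'a pair_pre_digraph"
 assumes H: "pair_graph H" and tri: "(u0,v0) : parcs H" "(u0,w0) : parcs H" "(v0,w0) : parcs H"
 shows "in_NP (free_subdivision H)"
proof -
 note fH = pair_graph_facts[OF H]
 obtain hv where hv: "set hv = pverts H" "distinct hv" using finite_distinct_list[OF fH(1)] by blast
 define tab where "tab = map (%p. (fst p,snd p,(hv ! fst p,hv ! snd p) : parcs H)) (List.product [0..<length hv] [0..<length hv])"
 define R where "R = {z. accept (length hv) tab z}"
 have hc: "has_copy (length hv) tab s \<longleftrightarrow> (\<exists>ph. copy ph H (gr s))" for s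
  unfolding tab_def by (rule has_copy[OF hv(2,1)])
 have "ptime (%z. [z : R])" unfolding R_def mem_Collect_eq by (intro pt pt_accept)
 hence "in_P R" unfolding in_P_def by (rule ptime_polytime_computable)
 \<comment> \<open>A certificate has at most \<open>n * n\<close> pairs with entries below
   \<open>n + n * n\<close>. As the matrix is part of \<open>x\<close>, this gives at most
   \<open>4 * L ^ 2\<close> bits for \<open>L = length x\<close>, which the polynomial
   dominates.\<close>
 moreover have "x : free_subdivision H \<longleftrightarrow> (\<exists>u. length u <= poly [:0,0,2,2,2:] (length x) & encode_pair x u : R)" for x
 proof
  assume "\<exists>u. length u <= poly [:0,0,2,2,2:] (length x) & encode_pair x u : R"
  then obtain u where u: "valid x" "le_bits (length (edges_of u)) (rest_of x)" "\<not> has_copy (length hv) tab (foldl gstep (lead x,arcs_of x) (edges_of u))"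
   by (auto simp: R_def accept_def unpair)
  define G where "G = gr (lead x,arcs_of x)"
  have G: "input_graph G" "x = encode_instance G (horner_sum of_bool 2 (rest_of x))"
   using valid_instance[OF u(1)] by (simp_all add: G_def gr_def)
  hence pg: "pair_graph G" by (simp add: input_graph_def)
  obtain j where j: "j <= length (edges_of u)" "(edge_subdivision ^^ j) G (gr (foldl gstep (lead x,arcs_of x) (edges_of u)))"
   using grun_sound[of "edges_of u" "(lead x,arcs_of x)"] unfolding G_def by blast
  have "induced_free H (gr (foldl gstep (lead x,arcs_of x) (edges_of u)))"
   using induced_free_copy[OF H subdivisions_graph[OF pg j(2)]] u(3) hc by simp
  moreover have "j <= horner_sum of_bool 2 (rest_of x)" using j(1) u(2) unfolding le_bits by (rule order_trans)
  ultimately have "subdividable_to_free H G (horner_sum of_bool 2 (rest_of x))"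
   unfolding subdividable_to_free_def using j(2) by blast
  thus "x : free_subdivision H" unfolding free_subdivision_def using G by blast
 next
  assume "x : free_subdivision H"
  then obtain G k where G: "x = encode_instance G k" "input_graph G" "subdividable_to_free H G k"
   unfolding free_subdivision_def by blast
  note d = decode_instance[OF G(2,1)]
  have pg: "pair_graph G" and V: "pverts G = {..<card (pverts G)}" using G(2) by (auto simp: input_graph_def)
  note f = pair_graph_facts[OF pg]
  let ?s = "(lead x,arcs_of x)" and ?n = "lead x" and ?L = "length x"
  have Gs: "gr ?s = G"
  proof -
   have "pverts (gr ?s) = pverts G" "parcs (gr ?s) = parcs G" using d V by (simp_all add: gr_def)
   thus ?thesis by (rule pair_pre_digraph.equality) simp
  qed
  have xl: "x = replicate ?n True @ [False] @ mat_of x @ rest_of x" "length (mat_of x) = ?n * ?n" using d(4) by (simp_all add: valid_def)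
  have nL: "?n <= ?L" "?n * ?n <= ?L" using arg_cong[OF xl(1), of length] xl(2) by simp_all
  have al: "length (arcs_of x) <= ?n * ?n" unfolding arcs_of_def by (rule order_trans[OF length_filter_le]) simp
  have fin: "x' : R & length u <= poly [:0,0,2,2,2:] (length x)"
   if es: "length es <= k" "length es <= ?n * ?n" "!!e. e : set es ==> fst e < ?n + ?n * ?n & snd e < ?n + ?n * ?n"
    and nc: "\<not> (\<exists>ph. copy ph H (gr (foldl gstep ?s es)))" and x': "u = bits_of es" "x' = encode_pair x u" for es u x'
  proof
   have "le_bits (length es) (rest_of x)" unfolding le_bits d(2) horner_sum_nat_bits by (rule es(1))
   thus "x' : R" using d(4) nc hc by (simp add: R_def accept_def x' unpair edges_of_bits_of)
   have "length (bits_of es) <= length es * (2 * (?n + ?n * ?n))"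
    using es(3)
   proof (induction es)
    case (Cons e es)
    have "length (bits_of (e # es)) = fst e + snd e + 2 + length (bits_of es)" by (simp add: bits_of_def unary_def)
    moreover have "fst e + snd e + 2 <= 2 * (?n + ?n * ?n)" using Cons.prems[of e] by simp
    moreover have "length (bits_of es) <= length es * (2 * (?n + ?n * ?n))" using Cons by simp
    ultimately show ?case by simp
   qed (simp add: bits_of_def)
   also have "\<dots> <= ?L * (2 * (?L + ?L))" using es(2) nL by (intro mult_mono add_mono) auto
   also have "\<dots> <= poly [:0,0,2,2,2:] ?L" by (simp add: algebra_simps) (cases ?L, simp, simp add: algebra_simps)
   finally show "length u <= poly [:0,0,2,2,2:] (length x)" using x' by simp
  qed
  obtain j G' where j: "j <= k" "(edge_subdivision ^^ j) G G'" "induced_free H G'"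
   using G(3) unfolding subdividable_to_free_def by blast
  show "\<exists>u. length u <= poly [:0,0,2,2,2:] (length x) & encode_pair x u : R"
  proof (cases "j <= ?n * ?n")
   case True
   obtain es bt where E: "length es = j & fst (foldl gstep ?s es) = ?n + j & (\<forall>e\<in>set es. fst e < ?n + j & snd e < ?n + j) &
     bij_betw bt (pverts G') {..<?n + j} &
     (\<forall>x\<in>pverts G'. \<forall>y\<in>pverts G'. (bt x,bt y) : set (snd (foldl gstep ?s es)) \<longleftrightarrow> (x,y) : parcs G')"
    using grun_complete[of ?s j G', unfolded Gs fst_conv, OF pg j(2)] by blast
   have es: "length es = j" "fst (foldl gstep ?s es) = ?n + j" "bij_betw bt (pverts G') {..<?n + j}" using E by simp_all
   have esl: "fst e < ?n + j & snd e < ?n + j" if "e : set es" for e using E that by simp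
   have esa: "(bt x,bt y) : set (snd (foldl gstep ?s es)) \<longleftrightarrow> (x,y) : parcs G'" if "x : pverts G'" "y : pverts G'" for x y
    using E that by simp
   have nG: "\<not> (\<exists>ph. copy ph H G')" using induced_free_copy[OF H subdivisions_graph[OF pg j(2)]] j(3) by simp
   have "\<not> (\<exists>ph. copy ph H (gr (foldl gstep ?s es)))"
   proof
    assume "\<exists>ph. copy ph H (gr (foldl gstep ?s es))"
    then obtain ph where c: "inj_on ph (pverts H)" "ph ` pverts H \<subseteq> {..<?n + j}"
     "!!x y. x : pverts H ==> y : pverts H ==> (ph x,ph y) : set (snd (foldl gstep ?s es)) \<longleftrightarrow> (x,y) : parcs H"
     unfolding copy_def gr_def using es(2) by auto
    define \<gamma> where "\<gamma> = inv_into (pverts G') bt"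
    have g: "\<gamma> z : pverts G'" "bt (\<gamma> z) = z" if "z < ?n + j" for z
     using that inv_into_into[of z bt "pverts G'"] f_inv_into_f[of z bt "pverts G'"] bij_betw_imp_surj_on[OF es(3)]
     unfolding \<gamma>_def by simp_all
    have m: "ph x < ?n + j" if "x : pverts H" for x using c(2) that by blast
    have "copy (%z. \<gamma> (ph z)) H G'" unfolding copy_def
    proof (intro conjI ballI)
     show "inj_on (%z. \<gamma> (ph z)) (pverts H)"
     proof (rule inj_onI)
      fix x y assume xy: "x : pverts H" "y : pverts H" "\<gamma> (ph x) = \<gamma> (ph y)"
      hence "ph x = ph y" using g(2)[OF m] by metis
      thus "x = y" using inj_onD[OF c(1)] xy by blast
     qed
     show "(%z. \<gamma> (ph z)) ` pverts H \<subseteq> pverts G'" using g(1)[OF m] by blast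
     fix x y assume xy: "x : pverts H" "y : pverts H"
     show "(\<gamma> (ph x),\<gamma> (ph y)) : parcs G' \<longleftrightarrow> (x,y) : parcs H"
      using esa[OF g(1)[OF m[OF xy(1)]] g(1)[OF m[OF xy(2)]]] c(3)[OF xy] g(2)[OF m[OF xy(1)]] g(2)[OF m[OF xy(2)]] by simp
    qed
    thus False using nG by blast
   qed
   moreover have "fst e < ?n + ?n * ?n & snd e < ?n + ?n * ?n" if "e : set es" for e using esl[OF that] True by linarith
   moreover have "length es <= k" "length es <= ?n * ?n" using es(1) j(1) True by simp_all
   ultimately have "encode_pair x (bits_of es) : R & length (bits_of es) <= poly [:0,0,2,2,2:] (length x)"
    by (intro fin) (rule refl | assumption | simp)+
   thus ?thesis by (intro exI[of _ "bits_of es"]) simp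
  next
   case False
   define es where "es = filter (%p. fst p < snd p) (arcs_of x)"
   have el: "length es <= ?n * ?n" unfolding es_def by (rule order_trans[OF length_filter_le al])
   have lt: "fst e < ?n & snd e < ?n" if "e : set (arcs_of x)" for e using that by (auto simp: arcs_of_def)
   hence lt': "fst e < ?n & snd e < ?n" if "e : set es" for e using that by (auto simp: es_def)
   have bip: "fst p < ?n \<longleftrightarrow> \<not> snd p < ?n" if p: "p : set (snd (foldl gstep ?s es))" for p
   proof -
    have "(fst p < ?n \<longleftrightarrow> \<not> snd p < ?n) \<or> p : set (arcs_of x) & p ~: set es & (snd p,fst p) ~: set es"
     by (rule subdivide_all[OF lt' _ _ _ p]) (use pg Gs in auto)
    moreover have "p : set es \<or> (snd p,fst p) : set es" if "p : set (arcs_of x)"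
    proof -
     have "(fst p,snd p) : parcs G" using that d(3) by simp
     hence "(snd p,fst p) : set (arcs_of x)" "fst p ~= snd p" using f(3,4) d(3) by (auto, metis)
     thus ?thesis using that by (auto simp: es_def)
    qed
    ultimately show ?thesis by blast
   qed
   have "\<not> (\<exists>ph. copy ph H (gr (foldl gstep ?s es)))"
   proof
    assume "\<exists>ph. copy ph H (gr (foldl gstep ?s es))"
    then obtain ph where "copy ph H (gr (foldl gstep ?s es))" by blast
    hence "(ph a,ph b) : set (snd (foldl gstep ?s es))" if "(a,b) : parcs H" for a b
     using that fH(2)[OF that] unfolding copy_def gr_def by auto
    from bip[OF this[OF tri(1)]] bip[OF this[OF tri(2)]] bip[OF this[OF tri(3)]] show False by auto
   qed
   moreover have "fst e < ?n + ?n * ?n & snd e < ?n + ?n * ?n" if "e : set es" for e using lt'[OF that] by simp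
   moreover have "length es <= k" using el j(1) False by linarith
   ultimately have "encode_pair x (bits_of es) : R & length (bits_of es) <= poly [:0,0,2,2,2:] (length x)"
    using el by (intro fin) (rule refl | assumption | simp)+
   thus ?thesis by (intro exI[of _ "bits_of es"]) simp
  qed
 qed
 ultimately show ?thesis unfolding in_NP_def by blast
qed

section \<open>Sparsification\<close>

text \<open>The number \<open>2 * v + 1\<close> is the positive and \<open>2 * v\<close> the
  negative literal of the variable \<open>v\<close>.\<close>

definition csat :: "(nat => bool) => nat list => bool" where
 "csat sg c \<longleftrightarrow> (\<exists>l\<in>set c. sg (l div 2) = odd l)"

definition ssat :: "nat list list => bool" where
 "ssat S \<longleftrightarrow> (\<exists>sg. \<forall>c\<in>set S. csat sg c)"

text \<open>The sorted list without repetitions: clauses with the same literals become equal, and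
  only polynomially many short clauses exist.\<close>

definition norm_clause :: "nat => nat list => nat list" where
 "norm_clause n c = filter (%l. l : set c) [0..<2 * n]"

definition normal :: "nat => nat list => bool" where
 "normal n c \<longleftrightarrow> norm_clause n c = c"

lemma norm_set: "set (norm_clause n c) = {l \<in> set c. l < 2 * n}"
 by (auto simp: norm_clause_def)

lemma normal_norm: "normal n (norm_clause n c)"
 unfolding normal_def norm_clause_def by (rule filter_cong) auto

lemma normal_lt: "normal n c ==> l : set c ==> l < 2 * n"
proof -
 assume n: "normal n c" and "l : set c"
 hence "l : set (norm_clause n c)" by (simp add: normal_def)
 thus "l < 2 * n" by (simp add: norm_set)
qed

lemma normal_eq: "normal n c ==> normal n d ==> set c = set d ==> c = d"
proof -
 assume c: "normal n c" and d: "normal n d" and e: "set c = set d"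
 have "c = norm_clause n c" using c by (simp add: normal_def)
 also have "\<dots> = norm_clause n d" unfolding norm_clause_def e ..
 also have "\<dots> = d" using d by (simp add: normal_def)
 finally show "c = d" .
qed

lemma normal_distinct: "normal n c ==> distinct c"
proof -
 assume "normal n c"
 hence "norm_clause n c = c" by (simp add: normal_def)
 moreover have "distinct (norm_clause n c)" by (simp add: norm_clause_def)
 ultimately show "distinct c" by simp
qed

lemma normal_card: "normal n c ==> card (set c) = length c"
 using normal_distinct distinct_card by blast

lemma normal_filter: "normal n c ==> normal n (filter P c)"
proof -
 assume c: "normal n c"
 have "norm_clause n (filter P c) = filter P (norm_clause n c)"
  unfolding norm_clause_def by (simp add: conj_commute)
 thus ?thesis using c by (simp add: normal_def)
qed

lemma normal_single: "x < 2 * n ==> normal n [x]" "normal n [x] ==> x < 2 * n"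
proof -
 assume x: "x < 2 * n"
 have "set (norm_clause n [x]) = {x}" "distinct (norm_clause n [x])" using x normal_distinct[OF normal_norm] by (auto simp: norm_set)
 hence "length (norm_clause n [x]) = 1" using distinct_card[of "norm_clause n [x]"] by simp
 then obtain y where y: "norm_clause n [x] = [y]" by (auto simp: length_Suc_conv)
 moreover have "y = x" using \<open>set (norm_clause n [x]) = {x}\<close> y by simp
 ultimately show "normal n [x]" by (simp add: normal_def)
next
 assume "normal n [x]" thus "x < 2 * n" by (rule normal_lt) simp
qed

definition active :: "nat list list => nat list => bool" where
 "active S c \<longleftrightarrow> \<not> (\<exists>d\<in>set S. (\<forall>l\<in>set d. l : set c) & \<not> (\<forall>l\<in>set c. l : set d))"

lemma active_iff: "active S c \<longleftrightarrow> \<not> (\<exists>d\<in>set S. set d \<subset> set c)"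
 unfolding active_def by blast

text \<open>The clauses of a flower with heart \<open>h\<close>. An assignment that satisfies them
  satisfies the heart or else all the petals, which is what the branching exploits.\<close>

definition hosts :: "nat list list => nat list => nat => nat list list" where
 "hosts S h s = filter (%c. active S c & length c = s & (\<forall>l\<in>set h. l : set c)) S"

definition petals :: "nat list list => nat list => nat => nat list list" where
 "petals S h s = map (filter (%l. l ~: set h)) (hosts S h s)"

text \<open>The order matters: when a pair serves as heart, no literal lies in \<open>D\<close>
  active 2-clauses, and when the last kind is used, also no pair lies in \<open>D\<close> active
  3-clauses. This keeps at most \<open>2 * D\<close> new 2-clauses at a literal.\<close>

definition cands :: "nat => nat => (nat list * nat * nat) list" where
 "cands n D = map (%x. (norm_clause n [x],2,D)) [0..<2 * n] @
   map (%p. (norm_clause n [fst p,snd p],3,D)) (filter (%p. fst p ~= snd p) (List.product [0..<2 * n] [0..<2 * n])) @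
   map (%x. (norm_clause n [x],3,2 * D * D)) [0..<2 * n]"

definition branch :: "nat => nat => nat list list => nat list list list" where
 "branch n D S = (case filter (%q. snd (snd q) <= length (hosts S (fst q) (fst (snd q)))) (cands n D) of [] => []
   | q # _ => [dedup (S @ [fst q]),dedup (S @ petals S (fst q) (fst (snd q)))])"

definition units :: "nat list list => nat set" where "units S = {x. [x] : set S}"

definition newp :: "nat list list => nat list list => nat list set" where
 "newp S0 S = {c \<in> set S - set S0. length c = 2 & active S c}"

definition inv :: "nat => nat => nat list list => nat list list => bool" where
 "inv n D S0 S \<longleftrightarrow> distinct S & set S0 \<subseteq> set S & (\<forall>c\<in>set S. normal n c & length c <= 3) &
   (\<forall>x. card {c \<in> newp S0 S. x : set c} <= 2 * D)"

text \<open>A unit is worth \<open>4 * D\<close> and a new 2-clause 1. A new unit may deactivate up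
  to \<open>2 * D\<close> new 2-clauses and still lowers the potential by
  \<open>2 * D\<close>.\<close>

definition mu :: "nat => nat => nat list list => nat list list => int" where
 "mu n D S0 S = 4 * int D * (2 * int n - int (card (units S))) - int (card (newp S0 S))"

lemma fin_newp: "finite (newp S0 S)" by (rule finite_subset[of _ "set S"]) (auto simp: newp_def)

lemma units_lt: "inv n D S0 S ==> units S \<subseteq> {..<2 * n}"
proof
 fix x assume i: "inv n D S0 S" and "x : units S"
 hence "[x] : set S" by (simp add: units_def)
 hence "normal n [x]" using i by (simp add: inv_def)
 thus "x : {..<2 * n}" using normal_single(2) by simp
qed

lemma fin_units: "inv n D S0 S ==> finite (units S)" by (rule finite_subset[OF units_lt]) simp_all

lemma newp_lit:
 assumes i: "inv n D S0 S" and c: "c : newp S0 S" and x: "x : set c"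
 shows "x < 2 * n" "x ~: units S"
proof -
 have cS: "c : set S" "length c = 2" "active S c" using c by (auto simp: newp_def)
 have n: "normal n c" using i cS by (simp add: inv_def)
 show "x < 2 * n" using normal_lt[OF n x] .
 show "x ~: units S"
 proof
  assume "x : units S"
  hence "[x] : set S" by (simp add: units_def)
  moreover have "set [x] \<subset> set c"
  proof -
   have "card (set [x]) ~= card (set c)" using normal_card[OF n] cS(2) by simp
   hence "set [x] ~= set c" by metis
   thus ?thesis using x by (simp add: psubset_eq)
  qed
  ultimately show False using cS(3) unfolding active_iff by blast
 qed
qed

text \<open>The literals of a new active 2-clause are not units, and each of the other literals is
  in at most \<open>2 * D\<close> such clauses; so the subtracted count is at most half of the first
  term.\<close>

lemma mu_bounds:
 assumes i: "inv n D S0 S" shows "0 <= mu n D S0 S" "mu n D S0 S <= 8 * int D * int n"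
proof -
 let ?L = "{..<2 * n} - units S"
 have "newp S0 S \<subseteq> (\<Union>x\<in>?L. {c \<in> newp S0 S. x : set c})"
 proof
  fix c assume c: "c : newp S0 S"
  hence "c ~= []" by (auto simp: newp_def)
  then obtain x where "x : set c" by (cases c) auto
  thus "c : (\<Union>x\<in>?L. {c \<in> newp S0 S. x : set c})" using newp_lit[OF i c] c by blast
 qed
 hence "card (newp S0 S) <= card (\<Union>x\<in>?L. {c \<in> newp S0 S. x : set c})"
  using fin_newp by (intro card_mono) auto
 also have "\<dots> <= (\<Sum>x\<in>?L. card {c \<in> newp S0 S. x : set c})" by (rule card_UN_le) simp
 also have "\<dots> <= (\<Sum>x\<in>?L. 2 * D)" using i by (intro sum_mono) (simp add: inv_def)
 also have "\<dots> = (2 * n - card (units S)) * (2 * D)"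
  using units_lt[OF i] fin_units[OF i] by (simp add: card_Diff_subset)
 finally have a: "card (newp S0 S) <= (2 * n - card (units S)) * (2 * D)" .
 have u: "card (units S) <= 2 * n" using card_mono[OF _ units_lt[OF i]] by simp
 have "int (card (newp S0 S)) <= (2 * int n - int (card (units S))) * (2 * int D)"
  using iffD2[OF of_nat_le_iff[where ?'a = int] a] u by (simp add: of_nat_diff)
 moreover define q where "q = (2 * int n - int (card (units S))) * int D"
 have q: "0 <= q" using u by (simp add: q_def)
 have "(2 * int n - int (card (units S))) * (2 * int D) = 2 * q" "4 * int D * (2 * int n - int (card (units S))) = 4 * q"
  by (simp_all add: q_def)
 ultimately show "0 <= mu n D S0 S" using q unfolding mu_def by linarith
 have "4 * int D * (2 * int n - int (card (units S))) <= 4 * int D * (2 * int n)" by (intro mult_left_mono) auto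
 thus "mu n D S0 S <= 8 * int D * int n" by (simp add: mu_def)
qed

lemma add_units:
 assumes i: "inv n D S0 S" and Z: "finite Z" "Z \<subseteq> {..<2 * n}" "Z \<inter> units S = {}"
  and S': "distinct S'" "set S' = set S \<union> (%z. [z]) ` Z"
 shows "inv n D S0 S'" "mu n D S0 S' <= mu n D S0 S - 2 * int D * int (card Z)"
proof -
 have sub: "newp S0 S' \<subseteq> newp S0 S" using S'(2) by (auto simp: newp_def active_def)
 have lost: "newp S0 S - newp S0 S' \<subseteq> (\<Union>z\<in>Z. {c \<in> newp S0 S. z : set c})"
 proof
  fix c assume c: "c : newp S0 S - newp S0 S'"
  hence "\<not> active S' c" using S'(2) by (auto simp: newp_def)
  then obtain d where d: "d : set S'" "set d \<subset> set c" unfolding active_iff by blast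
  have "d ~: set S" using c d(2) unfolding newp_def active_iff by blast
  then obtain z where "z : Z" "d = [z]" using d(1) S'(2) by auto
  thus "c : (\<Union>z\<in>Z. {c \<in> newp S0 S. z : set c})" using c d(2) by auto
 qed
 have d: "card {c \<in> newp S0 S. x : set c} <= 2 * D" for x using i by (simp add: inv_def)
 have "card (newp S0 S) <= card (newp S0 S') + card (newp S0 S - newp S0 S')"
  using card_Un_le[of "newp S0 S'" "newp S0 S - newp S0 S'"] sub by (simp add: Un_absorb1)
 also have "card (newp S0 S - newp S0 S') <= card (\<Union>z\<in>Z. {c \<in> newp S0 S. z : set c})"
  using lost fin_newp Z(1) by (intro card_mono) auto
 also have "\<dots> <= (\<Sum>z\<in>Z. card {c \<in> newp S0 S. z : set c})" by (rule card_UN_le[OF Z(1)])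
 also have "\<dots> <= (\<Sum>z\<in>Z. 2 * D)" using d by (intro sum_mono) simp
 finally have a: "card (newp S0 S) <= card (newp S0 S') + card Z * (2 * D)" by simp
 have u: "units S' = units S \<union> Z" using S'(2) by (auto simp: units_def)
 have cu: "card (units S') = card (units S) + card Z"
  unfolding u using Z fin_units[OF i] by (intro card_Un_disjoint) auto
 have "int (card (newp S0 S)) <= int (card (newp S0 S')) + int (card Z) * (2 * int D)"
  using iffD2[OF of_nat_le_iff[where ?'a = int] a] by simp
 thus "mu n D S0 S' <= mu n D S0 S - 2 * int D * int (card Z)"
  unfolding mu_def cu by (simp add: algebra_simps)
 have "card {c \<in> newp S0 S'. x : set c} <= 2 * D" for x
  using card_mono[of "{c \<in> newp S0 S. x : set c}" "{c \<in> newp S0 S'. x : set c}"] sub fin_newp[of S0 S] d[of x] by fastforce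
 moreover have "normal n c & length c <= 3" if "c : set S'" for c
  using that i Z(2) normal_single(1)[of _ n] unfolding S'(2) inv_def by auto
 ultimately show "inv n D S0 S'" using i S' unfolding inv_def by auto
qed

text \<open>A 2-clause is never properly contained in another one, so no 2-clause counted before
  becomes inactive.\<close>

lemma add_pairs:
 assumes i: "inv n D S0 S" and P: "finite P" "!!p. p : P ==> normal n p & length p = 2 & p ~: set S & active S p"
  and deg: "!!x. card {c \<in> newp S0 S. x : set c} + card {p \<in> P. x : set p} <= 2 * D"
  and S': "distinct S'" "set S' = set S \<union> P"
 shows "inv n D S0 S'" "mu n D S0 S' = mu n D S0 S - int (card P)"
proof -
 have n: "normal n c" if "c : set S'" for c using that i P unfolding S'(2) inv_def by blast
 have np: "\<not> set d \<subset> set c" if "d : P" "c : set S'" "length c = 2" for c d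
 proof
  assume "set d \<subset> set c"
  hence "card (set d) < card (set c)" by (intro psubset_card_mono) auto
  thus False using normal_card[of n d] normal_card[OF n[OF that(2)]] P(2)[OF that(1)] that(3) by simp
 qed
 have act: "active S' c \<longleftrightarrow> active S c" if "c : set S'" "length c = 2" for c
  using np[OF _ that] unfolding active_iff S'(2) by blast
 have s0: "set S0 \<subseteq> set S" using i by (simp add: inv_def)
 have e: "newp S0 S' = newp S0 S \<union> P"
 proof (intro equalityI subsetI)
  fix c assume "c : newp S0 S'"
  thus "c : newp S0 S \<union> P" using act[of c] S'(2) unfolding newp_def by blast
 next
  fix c assume "c : newp S0 S \<union> P"
  thus "c : newp S0 S'"
  proof
   assume "c : newp S0 S" thus ?thesis using act[of c] S'(2) unfolding newp_def by blast
  next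
   assume c: "c : P" thus ?thesis using act[of c] P(2)[OF c] S'(2) s0 unfolding newp_def by blast
  qed
 qed
 have dis: "newp S0 S \<inter> P = {}" using P(2) by (auto simp: newp_def)
 have u: "units S' = units S" using P(2) S'(2) by (fastforce simp: units_def)
 have "card (newp S0 S') = card (newp S0 S) + card P" unfolding e by (rule card_Un_disjoint[OF fin_newp P(1) dis])
 thus "mu n D S0 S' = mu n D S0 S - int (card P)" unfolding mu_def u by simp
 have "card {c \<in> newp S0 S'. x : set c} <= 2 * D" for x
 proof -
  have "{c \<in> newp S0 S'. x : set c} = {c \<in> newp S0 S. x : set c} \<union> {p \<in> P. x : set p}" unfolding e by blast
  hence "card {c \<in> newp S0 S'. x : set c} <= card {c \<in> newp S0 S. x : set c} + card {p \<in> P. x : set p}" by (simp add: card_Un_le)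
  thus ?thesis using deg[of x] by simp
 qed
 moreover have "length c <= 3" if "c : set S'" for c using that i P unfolding S'(2) inv_def by fastforce
 ultimately show "inv n D S0 S'" using i S' n unfolding inv_def by blast
qed

lemma hosts_mem: "c : set (hosts S h s) \<longleftrightarrow> c : set S & active S c & length c = s & set h \<subseteq> set c"
 by (auto simp: hosts_def)

text \<open>Heart and petal are proper parts of an active clause; so neither can already be present
  or be subsumed, and adding them is real progress.\<close>

lemma petal_facts:
 assumes i: "inv n D S0 S" and h: "normal n h" and c: "c : set (hosts S h s)"
 defines "p \<equiv> filter (%l. l ~: set h) c"
 shows "normal n p" "set p = set c - set h" "length p = s - length h" "length h <= s"
  and "h ~= [] ==> length h < s ==> p ~: set S & active S p & h ~: set S & active S h"
proof -
 have cS: "c : set S" "active S c" "length c = s" "set h \<subseteq> set c" using c by (auto simp: hosts_mem)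
 have n: "normal n c" using i cS by (simp add: inv_def)
 show np: "normal n p" unfolding p_def by (rule normal_filter[OF n])
 show sp: "set p = set c - set h" by (auto simp: p_def)
 have "card (set p) = card (set c) - card (set h)" unfolding sp using cS(4) by (simp add: card_Diff_subset)
 thus "length p = s - length h" using normal_card[OF np] normal_card[OF n] normal_card[OF h] cS(3) by simp
 show "length h <= s" using card_mono[OF _ cS(4)] normal_card[OF n] normal_card[OF h] cS(3) by simp
 assume "h ~= []" "length h < s"
 have "set p \<subset> set c" unfolding sp using cS(4) \<open>h \<noteq> []\<close> by (cases h) auto
 moreover have "set h \<subset> set c"
 proof -
  have "set h ~= set c" using normal_card[OF n] normal_card[OF h] cS(3) \<open>length h < s\<close> by auto
  thus ?thesis using cS(4) by blast
 qed
 ultimately show "p ~: set S & active S p & h ~: set S & active S h" using cS(2) unfolding active_iff by blast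
qed

lemma petals_card:
 assumes i: "inv n D S0 S" shows "card (set (petals S h s)) = length (hosts S h s)"
proof -
 have d: "distinct (hosts S h s)" using i by (simp add: inv_def hosts_def)
 have "inj_on (filter (%l. l ~: set h)) (set (hosts S h s))"
 proof (rule inj_onI)
  fix c d assume c: "c : set (hosts S h s)" and d: "d : set (hosts S h s)" and e: "filter (%l. l ~: set h) c = filter (%l. l ~: set h) d"
  have "set c - set h = set d - set h" using arg_cong[OF e, of set] by auto
  moreover have "set h \<subseteq> set c" "set h \<subseteq> set d" using c d by (auto simp: hosts_mem)
  ultimately have "set c = set d" by blast
  moreover have "normal n c" "normal n d" using i c d by (auto simp: inv_def hosts_mem)
  ultimately show "c = d" using normal_eq by blast
 qed
 thus ?thesis unfolding petals_def set_map using d by (simp add: card_image distinct_card)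
qed

lemma single_petals:
 assumes i: "inv n D S0 S" and h: "normal n h" "h ~= []" "s = Suc (length h)"
 obtains Z where "finite Z" "Z \<subseteq> {..<2 * n}" "Z \<inter> units S = {}" "set (petals S h s) = (%z. [z]) ` Z" "card Z = length (hosts S h s)"
proof -
 define Z where "Z = {z. [z] : set (petals S h s)}"
 have p: "length p = 1 & normal n p & p ~: set S" if p: "p : set (petals S h s)" for p
 proof -
  obtain c where c: "c : set (hosts S h s)" "p = filter (%l. l ~: set h) c" using p unfolding petals_def by auto
  show ?thesis using petal_facts(1,3,5)[OF i h(1) c(1)] h(2,3) c(2) by simp
 qed
 have e: "set (petals S h s) = (%z. [z]) ` Z"
 proof (intro equalityI subsetI)
  fix p assume "p : set (petals S h s)"
  moreover from this obtain z where "p = [z]" using p by (auto simp: length_Suc_conv)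
  ultimately show "p : (%z. [z]) ` Z" by (simp add: Z_def)
 qed (auto simp: Z_def)
 have "card Z = card (set (petals S h s))" unfolding e by (simp add: card_image inj_on_def)
 hence c: "card Z = length (hosts S h s)" using petals_card[OF i] by simp
 have "Z \<subseteq> {..<2 * n}" using p normal_single(2) by (auto simp: Z_def)
 moreover have "Z \<inter> units S = {}" using p by (auto simp: Z_def units_def)
 ultimately show thesis using that[OF _ _ _ e c] finite_subset[of Z "{..<2 * n}"] by blast
qed

lemma heart_unit:
 assumes i: "inv n D S0 S" and x: "x < 2 * n" and c: "c : set (hosts S [x] s)" and s: "1 < s"
  and S': "distinct S'" "set S' = set S \<union> {[x]}"
 shows "inv n D S0 S'" "mu n D S0 S' <= mu n D S0 S - 2 * int D"
proof -
 have "[x] ~: set S" using petal_facts(5)[OF i normal_single(1)[OF x] c] s by simp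
 hence "{x} \<inter> units S = {}" by (simp add: units_def)
 from add_units[OF i _ _ this, of S'] x S' show "inv n D S0 S'" "mu n D S0 S' <= mu n D S0 S - 2 * int D" by auto
qed

lemma first_filter:
 assumes "filter P (xs @ ys @ zs) = q # qs"
 shows "P q" "q : set xs \<or> filter P xs = [] & q : set ys \<or> filter P xs = [] & filter P ys = [] & q : set zs"
proof -
 have "q : set (filter P (xs @ ys @ zs))" using assms by simp
 thus "P q" by auto
 show "q : set xs \<or> filter P xs = [] & q : set ys \<or> filter P xs = [] & filter P ys = [] & q : set zs"
 proof (cases "filter P xs")
  case (Cons a as)
  hence "q : set (filter P xs)" using assms by simp
  thus ?thesis by simp
 next
  case Nil
  show ?thesis
  proof (cases "filter P ys")
   case (Cons a as)
   hence "q : set (filter P ys)" using assms Nil by simp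
   thus ?thesis using Nil by simp
  next
   case Nil2: Nil
   hence "q : set (filter P zs)" using assms Nil by simp
   thus ?thesis using Nil Nil2 by simp
  qed
 qed
qed

lemma deg_newp:
 assumes i: "inv n D S0 S" and D: "1 <= D" and A: "!!x. x < 2 * n ==> length (hosts S [x] 2) < D"
 shows "card {c \<in> newp S0 S. x : set c} < D"
proof (cases "x < 2 * n")
 case True
 have "{c \<in> newp S0 S. x : set c} \<subseteq> set (hosts S [x] 2)" by (auto simp: newp_def hosts_mem)
 hence "card {c \<in> newp S0 S. x : set c} <= card (set (hosts S [x] 2))" by (intro card_mono) auto
 also have "\<dots> <= length (hosts S [x] 2)" by (rule card_length)
 finally show ?thesis using A[OF True] by simp
next
 case False
 hence "{c \<in> newp S0 S. x : set c} = {}" using newp_lit(1)[OF i] by blast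
 hence "card {c \<in> newp S0 S. x : set c} = 0" by (simp only: card.empty)
 thus ?thesis using D by linarith
qed

lemma norm_single: "x < 2 * n ==> norm_clause n [x] = [x]"
 using normal_single(1) by (simp add: normal_def)

lemma norm_pair: assumes "x < 2 * n" "y < 2 * n" "x ~= y" shows "set (norm_clause n [x,y]) = {x,y}" "length (norm_clause n [x,y]) = 2"
proof -
 show s: "set (norm_clause n [x,y]) = {x,y}" using assms by (auto simp: norm_set)
 show "length (norm_clause n [x,y]) = 2" using normal_card[OF normal_norm, of n "[x,y]"] assms(3) unfolding s by simp
qed

text \<open>For each kind of flower the heart lowers the potential by at least 1, and the petals by
  at least \<open>2 * D * D\<close>: either \<open>D\<close> units worth \<open>2 * D\<close> each,
  or \<open>2 * D * D\<close> new 2-clauses.\<close>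

theorem branch_step:
 assumes i: "inv n D S0 S" and D: "1 <= D" and b: "branch n D S ~= []"
 obtains A B where "branch n D S = [A,B]" "inv n D S0 A" "inv n D S0 B" "mu n D S0 A <= mu n D S0 S - 1"
  "mu n D S0 B <= mu n D S0 S - 2 * int D * int D" "ssat S \<longleftrightarrow> ssat A \<or> ssat B"
proof -
 let ?P = "%q. snd (snd q) <= length (hosts S (fst q) (fst (snd q)))"
 obtain q qs where q: "filter ?P (cands n D) = q # qs" using b by (auto simp: branch_def split: list.splits)
 obtain h s t where hst: "q = (h,s,t)" by (cases q) auto
 define A where "A = dedup (S @ [h])"
 define B where "B = dedup (S @ petals S h s)"
 have br: "branch n D S = [A,B]" using q by (simp add: branch_def hst A_def B_def)
 have sA: "distinct A" "set A = set S \<union> {h}" by (auto simp: A_def dedup)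
 have sB: "distinct B" "set B = set S \<union> set (petals S h s)" by (auto simp: B_def dedup)
 note ff = first_filter[OF q[unfolded cands_def]]
 have t: "t <= length (hosts S h s)" using ff(1) by (simp add: hst)
 have sat: "ssat S \<longleftrightarrow> ssat A \<or> ssat B"
 proof
  assume "ssat S"
  then obtain sg where sg: "!!c. c : set S ==> csat sg c" unfolding ssat_def by blast
  show "ssat A \<or> ssat B"
  proof (cases "csat sg h")
   case True thus ?thesis unfolding ssat_def sA(2) using sg by blast
  next
   case False
   have "csat sg p" if pp: "p : set (petals S h s)" for p
   proof -
    obtain c where c: "c : set (hosts S h s)" "p = filter (%l. l ~: set h) c" using pp unfolding petals_def by auto
    hence "csat sg c" using sg by (simp add: hosts_mem)
    thus ?thesis using False c(2) unfolding csat_def by auto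
   qed
   thus ?thesis unfolding ssat_def sB(2) using sg by blast
  qed
 next
  assume "ssat A \<or> ssat B"
  thus "ssat S" unfolding ssat_def sA(2) sB(2) by blast
 qed
 let ?two = "map (%x. (norm_clause n [x],2,D)) [0..<2 * n]"
 let ?pair = "map (%p. (norm_clause n [fst p,snd p],3,D)) (filter (%p. fst p ~= snd p) (List.product [0..<2 * n] [0..<2 * n]))"
 have noA: "length (hosts S [x] 2) < D" if "filter ?P ?two = []" "x < 2 * n" for x
 proof -
  have "\<not> ?P q" if "q : set ?two" for q using \<open>filter ?P ?two = []\<close> that unfolding filter_empty_conv by blast
  moreover have "(norm_clause n [x],2,D) : set ?two" unfolding set_map by (rule image_eqI[of _ _ x]) (use that(2) in simp_all)
  ultimately show ?thesis using norm_single[OF that(2)] by fastforce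
 qed
 have noB: "length (hosts S (norm_clause n [x,y]) 3) < D" if "filter ?P ?pair = []" "x < 2 * n" "y < 2 * n" "x ~= y" for x y
 proof -
  have "\<not> ?P q" if "q : set ?pair" for q using \<open>filter ?P ?pair = []\<close> that unfolding filter_empty_conv by blast
  moreover have "(norm_clause n [x,y],3,D) : set ?pair" unfolding set_map by (rule image_eqI[of _ _ "(x,y)"]) (use that(2-4) in simp_all)
  ultimately show ?thesis by fastforce
 qed
 have "inv n D S0 A & inv n D S0 B & mu n D S0 A <= mu n D S0 S - 1 & mu n D S0 B <= mu n D S0 S - 2 * int D * int D"
  using ff(2)
 proof (elim disjE conjE)
  assume "q : set ?two"
  then obtain x where x: "x < 2 * n" "h = [x]" "s = 2" "t = D" using norm_single by (auto simp: hst)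
  obtain c where c: "c : set (hosts S [x] s)" using t D x by (cases "hosts S [x] s") auto
  obtain Z where Z: "finite Z" "Z \<subseteq> {..<2 * n}" "Z \<inter> units S = {}" "set (petals S h s) = (%z. [z]) ` Z" "card Z = length (hosts S h s)"
   using single_petals[OF i, of h s] normal_single(1)[OF x(1)] x by auto
  have "int D <= int (card Z)" using Z(5) t x(4) by simp
  hence "2 * int D * int D <= 2 * int D * int (card Z)" by (intro mult_left_mono) auto
  moreover have "inv n D S0 A & mu n D S0 A <= mu n D S0 S - 1" using heart_unit[OF i x(1) c _ sA(1)] sA(2) x(2,3) D by auto
  moreover have "set B = set S \<union> (%z. [z]) ` Z" using sB(2) Z(4) by simp
  note add_units[OF i Z(1-3) sB(1) this]
  ultimately show ?thesis by (intro conjI; (linarith | simp))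
 next
  assume n2: "filter ?P ?two = []" and "q : set ?pair"
  then obtain x y where xy: "x < 2 * n" "y < 2 * n" "x ~= y" "h = norm_clause n [x,y]" "s = 3" "t = D" by (auto simp: hst)
  note np = norm_pair[OF xy(1-3), folded xy(4)]
  have hn: "normal n h" unfolding xy(4) by (rule normal_norm)
  have h0: "h ~= []" using np(2) by auto
  obtain c where c: "c : set (hosts S h s)" using t D xy by (cases "hosts S h s") auto
  obtain Z where Z: "finite Z" "Z \<subseteq> {..<2 * n}" "Z \<inter> units S = {}" "set (petals S h s) = (%z. [z]) ` Z" "card Z = length (hosts S h s)"
   using single_petals[OF i hn h0, of s] np(2) xy(5) by auto
  have "int D <= int (card Z)" using Z(5) t xy(6) by simp
  hence "2 * int D * int D <= 2 * int D * int (card Z)" by (intro mult_left_mono) auto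
  moreover have "set B = set S \<union> (%z. [z]) ` Z" using sB(2) Z(4) by simp
  note add_units[OF i Z(1-3) sB(1) this]
  ultimately have B: "inv n D S0 B & mu n D S0 B <= mu n D S0 S - 2 * int D * int D"
   by (intro conjI; (linarith | simp))
  have hh: "h ~: set S" "active S h" using petal_facts(5)[OF i hn c h0] np(2) xy(5) by auto
  have "card {c \<in> newp S0 S. z : set c} + card {p \<in> {h}. z : set p} <= 2 * D" for z
  proof -
   have "card {p \<in> {h}. z : set p} <= card {h}" by (intro card_mono) auto
   thus ?thesis using deg_newp[OF i D noA[OF n2], of z] D by simp
  qed
  hence "inv n D S0 A" "mu n D S0 A = mu n D S0 S - int (card {h})"
   using add_pairs[OF i, of "{h}" A] hn np(2) hh sA by auto
  thus ?thesis using B by simp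
 next
  assume n2: "filter ?P ?two = []" and n3: "filter ?P ?pair = []" and "q : set (map (%x. (norm_clause n [x],3,2 * D * D)) [0..<2 * n])"
  then obtain x where x: "x < 2 * n" "h = [x]" "s = 3" "t = 2 * D * D" using norm_single by (auto simp: hst)
  obtain c where c: "c : set (hosts S [x] s)" using t D x by (cases "hosts S [x] s") auto
  have A: "inv n D S0 A & mu n D S0 A <= mu n D S0 S - 1" using heart_unit[OF i x(1) c _ sA(1)] sA(2) x(2,3) D by auto
  let ?Q = "set (petals S h s)"
  have hn: "normal n h" using normal_single(1)[OF x(1)] x(2) by simp
  have pf: "normal n p & length p = 2 & p ~: set S & active S p" if pp: "p : ?Q" for p
  proof -
   obtain c where c: "c : set (hosts S h s)" "p = filter (%l. l ~: set h) c" using pp unfolding petals_def by auto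
   show ?thesis using petal_facts(1,3,5)[OF i hn c(1)] c(2) x(2,3) by auto
  qed
  \<comment> \<open>Fewer than \<open>D\<close> new 2-clauses contain \<open>z\<close> because the
    first kind does not apply, and at most \<open>D\<close> petals do because the second kind does
    not.\<close>
  have "card {c \<in> newp S0 S. z : set c} + card {p \<in> ?Q. z : set p} <= 2 * D" for z
  proof -
   have "card {p \<in> ?Q. z : set p} <= D"
   proof (cases "z < 2 * n & z ~= x")
    case True
    let ?H = "set (hosts S (norm_clause n [x,z]) 3)"
    have "{p \<in> ?Q. z : set p} \<subseteq> filter (%l. l ~: set h) ` ?H"
    proof
     fix p assume p: "p : {p \<in> ?Q. z : set p}"
     then obtain c where c: "c : set (hosts S h s)" "p = filter (%l. l ~: set h) c" unfolding petals_def by auto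
     have "set (norm_clause n [x,z]) = {x,z}" using norm_pair(1) True x(1) by auto
     hence "c : ?H" using c p x(2,3) by (auto simp: hosts_mem)
     thus "p : filter (%l. l ~: set h) ` ?H" using c(2) by blast
    qed
    hence "card {p \<in> ?Q. z : set p} <= card (filter (%l. l ~: set h) ` ?H)" by (intro card_mono) auto
    also have "\<dots> <= card ?H" by (rule card_image_le) simp
    also have "\<dots> <= length (hosts S (norm_clause n [x,z]) 3)" by (rule card_length)
    finally show ?thesis using noB[OF n3 x(1), of z] True by simp
   next
    case False
    have "{p \<in> ?Q. z : set p} = {}"
    proof (rule ccontr)
     assume "{p \<in> ?Q. z : set p} ~= {}"
     then obtain p where p: "p : ?Q" "z : set p" by blast
     have "z < 2 * n" using pf[OF p(1)] normal_lt p(2) by blast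
     moreover have "z ~= x" using p x(2) unfolding petals_def by auto
     ultimately show False using False by blast
    qed
    thus ?thesis by (metis card.empty le0)
   qed
   thus ?thesis using deg_newp[OF i D noA[OF n2], of z] by linarith
  qed
  note ap = add_pairs[OF i finite_set pf this sB]
  have "inv n D S0 B" by (rule ap(1)) simp_all
  moreover have "mu n D S0 B = mu n D S0 S - int (card ?Q)" by (rule ap(2)) simp_all
  moreover have "2 * int D * int D <= int (card ?Q)"
  proof -
   have "2 * D * D <= card ?Q" using petals_card[OF i, of h s] t x(4) by simp
   hence "int (2 * D * D) <= int (card ?Q)" by (simp only: of_nat_le_iff)
   thus ?thesis by simp
  qed
  ultimately show ?thesis using A by simp
 qed
 thus thesis using that[OF br _ _ _ _ sat] by blast
qed

definition kernel :: "nat list list => nat list list" where "kernel S = filter (active S) S"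

lemma kernel_sat: "ssat (kernel S) \<longleftrightarrow> ssat S"
proof
 assume "ssat (kernel S)"
 then obtain sg where sg: "!!c. c : set S ==> active S c ==> csat sg c" unfolding ssat_def kernel_def by auto
 have "csat sg c" if "c : set S" for c
  using that
 proof (induction "card (set c)" arbitrary: c rule: less_induct)
  case less
  show ?case
  proof (cases "active S c")
   case True thus ?thesis using sg less by blast
  next
   case False
   then obtain d where d: "d : set S" "set d \<subset> set c" unfolding active_iff by blast
   hence "csat sg d" using less.hyps psubset_card_mono[of "set c" "set d"] by simp
   thus ?thesis using d(2) unfolding csat_def by blast
  qed
 qed
 thus "ssat S" unfolding ssat_def by blast
qed (auto simp: ssat_def kernel_def)

text \<open>Since no candidate applies, each literal heads at most one unit, \<open>D\<close>
  2-clauses and \<open>2 * D * D\<close> 3-clauses; the 1 is for the empty clause.\<close>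

theorem kernel_sparse:
 assumes i: "inv n D S0 S" and b: "branch n D S = []"
 shows "length (kernel S) <= 1 + 2 * n * (1 + D + 2 * D * D)"
proof -
 have f: "filter (%q. snd (snd q) <= length (hosts S (fst q) (fst (snd q)))) (cands n D) = []"
  using b by (auto simp: branch_def split: list.splits)
 have nb: "\<not> snd (snd q) <= length (hosts S (fst q) (fst (snd q)))" if "q : set (cands n D)" for q
  using f that unfolding filter_empty_conv by blast
 have s2: "length (hosts S [x] 2) <= D" if "x < 2 * n" for x
 proof -
  have "(norm_clause n [x],2,D) : set (cands n D)"
   unfolding cands_def set_append set_map by (rule UnI1) (rule image_eqI[of _ _ x], use that in simp_all)
  thus ?thesis using nb norm_single[OF that] by fastforce
 qed
 have s3: "length (hosts S [x] 3) <= 2 * D * D" if "x < 2 * n" for x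
 proof -
  have "(norm_clause n [x],3,2 * D * D) : set (cands n D)"
   unfolding cands_def set_append set_map by (rule UnI2)+ (rule image_eqI[of _ _ x], use that in simp_all)
  thus ?thesis using nb norm_single[OF that] by fastforce
 qed
 have n: "normal n c & length c <= 3" if "c : set S" for c using i that by (simp add: inv_def)
 let ?U = "\<Union>x\<in>{..<2 * n}. insert [x] (set (hosts S [x] 2) \<union> set (hosts S [x] 3))"
 have "set (kernel S) \<subseteq> insert [] ?U"
 proof
  fix c assume c: "c : set (kernel S)"
  hence cS: "c : set S" "active S c" by (auto simp: kernel_def)
  show "c : insert [] ?U"
  proof (cases c)
   case (Cons x d)
   have x: "x < 2 * n" using normal_lt[of n c x] n[OF cS(1)] Cons by simp
   have "length c <= 3" "1 <= length c" using n[OF cS(1)] Cons by simp_all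
   hence "length c = 1 \<or> length c = 2 \<or> length c = 3" by linarith
   hence "c = [x] \<or> c : set (hosts S [x] 2) \<or> c : set (hosts S [x] 3)"
    using cS Cons by (auto simp: hosts_mem)
   thus ?thesis using x by blast
  qed simp
 qed
 hence "card (set (kernel S)) <= card (insert [] ?U)" by (intro card_mono) auto
 also have "\<dots> <= 1 + card ?U" by (simp add: card_insert_le_m1 card_insert_if)
 also have "card ?U <= (\<Sum>x<2 * n. card (insert [x] (set (hosts S [x] 2) \<union> set (hosts S [x] 3))))" by (rule card_UN_le) simp
 also have "\<dots> <= (\<Sum>x<2 * n. 1 + D + 2 * D * D)"
 proof (rule sum_mono)
  fix x assume "x : {..<2 * n}"
  hence x: "x < 2 * n" by simp
  have "card (insert [x] (set (hosts S [x] 2) \<union> set (hosts S [x] 3))) <= Suc (card (set (hosts S [x] 2) \<union> set (hosts S [x] 3)))"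
   by (simp add: card_insert_if)
  also have "card (set (hosts S [x] 2) \<union> set (hosts S [x] 3)) <= card (set (hosts S [x] 2)) + card (set (hosts S [x] 3))" by (rule card_Un_le)
  finally show "card (insert [x] (set (hosts S [x] 2) \<union> set (hosts S [x] 3))) <= 1 + D + 2 * D * D"
   using card_length[of "hosts S [x] 2"] card_length[of "hosts S [x] 3"] s2[OF x] s3[OF x] by linarith
 qed
 finally have "card (set (kernel S)) <= 1 + 2 * n * (1 + D + 2 * D * D)" by simp
 moreover have "distinct (kernel S)" using i by (simp add: inv_def kernel_def)
 ultimately show ?thesis by (simp add: distinct_card)
qed

text \<open>The recurrence with decreases 1 and \<open>2 * D * D\<close> for the base
  \<open>2 powr (\<epsilon> / (8 * D))\<close>. The first term falls short of 1 by about
  \<open>1 / D\<close> up to a factor, while the second is exponentially small in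
  \<open>D\<close>.\<close>

lemma branching_base:
 assumes "0 < (\<epsilon>::real)"
 shows "\<exists>D::nat. 1 <= D & 2 powr (- \<epsilon> / (8 * real D)) + 2 powr (- \<epsilon> * real D / 4) <= 1"
proof -
 have "\<forall>\<^sub>F D in at_top. 2 powr (- \<epsilon> / (8 * real D)) + 2 powr (- \<epsilon> * real D / 4) <= 1"
  using assms by real_asymp
 then obtain N where "!!D. N <= D ==> 2 powr (- \<epsilon> / (8 * real D)) + 2 powr (- \<epsilon> * real D / 4) <= 1"
  unfolding eventually_at_top_linorder by blast
 thus ?thesis by (intro exI[of _ "max 1 N"]) simp
qed

section \<open>Simulating Turing machines\<close>

text \<open>The exponent \<open>E\<close> depends on the programs alone and is fixed before the
  bounds \<open>N\<close> and \<open>W\<close>. So the number of rounds may be exponential, and the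
  final constants may be chosen in terms of \<open>E\<close>.\<close>

lemma tm_of_while:
 fixes g :: "'s::coded => 's" and h :: "bool list => 's" and out :: "'s => bool list"
 assumes t: "ptime t" and g: "ptime g" and h: "ptime h" and out: "ptime out"
 shows "\<exists>E. \<forall>(inp :: 'i => bool list) f N W. (\<forall>x. \<exists>n\<le>N x. f x = (g ^^ n) (h (inp x)) & (\<forall>i<n. t ((g ^^ i) (h (inp x)))) &
   \<not> t (f x) & (\<forall>i\<le>n. tsz ((g ^^ i) (h (inp x))) <= W x)) -->
  (\<exists>M. turing_machine M & (\<forall>x. computes_within M (inp x) (out (f x)) ((N x + 2) * (length (inp x) + W x + 2) ^ E)))"
proof -
 obtain tt where tt: "m.impl tr (%x. tr (t x)) tt" "pb tt" "pb (%x. tsz (t x))" using t by (elim ptimeE)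
 obtain tg where tg: "m.impl tr (%x. tr (g x)) tg" "pb tg" "pb (%x. tsz (g x))" using g by (elim ptimeE)
 obtain th where th: "m.impl tr (%x. tr (h x)) th" "pb th" "pb (%x. tsz (h x))" using h by (elim ptimeE)
 obtain to where to: "m.impl tr (%x. tr (out x)) to" "pb to" "pb (%x. tsz (out x))" using out by (elim ptimeE)
 have "pb (m.wcost tr (%x. tr (t x)) tt tg)"
  unfolding m.wcost_def by (intro pb_intros tt tg pb_tsz[unfolded tsz_def] tt(3)[unfolded tsz_def])
 then obtain K where K: "!!s. m.wcost tr (%x. tr (t x)) tt tg s <= (tsz s + 2) ^ K" unfolding pb_def by auto
 obtain a where a: "!!x. th x <= (tsz x + 2) ^ a" using th(2) unfolding pb_def by auto
 obtain b where b: "!!x. to x <= (tsz x + 2) ^ b" using to(2) unfolding pb_def by auto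
 obtain c where c: "!!x. tsz (out x) <= (tsz x + 2) ^ c" using to(3) unfolding pb_def by auto
 define E' where "E' = 3 * a + K + b + c + 1"
 show ?thesis
 proof (intro exI[of _ "E' + 9"] allI impI)
  fix inp :: "'i => bool list" and f N W
  assume run: "\<forall>x. \<exists>n\<le>N x. f x = (g ^^ n) (h (inp x)) & (\<forall>i<n. t ((g ^^ i) (h (inp x)))) &
   \<not> t (f x) & (\<forall>i\<le>n. tsz ((g ^^ i) (h (inp x))) <= W x)"
  let ?tw = "%x. (N x + 1) * (W x + 2) ^ K + 10"
  have w: "m.impl (%x. tr (h (inp x))) (%x. tr (f x)) ?tw"
  proof (rule m.impl_while[OF tt(1) tg(1)])
   fix x
   obtain n where n: "n <= N x" "f x = (g ^^ n) (h (inp x))" "\<forall>i<n. t ((g ^^ i) (h (inp x)))" "\<not> t (f x)"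
    "\<forall>i\<le>n. tsz ((g ^^ i) (h (inp x))) <= W x" using run by blast
   have "(\<Sum>j\<le>n. m.wcost tr (%x. tr (t x)) tt tg ((g ^^ j) (h (inp x)))) <= (\<Sum>j\<le>n. (W x + 2) ^ K)"
   proof (rule sum_mono)
    fix j assume "j : {..n}"
    hence "(tsz ((g ^^ j) (h (inp x))) + 2) ^ K <= (W x + 2) ^ K" using n(5) by (intro power_mono) auto
    thus "m.wcost tr (%x. tr (t x)) tt tg ((g ^^ j) (h (inp x))) <= (W x + 2) ^ K" using K le_trans by blast
   qed
   also have "\<dots> = (n + 1) * (W x + 2) ^ K" by simp
   also have "\<dots> <= (N x + 1) * (W x + 2) ^ K" using n(1) by (intro mult_right_mono) auto
   finally show "\<exists>n. f x = (g ^^ n) (h (inp x)) & (\<forall>i<n. tr (t ((g ^^ i) (h (inp x)))) ~= Nl) & tr (t (f x)) = Nl &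
     (\<Sum>j\<le>n. m.wcost tr (%x. tr (t x)) tt tg ((g ^^ j) (h (inp x)))) + 10 <= ?tw x"
    using n by (intro exI[of _ n]) simp
  qed
  note i1 = m.impl_comp[OF m.impl_reindex[OF th(1), of inp] w]
  note i2 = m.impl_comp[OF i1 m.impl_reindex[OF to(1), of f]]
  obtain M where M: "turing_machine M" "!!x t. th (inp x) + ?tw x + 1 + to (f x) + 1 + 100 * length (inp x) + 100 * length (out (f x)) + 100 <= t
    ==> computes_within M (inp x) (out (f x)) t"
   by (rule m.tm_of_impl[OF i2[unfolded tr_bits]]) blast
  have "computes_within M (inp x) (out (f x)) ((N x + 2) * (length (inp x) + W x + 2) ^ (E' + 9))" for x
  proof (rule M(2))
   define Y where "Y = length (inp x) + W x + 2"
   define Z where "Z = Y ^ E'"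
   have Y: "2 <= Y" by (simp add: Y_def)
   have pw: "Y ^ j <= Z" if "j <= E'" for j unfolding Z_def using that Y by (intro power_increasing) auto
   have fx: "tsz (f x) <= W x"
   proof -
    obtain n where "n <= N x & f x = (g ^^ n) (h (inp x)) & (\<forall>i<n. t ((g ^^ i) (h (inp x)))) &
     \<not> t (f x) & (\<forall>i\<le>n. tsz ((g ^^ i) (h (inp x))) <= W x)" using run by blast
    thus ?thesis by simp
   qed
   have "tsz (inp x) + 2 <= 4 * Y" using tsz_bits[of "inp x"] by (simp add: Y_def)
   also have "4 * Y <= Y ^ 3" using mult_mono[OF Y Y] by (simp add: power3_eq_cube)
   finally have "(tsz (inp x) + 2) ^ a <= (Y ^ 3) ^ a" by (intro power_mono) auto
   hence h1: "th (inp x) <= Z" using a[of "inp x"] pw[of "3 * a"] by (simp add: E'_def power_mult)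
   have wY: "(tsz (f x) + 2) ^ j <= Y ^ j" "(W x + 2) ^ j <= Y ^ j" for j using fx by (auto simp: Y_def intro!: power_mono)
   have h2: "to (f x) <= Z" using b[of "f x"] wY(1)[of b] pw[of b] by (simp add: E'_def)
   have "length (out (f x)) < tsz (out (f x))" by (rule length_le_tsz)
   hence h3: "length (out (f x)) <= Z" using c[of "f x"] wY(1)[of c] pw[of c] by (simp add: E'_def)
   have "(W x + 2) ^ K <= Z" using wY(2)[of K] pw[of K] by (simp add: E'_def)
   hence h4: "(N x + 1) * (W x + 2) ^ K <= (N x + 1) * Z" by (rule mult_le_mono2)
   have h5: "length (inp x) <= Z" using pw[of 1] by (simp add: E'_def Y_def)
   have z: "1 <= Z" using Y by (simp add: Z_def)
   have "th (inp x) + ?tw x + 1 + to (f x) + 1 + 100 * length (inp x) + 100 * length (out (f x)) + 100 <= (N x + 1) * Z + 314 * Z"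
    using h1 h2 h3 h4 h5 z by linarith
   also have "\<dots> <= (N x + 2) * 512 * Z" by (simp add: algebra_simps)
   also have "\<dots> <= (N x + 2) * Y ^ 9 * Z" using power_mono[OF Y, of 9] by (intro mult_mono) auto
   also have "\<dots> = (N x + 2) * Y ^ (E' + 9)" by (simp only: Z_def power_add mult_ac)
   finally show "th (inp x) + ?tw x + 1 + to (f x) + 1 + 100 * length (inp x) + 100 * length (out (f x)) + 100
    <= (N x + 2) * (length (inp x) + W x + 2) ^ (E' + 9)" unfolding Y_def .
  qed
  thus "\<exists>M. turing_machine M & (\<forall>x. computes_within M (inp x) (out (f x)) ((N x + 2) * (length (inp x) + W x + 2) ^ (E' + 9)))"
   using M(1) by blast
 qed
qed

section \<open>Configurations of a simulated machine as finite data\<close>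

instantiation int :: coded begin
definition tr_int :: "int => tree" where "tr_int i = tr (nat i,nat (- i))"
instance by standard (auto simp: tr_int_def tr_inject)
end

lemma tsz_int: "tsz i = 2 * nat \<bar>i\<bar> + 3" for i :: int
proof -
 have "tsz i = tsz (nat i,nat (- i))" by (simp only: tsz_def tr_int_def)
 thus ?thesis by auto
qed

lemma pt_int[pt]: "ptime f ==> ptime (%x. int (f x))"
 by (rule pt_recode[where f = "%x. (f x,0::nat)"]) (auto intro!: pt simp: tr_int_def)

lemma pt_move[pt]:
 fixes f :: "'x::coded => int" and d :: "'x => nat"
 assumes f: "ptime f" and d: "ptime d" shows "ptime (%x. f x + int (d x) - 1)"
proof -
 have n: "ptime (%x. (nat (f x),nat (- f x)))" by (rule pt_recode[OF f]) (simp add: tr_int_def)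
 have p: "ptime (%x. nat (f x))" "ptime (%x. nat (- f x))" using pt_fst[OF n] pt_snd[OF n] by simp_all
 show ?thesis
  by (rule pt_recode[where f = "%x. ((nat (f x) + d x) - (nat (- f x) + 1),(nat (- f x) + 1) - (nat (f x) + d x))"])
   (intro pt p d, simp add: tr_int_def tr_inject, arith)
qed

type_synonym ltape = "(int \<times> nat) list \<times> int"

text \<open>A tape is the list of its writes, latest first, so the first match is the current
  content and cells never written are blank.\<close>

definition lookup :: "(int * nat) list => int => nat" where
 "lookup l p = (case filter (%e. fst e = p) l of [] => 0 | e # _ => snd e)"

lemma lookup_simps[simp]: "lookup [] p = 0" "lookup (e # l) p = (if fst e = p then snd e else lookup l p)"
 by (simp_all add: lookup_def)

lemma pt_lookup[pt]: assumes l: "ptime l" and p: "ptime p" shows "ptime (%x. lookup (l x) (p x))"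
 unfolding lookup_def by (intro pt l p pt_comp[OF p])

definition conf :: "nat * ltape list => config" where
 "conf c = (fst c,map (%t. (lookup (fst t),snd t)) (snd c))"

text \<open>A direction \<open>d\<close> is stored as \<open>offset d + 1\<close>.\<close>

definition sstep :: "nat => (nat * nat list => nat * (nat * nat) list) => nat * ltape list => nat * ltape list" where
 "sstep qh h c = (if fst c = qh then c else
   (fst (h (fst c,map (%t. lookup (fst t) (snd t)) (snd c))),
   map (%i. ((snd (nthd ([],0) (snd c) i),fst (nthd (0,1) (snd (h (fst c,map (%t. lookup (fst t) (snd t)) (snd c)))) i)) # fst (nthd ([],0) (snd c) i),
     snd (nthd ([],0) (snd c) i) + int (snd (nthd (0,1) (snd (h (fst c,map (%t. lookup (fst t) (snd t)) (snd c)))) i)) - 1)) [0..<length (snd c)]))"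

lemma pt_sstep: assumes h: "ptime h" shows "ptime (sstep qh h)"
 unfolding sstep_def by (intro pt pt_comp[OF h])

text \<open>A size budget that grows by one per simulated step: each step adds one entry per tape
  and moves each head by at most one cell.\<close>

definition small :: "turing_machine => nat => nat * ltape list => bool" where
 "small M k c \<longleftrightarrow> fst c <= num_states M & length (snd c) = num_tapes M &
   (\<forall>t\<in>set (snd c). length (fst t) <= k & \<bar>snd t\<bar> <= int k & (\<forall>e\<in>set (fst t). \<bar>fst e\<bar> <= int k & snd e < num_symbols M))"

lemma small_mono: "small M k c ==> k <= l ==> small M l c"
 unfolding small_def by fastforce

lemma lookup_lt: "\<forall>e\<in>set l. snd e < s ==> 0 < s ==> lookup l p < s"
 by (induction l) auto

text \<open>\<open>transition\<close> is an arbitrary function, but only finitely many of its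
  arguments are legal; on these a table replaces it, and the table is in
  \<open>ptime\<close>.\<close>

definition table :: "turing_machine => (nat * nat list => nat * (nat * nat) list) => bool" where
 "table M h \<longleftrightarrow> ptime h & (\<forall>q gs. q < num_states M & length gs = num_tapes M & set gs \<subseteq> {..<num_symbols M} -->
   h (q,gs) = (fst (transition M q gs),map (%a. (fst a,nat (offset (snd a) + 1))) (snd (transition M q gs))))"

lemma table_exists: "\<exists>h. table M h"
proof -
 let ?A = "{..<num_states M} \<times> {gs. set gs \<subseteq> {..<num_symbols M} & length gs = num_tapes M}"
 have "finite ?A" by (intro finite_cartesian_product finite_lists_length_eq) simp_all
 from pt_finite[OF this, of "%p. (fst (transition M (fst p) (snd p)),map (%a. (fst a,nat (offset (snd a) + 1))) (snd (transition M (fst p) (snd p))))"]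
 show ?thesis unfolding table_def by fastforce
qed

lemma offset_range: "0 <= offset d + 1" "offset d + 1 <= 2" by (cases d; simp)+

lemma sstep_correct:
 assumes M: "turing_machine M" and h: "table M h" and s: "small M k c"
 shows "conf (sstep (num_states M) h c) = step M (conf c)" "small M (Suc k) (sstep (num_states M) h c)"
proof -
 obtain q ts where c: "c = (q,ts)" by (cases c)
 have "conf (sstep (num_states M) h c) = step M (conf c) & small M (Suc k) (sstep (num_states M) h c)"
 proof (cases "q = num_states M")
  case True
  thus ?thesis using small_mono[OF s, of "Suc k"] by (simp add: c sstep_def step_def conf_def)
 next
  case False
  define gs where "gs = map (%t. lookup (fst t) (snd t)) ts"
  have S: "0 < num_symbols M" using M by (auto simp: turing_machine_def)
  have q: "q < num_states M" using s False by (simp add: small_def c)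
  have tl: "length ts = num_tapes M" using s by (simp add: small_def c)
  have ts: "length (fst t) <= k" "\<bar>snd t\<bar> <= int k" "!!e. e : set (fst t) ==> \<bar>fst e\<bar> <= int k & snd e < num_symbols M"
   if "t : set ts" for t using s that by (simp_all add: small_def c)
  have "lookup (fst t) (snd t) < num_symbols M" if "t : set ts" for t
   by (rule lookup_lt[OF _ S]) (use ts(3)[OF that] in blast)
  hence gs: "length gs = num_tapes M" "set gs \<subseteq> {..<num_symbols M}"
   using tl unfolding gs_def by (simp, force)
  obtain q' as where tr: "transition M q gs = (q',as)" by (cases "transition M q gs")
  have as: "q' <= num_states M" "length as = num_tapes M" "fst ` set as \<subseteq> {..<num_symbols M}"
   using M q gs tr unfolding turing_machine_def by fastforce+
  have h': "h (q,gs) = (q',map (%a. (fst a,nat (offset (snd a) + 1))) as)"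
   using h q gs tr unfolding table_def by simp
  define f where "f i = ((snd (ts ! i),fst (as ! i)) # fst (ts ! i),snd (ts ! i) + offset (snd (as ! i)))" for i
  have st: "sstep (num_states M) h c = (q',map f [0..<length ts])"
   using False h' offset_range(1) as(2) tl by (auto simp: c sstep_def gs_def[symmetric] f_def)
  have "map (%t. (lookup (fst t),snd t)) (map f [0..<length ts]) = map2 act as (map (%t. (lookup (fst t),snd t)) ts)"
  proof (rule nth_equalityI)
   fix i assume "i < length (map (%t. (lookup (fst t),snd t)) (map f [0..<length ts]))"
   thus "map (%t. (lookup (fst t),snd t)) (map f [0..<length ts]) ! i = map2 act as (map (%t. (lookup (fst t),snd t)) ts) ! i"
    using as(2) tl by (auto simp: f_def act_def fun_eq_iff split: prod.split)
  qed (use as(2) tl in simp)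
  moreover have "map ((%(c,h). c h) \<circ> (%t. (lookup (fst t),snd t))) ts = gs" by (simp add: gs_def)
  ultimately have e: "conf (sstep (num_states M) h c) = step M (conf c)"
   unfolding st using False tr by (simp add: conf_def c step_def comp_def case_prod_beta)
  have "length (fst (f i)) <= Suc k & \<bar>snd (f i)\<bar> <= int (Suc k) & (\<forall>e\<in>set (fst (f i)). \<bar>fst e\<bar> <= int (Suc k) & snd e < num_symbols M)"
   if i: "i < length ts" for i
  proof -
   have m: "ts ! i : set ts" "as ! i : set as" using i as(2) tl by simp_all
   have "fst (as ! i) < num_symbols M" using as(3) m(2) by auto
   moreover have "\<bar>fst e\<bar> <= int (Suc k) & snd e < num_symbols M" if "e : set (fst (ts ! i))" for e
    using ts(3)[OF m(1) that] by simp
   ultimately show ?thesis using ts(1,2)[OF m(1)] offset_range[of "snd (as ! i)"] by (auto simp: f_def)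
  qed
  thus ?thesis using e as(1) tl unfolding st small_def by simp
 qed
 thus "conf (sstep (num_states M) h c) = step M (conf c)" "small M (Suc k) (sstep (num_states M) h c)" by simp_all
qed

lemma ssteps:
 assumes M: "turing_machine M" and h: "table M h" and s: "small M k c"
 shows "conf ((sstep (num_states M) h ^^ t) c) = (step M ^^ t) (conf c)" "small M (k + t) ((sstep (num_states M) h ^^ t) c)"
proof -
 have "conf ((sstep (num_states M) h ^^ t) c) = (step M ^^ t) (conf c) & small M (k + t) ((sstep (num_states M) h ^^ t) c)"
 proof (induction t)
  case (Suc t)
  thus ?case using sstep_correct[OF M h, of "k + t" "(sstep (num_states M) h ^^ t) c"] by simp
 qed (use s in simp)
 thus "conf ((sstep (num_states M) h ^^ t) c) = (step M ^^ t) (conf c)" "small M (k + t) ((sstep (num_states M) h ^^ t) c)" by simp_all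
qed

definition sinit :: "nat => bool list => nat * ltape list" where
 "sinit K x = (0,(map (%i. (int i,if nthd False x i then 2 else 1)) [0..<length x],0) # replicate (K - 1) ([],0))"

lemma pt_sinit: "ptime x ==> ptime (%z. sinit K (x z))"
proof -
 assume x: "ptime x"
 have z: "ptime (%_. 0 :: int)" by (rule pt_const)
 show ?thesis unfolding sinit_def by (intro pt x z pt_comp[OF x])
qed

lemma lookup_map: "lookup (map (%i. (int i,f i)) [0..<n]) p = (if 0 <= p & p < int n then f (nat p) else 0)"
proof -
 have "lookup (map (%i. (int i,f i)) is) p = (if \<exists>i\<in>set is. int i = p then f (nat p) else 0)" for "is" by (induction "is") auto
 moreover have "(\<exists>i\<in>set [0..<n]. int i = p) \<longleftrightarrow> 0 <= p & p < int n" by (auto intro!: bexI[of _ "nat p"])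
 ultimately show ?thesis by simp
qed

lemma sinit:
 assumes M: "turing_machine M"
 shows "conf (sinit (num_tapes M) x) = initial_config M x" "small M (length x) (sinit (num_tapes M) x)"
proof -
 have "lookup (map (%i. (int i,if nthd False x i then 2 else 1)) [0..<length x])
  = (%i. if 0 <= i & i < int (length x) then bit_symbol (x ! nat i) else 0)"
  unfolding lookup_map by (auto simp: fun_eq_iff bit_symbol_def)
 thus "conf (sinit (num_tapes M) x) = initial_config M x"
  by (simp add: conf_def sinit_def initial_config_def fun_eq_iff)
 show "small M (length x) (sinit (num_tapes M) x)" using M unfolding turing_machine_def by (auto simp: small_def sinit_def)
qed

lemma small_tsz:
 "\<exists>C. \<forall>k c. small M k c --> tsz c <= C * (k + 1) ^ 2"
proof (intro exI allI impI)
 fix k and c :: "nat * ltape list" assume s: "small M k c"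
 define S where "S = num_symbols M"
 define X where "X = (k + 1) ^ 2"
 have X: "1 <= X" "k <= X" "k * k <= X" by (simp_all add: X_def power2_eq_square)
 have t: "tsz t <= 13 * X + 2 * S * X" if t: "t : set (snd c)" for t
 proof -
  have e: "tsz e <= 2 * k + 2 * S + 5" if "e : set (fst t)" for e
  proof -
   have "\<bar>fst e\<bar> <= int k & snd e < S" using s t that by (auto simp: small_def S_def)
   thus ?thesis by (cases e) (auto simp: tsz_int)
  qed
  have "tsz (fst t) <= 1 + length (fst t) * (1 + (2 * k + 2 * S + 5))" by (rule tsz_list_bound[OF e])
  also have "\<dots> <= 1 + k * (1 + (2 * k + 2 * S + 5))" using s t by (auto simp: small_def)
  also have "\<dots> = 1 + 6 * k + 2 * (k * k) + 2 * S * k" by (simp add: algebra_simps)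
  also have "\<dots> <= 1 + 6 * X + 2 * X + 2 * S * X" using X by (intro add_mono mult_le_mono2) simp_all
  finally have "tsz (fst t) <= 1 + 8 * X + 2 * S * X" by simp
  moreover have "tsz (snd t) <= 2 * k + 3" using s t by (auto simp: tsz_int small_def)
  moreover have "2 * k <= k * k + 1" using sum_squares_bound[of "int k" 1] by (simp add: power2_eq_square flip: of_nat_mult) 
  hence "2 * k + 3 + 2 <= 4 * X + 1" using X by (simp add: X_def power2_eq_square)
  ultimately show ?thesis by (cases t) simp
 qed
 have "tsz (snd c) <= 1 + length (snd c) * (1 + (13 * X + 2 * S * X))" by (rule tsz_list_bound[OF t])
 also have "\<dots> <= X + num_tapes M * (X + (13 * X + 2 * S * X))"
  using X s by (intro add_mono mult_mono) (simp_all add: small_def)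
 finally have "tsz (snd c) <= X + num_tapes M * (X + (13 * X + 2 * S * X))" .
 moreover have "fst c <= num_states M * X" using s X(1) unfolding small_def by (metis le_trans mult_le_mono2 mult.right_neutral)
 ultimately have "tsz c <= X + num_tapes M * (X + (13 * X + 2 * S * X)) + 2 * (num_states M * X) + 2 * X"
  using X(1) by (cases c) simp
 also have "\<dots> = (3 + num_tapes M * (14 + 2 * S) + 2 * num_states M) * X" by (simp add: algebra_simps)
 finally show "tsz c <= (3 + num_tapes M * (14 + 2 * num_symbols M) + 2 * num_states M) * (k + 1) ^ 2" by (simp add: X_def S_def)
qed

section \<open>Parsing formulas\<close>

type_synonym pstate = "(nat \<times> nat) \<times> (nat \<times> bool) list list \<times> (nat \<times> bool) list \<times> nat \<times> bool"

text \<open>Modes: 0 counts the variables, 1 expects a clause or the end, 2 a literal or the end of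
  the clause, 3 reads a sign, 4 a variable, 5 is final. Lists come out reversed.\<close>

definition pstep :: "pstate => bool => pstate" where
 "pstep s x = (let m = fst (fst s); n = snd (fst s); F = fst (snd s); C = fst (snd (snd s)); v = fst (snd (snd (snd s))); b = snd (snd (snd (snd s))) in
   if m = 0 then if x then ((0,Suc n),F,C,v,b) else ((1,n),F,C,v,b)
   else if m = 1 then if x then ((2,n),F,[],v,b) else ((5,n),F,C,v,b)
   else if m = 2 then if x then ((3,n),F,C,v,b) else ((1,n),C # F,[],v,b)
   else if m = 3 then ((4,n),F,C,0,x)
   else if m = 4 then if x then ((4,n),F,C,Suc v,b) else ((2,n),F,(v,b) # C,0,b)
   else s)"

definition parse :: "bool list => pstate" where
 "parse z = foldl pstep ((0,0),[],[],0,False) z"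

lemma tsz_bool: "tsz b <= 3" for b :: bool by (cases b) simp_all

lemma tsz_pstep: "tsz (pstep s x) <= tsz s + 20"
proof -
 obtain m n F C v b where "s = ((m,n),F,C,v,b)" by (metis surj_pair)
 thus ?thesis using tsz_bool[of x] tsz_bool[of b] tsz_pos[of C] by (simp add: pstep_def Let_def)
qed

lemma pt_parse: "ptime parse"
 unfolding parse_def
proof (rule pt_foldl[where F = "%s x _. pstep s x" and B = "%z. 40 + 20 * tsz z"])
 show "ptime (%p :: pstate \<times> bool \<times> bool list. pstep (fst p) (fst (snd p)))" unfolding pstep_def Let_def by (intro pt)
 fix z :: "bool list" and i
 have "tsz (foldl pstep s z) <= tsz s + 20 * length z" for s z
 proof (induction z arbitrary: s)
  case (Cons x z)
  have "tsz (foldl pstep (pstep s x) z) <= tsz (pstep s x) + 20 * length z" by (rule Cons)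
  thus ?case using tsz_pstep[of s x] by simp
 qed simp
 from this[of "((0,0),[],[],0,False)" "take i z"]
 show "tsz (foldl pstep ((0,0),[],[],0,False) (take i z)) <= 40 + 20 * tsz z" using length_le_tsz[of z] by simp
qed (intro pt pb_intros pb_tsz)+

lemma parse_run:
 "foldl pstep ((0,n),F,C,v,b) (unary j) = ((1,n + j),F,C,v,b)"
 "foldl pstep ((4,n),F,C,v,b) (unary j) = ((2,n),F,(v + j,b) # C,0,b)"
proof -
 have "foldl pstep ((0,n),F,C,v,b) (replicate j True) = ((0,n + j),F,C,v,b)" by (induction j arbitrary: n) (auto simp: pstep_def)
 thus "foldl pstep ((0,n),F,C,v,b) (unary j) = ((1,n + j),F,C,v,b)" by (simp add: unary_def pstep_def)
 have "foldl pstep ((4,n),F,C,v,b) (replicate j True) = ((4,n),F,C,v + j,b)" by (induction j arbitrary: v) (auto simp: pstep_def)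
 thus "foldl pstep ((4,n),F,C,v,b) (unary j) = ((2,n),F,(v + j,b) # C,0,b)" by (simp add: unary_def pstep_def)
qed

lemma parse_clause: "\<exists>v' b'. foldl pstep ((2,n),F,C,v,b) (encode_list encode_literal D) = ((1,n),(rev D @ C) # F,[],v',b')"
proof (induction D arbitrary: C v b)
 case Nil thus ?case by (simp add: encode_list_def pstep_def)
next
 case (Cons l D)
 obtain w d where l: "l = (w,d)" by (cases l)
 have "pstep ((2,n),F,C,v,b) True = ((3,n),F,C,v,b)" "pstep ((3,n),F,C,v,b) d = ((4,n),F,C,0,d)" by (simp_all add: pstep_def)
 hence "foldl pstep ((2,n),F,C,v,b) (encode_list encode_literal (l # D))
   = foldl pstep ((2,n),F,l # C,0,d) (encode_list encode_literal D)"
  using parse_run(2)[of n F C 0 d w] by (simp add: encode_list_def encode_literal_def l)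
 thus ?case using Cons[of "l # C" 0 d] by simp
qed

lemma parse_clauses: "\<exists>s. foldl pstep ((1,n),F,C,v,b) (encode_list (encode_list encode_literal) G) = ((5,n),rev (map rev G) @ F,s)"
proof (induction G arbitrary: F C v b)
 case Nil thus ?case by (simp add: encode_list_def pstep_def)
next
 case (Cons D G)
 obtain v' b' where d: "foldl pstep ((2,n),F,[],v,b) (encode_list encode_literal D) = ((1,n),(rev D @ []) # F,[],v',b')"
  using parse_clause[of n F "[]" v b D] by blast
 have "pstep ((1,n),F,C,v,b) True = ((2,n),F,[],v,b)" by (simp add: pstep_def)
 hence "foldl pstep ((1,n),F,C,v,b) (encode_list (encode_list encode_literal) (D # G))
   = foldl pstep ((1,n),rev D # F,[],v',b') (encode_list (encode_list encode_literal) G)"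
  using d by (simp add: encode_list_def)
 thus ?case using Cons[of "rev D # F" "[]" v' b'] by simp
qed

lemma parse: "snd (fst (parse (encode_cnf n F))) = n" "fst (snd (parse (encode_cnf n F))) = rev (map rev F)"
proof -
 obtain s where "foldl pstep ((1,n),[],[],0,False) (encode_list (encode_list encode_literal) F) = ((5,n),rev (map rev F) @ [],s)"
  using parse_clauses[of n "[]" "[]" 0 False F] by blast
 hence "parse (encode_cnf n F) = ((5,n),rev (map rev F),s)"
  using parse_run(1)[of 0 "[]" "[]" 0 False n] by (simp add: parse_def encode_cnf_def)
 thus "snd (fst (parse (encode_cnf n F))) = n" "fst (snd (parse (encode_cnf n F))) = rev (map rev F)" by simp_all
qed

section \<open>Exhaustive search with a simulated decision procedure\<close>

lemma pt_active[pt]: assumes "ptime S" "ptime c" shows "ptime (%x. active (S x) (c x))"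
 unfolding active_def by (intro pt assms pt_comp[OF assms(1)] pt_comp[OF assms(2)])

lemma pt_norm_clause[pt]: assumes "ptime n" "ptime c" shows "ptime (%x. norm_clause (n x) (c x))"
 unfolding norm_clause_def by (intro pt assms pt_comp[OF assms(1)] pt_comp[OF assms(2)])

lemma pt_hosts[pt]: assumes "ptime S" "ptime h" "ptime s" shows "ptime (%x. hosts (S x) (h x) (s x))"
 unfolding hosts_def by (intro pt assms pt_comp[OF assms(1)] pt_comp[OF assms(2)] pt_comp[OF assms(3)])

lemma pt_petals[pt]: assumes "ptime S" "ptime h" "ptime s" shows "ptime (%x. petals (S x) (h x) (s x))"
 unfolding petals_def by (intro pt assms pt_comp[OF assms(1)] pt_comp[OF assms(2)] pt_comp[OF assms(3)])

lemma pt_kernel[pt]: assumes "ptime S" shows "ptime (%x. kernel (S x))"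
 unfolding kernel_def by (intro pt assms pt_comp[OF assms(1)])

lemma pt_cands[pt]: assumes "ptime n" shows "ptime (%x. cands (n x) D)"
 unfolding cands_def by (intro pt assms pt_comp[OF assms(1)])

lemma pt_branch[pt]: assumes "ptime n" "ptime S" shows "ptime (%x. branch (n x) D (S x))"
 unfolding branch_def by (intro pt assms pt_comp[OF assms(1)] pt_comp[OF assms(2)])

text \<open>
  A state consists of the number of variables, a stack of formulas, at most one configuration of
  the simulated machine, and the answer.
\<close>

type_synonym sstate = "(nat \<times> nat list list list) \<times> (nat \<times> ltape list) list \<times> bool"

text \<open>One step of a depth-first search. A simulation in progress has priority; symbol 2 on its
  output tape is the answer \<open>True\<close> and empties the stack. A leaf whose kernel contains
  the empty clause is dropped, because \<open>wf3\<close> demands nonempty clauses.\<close>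

definition srch :: "nat => nat => (nat * nat list => nat * (nat * nat) list) => nat => (nat list list => bool list) => sstate => sstate" where
 "srch D qh h K r s =
   (if fst (snd s) ~= [] then
    (if fst (hd (fst (snd s))) = qh then
      (if lookup (fst (nthd ([],0) (snd (hd (fst (snd s)))) 1)) 0 = 2 then ((fst (fst s),[]),[],True) else (fst s,[],snd (snd s)))
     else (fst s,[sstep qh h (hd (fst (snd s)))],snd (snd s)))
   else if snd (fst s) = [] then s
   else if branch (fst (fst s)) D (hd (snd (fst s))) ~= [] then
    ((fst (fst s),branch (fst (fst s)) D (hd (snd (fst s))) @ tl (snd (fst s))),[],snd (snd s))
   else if [] : set (kernel (hd (snd (fst s)))) then ((fst (fst s),tl (snd (fst s))),[],snd (snd s))
   else ((fst (fst s),tl (snd (fst s))),[sinit K (r (kernel (hd (snd (fst s)))))],snd (snd s)))"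

lemma pt_srch: assumes h: "ptime h" and r: "ptime r" shows "ptime (srch D qh h K r)"
proof -
 have z: "ptime (%_ :: sstate. 0 :: int)" "ptime (%_ :: sstate. ([],0) :: ltape)" by (rule pt_const)+
 show ?thesis unfolding srch_def by (intro pt z pt_comp[OF pt_sstep[OF h]] pt_sinit pt_comp[OF r])
qed

definition path :: "('s => 's) => ('s => bool) => nat => 's => 's => bool" where
 "path g P i s s' \<longleftrightarrow> (g ^^ i) s = s' & (\<forall>j<i. P ((g ^^ j) s))"

lemma path_0: "path g P 0 s s" by (simp add: path_def)

lemma path_step: "P s ==> path g P i (g s) s' ==> path g P (Suc i) s s'"
proof -
 assume P: "P s" and p: "path g P i (g s) s'"
 have "P ((g ^^ j) s)" if "j < Suc i" for j
 proof (cases j)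
  case (Suc k)
  hence "P ((g ^^ k) (g s))" using p that by (simp add: path_def)
  thus ?thesis using Suc by (simp add: funpow_swap1)
 qed (simp add: P)
 thus ?thesis using p by (simp add: path_def funpow_swap1)
qed

lemma path_trans: "path g P i s s' ==> path g P k s' s'' ==> path g P (i + k) s s''"
proof (induction i arbitrary: s)
 case 0 thus ?case by (simp add: path_def)
next
 case (Suc i)
 have "P s" using Suc.prems(1) unfolding path_def by (metis funpow_0 zero_less_Suc)
 moreover have "path g P i (g s) s'"
 proof -
  have "P ((g ^^ j) (g s))" if "j < i" for j
  proof -
   have "P ((g ^^ Suc j) s)" using Suc.prems(1) that unfolding path_def by blast
   thus ?thesis by (simp add: funpow_swap1)
  qed
  thus ?thesis using Suc.prems(1) by (simp add: path_def funpow_swap1)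
 qed
 hence "path g P (i + k) (g s) s''" using Suc by blast
 ultimately have "path g P (Suc (i + k)) s s''" by (rule path_step)
 thus ?case by simp
qed

locale search =
 fixes M h D n S0 r X T
 assumes M: "turing_machine M" and h: "table M h" and D: "1 <= D"
  and solver: "!!S. inv n D S0 S ==> branch n D S = [] ==> [] ~: set (kernel S) ==>
    computes_within M (r (kernel S)) [ssat S] T & length (r (kernel S)) <= X"
begin

abbreviation "g \<equiv> srch D (num_states M) h (num_tapes M) r"

definition good :: "nat => sstate => bool" where
 "good L s \<longleftrightarrow> (\<exists>st cs b. s = ((n,st),cs,b) & (st ~= [] \<or> cs ~= []) & (\<forall>S\<in>set st. inv n D S0 S) &
   length st <= L & length cs <= 1 & (\<forall>c\<in>set cs. small M (X + T) c))"

lemma simulate: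
 assumes c: "computes_within M z [v] T" and z: "length z <= X" and st: "\<forall>S\<in>set st. inv n D S0 S" "length st <= L"
 shows "\<exists>i\<le>T + 1. path g (good L) i ((n,st),[sinit (num_tapes M) z],b) (if v then ((n,[]),[],True) else ((n,st),[],b))"
proof -
 let ?c = "%j. (sstep (num_states M) h ^^ j) (sinit (num_tapes M) z)"
 note ss = ssteps[OF M h sinit(2)[OF M, of z], unfolded sinit(1)[OF M]]
 have fc: "fst (conf c) = fst c" for c by (simp add: conf_def)
 have hT: "fst (?c T) = num_states M"
  using c ss(1)[of T] fc[of "?c T"] by (auto simp: computes_within_def split: prod.splits)
 \<comment> \<open>\<open>srch\<close> stops at the first halting time, and \<open>T\<close> is only
   an upper bound for it; so the search never has to compute a time bound.\<close>
 define i where "i = (LEAST j. fst (?c j) = num_states M)"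
 have i: "fst (?c i) = num_states M" "i <= T" using LeastI[of "%j. fst (?c j) = num_states M", OF hT] Least_le[of "%j. fst (?c j) = num_states M", OF hT]
  by (simp_all add: i_def)
 have nh: "fst (?c j) ~= num_states M" if "j < i" for j using not_less_Least[of j] that unfolding i_def by blast
 have run: "(g ^^ j) ((n,st),[?c 0],b) = ((n,st),[?c j],b)" if "j <= i" for j
  using that
 proof (induction j)
  case (Suc j)
  hence "(g ^^ Suc j) ((n,st),[?c 0],b) = g ((n,st),[?c j],b)" by simp
  also have "\<dots> = ((n,st),[?c (Suc j)],b)" using nh[of j] Suc.prems by (simp add: srch_def)
  finally show ?case .
 qed simp
 have gd: "good L ((g ^^ j) ((n,st),[?c 0],b))" if "j <= i" for j
 proof -
  have "small M (X + T) (?c j)" by (rule small_mono[OF ss(2)]) (use z that i(2) in simp)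
  thus ?thesis unfolding run[OF that] good_def using st by auto
 qed
 have "(step M ^^ T) (initial_config M z) = (step M ^^ (T - i)) ((step M ^^ i) (initial_config M z))"
  using i(2) funpow_add[of "T - i" i "step M"] by simp
 also have "\<dots> = (step M ^^ i) (initial_config M z)" using i(1) ss(1)[of i] fc[of "?c i"] by (intro halted_funpow) simp
 also have "\<dots> = conf (?c i)" by (rule ss(1)[symmetric])
 finally have e: "(step M ^^ T) (initial_config M z) = conf (?c i)" .
 have "length (snd (?c i)) = num_tapes M" using ss(2)[of i] unfolding small_def by blast
 moreover have "2 <= num_tapes M" using M unfolding turing_machine_def by blast
 ultimately have len: "1 < length (snd (?c i))" by linarith
 have "tape_holds (snd ((step M ^^ T) (initial_config M z)) ! 1) [v]" using c by (auto simp: computes_within_def split: prod.splits)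
 hence "tape_holds (snd (conf (?c i)) ! 1) [v]" by (simp only: e)
 hence "lookup (fst (snd (?c i) ! 1)) 0 = bit_symbol v" using len by (simp add: tape_holds_def conf_def)
 hence "g ((n,st),[?c i],b) = (if v then ((n,[]),[],True) else ((n,st),[],b))"
  using i(1) len by (simp add: srch_def bit_symbol_def)
 hence "path g (good L) (Suc i) ((n,st),[?c 0],b) (if v then ((n,[]),[],True) else ((n,st),[],b))"
  using run[of i] gd unfolding path_def by (simp add: less_Suc_eq_le)
 thus ?thesis using i(2) by (intro exI[of _ "Suc i"]) simp
qed

text \<open>A binary tree with \<open>N\<close> leaves has \<open>2 * N - 1\<close> nodes, and
  \<open>lam powr mu\<close> bounds the leaves: \<open>(2 * a - 1) + (2 * b - 1) + 1\<close> is at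
  most \<open>2 * P - 1\<close> when \<open>a + b <= P\<close>. A node costs at most
  \<open>T + 3\<close> steps. Each branching adds one formula to the stack while \<open>mu\<close>
  falls, so the height stays within \<open>L\<close>.\<close>

theorem process:
 fixes lam :: real
 assumes lam: "1 <= lam" "1 / lam + 1 / lam powr (2 * D * D) <= 1"
  and i: "inv n D S0 S" "\<forall>R\<in>set rest. inv n D S0 R" "length rest + 1 + nat (mu n D S0 S) <= L"
 shows "\<exists>i. real i <= (2 * lam powr mu n D S0 S - 1) * (T + 3) &
  path g (good L) i ((n,S # rest),[],b) (if ssat S then ((n,[]),[],True) else ((n,rest),[],b))"
 using i
proof (induction "nat (mu n D S0 S)" arbitrary: S rest rule: less_induct)
 case less
 have gs: "good L ((n,S # rest),[],b)"
  unfolding good_def using less.prems by (intro exI[of _ "S # rest"] exI[of _ "[]"] exI[of _ b]) simp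
 note stp = path_step[of "good L" "((n,S # rest),[],b)" g, OF gs]
 have mu0: "0 <= mu n D S0 S" by (rule mu_bounds(1)[OF less.prems(1)])
 have l1: "1 <= lam powr mu n D S0 S" using lam(1) mu0 by (simp add: ge_one_powr_ge_zero)
 have big: "T + 3 <= (2 * lam powr mu n D S0 S - 1) * (T + 3)"
 proof -
  have "1 * real (T + 3) <= (2 * lam powr mu n D S0 S - 1) * real (T + 3)" using l1 by (intro mult_right_mono) linarith+
  thus ?thesis by (simp only: mult_1)
 qed
 show ?case
 proof (cases "branch n D S = []")
  case leaf: True
  show ?thesis
  proof (cases "[] : set (kernel S)")
   case True
   hence "\<not> ssat (kernel S)" unfolding ssat_def csat_def by force
   hence "\<not> ssat S" by (simp only: kernel_sat not_False_eq_True)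
   moreover have "g ((n,S # rest),[],b) = ((n,rest),[],b)" using leaf True by (simp add: srch_def)
   ultimately have "path g (good L) (Suc 0) ((n,S # rest),[],b) (if ssat S then ((n,[]),[],True) else ((n,rest),[],b))"
    by (intro stp) (simp add: path_0)
   show ?thesis by (rule exI[of _ "Suc 0"], rule conjI[OF order_trans[OF _ big] \<open>path g (good L) (Suc 0) _ _\<close>]) simp
  next
   case False
   have rl: "length rest <= L" using less.prems(3) by linarith
   note sv = solver[OF less.prems(1) leaf False]
   obtain i where i: "i <= T + 1" "path g (good L) i ((n,rest),[sinit (num_tapes M) (r (kernel S))],b)
     (if ssat S then ((n,[]),[],True) else ((n,rest),[],b))"
    using simulate[OF conjunct1[OF sv] conjunct2[OF sv] less.prems(2) rl, of b] by blast
   have "g ((n,S # rest),[],b) = ((n,rest),[sinit (num_tapes M) (r (kernel S))],b)" using leaf False by (simp add: srch_def)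
   hence "path g (good L) (Suc i) ((n,S # rest),[],b) (if ssat S then ((n,[]),[],True) else ((n,rest),[],b))"
    using stp[of i] i(2) by simp
   show ?thesis by (rule exI[of _ "Suc i"], rule conjI[OF order_trans[OF _ big] \<open>path g (good L) (Suc i) _ _\<close>]) (use i(1) in simp)
  qed
 next
  case False
  obtain A B where AB: "branch n D S = [A,B]" "inv n D S0 A" "inv n D S0 B" "mu n D S0 A <= mu n D S0 S - 1"
   "mu n D S0 B <= mu n D S0 S - 2 * int D * int D" "ssat S \<longleftrightarrow> ssat A \<or> ssat B"
   by (rule branch_step[OF less.prems(1) D False])
  have DD: "1 <= 2 * int D * int D"
  proof -
   have "1 * 1 <= D * D" using D by (intro mult_mono) simp_all
   hence "1 <= int (D * D)" by linarith
   thus ?thesis by simp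
  qed
  have muA: "0 <= mu n D S0 A" and muB: "0 <= mu n D S0 B" by (rule mu_bounds(1)[OF AB(2)], rule mu_bounds(1)[OF AB(3)])
  have mA: "nat (mu n D S0 A) < nat (mu n D S0 S)" "nat (mu n D S0 A) + 1 <= nat (mu n D S0 S)" using AB(4) muA mu0 by linarith+
  have mB: "nat (mu n D S0 B) < nat (mu n D S0 S)" using AB(5) DD muB mu0 by linarith
  have g1: "g ((n,S # rest),[],b) = ((n,A # B # rest),[],b)" using AB(1) by (simp add: srch_def)
  obtain ia where ia: "real ia <= (2 * lam powr mu n D S0 A - 1) * (T + 3)"
   "path g (good L) ia ((n,A # B # rest),[],b) (if ssat A then ((n,[]),[],True) else ((n,B # rest),[],b))"
  proof -
   have "\<forall>R\<in>set (B # rest). inv n D S0 R" using less.prems(2) AB(3) by simp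
   moreover have "length (B # rest) + 1 + nat (mu n D S0 A) <= L" using less.prems(3) mA(2) by simp
   ultimately show thesis using less.hyps[OF mA(1) AB(2)] that by blast
  qed
  obtain ib where ib: "real ib <= (2 * lam powr mu n D S0 B - 1) * (T + 3)"
   "path g (good L) ib ((n,B # rest),[],b) (if ssat B then ((n,[]),[],True) else ((n,rest),[],b))"
  proof -
   have "length rest + 1 + nat (mu n D S0 B) <= L" using less.prems(3) mB by linarith
   thus thesis using less.hyps[OF mB AB(3) less.prems(2)] that by blast
  qed
  define P where "P = lam powr mu n D S0 S"
  have "lam powr mu n D S0 A <= lam powr (mu n D S0 S - 1)" using AB(4) lam(1) by (intro powr_mono) linarith+
  also have "\<dots> = P * (1 / lam)" using lam(1) by (simp add: P_def powr_diff)
  finally have pa: "lam powr mu n D S0 A <= P * (1 / lam)" .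
  have "real_of_int (mu n D S0 B) <= real_of_int (mu n D S0 S - 2 * int D * int D)" using AB(5) by (simp only: of_int_le_iff)
  hence "lam powr mu n D S0 B <= lam powr (mu n D S0 S - 2 * D * D)" using lam(1) by (intro powr_mono) simp_all
  also have "\<dots> = P * (1 / lam powr (2 * D * D))" using lam(1) by (simp add: P_def powr_diff)
  finally have pb: "lam powr mu n D S0 B <= P * (1 / lam powr (2 * D * D))" .
  have "P * (1 / lam + 1 / lam powr (2 * D * D)) <= P * 1" using lam(2) l1 unfolding P_def by (intro mult_left_mono) simp_all
  hence "lam powr mu n D S0 A + lam powr mu n D S0 B <= P" using pa pb by (simp add: distrib_left)
  hence "((2 * lam powr mu n D S0 A - 1) + (2 * lam powr mu n D S0 B - 1) + 1) * (T + 3) <= (2 * P - 1) * (T + 3)"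
   by (intro mult_right_mono) simp_all
  hence cost: "real (Suc (ia + ib)) <= (2 * P - 1) * (T + 3)" using ia(1) ib(1) by (simp add: algebra_simps)
  show ?thesis
  proof (cases "ssat A")
   case True
   hence "path g (good L) (Suc ia) ((n,S # rest),[],b) (if ssat S then ((n,[]),[],True) else ((n,rest),[],b))"
    using stp[of ia] ia(2) AB(6) unfolding g1 by simp
   moreover have "real (Suc ia) <= real (Suc (ia + ib))" by simp
   ultimately show ?thesis using order_trans[OF _ cost[unfolded P_def]] by blast
  next
   case False
   hence "path g (good L) (ia + ib) ((n,A # B # rest),[],b) (if ssat S then ((n,[]),[],True) else ((n,rest),[],b))"
    using path_trans[of g "good L" ia _ _ ib] ia(2) ib(2) AB(6) by simp
   hence "path g (good L) (Suc (ia + ib)) ((n,S # rest),[],b) (if ssat S then ((n,[]),[],True) else ((n,rest),[],b))"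
    using stp[of "ia + ib"] unfolding g1 by simp
   thus ?thesis using cost[unfolded P_def] by blast
  qed
 qed
qed

end

text \<open>Clauses are distinct and normal, of length at most 3, so a formula stays polynomial in
  \<open>n\<close> however deep the branching is.\<close>

lemma inv_tsz:
 assumes i: "inv n D S0 S" shows "tsz S <= 1 + 4 * (2 * n + 1) ^ 3 * (12 * n + 20)"
proof -
 have n: "normal n c & length c <= 3" if "c : set S" for c using i that by (simp add: inv_def)
 have "tsz c <= 1 + length c * (1 + (4 * n + 1))" if "c : set S" for c
 proof (rule tsz_list_bound)
  fix l assume "l : set c"
  hence "l < 2 * n" using normal_lt n[OF that] by blast
  thus "tsz l <= 4 * n + 1" by simp
 qed
 moreover have "length c * (1 + (4 * n + 1)) <= 3 * (1 + (4 * n + 1))" if "c : set S" for c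
  using n[OF that] by (intro mult_right_mono) simp_all
 ultimately have t: "tsz c <= 12 * n + 7" if "c : set S" for c using that by fastforce
 have "set S \<subseteq> {c. set c \<subseteq> {..<2 * n} & length c <= 3}" using n normal_lt by fastforce
 hence "card (set S) <= card {c. set c \<subseteq> {..<2 * n} & length c <= 3}"
  by (intro card_mono finite_lists_length_le) simp_all
 also have "\<dots> = (\<Sum>i\<le>3. (2 * n) ^ i)" by (simp add: card_lists_length_le)
 also have "\<dots> <= (\<Sum>i\<le>(3::nat). (2 * n + 1) ^ 3)"
 proof (rule sum_mono)
  fix i :: nat assume "i : {..3}"
  hence "(2 * n + 1) ^ i <= (2 * n + 1) ^ 3" by (intro power_increasing) simp_all
  moreover have "(2 * n) ^ i <= (2 * n + 1) ^ i" by (intro power_mono) simp_all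
  ultimately show "(2 * n) ^ i <= (2 * n + 1) ^ 3" by linarith
 qed
 finally have "card (set S) <= 4 * (2 * n + 1) ^ 3" by simp
 moreover have "card (set S) = length S" using i by (simp add: inv_def distinct_card)
 ultimately have l: "length S <= 4 * (2 * n + 1) ^ 3" by simp
 have "tsz S <= 1 + length S * (1 + (12 * n + 7))" by (rule tsz_list_bound[OF t])
 also have "length S * (1 + (12 * n + 7)) <= 4 * (2 * n + 1) ^ 3 * (12 * n + 20)" using l by (intro mult_mono) simp_all
 finally show ?thesis by simp
qed

section \<open>The lower bound\<close>

definition lits :: "nat list list => (nat * bool) list list" where
 "lits S = map (map (%l. (l div 2,odd l))) S"

definition vars :: "nat list list => nat list" where
 "vars S = dedup (map fst (concat (lits S)))"

lemma pt_lits[pt]: "ptime S ==> ptime (%x. lits (S x))"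
 unfolding lits_def by (intro pt)

lemma pt_vars[pt]: "ptime S ==> ptime (%x. vars (S x))"
 unfolding vars_def by (intro pt)

text \<open>The gain from sparsification: the parameter of the instance made from a leaf is linear
  in \<open>n\<close> for fixed \<open>D\<close>.\<close>

lemma leaf_facts:
 assumes i: "inv n D S0 S" and b: "branch n D S = []" and e: "[] ~: set (kernel S)"
 shows "wf3 (vars (kernel S)) (lits (kernel S))" "sat (lits (kernel S)) \<longleftrightarrow> ssat S"
  "3 * length (vars (kernel S)) + 3 * length (lits (kernel S)) <= (3 + 6 * (1 + D + 2 * D * D)) * n + 3"
proof -
 have k: "normal n c & length c <= 3 & c ~= []" if c: "c : set (kernel S)" for c
 proof -
  have "c : set S" using c by (simp add: kernel_def)
  hence "normal n c & length c <= 3" using i by (simp add: inv_def)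
  moreover have "c ~= []" using c e by blast
  ultimately show ?thesis by blast
 qed
 have sv: "set (vars (kernel S)) = (\<Union>c\<in>set (kernel S). (%l. l div 2) ` set c)" by (simp add: vars_def dedup lits_def image_UN image_image)
 show "wf3 (vars (kernel S)) (lits (kernel S))"
  unfolding wf3_def
 proof (intro conjI ballI)
  show "distinct (vars (kernel S))" by (simp add: vars_def dedup)
  fix c assume "c : set (lits (kernel S))"
  then obtain d where d: "d : set (kernel S)" "c = map (%l. (l div 2,odd l)) d" unfolding lits_def by auto
  show "c ~= []" "length c <= 3" using k[OF d(1)] d(2) by simp_all
  show "fst ` set c \<subseteq> set (vars (kernel S))" unfolding sv d(2) using d(1) by force
 qed
 have "sat (lits (kernel S)) \<longleftrightarrow> ssat (kernel S)" by (simp add: sat_def ssat_def csat_def lits_def)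
 thus "sat (lits (kernel S)) \<longleftrightarrow> ssat S" by (simp only: kernel_sat)
 have "set (vars (kernel S)) \<subseteq> {..<n}"
 proof
  fix v assume "v : set (vars (kernel S))"
  then obtain c l where c: "c : set (kernel S)" "l : set c" "v = l div 2" unfolding sv by blast
  have "l < 2 * n" by (rule normal_lt[OF conjunct1[OF k[OF c(1)]] c(2)])
  thus "v : {..<n}" using c(3) by simp
 qed
 hence "card (set (vars (kernel S))) <= card {..<n}" by (intro card_mono) simp_all
 moreover have "distinct (vars (kernel S))" by (simp add: vars_def dedup)
 ultimately have v: "length (vars (kernel S)) <= n" by (simp add: distinct_card)
 define d where "d = 1 + D + 2 * D * D"
 define y where "y = n * d"
 have "length (lits (kernel S)) <= 1 + 2 * y" using kernel_sparse[OF i b] by (simp only: lits_def length_map y_def d_def mult.assoc)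
 moreover have "(3 + 6 * d) * n + 3 = 3 * n + 6 * y + 3" by (simp add: y_def algebra_simps)
 ultimately show "3 * length (vars (kernel S)) + 3 * length (lits (kernel S)) <= (3 + 6 * (1 + D + 2 * D * D)) * n + 3"
  using v unfolding d_def[symmetric] by simp
qed

text \<open>The constant absorbs the finitely many values below the threshold.\<close>

lemma little_o_bound:
 fixes f :: "nat => real"
 assumes f: "f : o(%k. real k)" and \<eta>: "0 < \<eta>"
 shows "\<exists>C\<ge>0. \<forall>k. f k <= \<eta> * real k + C"
proof -
 have "eventually (%k. norm (f k) <= \<eta> * norm (real k)) at_top" by (rule landau_o.smallD[OF f \<eta>])
 then obtain k0 where k0: "!!k. k0 <= k ==> \<bar>f k\<bar> <= \<eta> * real k" unfolding eventually_at_top_linorder by auto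
 have "f k <= \<eta> * real k + (\<Sum>j<k0. \<bar>f j\<bar>)" for k
 proof (cases "k0 <= k")
  case True
  have "0 <= (\<Sum>j<k0. \<bar>f j\<bar>)" by (intro sum_nonneg) simp
  thus ?thesis using k0[OF True] by linarith
 next
  case False
  have "\<bar>f k\<bar> <= (\<Sum>j<k0. \<bar>f j\<bar>)" by (rule member_le_sum) (use False in auto)
  moreover have "0 <= \<eta> * real k" using \<eta> by simp
  ultimately show ?thesis by linarith
 qed
 moreover have "0 <= (\<Sum>j<k0. \<bar>f j\<bar>)" by (intro sum_nonneg) simp
 ultimately show ?thesis by blast
qed

definition start :: "bool list => sstate" where
 "start z = ((snd (fst (parse z)),[dedup (map (%C. norm_clause (snd (fst (parse z))) (map (%l. 2 * fst l + (if snd l then 1 else 0)) C)) (fst (snd (parse z))))]),[],False)"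

lemma pt_start: "ptime start"
proof -
 note p = pt_comp[OF pt_parse]
 show ?thesis unfolding start_def by (intro pt p)
qed

lemma start_facts:
 assumes F: "three_cnf n F"
 obtains S where "start (encode_cnf n F) = ((n,[S]),[],False)" "inv n D S S" "ssat S \<longleftrightarrow> satisfiable F"
proof -
 let ?c = "%l. 2 * fst l + (if snd l then 1 else 0 :: nat)"
 let ?k = "%C. norm_clause n (map ?c C)"
 define S where "S = dedup (map ?k (rev (map rev F)))"
 have st: "start (encode_cnf n F) = ((n,[S]),[],False)" by (simp add: start_def parse S_def)
 have rv: "?k (rev C) = ?k C" for C :: "literal list" unfolding norm_clause_def by simp
 have S: "set S = ?k ` set F" unfolding S_def dedup set_map set_rev image_image rv ..
 have len: "length (?k C) <= 3" if "C : set F" for C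
 proof -
  have "length (?k C) = card (set (?k C))" using normal_card[OF normal_norm] by simp
  also have "\<dots> <= card (?c ` set C)" by (intro card_mono) (auto simp: norm_set)
  also have "\<dots> <= card (set C)" by (rule card_image_le) simp
  also have "\<dots> <= length C" by (rule card_length)
  finally show ?thesis using F that unfolding three_cnf_def by fastforce
 qed
 have np: "newp S S = {}" by (auto simp: newp_def)
 have "inv n D S S" unfolding inv_def np S using len normal_norm by (auto simp: S_def dedup)
 moreover have cs: "csat sg (?k C) \<longleftrightarrow> (\<exists>(v,b)\<in>set C. sg v = b)" if "C : set F" for C sg
 proof -
  have "?c l < 2 * n" if "l : set C" for l
  proof -
   have "fst l < n" using F \<open>C \<in> set F\<close> that unfolding three_cnf_def by auto
   thus ?thesis by auto
  qed
  hence "set (?k C) = ?c ` set C" by (auto simp: norm_set)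
  moreover have "sg (?c l div 2) = odd (?c l) \<longleftrightarrow> sg (fst l) = snd l" for l by (cases "snd l") simp_all
  ultimately have "csat sg (?k C) \<longleftrightarrow> (\<exists>l\<in>set C. sg (fst l) = snd l)" unfolding csat_def by (simp only: bex_simps)
  thus ?thesis by (simp add: case_prod_beta)
 qed
 hence "ssat S \<longleftrightarrow> satisfiable F" unfolding ssat_def satisfiable_def S by simp
 ultimately show thesis using st that by blast
qed

lemma tsz_filter: "tsz (filter P xs) <= tsz xs" by (induction xs) auto

text \<open>The number of rounds contributes one factor \<open>T + 1\<close>, and the state size,
  quadratic in \<open>T + 1\<close>, is raised to \<open>E\<close>; together this is the exponent
  \<open>2 * E + 1\<close>.\<close>

lemma final_bound:
 fixes a u R :: real
 assumes N: "real N + 2 <= 8 * a * (real T + 1)" and W: "W <= Q * (T + 1) ^ 2" and T: "real T + 1 <= u * R" and a: "0 <= a"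
 shows "real ((N + 2) * W ^ E) <= a * u ^ (2 * E + 1) * (8 * real Q ^ E * R ^ (2 * E + 1))"
proof -
 have "real (W ^ E) <= real ((Q * (T + 1) ^ 2) ^ E)" using W by (simp only: of_nat_le_iff power_mono le0)
 also have "\<dots> = real Q ^ E * (real T + 1) ^ (2 * E)" by (simp only: of_nat_power of_nat_mult of_nat_add of_nat_1 power_mult_distrib power_mult)
 finally have "real (N + 2) * real (W ^ E) <= (8 * a * (real T + 1)) * (real Q ^ E * (real T + 1) ^ (2 * E))"
  using N a by (intro mult_mono) simp_all
 also have "\<dots> = 8 * a * real Q ^ E * (real T + 1) ^ (2 * E + 1)" by simp
 also have "\<dots> <= 8 * a * real Q ^ E * (u * R) ^ (2 * E + 1)" using T a by (intro mult_left_mono power_mono) simp_all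
 also have "\<dots> = a * u ^ (2 * E + 1) * (8 * real Q ^ E * R ^ (2 * E + 1))" by (simp only: power_mult_distrib mult_ac)
 finally show ?thesis by (simp only: of_nat_mult)
qed

lemma pb_nat: "pb (%n :: nat. n)" by (rule pb_mono[OF pb_tsz]) simp

lemma pb_natE: assumes "pb (f :: nat => nat)" obtains k where "!!n m. n <= m ==> f n <= (2 * m + 3) ^ k"
proof -
 obtain k where k: "!!n. f n <= (tsz n + 2) ^ k" using assms unfolding pb_def by auto
 have "f n <= (2 * m + 3) ^ k" if "n <= m" for n m
 proof -
  have "(tsz n + 2) ^ k <= (2 * m + 3) ^ k" using that by (intro power_mono) simp_all
  thus ?thesis using k le_trans by blast
 qed
 thus thesis using that by blast
qed

lemma (in search) good_tsz:
 assumes s: "good L s" and c: "!!c. small M (X + T) c ==> tsz c <= Z"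
 shows "tsz s <= 2 * n + 12 + L * (2 + 4 * (2 * n + 1) ^ 3 * (12 * n + 20)) + Z"
  "snd (fst s) ~= [] \<or> fst (snd s) ~= []"
proof -
 obtain st cs b where g: "s = ((n,st),cs,b)" "st ~= [] \<or> cs ~= []" "\<forall>S\<in>set st. inv n D S0 S" "length st <= L" "length cs <= 1"
  "\<forall>c\<in>set cs. small M (X + T) c" using s unfolding good_def by blast
 show "snd (fst s) ~= [] \<or> fst (snd s) ~= []" using g(1,2) by simp
 let ?B = "1 + 4 * (2 * n + 1) ^ 3 * (12 * n + 20)"
 have "tsz st <= 1 + length st * (1 + ?B)" by (rule tsz_list_bound) (use g(3) inv_tsz in blast)
 moreover have "length st * (1 + ?B) <= L * (1 + ?B)" using g(4) by (rule mult_le_mono1)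
 ultimately have 1: "tsz st <= 1 + L * (1 + ?B)" by linarith
 have "tsz cs <= 1 + length cs * (1 + Z)" by (rule tsz_list_bound) (use g(6) c in blast)
 moreover have "length cs * (1 + Z) <= 1 * (1 + Z)" using g(5) by (rule mult_le_mono1)
 ultimately have 2: "tsz cs <= 2 + Z" by simp
 have 3: "1 + ?B = 2 + 4 * (2 * n + 1) ^ 3 * (12 * n + 20)" by simp
 have "tsz s = 2 * n + 1 + tsz st + tsz cs + tsz b + 3" unfolding g(1) by simp
 thus "tsz s <= 2 * n + 12 + L * (2 + 4 * (2 * n + 1) ^ 3 * (12 * n + 20)) + Z"
  using 1[unfolded 3] 2 tsz_bool[of b] by linarith
qed

theorem eth_hardness:
 fixes H :: "'a pair_pre_digraph"
 assumes H: "pair_graph H"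
  and tri: "(\<exists>T. roof_triangle H T) \<or>
     (\<exists>S T. S ~= T & hanging_triangle H S & hanging_triangle H T &
      (\<exists>a\<in>attachment_vertices H S. \<exists>b\<in>attachment_vertices H T. (a,b) : parcs H))"
  and eth: exponential_time_hypothesis
 shows "\<not> subexponentially_solvable H"
proof
 assume "subexponentially_solvable H"
 then obtain M f p where M: "turing_machine M" and f: "f : o(%k. real k)"
  and run: "!!G k. input_graph G ==> \<exists>t. real t <= 2 powr f k * real (poly p (card (pverts G))) &
    computes_within M (encode_instance G k) [subdividable_to_free H G k] t"
  unfolding subexponentially_solvable_def by blast
 obtain r :: "nat list * (nat * bool) list list => bool list" where r: "ptime r"
  "!!vl F. wf3 vl F ==> \<exists>G. input_graph G & r (vl,F) = encode_instance G (3 * length vl + 3 * length F) &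
   (subdividable_to_free H G (3 * length vl + 3 * length F) \<longleftrightarrow> sat F)"
  using main_reduction[OF H tri] by blast
 obtain \<delta> :: real where \<delta>: "0 < \<delta>" and lower: "\<not> (\<exists>M (p :: nat poly). turing_machine M &
       (\<forall>n F. three_cnf n F -->
        (\<exists>t. real t <= 2 powr (\<delta> * real n) * real (poly p (length (encode_cnf n F))) &
           computes_within M (encode_cnf n F) [satisfiable F] t)))"
  using eth unfolding exponential_time_hypothesis_def by blast
 \<comment> \<open>\<open>\<delta>\<close> is shared equally between the number of leaves and the
   time spent at them.\<close>
 define \<epsilon> where "\<epsilon> = \<delta> / 2"
 have \<epsilon>: "0 < \<epsilon>" using \<delta> by (simp add: \<epsilon>_def)
 obtain D :: nat where D: "1 <= D" and base: "2 powr (- \<epsilon> / (8 * real D)) + 2 powr (- \<epsilon> * real D / 4) <= 1"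
  using branching_base[OF \<epsilon>] by blast
 \<comment> \<open>Chosen so that \<open>lam powr (8 * D * n)\<close> equals
   \<open>2 powr (\<epsilon> * n)\<close>, where \<open>8 * D * n\<close> bounds the initial
   potential.\<close>
 define lam :: real where "lam = 2 powr (\<epsilon> / (8 * D))"
 have lam: "1 <= lam" unfolding lam_def using \<epsilon> by (simp add: ge_one_powr_ge_zero)
 have "1 / lam = 2 powr (- \<epsilon> / (8 * real D))" by (simp add: lam_def powr_minus_divide)
 moreover have "1 / lam powr (2 * D * D) = 2 powr (- \<epsilon> * real D / 4)"
 proof -
  have "\<epsilon> / (8 * real D) * (2 * real D * real D) = \<epsilon> * real D / 4" using D by (simp add: field_simps)
  hence "lam powr (2 * D * D) = 2 powr (\<epsilon> * real D / 4)" by (simp add: lam_def powr_powr)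
  thus ?thesis by (simp add: powr_minus_divide)
 qed
 ultimately have lam2: "1 / lam + 1 / lam powr (2 * D * D) <= 1" using base by simp
 obtain h where h: "table M h" using table_exists by blast
 define r' where "r' = (%S. r (vars S,lits S))"
 have pr': "ptime r'" unfolding r'_def by (intro pt_comp[OF r(1)] pt)
 define g where "g = srch D (num_states M) h (num_tapes M) r'"
 have pg: "ptime g" unfolding g_def by (rule pt_srch[OF _ pr']) (use h in \<open>simp add: table_def\<close>)
 have pt: "ptime (%s :: sstate. snd (fst s) ~= [] \<or> fst (snd s) ~= [])" "ptime (%s :: sstate. [snd (snd s)])" by (intro pt)+
 obtain E where E: "!!(inp :: nat \<times> cnf => bool list) f N W. (\<forall>x. \<exists>n\<le>N x. f x = (g ^^ n) (start (inp x)) &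
   (\<forall>i<n. snd (fst ((g ^^ i) (start (inp x)))) ~= [] \<or> fst (snd ((g ^^ i) (start (inp x)))) ~= []) &
   \<not> (snd (fst (f x)) ~= [] \<or> fst (snd (f x)) ~= []) & (\<forall>i\<le>n. tsz ((g ^^ i) (start (inp x))) <= W x)) ==>
  (\<exists>M. turing_machine M & (\<forall>x. computes_within M (inp x) [snd (snd (f x))] ((N x + 2) * (length (inp x) + W x + 2) ^ E)))"
  using tm_of_while[OF pt(1) pg pt_start pt(2), where 'i = "nat \<times> cnf"] by blast
 define c0 where "c0 = 3 + 6 * (1 + D + 2 * D * D)"
 \<comment> \<open>The parameter at a leaf is at most \<open>c0 * n + 3\<close>, and the time at a
   leaf enters with exponent \<open>2 * E + 1\<close>; this choice of \<open>\<eta>\<close> makes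
   the total exponent \<open>\<delta> / 2\<close>.\<close>
 define \<eta> where "\<eta> = \<delta> / (2 * real c0 * (2 * real E + 1))"
 have c0: "0 < c0" by (simp add: c0_def)
 have \<eta>: "0 < \<eta>" using \<delta> c0 by (simp add: \<eta>_def)
 obtain C where C: "0 <= C" "!!k. f k <= \<eta> * real k + C" using little_o_bound[OF f \<eta>] by blast
 obtain e1 where e1: "!!S. tsz (r' S) <= (tsz S + 2) ^ e1" using pb_ptime[OF pr'] unfolding pb_def by blast
 obtain Cs where Cs: "!!k c. small M k c ==> tsz c <= Cs * (k + 1) ^ 2" using small_tsz[of M] by blast
 define X where "X n = (3 + 4 * (2 * n + 1) ^ 3 * (12 * n + 20)) ^ e1" for n :: nat
 define T where "T n = nat \<lfloor>2 powr (\<eta> * real (c0 * n + 3) + C) * real (poly p (X n))\<rfloor>" for n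
 define L where "L n = 8 * D * n + 1" for n
 define Z where "Z n = Cs * (X n + T n + 1) ^ 2" for n
 define W where "W n = 2 * n + 12 + L n * (2 + 4 * (2 * n + 1) ^ 3 * (12 * n + 20)) + Z n" for n
 define N where "N n = nat \<lfloor>(2 * 2 powr (\<epsilon> * real n) - 1) * (real (T n) + 3)\<rfloor>" for n
 have solver: "computes_within M (r' (kernel S)) [ssat S] (T n) & length (r' (kernel S)) <= X n"
  if i: "inv n D S0 S" and b: "branch n D S = []" and e: "[] ~: set (kernel S)" for n S0 S
 proof -
  note lf = leaf_facts[OF i b e]
  define k where "k = 3 * length (vars (kernel S)) + 3 * length (lits (kernel S))"
  obtain G where G: "input_graph G" "r' (kernel S) = encode_instance G k" "subdividable_to_free H G k \<longleftrightarrow> sat (lits (kernel S))"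
   using r(2)[OF lf(1)] unfolding r'_def k_def by blast
  have "tsz (kernel S) + 2 <= 3 + 4 * (2 * n + 1) ^ 3 * (12 * n + 20)"
   using tsz_filter[of "active S" S, folded kernel_def] inv_tsz[OF i] by linarith
  hence "(tsz (kernel S) + 2) ^ e1 <= X n" unfolding X_def by (rule power_mono) simp
  hence len: "length (r' (kernel S)) <= X n" using e1[of "kernel S"] length_le_tsz[of "r' (kernel S)"] by linarith
  have "card (pverts G) <= length (r' (kernel S))" unfolding G(2) by (simp add: encode_instance_def Let_def unary_def)
  hence cG: "poly p (card (pverts G)) <= poly p (X n)" using len by (intro poly_nat_mono) linarith
  obtain t where t: "real t <= 2 powr f k * real (poly p (card (pverts G)))" "computes_within M (encode_instance G k) [subdividable_to_free H G k] t"
   using run[OF G(1)] by blast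
  have "\<eta> * real k <= \<eta> * real (c0 * n + 3)" using lf(3) \<eta> unfolding k_def c0_def by (intro mult_left_mono) (simp_all only: of_nat_le_iff less_imp_le)
  hence "f k <= \<eta> * real (c0 * n + 3) + C" using C(2)[of k] by linarith
  hence "2 powr f k <= 2 powr (\<eta> * real (c0 * n + 3) + C)" by (intro powr_mono) simp_all
  hence "2 powr f k * real (poly p (card (pverts G))) <= 2 powr (\<eta> * real (c0 * n + 3) + C) * real (poly p (X n))"
   using cG by (intro mult_mono) simp_all
  hence "real t <= 2 powr (\<eta> * real (c0 * n + 3) + C) * real (poly p (X n))" using t(1) by linarith
  hence "t <= T n" unfolding T_def by (rule le_nat_floor)
  have "computes_within M (encode_instance G k) [subdividable_to_free H G k] (T n)" by (rule computes_mono[OF t(2) \<open>t \<le> T n\<close>])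
  thus ?thesis using len unfolding G(2) G(3) lf(2) by (rule conjI)
 qed
 have path: "\<exists>i\<le>N n. (g ^^ i) (start (encode_cnf n F)) = ((n,[]),[],satisfiable F) &
   (\<forall>j<i. snd (fst ((g ^^ j) (start (encode_cnf n F)))) ~= [] \<or> fst (snd ((g ^^ j) (start (encode_cnf n F)))) ~= []) &
   (\<forall>j\<le>i. tsz ((g ^^ j) (start (encode_cnf n F))) <= W n)" if F: "three_cnf n F" for n F
 proof -
  obtain S where S: "start (encode_cnf n F) = ((n,[S]),[],False)" "inv n D S S" "ssat S \<longleftrightarrow> satisfiable F"
   by (rule start_facts[OF F])
  interpret s: search M h D n S r' "X n" "T n" by (rule search.intro[OF M h D solver])
  have mu: "0 <= mu n D S S" "mu n D S S <= 8 * int D * int n" by (rule mu_bounds[OF S(2)])+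
  have "nat (mu n D S S) <= 8 * D * n" using mu(2) by (simp add: nat_le_iff)
  hence Lb: "length ([] :: nat list list list) + 1 + nat (mu n D S S) <= L n" by (simp add: L_def)
  obtain i where i: "real i <= (2 * lam powr mu n D S S - 1) * (T n + 3)"
   "path g (s.good (L n)) i ((n,[S]),[],False) (if ssat S then ((n,[]),[],True) else ((n,[]),[],False))"
  proof -
   have "\<forall>R\<in>set []. inv n D S R" by simp
   from s.process[OF lam lam2 S(2) this Lb, of False, folded g_def] show thesis using that by blast
  qed
  have "real_of_int (mu n D S S) <= 8 * real D * real n" using iffD2[OF of_int_le_iff[where ?'a = real] mu(2)] by simp
  hence "lam powr mu n D S S <= lam powr (8 * real D * real n)" using lam by (intro powr_mono)
  also have "\<dots> = 2 powr (\<epsilon> * real n)"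
  proof -
   have "\<epsilon> / (8 * real D) * (8 * real D * real n) = \<epsilon> * real n" using D by (simp add: field_simps)
   thus ?thesis by (simp add: lam_def powr_powr)
  qed
  finally have lm: "(2 * lam powr mu n D S S - 1) * (real (T n) + 3) <= (2 * 2 powr (\<epsilon> * real n) - 1) * (real (T n) + 3)"
   by (intro mult_right_mono) simp_all
  have "real i <= (2 * lam powr mu n D S S - 1) * (real (T n) + 3)" using i(1) by simp
  hence "real i <= (2 * 2 powr (\<epsilon> * real n) - 1) * (real (T n) + 3)" using lm by (rule order_trans)
  hence iN: "i <= N n" unfolding N_def by (rule le_nat_floor)
  have sm: "tsz c <= Z n" if "small M (X n + T n) c" for c using Cs[OF that] by (simp add: Z_def)
  have fin: "(g ^^ i) (start (encode_cnf n F)) = ((n,[]),[],satisfiable F)" using i(2) S(1,3) unfolding path_def by (cases "ssat S") simp_all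
  have gd: "s.good (L n) ((g ^^ j) (start (encode_cnf n F)))" if "j < i" for j using i(2) that unfolding path_def S(1) by blast
  have "tsz ((g ^^ j) (start (encode_cnf n F))) <= W n" if "j <= i" for j
  proof (cases "j < i")
   case True
   show ?thesis unfolding W_def by (rule s.good_tsz(1)[OF gd[OF True] sm])
  next
   case False
   hence "j = i" using that by simp
   thus ?thesis using fin tsz_bool[of "satisfiable F"] by (simp add: W_def)
  qed
  thus ?thesis using iN fin s.good_tsz(2)[OF gd sm] by (intro exI[of _ i]) simp
 qed
 \<comment> \<open>\<open>E\<close> asks for a run on every index, so pairs that are not 3-CNF are
   replaced by the empty formula.\<close>
 define cn where "cn x = (if three_cnf (fst x) (snd x) then x else (0,[]))" for x :: "nat * cnf"
 have cn: "three_cnf (fst (cn x)) (snd (cn x))" for x by (simp add: cn_def three_cnf_def)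
 have "\<exists>M. turing_machine M & (\<forall>x. computes_within M (encode_cnf (fst (cn x)) (snd (cn x)))
   [snd (snd ((fst (cn x),[] :: nat list list list),[] :: (nat \<times> ltape list) list,satisfiable (snd (cn x))))]
   ((N (fst (cn x)) + 2) * (length (encode_cnf (fst (cn x)) (snd (cn x))) + W (fst (cn x)) + 2) ^ E))"
 proof (rule E, rule allI)
  fix x
  obtain i where i: "i <= N (fst (cn x))" "(g ^^ i) (start (encode_cnf (fst (cn x)) (snd (cn x)))) = ((fst (cn x),[]),[],satisfiable (snd (cn x)))"
   "\<forall>j<i. snd (fst ((g ^^ j) (start (encode_cnf (fst (cn x)) (snd (cn x)))))) ~= [] \<or> fst (snd ((g ^^ j) (start (encode_cnf (fst (cn x)) (snd (cn x)))))) ~= []"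
   "\<forall>j\<le>i. tsz ((g ^^ j) (start (encode_cnf (fst (cn x)) (snd (cn x))))) <= W (fst (cn x))"
   using path[OF cn[of x]] by blast
  show "\<exists>n\<le>N (fst (cn x)). ((fst (cn x),[]),[],satisfiable (snd (cn x))) = (g ^^ n) (start (encode_cnf (fst (cn x)) (snd (cn x)))) &
   (\<forall>i<n. snd (fst ((g ^^ i) (start (encode_cnf (fst (cn x)) (snd (cn x)))))) ~= [] \<or> fst (snd ((g ^^ i) (start (encode_cnf (fst (cn x)) (snd (cn x)))))) ~= []) &
   \<not> (snd (fst ((fst (cn x),[] :: nat list list list),[] :: (nat \<times> ltape list) list,satisfiable (snd (cn x)))) ~= [] \<or>
     fst (snd ((fst (cn x),[] :: nat list list list),[] :: (nat \<times> ltape list) list,satisfiable (snd (cn x)))) ~= []) &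
   (\<forall>i\<le>n. tsz ((g ^^ i) (start (encode_cnf (fst (cn x)) (snd (cn x))))) <= W (fst (cn x)))"
   by (rule exI[of _ i]) (intro conjI i(1) i(2)[symmetric] i(3,4), simp)
 qed
 then obtain M' where M': "turing_machine M'" "!!x. computes_within M' (encode_cnf (fst (cn x)) (snd (cn x))) [satisfiable (snd (cn x))]
   ((N (fst (cn x)) + 2) * (length (encode_cnf (fst (cn x)) (snd (cn x))) + W (fst (cn x)) + 2) ^ E)" by auto
 have pX: "pb X" unfolding X_def by (intro pb_intros pb_nat)
 obtain kx where kx: "!!n m. n <= m ==> X n <= (2 * m + 3) ^ kx" using pb_natE[OF pX] by blast
 define B where "B n = 2 * n + 14 + L n * (2 + 4 * (2 * n + 1) ^ 3 * (12 * n + 20)) + Cs * (X n + 1) ^ 2" for n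
 have "pb B" unfolding B_def L_def by (intro pb_intros pb_nat pX)
 then obtain kb where kb: "!!n m. n <= m ==> B n <= (2 * m + 3) ^ kb" by (rule pb_natE) blast
 define A where "A = nat \<lceil>2 powr (\<eta> * 3 + C)\<rceil>"
 have A: "2 powr (\<eta> * 3 + C) <= real A" "1 <= real A"
 proof -
  show a: "2 powr (\<eta> * 3 + C) <= real A" unfolding A_def by linarith
  have "1 <= 2 powr (\<eta> * 3 + C)" using \<eta> C(1) by (intro ge_one_powr_ge_zero) simp_all
  thus "1 <= real A" using a by linarith
 qed
 \<comment> \<open>The polynomial factor left when the exponential parts \<open>a\<close> of the
   rounds and \<open>u\<close> of the leaf time are split off.\<close>
 define P where "P = 8 * ([:0,1:] + [:3,2:] ^ kb) ^ E * (smult A (pcompose p ([:3,2:] ^ kx) + 1)) ^ (2 * E + 1)"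
 have "real ((N n + 2) * (length (encode_cnf n F) + W n + 2) ^ E) <= 2 powr (\<delta> * real n) * real (poly P (length (encode_cnf n F)))" for n F
 proof -
  define l where "l = length (encode_cnf n F)"
  have nl: "n <= l" by (simp add: l_def encode_cnf_def unary_def)
  define R where "R = A * (poly p ((2 * l + 3) ^ kx) + 1)"
  define Q where "Q = l + (2 * l + 3) ^ kb"
  have P: "poly P l = 8 * Q ^ E * R ^ (2 * E + 1)"
  proof -
   have "poly ([:0,1:] + [:3,2:] ^ kb) l = Q" "poly (smult A (pcompose p ([:3,2:] ^ kx) + 1)) l = R"
    by (simp_all add: Q_def R_def poly_pcompose poly_power mult.commute[of 2] add.commute[of 3])
   thus ?thesis by (simp only: P_def poly_mult poly_power poly_numeral)
  qed
  have "X n + T n + 1 <= (X n + 1) * (T n + 1)" by simp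
  hence "(X n + T n + 1) ^ 2 <= (X n + 1) ^ 2 * (T n + 1) ^ 2" by (metis power_mono power_mult_distrib le0)
  hence z: "Z n <= Cs * (X n + 1) ^ 2 * (T n + 1) ^ 2" unfolding Z_def by (simp only: mult.assoc mult_le_mono2)
  define t2 where "t2 = (T n + 1) ^ 2"
  have t2: "1 <= t2" by (simp add: t2_def)
  define w where "w = 2 * n + 14 + L n * (2 + 4 * (2 * n + 1) ^ 3 * (12 * n + 20))"
  have "l + W n + 2 = l + w + Z n" by (simp add: W_def w_def)
  also have "\<dots> <= l * t2 + w * t2 + Cs * (X n + 1) ^ 2 * t2" using z t2 by (intro add_mono) (simp_all add: t2_def)
  also have "\<dots> = (l + B n) * t2" by (simp add: B_def w_def distrib_right)
  also have "\<dots> <= Q * t2" using kb[OF nl] by (intro mult_le_mono1) (simp add: Q_def)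
  finally have W: "l + W n + 2 <= Q * (T n + 1) ^ 2" by (simp add: t2_def)
  define a :: real where "a = 2 powr (\<epsilon> * real n)"
  define u :: real where "u = 2 powr (\<eta> * real c0 * real n)"
  have a: "1 <= a" unfolding a_def using \<epsilon> by (intro ge_one_powr_ge_zero) simp_all
  have u: "1 <= u" unfolding u_def using \<eta> by (intro ge_one_powr_ge_zero) simp_all
  have "0 <= (2 * a - 1) * (real (T n) + 3)" using a by (intro mult_nonneg_nonneg) simp_all
  hence "real (N n) <= (2 * a - 1) * (real (T n) + 3)" unfolding N_def a_def by linarith
  moreover have "real (T n) <= a * real (T n)" using mult_right_mono[OF a, of "real (T n)"] by simp
  moreover have "(2 * a - 1) * (real (T n) + 3) = 2 * (a * real (T n)) + 6 * a - real (T n) - 3" by (simp add: algebra_simps)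
  moreover have "8 * a * (real (T n) + 1) = 8 * (a * real (T n)) + 8 * a" by (simp add: algebra_simps)
  ultimately have N: "real (N n) + 2 <= 8 * a * (real (T n) + 1)" using a by linarith
  have px: "poly p (X n) <= poly p ((2 * l + 3) ^ kx)" by (rule poly_nat_mono[OF kx[OF nl]])
  define q where "q = real (poly p ((2 * l + 3) ^ kx))"
  have q: "real (poly p (X n)) <= q" "0 <= q" using px by (simp_all add: q_def)
  have "2 powr (\<eta> * real (c0 * n + 3) + C) = u * 2 powr (\<eta> * 3 + C)" by (simp add: u_def algebra_simps flip: powr_add)
  also have "\<dots> <= u * real A" using A(1) u by (intro mult_left_mono) simp_all
  finally have "2 powr (\<eta> * real (c0 * n + 3) + C) * real (poly p (X n)) <= u * real A * q" using q u by (intro mult_mono) simp_all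
  moreover have "real (T n) <= 2 powr (\<eta> * real (c0 * n + 3) + C) * real (poly p (X n))"
  proof -
   have "0 <= 2 powr (\<eta> * real (c0 * n + 3) + C) * real (poly p (X n))" by simp
   thus ?thesis unfolding T_def by linarith
  qed
  moreover have "1 <= u * real A" using mult_mono[OF u A(2)] u by simp
  moreover have "u * real R = u * real A * q + u * real A" by (simp add: R_def q_def algebra_simps)
  ultimately have T: "real (T n) + 1 <= u * real R" by linarith
  have "real ((N n + 2) * (l + W n + 2) ^ E) <= a * u ^ (2 * E + 1) * (8 * real Q ^ E * real R ^ (2 * E + 1))"
   using final_bound[OF N W T] a by simp
  also have "a * u ^ (2 * E + 1) = 2 powr (\<delta> * real n)"
  proof -
   have "u ^ (2 * E + 1) = u powr real (2 * E + 1)" by (rule powr_realpow[symmetric]) (use u in simp)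
   also have "\<dots> = 2 powr (\<eta> * real c0 * real n * real (2 * E + 1))" unfolding u_def by (rule powr_powr)
   finally have "u ^ (2 * E + 1) = 2 powr (real (2 * E + 1) * (\<eta> * real c0 * real n))" by (simp only: mult.commute)
   moreover have "real (2 * E + 1) * (\<eta> * real c0 * real n) = \<delta> / 2 * real n"
   proof -
    have "(2 * real E + 1) * \<eta> * real c0 = \<delta> / 2" unfolding \<eta>_def using c0 by (simp add: divide_simps)
    moreover have "real (2 * E + 1) * (\<eta> * real c0 * real n) = (2 * real E + 1) * \<eta> * real c0 * real n" by simp
    ultimately show ?thesis by (simp only:)
   qed
   ultimately have "u ^ (2 * E + 1) = 2 powr (\<delta> / 2 * real n)" by (simp only:)
   hence "a * u ^ (2 * E + 1) = 2 powr (\<epsilon> * real n + \<delta> / 2 * real n)" by (simp only: a_def powr_add)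
   also have "\<epsilon> * real n + \<delta> / 2 * real n = \<delta> * real n" by (simp add: \<epsilon>_def)
   finally show ?thesis .
  qed
  finally show ?thesis unfolding l_def[symmetric] P by simp
 qed
 hence "\<exists>t. real t <= 2 powr (\<delta> * real n) * real (poly P (length (encode_cnf n F))) & computes_within M' (encode_cnf n F) [satisfiable F] t"
  if "three_cnf n F" for n F
  using M'(2)[of "(n,F)"] that unfolding cn_def by (intro exI[of _ "(N n + 2) * (length (encode_cnf n F) + W n + 2) ^ E"]) simp
 thus False using lower M'(1) by blast
qed

theorem theorem4:
  fixes H :: "'a pair_pre_digraph"
  assumes "pair_graph H"
    and "(\<exists>T. roof_triangle H T) \<or>
         (\<exists>S T. S \<noteq> T \<and> hanging_triangle H S \<and> hanging_triangle H T \<and>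
            (\<exists>a\<in>attachment_vertices H S. \<exists>b\<in>attachment_vertices H T. (a, b) \<in> parcs H))"
  shows "NP_complete (free_subdivision H) \<and>
         (exponential_time_hypothesis \<longrightarrow> \<not> subexponentially_solvable H)"
proof (rule low_triangle[OF assms])
  fix u v w
  assume t: "(u, v) \<in> parcs H" "(u, w) \<in> parcs H" "(v, w) \<in> parcs H"
  have "in_NP (free_subdivision H)" by (rule in_NP_free_subdivision[OF assms(1) t])
  moreover have "NP_hard (free_subdivision H)" by (rule NP_hard_free_subdivision[OF assms])
  ultimately have "NP_complete (free_subdivision H)" unfolding NP_complete_def by (rule conjI)
  moreover have "exponential_time_hypothesis \<longrightarrow> \<not> subexponentially_solvable H" by (rule impI) (rule eth_hardness[OF assms])
  ultimately show ?thesis by (rule conjI)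
qed

end
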